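(* Let $q\ge 1$, $\vec{\psi}\in\mathcal{C}^{+1}(\Omega)^q$ and $\beta\ge0$. One-dimensional case: if $q=1$ (write $\psi=\vec\psi$), then, as $n\to+\infty$, the probabilistic Gibbs measure $\mu_{n,\beta}$ converges weakly to a convex combination of the conformal measures $\nu_{\beta t\psi}$ associated to the dynamical Gibbs measures $\mu_{\beta t\psi}$, where the $t$'s are the maxima (maximum points) for $\varphi_\beta$. Higher-dimensional case: if $q>1$ and $\varphi_\beta$ attains its maximum only at non-degenerate points (i.e. $d^2\varphi_\beta$ is invertible there), then these points are finitely many and, as $n\to+\infty$, $\mu_{n,\beta}$ converges weakly to a convex combination of the conformal measures $\nu_{\beta t\cdot\vec{\psi}}$ associated to the dynamical Gibbs measures $\mu_{\beta t\cdot\vec{\psi}}$, where the $t$'s are the maxima (maximum points) for $\varphi_\beta$.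
   Context: Setting: $(E,d)$ is a compact metric space and $\rho$ is a Borel probability measure on $E$ with full support such that, for every sufficiently small $\varepsilon>0$, the map $x\mapsto\rho(B(x,\varepsilon))$ is continuous. The transition function $A:E\times E\to[0,1]$ satisfies: (i) $A$ is continuous with values in $\{0,1\}$; (ii) $A$ is Lipschitz continuous with respect to the second variable with Lipschitz constant $\mathrm{Lip}(A)$; (iii) there is $N\in\mathbb{N}$ such that for all $n\ge N$ and all $a,b\in E$ there exist $z_1,\dots,z_{n-1}\in E$ with $A(a,z_1)A(z_1,z_2)\cdots A(z_{n-1},b)=1$. Put $\Omega=\{x=x_0x_1x_2\ldots\in E^{\mathbb{N}}: A(x_i,x_{i+1})>0\ \forall i\in\mathbb{N}\}$, with metric $d_\Omega(x,y)=\sum_{n\ge0}d(x_n,y_n)/2^{n+1}$ and shift $\sigma(x_0x_1x_2\ldots)=x_1x_2\ldots$. $\mathcal{C}^0(\Omega)$ is the space of real continuous functions on $\Omega$ with the sup norm; $\mathcal{C}^{+1}(\Omega)$ is the space of real Lipschitz continuous functions on $\Omega$. For $\phi\in\mathcal{C}^{+1}(\Omega)$ the transfer operator is $\mathcal{L}_\phi(f)(\omega)=\int_E e^{\phi(t\omega)}A(t,\omega_0)f(t\omega)\,d\rho(t)$, where $t\omega=t\omega_0\omega_1\ldots$ and the integrand is $0$ when $A(t,\omega_0)=0$; $r_\phi$ is its spectral radius on $\mathcal{C}^0(\Omega)$. The conformal measure $\nu_\phi$ is the unique probability measure on $\Omega$ with $\mathcal{L}_\phi^*\nu_\phi=r_\phi\nu_\phi$.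 The number $r_\phi$ is also a simple eigenvalue of $\mathcal{L}_\phi$ acting on $\mathcal{C}^{+1}(\Omega)$, with a positive eigenfunction $G_\phi$ normalized so that $\mu_\phi=G_\phi\nu_\phi$ is a probability measure; $\mu_\phi$ is the dynamical Gibbs measure associated to $\phi$. For $t\in\mathbb{R}^q$ and $\vec{\psi}=(\psi_1,\dots,\psi_q)$, $t\cdot\vec{\psi}=\sum_i t_i\psi_i$; $\|\cdot\|$ is the Euclidean norm; $\varphi_\beta(t)=-\frac{\beta}{2}\|t\|^2+\log r_{\beta t\cdot\vec{\psi}}$ for $t\in\mathbb{R}^q$. For a function $\phi$, $S_n(\phi)=\phi+\phi\circ\sigma+\dots+\phi\circ\sigma^{n-1}$, and $S_n(\vec{\psi})=(S_n(\psi_1),\dots,S_n(\psi_q))$. Let $\mathbb{P}=\rho^{\otimes\mathbb{N}}$. The probabilistic Gibbs measure on $\Omega$ is defined by $$\mu_{n,\beta}(d\omega)=\frac{1}{Z_{n,\beta}}\,e^{\frac{\beta}{2n}\|S_n(\vec{\psi})(\omega)\|^2}\,\mathbb{P}(d\omega),$$ where $Z_{n,\beta}$ is the suitable normalization factor. Weak convergence $P_n\to P$ of probability measures on $\Omega$ means $\int f\,dP_n\to\int f\,dP$ for every $f\in\mathcal{C}^0(\Omega)$.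
   Formalization: The formal theorem also assumes that Ω has positive measure under ρ^{⊗ℕ}; otherwise Z_{n,β}=0 and μ_{n,β} is undefined. With full support and A continuous in {0,1}, this forces A≡1, so the result concerns the full shift. *)

theory Defs
  imports "HOL-Probability.Probability"
begin

section \<open>The subshift and its function spaces\<close>

text \<open>The spin space \<open>E\<close> is (the universe of) a type. The results are stated for types of
  class \<^class>\<open>polish_space\<close> with compact universe; since compact metric spaces are complete and
  separable, the class is no restriction and only serves to make the library's results on
  \<open>nat \<Rightarrow> 'a\<close> (metrizability, product \<open>\<sigma>\<close>-algebra = Borel \<open>\<sigma>\<close>-algebra) available.\<close>

definition Omega :: "('a \<Rightarrow> 'a \<Rightarrow> real) \<Rightarrow> (nat \<Rightarrow> 'a) set" where
  "Omega A = {x. \<forall>i. A (x i) (x (Suc i)) > 0}"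

definition shift :: "(nat \<Rightarrow> 'a) \<Rightarrow> nat \<Rightarrow> 'a" where
  "shift x = (\<lambda>n. x (Suc n))"

definition dOmega :: "(nat \<Rightarrow> 'a::metric_space) \<Rightarrow> (nat \<Rightarrow> 'a) \<Rightarrow> real" where
  "dOmega x y = (\<Sum>n. dist (x n) (y n) / 2 ^ (n + 1))"

text \<open>The class instance of \<^class>\<open>metric_space\<close> on \<open>nat \<Rightarrow> 'a\<close> uses a metric different from
  \<^const>\<open>dOmega\<close>, so Lipschitz continuity has to refer to \<^const>\<open>dOmega\<close> explicitly. The topology
  is the same, by \<open>tendsto_iff_dOmega\<close> below, so for continuity the library notion can be used.\<close>

lemma summable_dOmega:
  fixes x y :: "nat \<Rightarrow> 'a::metric_space"
  assumes "compact (UNIV :: 'a set)"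
  shows "summable (\<lambda>n. dist (x n) (y n) / 2 ^ (n + 1))"
proof -
  obtain D where D: "\<And>a b :: 'a. dist a b \<le> D"
    using compact_imp_bounded[OF assms] by (auto simp: bounded_two_points)
  have "summable (\<lambda>n. D * (1/2) ^ (n + 1) :: real)"
    by (intro summable_mult summable_ignore_initial_segment summable_geometric) auto
  then show ?thesis
    by (rule summable_comparison_test'[where N = 0])
      (auto simp: power_divide divide_simps D)
qed

lemma tendsto_iff_dOmega:
  fixes f :: "'b \<Rightarrow> nat \<Rightarrow> 'a::metric_space"
  assumes "compact (UNIV :: 'a set)"
  shows "(f \<longlongrightarrow> l) F \<longleftrightarrow> ((\<lambda>i. dOmega (f i) l) \<longlongrightarrow> 0) F"
proof
  assume L: "(f \<longlongrightarrow> l) F"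
  obtain D where D: "\<And>a b :: 'a. dist a b \<le> D"
    using compact_imp_bounded[OF assms] by (auto simp: bounded_two_points)
  have s: "summable (\<lambda>n. D * (1/2) ^ (n + 1) :: real)"
    by (intro summable_mult summable_ignore_initial_segment summable_geometric) auto
  have "continuous_on UNIV (\<lambda>x :: nat \<Rightarrow> 'a. \<Sum>n. dist (x n) (l n) / 2 ^ (n + 1))"
  proof (rule uniform_limit_theorem)
    show "uniform_limit UNIV (\<lambda>N x. \<Sum>n<N. dist (x n) (l n) / 2 ^ (n + 1))
            (\<lambda>x. \<Sum>n. dist (x n) (l n) / 2 ^ (n + 1)) sequentially"
      by (rule Weierstrass_m_test[OF _ s]) (auto simp: power_divide divide_simps D)
    show "\<forall>\<^sub>F N in sequentially.
        continuous_on UNIV (\<lambda>x :: nat \<Rightarrow> 'a. \<Sum>n<N. dist (x n) (l n) / 2 ^ (n + 1))"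
      by (intro always_eventually allI continuous_intros) auto
  qed auto
  then have "isCont (\<lambda>x. dOmega x l) l"
    by (simp add: dOmega_def continuous_on_eq_continuous_at)
  from isCont_tendsto_compose[OF this L]
  show "((\<lambda>i. dOmega (f i) l) \<longlongrightarrow> 0) F" by (simp add: dOmega_def)
next
  assume R: "((\<lambda>i. dOmega (f i) l) \<longlongrightarrow> 0) F"
  have "((\<lambda>i. f i n) \<longlongrightarrow> l n) F" for n
  proof -
    have le: "dist (f i n) (l n) \<le> 2 ^ (n + 1) * dOmega (f i) l" for i
    proof -
      have "(\<Sum>k\<in>{n}. dist (f i k) (l k) / 2 ^ (k + 1)) \<le> dOmega (f i) l"
        unfolding dOmega_def by (rule sum_le_suminf[OF summable_dOmega[OF assms]]) auto
      then show ?thesis by (simp add: field_simps)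
    qed
    have "((\<lambda>i. 2 ^ (n + 1) * dOmega (f i) l) \<longlongrightarrow> 0) F"
      using tendsto_mult_right_zero[OF R] by blast
    then have "((\<lambda>i. dist (f i n) (l n)) \<longlongrightarrow> 0) F"
      by (rule tendsto_sandwich[rotated 3, OF _ _ _ tendsto_const])
         (use le in \<open>auto intro: always_eventually\<close>)
    then show ?thesis using tendsto_dist_iff by blast
  qed
  then have "limitin (product_topology (\<lambda>_. euclidean) UNIV) f l F"
    by (subst limitin_componentwise) auto
  then show "(f \<longlongrightarrow> l) F"
    by (simp add: euclidean_product_topology)
qed

text \<open>Functions on \<open>\<Omega>\<close> are represented by total functions with the value \<^const>\<open>undefined\<close>
  outside \<open>\<Omega>\<close>, so that equality of elements of \<open>C0 \<Omega>\<close> is equality on \<open>\<Omega>\<close>.\<close>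

definition C0 :: "(nat \<Rightarrow> 'a::metric_space) set \<Rightarrow> ((nat \<Rightarrow> 'a) \<Rightarrow> 'b::topological_space) set" where
  "C0 \<Omega> = {f \<in> extensional \<Omega>. continuous_on \<Omega> f}"

definition C1 :: "(nat \<Rightarrow> 'a::metric_space) set \<Rightarrow> ((nat \<Rightarrow> 'a) \<Rightarrow> real) set" where
  "C1 \<Omega> = {f \<in> extensional \<Omega>. \<exists>L. \<forall>x\<in>\<Omega>. \<forall>y\<in>\<Omega>. \<bar>f x - f y\<bar> \<le> L * dOmega x y}"


section \<open>Transfer operator, spectral radius, conformal measure\<close>

text \<open>\<open>case_nat t \<omega>\<close> is the concatenation \<open>t\<omega>\<close>. For \<open>\<omega> \<in> \<Omega>\<close> one has \<open>t\<omega> \<in> \<Omega>\<close> unless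
  \<open>A t (\<omega> 0) = 0\<close>, in which case the integrand is 0. The operator acts on real and on complex
  functions.\<close>

definition transfer ::
  "'a measure \<Rightarrow> ('a \<Rightarrow> 'a \<Rightarrow> real) \<Rightarrow> ((nat \<Rightarrow> 'a) \<Rightarrow> real) \<Rightarrow>
   ((nat \<Rightarrow> 'a) \<Rightarrow> 'b::{banach, second_countable_topology}) \<Rightarrow> (nat \<Rightarrow> 'a) \<Rightarrow> 'b" where
  "transfer \<rho> A \<phi> f =
     restrict (\<lambda>\<omega>. \<integral>t. (exp (\<phi> (case_nat t \<omega>)) * A t (\<omega> 0)) *\<^sub>R f (case_nat t \<omega>) \<partial>\<rho>) (Omega A)"

text \<open>As usual, the spectrum of an operator on the real Banach space \<open>C0 \<Omega>\<close> is that of its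
  complexification, i.e. of the operator on the complex-valued continuous functions. By the
  open mapping theorem, a bounded operator on a Banach space has a bounded inverse iff it is
  bijective.\<close>

definition spectrum_C0 ::
  "(nat \<Rightarrow> 'a::metric_space) set \<Rightarrow>
   (((nat \<Rightarrow> 'a) \<Rightarrow> complex) \<Rightarrow> (nat \<Rightarrow> 'a) \<Rightarrow> complex) \<Rightarrow> complex set" where
  "spectrum_C0 \<Omega> T =
     {z. \<not> bij_betw (\<lambda>f. restrict (\<lambda>\<omega>. z * f \<omega> - T f \<omega>) \<Omega>) (C0 \<Omega>) (C0 \<Omega>)}"

definition spec_rad ::
  "'a::metric_space measure \<Rightarrow> ('a \<Rightarrow> 'a \<Rightarrow> real) \<Rightarrow> ((nat \<Rightarrow> 'a) \<Rightarrow> real) \<Rightarrow> real" where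
  "spec_rad \<rho> A \<phi> = Sup (cmod ` spectrum_C0 (Omega A) (transfer \<rho> A \<phi>))"

definition is_conformal ::
  "'a::metric_space measure \<Rightarrow> ('a \<Rightarrow> 'a \<Rightarrow> real) \<Rightarrow> ((nat \<Rightarrow> 'a) \<Rightarrow> real) \<Rightarrow>
   (nat \<Rightarrow> 'a) measure \<Rightarrow> bool" where
  "is_conformal \<rho> A \<phi> \<nu> \<longleftrightarrow>
     prob_space \<nu> \<and> sets \<nu> = sets (restrict_space borel (Omega A)) \<and>
     (\<forall>f \<in> C0 (Omega A). (\<integral>\<omega>. transfer \<rho> A \<phi> f \<omega> \<partial>\<nu>) = spec_rad \<rho> A \<phi> * (\<integral>\<omega>. f \<omega> \<partial>\<nu>))"

definition conformal_measure ::
  "'a::metric_space measure \<Rightarrow> ('a \<Rightarrow> 'a \<Rightarrow> real) \<Rightarrow> ((nat \<Rightarrow> 'a) \<Rightarrow> real) \<Rightarrow>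
   (nat \<Rightarrow> 'a) measure" where
  "conformal_measure \<rho> A \<phi> = (THE \<nu>. is_conformal \<rho> A \<phi> \<nu>)"


section \<open>The function \<open>\<phi>\<^sub>\<beta>\<close>\<close>

text \<open>A vector \<open>(\<psi>\<^sub>1, \<dots>, \<psi>\<^sub>q)\<close> of functions is a family indexed by a finite type \<open>'q\<close> with \<open>q\<close>
  elements.\<close>

definition lin_comb ::
  "real ^ 'q \<Rightarrow> ('q::finite \<Rightarrow> (nat \<Rightarrow> 'a) \<Rightarrow> real) \<Rightarrow> (nat \<Rightarrow> 'a) \<Rightarrow> real" where
  "lin_comb t \<psi> = (\<lambda>\<omega>. \<Sum>i\<in>UNIV. t $ i * \<psi> i \<omega>)"

definition phi_beta ::
  "'a::metric_space measure \<Rightarrow> ('a \<Rightarrow> 'a \<Rightarrow> real) \<Rightarrow> ('q::finite \<Rightarrow> (nat \<Rightarrow> 'a) \<Rightarrow> real) \<Rightarrow>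
   real \<Rightarrow> real ^ 'q \<Rightarrow> real" where
  "phi_beta \<rho> A \<psi> \<beta> t = - (\<beta> / 2) * (norm t)\<^sup>2 + ln (spec_rad \<rho> A (lin_comb (\<beta> *\<^sub>R t) \<psi>))"

definition maximizers :: "('v \<Rightarrow> real) \<Rightarrow> 'v set" where
  "maximizers f = {t. \<forall>s. f s \<le> f t}"

text \<open>The second derivative at \<open>t\<close>, as a linear map, is the derivative \<open>H\<close> of the gradient \<open>g\<close>.\<close>

definition nondegenerate_at :: "('v::real_inner \<Rightarrow> real) \<Rightarrow> 'v \<Rightarrow> bool" where
  "nondegenerate_at f t \<longleftrightarrow>
     (\<exists>g H. (\<forall>\<^sub>F s in nhds t. GDERIV f s :> g s) \<and> (g has_derivative H) (at t) \<and> bij H)"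


section \<open>Probabilistic Gibbs measures and weak convergence\<close>

definition birkhoff_sum :: "nat \<Rightarrow> ((nat \<Rightarrow> 'a) \<Rightarrow> real) \<Rightarrow> (nat \<Rightarrow> 'a) \<Rightarrow> real" where
  "birkhoff_sum n \<phi> \<omega> = (\<Sum>k<n. \<phi> ((shift ^^ k) \<omega>))"

text \<open>The measure \<open>exp(\<dots>) \<cdot> \<rho>\<^sup>\<otimes>\<^sup>\<nat>\<close> on \<open>\<Omega>\<close> can be normalized iff \<open>\<Omega>\<close> is not a null set of the product
  measure; otherwise \<open>gibbs_measure\<close> below is the null measure.\<close>

definition product_measure :: "'a measure \<Rightarrow> (nat \<Rightarrow> 'a) measure" where
  "product_measure \<rho> = PiM UNIV (\<lambda>_. \<rho>)"

definition gibbs_weight ::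
  "('q::finite \<Rightarrow> (nat \<Rightarrow> 'a) \<Rightarrow> real) \<Rightarrow> real \<Rightarrow> nat \<Rightarrow> (nat \<Rightarrow> 'a) \<Rightarrow> real" where
  "gibbs_weight \<psi> \<beta> n \<omega> =
     exp (\<beta> / (2 * real n) * (norm (\<chi> i. birkhoff_sum n (\<psi> i) \<omega>))\<^sup>2)"

definition partition_function ::
  "'a measure \<Rightarrow> ('a \<Rightarrow> 'a \<Rightarrow> real) \<Rightarrow> ('q::finite \<Rightarrow> (nat \<Rightarrow> 'a) \<Rightarrow> real) \<Rightarrow>
   real \<Rightarrow> nat \<Rightarrow> real" where
  "partition_function \<rho> A \<psi> \<beta> n =
     (\<integral>\<omega>. gibbs_weight \<psi> \<beta> n \<omega> \<partial>restrict_space (product_measure \<rho>) (Omega A))"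

definition gibbs_measure ::
  "'a measure \<Rightarrow> ('a \<Rightarrow> 'a \<Rightarrow> real) \<Rightarrow> ('q::finite \<Rightarrow> (nat \<Rightarrow> 'a) \<Rightarrow> real) \<Rightarrow>
   real \<Rightarrow> nat \<Rightarrow> (nat \<Rightarrow> 'a) measure" where
  "gibbs_measure \<rho> A \<psi> \<beta> n =
     density (restrict_space (product_measure \<rho>) (Omega A))
       (\<lambda>\<omega>. ennreal (gibbs_weight \<psi> \<beta> n \<omega> / partition_function \<rho> A \<psi> \<beta> n))"

definition mixture ::
  "(nat \<Rightarrow> 'a::metric_space) set \<Rightarrow> 't set \<Rightarrow> ('t \<Rightarrow> real) \<Rightarrow> ('t \<Rightarrow> (nat \<Rightarrow> 'a) measure) \<Rightarrow>
   (nat \<Rightarrow> 'a) measure" where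
  "mixture \<Omega> T c \<nu> =
     measure_of \<Omega> (sets (restrict_space borel \<Omega>)) (\<lambda>B. \<Sum>t\<in>T. ennreal (c t) * emeasure (\<nu> t) B)"

lemma emeasure_mixture:
  assumes "\<And>t. t \<in> T \<Longrightarrow> sets (\<nu> t) = sets (restrict_space borel \<Omega>)"
    and "B \<in> sets (restrict_space borel \<Omega>)"
  shows "emeasure (mixture \<Omega> T c \<nu>) B = (\<Sum>t\<in>T. ennreal (c t) * emeasure (\<nu> t) B)"
proof (rule emeasure_measure_of[OF mixture_def])
  have sp: "space (restrict_space borel \<Omega>) = \<Omega>" by (simp add: space_restrict_space)
  show "sets (restrict_space borel \<Omega>) \<subseteq> Pow \<Omega>"
    using sets.space_closed[of "restrict_space borel \<Omega>"] sp by simp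
  have sa: "sigma_algebra \<Omega> (sets (restrict_space borel \<Omega>))"
    using sets.sigma_algebra_axioms[of "restrict_space borel \<Omega>"] sp by simp
  have s: "sets (mixture \<Omega> T c \<nu>) = sets (restrict_space borel \<Omega>)"
    unfolding mixture_def using sa by (simp add: sigma_algebra.sets_measure_of_eq)
  show "B \<in> sets (mixture \<Omega> T c \<nu>)" using assms(2) s by simp
  show "positive (sets (mixture \<Omega> T c \<nu>)) (\<lambda>B. \<Sum>t\<in>T. ennreal (c t) * emeasure (\<nu> t) B)"
    by (auto simp: positive_def)
  show "countably_additive (sets (mixture \<Omega> T c \<nu>))
      (\<lambda>B. \<Sum>t\<in>T. ennreal (c t) * emeasure (\<nu> t) B)"
  proof (rule countably_additiveI)
    fix X :: "nat \<Rightarrow> _"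
    assume X: "range X \<subseteq> sets (mixture \<Omega> T c \<nu>)" "disjoint_family X"
    have "(\<Sum>i. \<Sum>t\<in>T. ennreal (c t) * emeasure (\<nu> t) (X i)) =
        (\<Sum>t\<in>T. \<Sum>i. ennreal (c t) * emeasure (\<nu> t) (X i))"
      by (rule suminf_sum) auto
    also have "\<dots> = (\<Sum>t\<in>T. ennreal (c t) * emeasure (\<nu> t) (\<Union>i. X i))"
      using X assms(1) s by (intro sum.cong refl) (simp add: suminf_emeasure)
    finally show "(\<Sum>i. \<Sum>t\<in>T. ennreal (c t) * emeasure (\<nu> t) (X i)) =
        (\<Sum>t\<in>T. ennreal (c t) * emeasure (\<nu> t) (\<Union>i. X i))" .
  qed
qed

definition converges_weakly ::
  "(nat \<Rightarrow> 'a::metric_space) set \<Rightarrow> (nat \<Rightarrow> (nat \<Rightarrow> 'a) measure) \<Rightarrow> (nat \<Rightarrow> 'a) measure \<Rightarrow> bool"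
  where
  "converges_weakly \<Omega> P Q \<longleftrightarrow>
     (\<forall>f :: (nat \<Rightarrow> 'a) \<Rightarrow> real. f \<in> C0 \<Omega> \<longrightarrow>
        (\<lambda>n. \<integral>\<omega>. f \<omega> \<partial>P n) \<longlonglongrightarrow> (\<integral>\<omega>. f \<omega> \<partial>Q))"

end

theory Submission
  imports Defs "HOL-Complex_Analysis.Complex_Analysis" "HOL-Real_Asymp.Real_Asymp"
begin

text \<open>
  Full support and \<open>\<rho>\<^sup>\<otimes>\<^sup>\<nat> \<Omega> > 0\<close> force \<open>A = 1\<close>: a zero of \<open>A\<close> would spread to an open rectangle, which
  almost every sequence visits, so that \<open>\<Omega>\<close> would be a null set. Hence \<open>\<Omega>\<close> is the full shift, and the integral of \<open>\<L>\<^sub>\<phi>\<^sup>n f\<close> with respect to \<open>\<rho>\<^sup>\<otimes>\<^sup>\<nat>\<close> is that of \<open>exp (S\<^sub>n \<phi>) f\<close>.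

  The normalised iterates \<open>\<L>\<^sub>\<phi>\<^sup>n f / \<L>\<^sub>\<phi>\<^sup>n 1\<close> are obtained from one another by averaging over
  prefixes with weights of bounded distortion. Such averages contract the Lipschitz constant for
  the truncated metric \<open>min 1 (K * d\<^sub>\<Omega>)\<close> with \<open>K\<close> large, so the iterates converge exponentially fast
  to a constant, the integral of \<open>f\<close> with respect to the conformal measure; the measure itself comes
  from Kolmogorov's extension theorem, applied to densities on cylinders.

  The Hubbard-Stratonovich transformation writes \<open>exp (\<beta> / (2 n) * \<parallel>S\<^sub>n \<psi>\<parallel>\<^sup>2)\<close> as a Gaussian mixture
  over \<open>t\<close> of the weights \<open>exp (\<beta> t \<bullet> S\<^sub>n \<psi>)\<close>, and the integral over \<open>t\<close> then behaves like that of
  \<open>exp (n * \<phi>\<^sub>\<beta> t)\<close>: Laplace's method concentrates it at the maximum points of \<open>\<phi>\<^sub>\<beta>\<close>. For \<open>q = 1\<close> these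
  are isolated and of finite order because the pressure is real-analytic: a complex perturbation of
  the normalised iterates stays in a cone away from \<open>0\<close>, and Montel's theorem passes to the limit.
\<close>

text \<open>The usual route (eigenfunction, spectral gap, perturbation of an isolated eigenvalue) is
  avoided. What Laplace's method demands is uniformity: after division by the \<open>n\<close>-th
  power of the spectral radius, the tilted masses must converge uniformly for \<open>t\<close> in a
  ball and have a majorant integrable over all \<open>t\<close>. So the constants of the contraction
  depend on the potential only through its Lipschitz constant. Dividing by the iterate of 1 instead
  of by an eigenfunction keeps all weights elementary: their distortion is inherited from Birkhoff
  sums, which change boundedly in \<open>n\<close> when the tail of the sequence changes.

  Maximum points of different flatness compete: one of order \<open>k\<close> carries mass of order
  \<open>n powr (- q / k)\<close>, so only the flattest receive positive coefficients. For
  \<open>q = 1\<close> flat pieces are excluded globally: by analyticity an interval of maximum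
  points would spread over the whole line, but \<phi>_\<beta> tends to minus infinity. The case
  \<beta> = 0 lies outside this scheme, having no Gaussian and every \<open>t\<close> as a maximum
  point, and is settled directly.\<close>

lemma compact_UNIV_seq:
  assumes "compact (UNIV :: 'a::metric_space set)"
  shows "compact (UNIV :: (nat \<Rightarrow> 'a) set)"
proof -
  have "compact_space (product_topology (\<lambda>_::nat. euclidean :: 'a topology) UNIV)"
    using assms by (subst compact_space_product_topology) (auto simp: compact_space_def)
  then show ?thesis
    by (simp add: euclidean_product_topology compact_space_def)
qed

section \<open>Concatenation of sequences, shifts and Birkhoff sums\<close>

lemma comb_seq_comb_seq: "comb_seq m a (comb_seq n b x) = comb_seq (m + n) (comb_seq m a b) x"
  by (auto simp: comb_seq_def fun_eq_iff)

lemma funpow_shift: "(shift ^^ n) x = (\<lambda>k. x (n + k))"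
  by (induction n arbitrary: x) (auto simp: shift_def funpow_swap1 fun_eq_iff)

lemma funpow_shift_comb_seq [simp]: "(shift ^^ n) (comb_seq n a x) = x"
  by (auto simp: funpow_shift comb_seq_def)

lemma comb_seq_funpow_shift [simp]: "comb_seq n x ((shift ^^ n) x) = x"
  by (auto simp: funpow_shift comb_seq_def)

lemma comb_seq_same [simp]: "comb_seq n (comb_seq n a b) x = comb_seq n a x"
  by (auto simp: comb_seq_def fun_eq_iff)

lemma birkhoff_sum_add:
  "birkhoff_sum (m + n) \<phi> x = birkhoff_sum m \<phi> x + birkhoff_sum n \<phi> ((shift ^^ m) x)"
  by (induction n) (auto simp: birkhoff_sum_def funpow_shift add.assoc)

lemma birkhoff_sum_0 [simp]: "birkhoff_sum 0 \<phi> x = 0"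
  by (simp add: birkhoff_sum_def)

lemma birkhoff_sum_linear:
  "birkhoff_sum n (\<lambda>\<omega>. \<Sum>i\<in>I. c i * \<psi> i \<omega>) x = (\<Sum>i\<in>I. c i * birkhoff_sum n (\<psi> i) x)"
  unfolding birkhoff_sum_def by (subst sum.swap) (simp add: sum_distrib_left)

lemma continuous_on_funpow_shift:
  "continuous_on UNIV (\<lambda>x :: nat \<Rightarrow> 'a::topological_space. (shift ^^ n) x)"
  unfolding funpow_shift by (intro continuous_on_coordinatewise_then_product continuous_intros) auto

lemma continuous_on_birkhoff_sum:
  assumes "continuous_on UNIV \<phi>"
  shows "continuous_on UNIV (birkhoff_sum n \<phi>)"
proof -
  have "continuous_on UNIV (\<lambda>x. \<phi> ((shift ^^ k) x))" for k
    by (rule continuous_on_compose2[OF assms continuous_on_funpow_shift]) auto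
  then show ?thesis unfolding birkhoff_sum_def by (intro continuous_on_sum) auto
qed

lemma continuous_on_comb_seq:
  "continuous_on UNIV (\<lambda>x :: nat \<Rightarrow> 'a::topological_space. comb_seq n a x)"
proof (intro continuous_on_coordinatewise_then_product)
  show "continuous_on UNIV (\<lambda>x :: nat \<Rightarrow> 'a. comb_seq n a x i)" for i
    by (cases "i < n") (auto simp: comb_seq_def intro!: continuous_intros continuous_on_product_coordinates)
qed

lemma birkhoff_sum_bound:
  assumes "\<And>x. \<bar>\<phi> x\<bar> \<le> B"
  shows "\<bar>birkhoff_sum n \<phi> x\<bar> \<le> real n * B"
proof -
  have "\<bar>birkhoff_sum n \<phi> x\<bar> \<le> (\<Sum>k<n. \<bar>\<phi> ((shift ^^ k) x)\<bar>)" unfolding birkhoff_sum_def by (rule sum_abs)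
  also have "\<dots> \<le> (\<Sum>k<n. B)" by (intro sum_mono assms)
  finally show ?thesis by simp
qed

section \<open>The full shift with its product measure\<close>

locale full_shift = prob_space \<rho> for \<rho> :: "'a::polish_space measure" +
  assumes compact_E: "compact (UNIV :: 'a set)"
    and sets_rho [measurable_cong]: "sets \<rho> = sets borel"
begin

abbreviation Pr :: "(nat \<Rightarrow> 'a) measure" where "Pr \<equiv> product_measure \<rho>"

lemma space_rho [simp]: "space \<rho> = UNIV"
  using sets_eq_imp_space_eq[OF sets_rho] by simp

sublocale sq: sequence_space \<rho> ..

sublocale Pr: prob_space Pr
  unfolding product_measure_def by (rule sq.P.prob_space_axioms)

lemma sets_Pr [measurable_cong]: "sets Pr = sets borel"
proof -
  have "sets Pr = sets (PiM UNIV (\<lambda>_::nat. borel :: 'a measure))"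
    unfolding product_measure_def by (intro sets_PiM_cong) (auto simp: sets_rho)
  then show ?thesis by (simp add: sets_PiM_equal_borel)
qed

lemma space_Pr [simp]: "space Pr = UNIV"
  using sets_eq_imp_space_eq[OF sets_Pr] by simp

lemma measurable_comb [measurable (raw)]:
  fixes f g :: "'b \<Rightarrow> nat \<Rightarrow> 'a"
  assumes "f \<in> borel_measurable N" "g \<in> borel_measurable N"
  shows "(\<lambda>x. comb_seq n (f x) (g x)) \<in> borel_measurable N"
proof -
  have e: "sets (PiM UNIV (\<lambda>_::nat. borel :: 'a measure)) = sets borel" by (rule sets_PiM_equal_borel)
  have "(\<lambda>x. comb_seq n (f x) (g x)) \<in> measurable N (PiM UNIV (\<lambda>_::nat. borel :: 'a measure))"
    by (rule measurable_comb_seq') (use assms e in \<open>simp_all cong: measurable_cong_sets\<close>)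
  then show ?thesis using e by (simp cong: measurable_cong_sets)
qed

lemma distr_comb: "distr (Pr \<Otimes>\<^sub>M Pr) Pr (\<lambda>(\<omega>, \<omega>'). comb_seq i \<omega> \<omega>') = Pr"
  unfolding product_measure_def by (rule sq.PiM_comb_seq)

lemma bounded_continuous:
  fixes f :: "(nat \<Rightarrow> 'a) \<Rightarrow> 'b::real_normed_vector"
  assumes "continuous_on UNIV f"
  obtains B where "B > 0" "\<And>x. norm (f x) \<le> B"
proof -
  have "bounded (f ` UNIV)"
    by (intro compact_imp_bounded compact_continuous_image assms compact_UNIV_seq compact_E)
  then obtain B where "\<And>x. norm (f x) \<le> B" by (auto simp: bounded_iff)
  then show ?thesis using that[of "max B 1"] by (simp add: max.coboundedI1)
qed

lemma borel_measurable_cont: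
  fixes f :: "(nat \<Rightarrow> 'a) \<Rightarrow> 'b::topological_space"
  shows "continuous_on UNIV f \<Longrightarrow> f \<in> borel_measurable borel"
  by (rule borel_measurable_continuous_onI)

lemma integrable_bounded_Pr:
  fixes f :: "(nat \<Rightarrow> 'a) \<Rightarrow> 'b::{banach, second_countable_topology}"
  assumes "f \<in> borel_measurable borel" "\<And>x. norm (f x) \<le> B"
  shows "integrable Pr f"
  by (rule Pr.integrable_const_bound[where B = B]) (use assms in \<open>auto simp: cong: measurable_cong_sets\<close>)

lemma integrable_cont:
  fixes f :: "(nat \<Rightarrow> 'a) \<Rightarrow> 'b::{banach, second_countable_topology}"
  assumes "continuous_on UNIV f"
  shows "integrable Pr f" "integrable Pr (\<lambda>\<omega>. f (comb_seq n \<omega> x))"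
proof -
  obtain B where "\<And>x. norm (f x) \<le> B" using bounded_continuous[OF assms] by metis
  moreover have [measurable]: "f \<in> borel_measurable borel" by (rule borel_measurable_cont[OF assms])
  ultimately show "integrable Pr f" "integrable Pr (\<lambda>\<omega>. f (comb_seq n \<omega> x))"
    by (auto intro!: integrable_bounded_Pr[where B = B])
qed

text \<open>Of two independent samples, the first \<open>n\<close> letters of one followed by the
  other are again distributed like \<open>Pr\<close>. The two equations are the two orders of
  integration.\<close>

lemma integral_comb:
  fixes f :: "(nat \<Rightarrow> 'a) \<Rightarrow> 'b::{banach, second_countable_topology}"
  assumes [measurable]: "f \<in> borel_measurable borel" and B: "\<And>x. norm (f x) \<le> B"
  shows "(\<integral>\<omega>. \<integral>\<eta>. f (comb_seq n \<omega> \<eta>) \<partial>Pr \<partial>Pr) = (\<integral>\<omega>. f \<omega> \<partial>Pr)"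
    and "(\<integral>\<eta>. \<integral>\<omega>. f (comb_seq n \<omega> \<eta>) \<partial>Pr \<partial>Pr) = (\<integral>\<omega>. f \<omega> \<partial>Pr)"
proof -
  interpret PP: pair_prob_space Pr Pr ..
  have i: "integrable (Pr \<Otimes>\<^sub>M Pr) (\<lambda>z. f (comb_seq n (fst z) (snd z)))"
    by (rule PP.integrable_const_bound[where B = B]) (use B in auto)
  have "(\<integral>\<omega>. f \<omega> \<partial>Pr) = (\<integral>\<omega>. f \<omega> \<partial>distr (Pr \<Otimes>\<^sub>M Pr) Pr (\<lambda>(\<omega>, \<omega>'). comb_seq n \<omega> \<omega>'))"
    by (simp add: distr_comb)
  also have "\<dots> = (\<integral>z. f (comb_seq n (fst z) (snd z)) \<partial>(Pr \<Otimes>\<^sub>M Pr))"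
    by (subst integral_distr) (auto simp: case_prod_beta)
  finally have e: "(\<integral>\<omega>. f \<omega> \<partial>Pr) = \<dots>" .
  show "(\<integral>\<omega>. \<integral>\<eta>. f (comb_seq n \<omega> \<eta>) \<partial>Pr \<partial>Pr) = (\<integral>\<omega>. f \<omega> \<partial>Pr)"
    unfolding e using PP.integral_fst'[OF i] by simp
  show "(\<integral>\<eta>. \<integral>\<omega>. f (comb_seq n \<omega> \<eta>) \<partial>Pr \<partial>Pr) = (\<integral>\<omega>. f \<omega> \<partial>Pr)"
    unfolding e using PP.integral_snd[of "\<lambda>\<omega> \<eta>. f (comb_seq n \<omega> \<eta>)"] i by (simp add: case_prod_beta')
qed

subsection \<open>The metric\<close>

lemma dOmega_summable: "summable (\<lambda>n. dist (x n) (y n :: 'a) / 2 ^ (n + 1))"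
  by (rule summable_dOmega[OF compact_E])

lemma dOmega_nonneg [simp]: "0 \<le> dOmega x (y :: nat \<Rightarrow> 'a)"
  unfolding dOmega_def by (intro suminf_nonneg dOmega_summable) auto

lemma dOmega_sym: "dOmega x (y :: nat \<Rightarrow> 'a) = dOmega y x"
  unfolding dOmega_def by (simp add: dist_commute)

definition diam :: real where "diam = max 1 (SUP (x, y)\<in>UNIV. dist x (y::'a))"

lemma diam_ge_1: "1 \<le> diam" by (simp add: diam_def)

lemma dist_le_diam: "dist x (y::'a) \<le> diam"
proof -
  obtain D where D: "\<And>a b :: 'a. dist a b \<le> D"
    using compact_imp_bounded[OF compact_E] by (auto simp: bounded_two_points)
  have "dist x y \<le> (SUP (x, y)\<in>UNIV. dist x (y::'a))"
    by (rule cSUP_upper2[of _ _ "(x, y)"]) (auto intro!: bdd_aboveI[of _ D] D)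
  then show ?thesis by (simp add: diam_def)
qed

lemma dOmega_le_diam: "dOmega x (y :: nat \<Rightarrow> 'a) \<le> diam"
proof -
  have s: "(\<lambda>n. diam * (1/2)^(Suc n)) sums (diam * 1)"
    by (intro sums_mult power_half_series)
  have "dOmega x y \<le> (\<Sum>n. diam * (1/2)^(Suc n))"
    unfolding dOmega_def
    by (intro suminf_le sums_summable[OF s] dOmega_summable)
       (simp add: power_divide divide_simps dist_le_diam)
  then show ?thesis using sums_unique[OF s] by simp
qed

text \<open>The inverse branches of the shift contract; every distortion bound below goes back to
  this.\<close>

lemma dOmega_comb: "dOmega (comb_seq n \<omega> x) (comb_seq n \<omega> y) = dOmega x (y :: nat \<Rightarrow> 'a) / 2 ^ n"
proof -
  let ?f = "\<lambda>k. dist (comb_seq n \<omega> x k) (comb_seq n \<omega> y k) / 2 ^ (k + 1)"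
  have "dOmega (comb_seq n \<omega> x) (comb_seq n \<omega> y) = (\<Sum>k. ?f (k + n)) + (\<Sum>k<n. ?f k)"
    unfolding dOmega_def by (rule suminf_split_initial_segment) (rule dOmega_summable)
  also have "(\<Sum>k<n. ?f k) = 0" by (simp add: comb_seq_def)
  also have "(\<Sum>k. ?f (k + n)) = (\<Sum>k. dist (x k) (y k) / 2 ^ (k + 1) / 2 ^ n)"
    by (intro suminf_cong) (simp add: comb_seq_def power_add)
  also have "\<dots> = dOmega x y / 2 ^ n"
    unfolding dOmega_def by (rule suminf_divide) (rule dOmega_summable)
  finally show ?thesis by simp
qed

definition lip :: "real \<Rightarrow> ((nat \<Rightarrow> 'a) \<Rightarrow> 'b::real_normed_vector) \<Rightarrow> bool" where
  "lip c f \<longleftrightarrow> (\<forall>x y. norm (f x - f y) \<le> c * dOmega x y)"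

lemma lip_imp_continuous:
  assumes "lip c f"
  shows "continuous_on UNIV f"
proof (clarsimp simp: continuous_on_eq_continuous_at isCont_def)
  fix x :: "nat \<Rightarrow> 'a"
  have "((\<lambda>y. dOmega y x) \<longlongrightarrow> 0) (at x)"
    using tendsto_iff_dOmega[OF compact_E, of "\<lambda>y. y" x "at x"] by (auto intro: tendsto_ident_at)
  then have "((\<lambda>y. c * dOmega y x) \<longlongrightarrow> 0) (at x)" by (auto intro!: tendsto_eq_intros)
  then have "((\<lambda>y. f y - f x) \<longlongrightarrow> 0) (at x)"
    by (rule Lim_null_comparison[rotated]) (use assms in \<open>auto simp: lip_def\<close>)
  then show "f \<midarrow>x\<rightarrow> f x" by (simp add: LIM_zero_iff)
qed

lemma lip_mono: "lip c f \<Longrightarrow> c \<le> c' \<Longrightarrow> lip c' f"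
  unfolding lip_def by (meson dOmega_nonneg mult_right_mono order_trans)

text \<open>Bounded distortion: the \<open>k\<close>-th summands are evaluated at points that share
  \<open>n - k\<close> letters, so they differ by at most
  \<open>l * dOmega x y / 2 ^ (n - k)\<close>, and the geometric series is bounded uniformly in
  \<open>n\<close>.\<close>

lemma lip_birkhoff:
  assumes "lip l \<phi>" "l \<ge> 0"
  shows "\<bar>birkhoff_sum n \<phi> (comb_seq n \<omega> x) - birkhoff_sum n \<phi> (comb_seq n \<omega> y)\<bar> \<le> l * dOmega x y"
proof -
  \<comment> \<open>The induction carries the exact geometric sum \<open>1 - 1 / 2 ^ n\<close>; the
    final bound with factor 1 would not be inductive.\<close>
  have *: "\<bar>birkhoff_sum n \<phi> (comb_seq n \<omega> x) - birkhoff_sum n \<phi> (comb_seq n \<omega> y)\<bar>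
      \<le> l * (1 - 1 / 2 ^ n) * dOmega x y"
  proof (induction n arbitrary: \<omega>)
    case (Suc n)
    have c: "comb_seq (Suc n) \<omega> z = comb_seq 1 \<omega> (comb_seq n (shift \<omega>) z)" for z :: "nat \<Rightarrow> 'a"
      by (auto simp: fun_eq_iff comb_seq_def shift_def split: nat.split)
    have s: "(shift ^^ 1) (comb_seq 1 \<omega> z) = z" for z :: "nat \<Rightarrow> 'a" by (rule funpow_shift_comb_seq)
    have d: "birkhoff_sum (1 + n) \<phi> (comb_seq (Suc n) \<omega> z) =
        \<phi> (comb_seq (Suc n) \<omega> z) + birkhoff_sum n \<phi> (comb_seq n (shift \<omega>) z)" for z :: "nat \<Rightarrow> 'a"
      unfolding birkhoff_sum_add c s by (simp add: birkhoff_sum_def)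
    have "\<bar>\<phi> (comb_seq (Suc n) \<omega> x) - \<phi> (comb_seq (Suc n) \<omega> y)\<bar> \<le> l * (dOmega x y / 2 ^ Suc n)"
      using assms(1) dOmega_comb[of "Suc n" \<omega> x y] unfolding lip_def real_norm_def by metis
    with Suc[of "shift \<omega>"] d[of x] d[of y]
    have "\<bar>birkhoff_sum (Suc n) \<phi> (comb_seq (Suc n) \<omega> x) - birkhoff_sum (Suc n) \<phi> (comb_seq (Suc n) \<omega> y)\<bar>
      \<le> l * (1 - 1 / 2 ^ n) * dOmega x y + l * (dOmega x y / 2 ^ Suc n)" by simp
    also have "\<dots> = l * (1 - 1 / 2 ^ Suc n) * dOmega x y" by (simp add: field_simps)
    finally show ?case .
  qed simp
  also have "\<dots> \<le> l * dOmega x y"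
    using assms(2) by (intro mult_right_mono dOmega_nonneg) (auto simp: algebra_simps)
  finally show ?thesis .
qed

subsection \<open>Iterated transfer operators\<close>

text \<open>The \<open>n\<close>-th iterate of the transfer operator as a single integral over
  prefixes. Only the first \<open>n\<close> letters of \<omega> enter; integrating over whole
  sequences keeps all iterates on one probability space.\<close>

definition iter_transfer :: "nat \<Rightarrow> ((nat \<Rightarrow> 'a) \<Rightarrow> real) \<Rightarrow> ((nat \<Rightarrow> 'a) \<Rightarrow> 'b) \<Rightarrow> (nat \<Rightarrow> 'a) \<Rightarrow>
    'b::{banach, second_countable_topology}" where
  "iter_transfer n \<phi> f x = (\<integral>\<omega>. exp (birkhoff_sum n \<phi> (comb_seq n \<omega> x)) *\<^sub>R f (comb_seq n \<omega> x) \<partial>Pr)"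

lemma continuous_on_weight:
  fixes f :: "(nat \<Rightarrow> 'a) \<Rightarrow> 'b::{banach, second_countable_topology}"
  assumes "continuous_on UNIV \<phi>" "continuous_on UNIV f"
  shows "continuous_on UNIV (\<lambda>x. exp (birkhoff_sum n \<phi> x) *\<^sub>R f x)"
  by (intro continuous_intros assms continuous_on_birkhoff_sum)

lemma integrable_weight:
  fixes f :: "(nat \<Rightarrow> 'a) \<Rightarrow> 'b::{banach, second_countable_topology}"
  assumes "continuous_on UNIV \<phi>" "continuous_on UNIV f"
  shows "integrable Pr (\<lambda>\<omega>. exp (birkhoff_sum n \<phi> (comb_seq n \<omega> x)) *\<^sub>R f (comb_seq n \<omega> x))"
  using integrable_cont(2)[OF continuous_on_weight[OF assms]] .

lemma continuous_on_integral_comb: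
  fixes f :: "(nat \<Rightarrow> 'a) \<Rightarrow> 'b::{banach, second_countable_topology}"
  assumes f: "continuous_on UNIV f"
  shows "continuous_on UNIV (\<lambda>x. \<integral>\<omega>. f (comb_seq n \<omega> x) \<partial>Pr)"
proof (clarsimp simp: continuous_on_sequentially)
  fix X :: "nat \<Rightarrow> nat \<Rightarrow> 'a" and x assume X: "X \<longlonglongrightarrow> x"
  obtain B where B: "\<And>x. norm (f x) \<le> B" using bounded_continuous[OF f] by metis
  have [measurable]: "f \<in> borel_measurable borel" by (rule borel_measurable_cont[OF f])
  have "(\<lambda>k. f (comb_seq n \<omega> (X k))) \<longlonglongrightarrow> f (comb_seq n \<omega> x)" for \<omega>
    by (rule continuous_on_tendsto_compose[OF continuous_on_compose2[OF f continuous_on_comb_seq] X]) auto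
  then have "(\<lambda>k. \<integral>\<omega>. f (comb_seq n \<omega> (X k)) \<partial>Pr) \<longlonglongrightarrow> (\<integral>\<omega>. f (comb_seq n \<omega> x) \<partial>Pr)"
    by (intro integral_dominated_convergence[where w = "\<lambda>_. B"]) (auto intro: B)
  then show "((\<lambda>x. \<integral>\<omega>. f (comb_seq n \<omega> x) \<partial>Pr) \<circ> X) \<longlonglongrightarrow> (\<integral>\<omega>. f (comb_seq n \<omega> x) \<partial>Pr)"
    by (simp add: o_def)
qed

lemma continuous_on_iter_transfer:
  fixes f :: "(nat \<Rightarrow> 'a) \<Rightarrow> 'b::{banach, second_countable_topology}"
  assumes "continuous_on UNIV \<phi>" "continuous_on UNIV f"
  shows "continuous_on UNIV (iter_transfer n \<phi> f)"
  unfolding iter_transfer_def using continuous_on_integral_comb[OF continuous_on_weight[OF assms]] .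

lemma iter_transfer_0 [simp]: "iter_transfer 0 \<phi> f = f"
  using Pr.prob_space by (simp add: iter_transfer_def fun_eq_iff comb_seq_0)

lemma iter_transfer_add:
  fixes f :: "(nat \<Rightarrow> 'a) \<Rightarrow> 'b::{banach, second_countable_topology}"
  assumes \<phi>: "continuous_on UNIV \<phi>" and f: "continuous_on UNIV f"
  shows "iter_transfer n \<phi> (iter_transfer m \<phi> f) x = iter_transfer (m + n) \<phi> f x"
proof -
  let ?F = "\<lambda>z. exp (birkhoff_sum (m + n) \<phi> z) *\<^sub>R f z"
  have cF: "continuous_on UNIV ?F" by (rule continuous_on_weight[OF \<phi> f])
  obtain B where B: "\<And>x. norm (?F x) \<le> B" using bounded_continuous[OF cF] by metis
  have [measurable]: "?F \<in> borel_measurable borel" by (rule borel_measurable_cont[OF cF])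
  \<comment> \<open>The prefix of length \<open>m + n\<close> is resampled as \<open>m\<close> fresh
    letters followed by letters of \<eta>, of which the first \<open>n\<close> are kept.\<close>
  have "iter_transfer (m + n) \<phi> f x = (\<integral>\<eta>. \<integral>\<omega>. ?F (comb_seq (m + n) (comb_seq m \<omega> \<eta>) x) \<partial>Pr \<partial>Pr)"
    unfolding iter_transfer_def by (rule integral_comb(2)[symmetric, where B = B]) (use B in auto)
  also have "\<dots> = (\<integral>\<eta>. exp (birkhoff_sum n \<phi> (comb_seq n \<eta> x)) *\<^sub>R iter_transfer m \<phi> f (comb_seq n \<eta> x) \<partial>Pr)"
  proof (rule Bochner_Integration.integral_cong[OF refl])
    fix \<eta>
    have "exp (birkhoff_sum n \<phi> (comb_seq n \<eta> x)) *\<^sub>R iter_transfer m \<phi> f (comb_seq n \<eta> x) =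
      (\<integral>\<omega>. exp (birkhoff_sum n \<phi> (comb_seq n \<eta> x)) *\<^sub>R
        (exp (birkhoff_sum m \<phi> (comb_seq m \<omega> (comb_seq n \<eta> x))) *\<^sub>R f (comb_seq m \<omega> (comb_seq n \<eta> x))) \<partial>Pr)"
      unfolding iter_transfer_def by (rule integral_scaleR_right[symmetric])
    then show "(\<integral>\<omega>. ?F (comb_seq (m + n) (comb_seq m \<omega> \<eta>) x) \<partial>Pr) =
      exp (birkhoff_sum n \<phi> (comb_seq n \<eta> x)) *\<^sub>R iter_transfer m \<phi> f (comb_seq n \<eta> x)"
      by (simp add: comb_seq_comb_seq[symmetric] birkhoff_sum_add exp_add mult.commute)
  qed
  also have "\<dots> = iter_transfer n \<phi> (iter_transfer m \<phi> f) x" by (simp add: iter_transfer_def[of n])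
  finally show ?thesis ..
qed

lemma integral_iter_transfer:
  fixes f :: "(nat \<Rightarrow> 'a) \<Rightarrow> 'b::{banach, second_countable_topology}"
  assumes \<phi>: "continuous_on UNIV \<phi>" and f: "continuous_on UNIV f"
  shows "(\<integral>x. iter_transfer n \<phi> f x \<partial>Pr) = (\<integral>x. exp (birkhoff_sum n \<phi> x) *\<^sub>R f x \<partial>Pr)"
proof -
  let ?F = "\<lambda>z. exp (birkhoff_sum n \<phi> z) *\<^sub>R f z"
  have cF: "continuous_on UNIV ?F" by (rule continuous_on_weight[OF \<phi> f])
  obtain B where B: "\<And>x. norm (?F x) \<le> B" using bounded_continuous[OF cF] by metis
  show ?thesis unfolding iter_transfer_def
    by (rule integral_comb(2)[where B = B]) (use B borel_measurable_cont[OF cF] in auto)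
qed

lemma transfer_eq_iter_transfer:
  fixes f :: "(nat \<Rightarrow> 'a) \<Rightarrow> 'b::{banach, second_countable_topology}"
  assumes \<phi>: "continuous_on UNIV \<phi>" and f: "continuous_on UNIV f"
  shows "transfer \<rho> (\<lambda>_ _. 1) \<phi> f = iter_transfer 1 \<phi> f"
proof
  fix x :: "nat \<Rightarrow> 'a"
  let ?g = "\<lambda>z. exp (\<phi> z) *\<^sub>R f z"
  have [measurable]: "?g \<in> borel_measurable borel"
    by (intro borel_measurable_cont continuous_intros \<phi> f)
  have O: "Omega (\<lambda>_ _::'a. 1) = UNIV" by (simp add: Omega_def)
  have m: "(\<lambda>t. ?g (case_nat t x)) \<in> borel_measurable \<rho>"
  proof -
    have "(\<lambda>t::'a. case_nat t x) \<in> borel_measurable borel"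
    proof (intro borel_measurable_continuous_onI continuous_on_coordinatewise_then_product)
      show "continuous_on UNIV (\<lambda>t::'a. case_nat t x i)" for i
        by (cases i) (auto intro!: continuous_intros)
    qed
    then show ?thesis by measurable
  qed
  have "iter_transfer 1 \<phi> f x = (\<integral>\<omega>. ?g (case_nat (\<omega> 0) x) \<partial>Pr)"
    by (simp add: iter_transfer_def birkhoff_sum_def)
  also have "\<dots> = (\<integral>t. ?g (case_nat t x) \<partial>distr Pr \<rho> (\<lambda>\<omega>. \<omega> 0))"
    by (subst integral_distr) (use m in \<open>auto simp: product_measure_def\<close>)
  also have "distr Pr \<rho> (\<lambda>\<omega>. \<omega> 0) = \<rho>"
    unfolding product_measure_def by (rule sq.PiM_component) simp
  finally show "transfer \<rho> (\<lambda>_ _. 1) \<phi> f x = iter_transfer 1 \<phi> f x"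
    by (simp add: transfer_def O)
qed

end

section \<open>Contraction of weighted averages in a truncated metric\<close>

lemma exp_diff_le: "\<bar>exp a - exp b\<bar> \<le> exp M * \<bar>a - b\<bar>" if "a \<le> M" "b \<le> M" for a b M :: real
proof -
  have *: "exp a - exp b \<le> exp M * \<bar>a - b\<bar>" if "b \<le> a" "a \<le> M" for a b M :: real
  proof -
    have "exp a - exp b = exp a * (1 - exp (b - a))" by (simp add: algebra_simps flip: exp_add)
    also have "1 - exp (b - a) \<le> a - b" using exp_ge_add_one_self[of "b - a"] by linarith
    then have "exp a * (1 - exp (b - a)) \<le> exp a * (a - b)" by (intro mult_left_mono) auto
    also have "\<dots> \<le> exp M * \<bar>a - b\<bar>" using that by (intro mult_mono) auto
    finally show ?thesis .
  qed
  show ?thesis using *[of a b M] *[of b a M] that by (cases "a \<le> b") (auto simp: abs_minus_commute)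
qed

context full_shift
begin

lemma integrable_scaleR_bounded:
  fixes g :: "(nat \<Rightarrow> 'a) \<Rightarrow> 'b::{banach, second_countable_topology}"
  assumes "integrable Pr w" "g \<in> borel_measurable borel" "\<And>x. norm (g x) \<le> B"
  shows "integrable Pr (\<lambda>\<omega>. w \<omega> *\<^sub>R g \<omega>)"
proof (rule Bochner_Integration.integrable_bound)
  show "integrable Pr (\<lambda>\<omega>. B * w \<omega>)" using assms(1) by simp
  show "(\<lambda>\<omega>. w \<omega> *\<^sub>R g \<omega>) \<in> borel_measurable Pr"
    using assms(2) borel_measurable_integrable[OF assms(1)] by (auto cong: measurable_cong_sets)
  have "norm (w \<omega> *\<^sub>R g \<omega>) \<le> norm (B * w \<omega>)" for \<omega>
    using mult_left_mono[OF assms(3)[of \<omega>], of "\<bar>w \<omega>\<bar>"] order_trans[OF norm_ge_zero assms(3)[of \<omega>]]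
    by (simp add: abs_mult mult.commute)
  then show "AE x in Pr. norm (w x *\<^sub>R g x) \<le> norm (B * w x)" by simp
qed

lemma norm_integral_weight_le:
  fixes g :: "(nat \<Rightarrow> 'a) \<Rightarrow> 'b::{banach, second_countable_topology}"
  assumes w: "integrable Pr w" and gm: "g \<in> borel_measurable borel" and B: "\<And>x. norm (g x) \<le> B"
    and v: "integrable Pr v" "\<And>\<omega>. \<bar>w \<omega>\<bar> \<le> v \<omega>"
  shows "norm (\<integral>\<omega>. w \<omega> *\<^sub>R g \<omega> \<partial>Pr) \<le> (\<integral>\<omega>. v \<omega> \<partial>Pr) * B"
proof -
  have "norm (\<integral>\<omega>. w \<omega> *\<^sub>R g \<omega> \<partial>Pr) \<le> (\<integral>\<omega>. v \<omega> * B \<partial>Pr)"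
  proof (rule order_trans[OF integral_norm_bound integral_mono])
    show "integrable Pr (\<lambda>\<omega>. norm (w \<omega> *\<^sub>R g \<omega>))"
      by (rule integrable_norm[OF integrable_scaleR_bounded[OF w gm B]])
    show "norm (w \<omega> *\<^sub>R g \<omega>) \<le> v \<omega> * B" for \<omega>
      unfolding norm_scaleR by (intro mult_mono B v(2) norm_ge_zero order_trans[OF abs_ge_zero v(2)])
  qed (use v in simp)
  also have "\<dots> = (\<integral>\<omega>. v \<omega> \<partial>Pr) * B" by simp
  finally show ?thesis .
qed

text \<open>Product coupling: averaging \<open>f \<omega> - g \<eta>\<close> with the weight
  \<open>w1 \<omega> * w2 \<eta>\<close>, of total mass \<open>\<mu>\<^sup>2\<close>, gives \<mu>
  times the difference of the two integrals. The proof averages over \<eta> first, then over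
  \<omega>.\<close>

lemma two_weights:
  fixes f g :: "(nat \<Rightarrow> 'a) \<Rightarrow> 'b::{banach, second_countable_topology}"
  assumes w: "integrable Pr w1" "integrable Pr w2" "\<And>\<omega>. 0 \<le> w1 \<omega>" "\<And>\<omega>. 0 \<le> w2 \<omega>"
    and \<mu>: "(\<integral>\<omega>. w1 \<omega> \<partial>Pr) = \<mu>" "(\<integral>\<omega>. w2 \<omega> \<partial>Pr) = \<mu>" "\<mu> > 0"
    and f: "f \<in> borel_measurable borel" "\<And>x. norm (f x) \<le> Bf"
    and g: "g \<in> borel_measurable borel" "\<And>x. norm (g x) \<le> Bg"
    and osc: "\<And>\<omega> \<eta>. norm (f \<omega> - g \<eta>) \<le> c"
  shows "norm ((\<integral>\<omega>. w1 \<omega> *\<^sub>R f \<omega> \<partial>Pr) - (\<integral>\<omega>. w2 \<omega> *\<^sub>R g \<omega> \<partial>Pr)) \<le> \<mu> * c"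
proof -
  note i1 = integrable_scaleR_bounded[OF w(1) f] and i2 = integrable_scaleR_bounded[OF w(2) g]
  define J where "J = (\<integral>\<omega>. w2 \<omega> *\<^sub>R g \<omega> \<partial>Pr)"
  have 1: "norm (\<mu> *\<^sub>R f \<omega> - J) \<le> \<mu> * c" for \<omega>
  proof -
    have "\<mu> *\<^sub>R f \<omega> - J = (\<integral>\<eta>. w2 \<eta> *\<^sub>R (f \<omega> - g \<eta>) \<partial>Pr)"
      unfolding J_def scaleR_diff_right using i2 w(2) \<mu>(2)
      by (subst Bochner_Integration.integral_diff) (auto simp: integral_scaleR_left)
    also have "norm \<dots> \<le> (\<integral>\<omega>. w2 \<omega> \<partial>Pr) * c"
      by (rule norm_integral_weight_le) (use w g f osc in auto)
    finally show ?thesis using \<mu> by simp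
  qed
  have "\<mu> *\<^sub>R ((\<integral>\<omega>. w1 \<omega> *\<^sub>R f \<omega> \<partial>Pr) - J) = (\<integral>\<omega>. w1 \<omega> *\<^sub>R (\<mu> *\<^sub>R f \<omega> - J) \<partial>Pr)"
    unfolding scaleR_diff_right using i1 w(1) \<mu>(1)
    by (subst Bochner_Integration.integral_diff)
       (auto simp: integral_scaleR_left scaleR_left_commute simp del: scaleR_scaleR)
  also have "norm \<dots> \<le> (\<integral>\<omega>. w1 \<omega> \<partial>Pr) * (\<mu> * c)"
    by (rule norm_integral_weight_le) (use w f 1 in auto)
  finally have "\<mu> * norm ((\<integral>\<omega>. w1 \<omega> *\<^sub>R f \<omega> \<partial>Pr) - J) \<le> \<mu> * (\<mu> * c)" using \<mu> by simp
  then show ?thesis using \<mu>(3) by (simp add: J_def)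
qed

text \<open>The constant \<open>c\<close> controls two things at once, the oscillation by
  \<open>c\<close> and the Lipschitz constant by \<open>c * K\<close>. Distant points contract
  because their weights share mass, close points because prefixes bring them closer; the truncation
  lets one seminorm see both effects.\<close>

definition trunc_lip :: "real \<Rightarrow> real \<Rightarrow> ((nat \<Rightarrow> 'a) \<Rightarrow> 'b::real_normed_vector) \<Rightarrow> bool" where
  "trunc_lip K c f \<longleftrightarrow> (\<forall>x y. norm (f x - f y) \<le> c * min 1 (K * dOmega x y))"

lemma trunc_lip_osc: "trunc_lip K c f \<Longrightarrow> 0 \<le> c \<Longrightarrow> norm (f x - f y) \<le> c"
  unfolding trunc_lip_def by (smt (verit, best) min.cobounded1 mult_left_le)

lemma trunc_lip_lip: "trunc_lip K c f \<Longrightarrow> 0 \<le> c \<Longrightarrow> lip (c * K) f"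
  unfolding trunc_lip_def lip_def by (metis min.cobounded2 mult.assoc mult_left_mono order_trans)

lemma trunc_lipI:
  "(\<And>x y. norm (f x - f y) \<le> c) \<Longrightarrow> (\<And>x y. norm (f x - f y) \<le> c * K * dOmega x y) \<Longrightarrow> trunc_lip K c f"
  unfolding trunc_lip_def by (simp add: min_def mult.assoc)

lemma lip_imp_trunc_lip:
  assumes "lip a f" "\<And>x. norm (f x) \<le> B" "K \<ge> 1" "0 \<le> a"
  shows "trunc_lip K (max (2 * B) a) f"
proof (rule trunc_lipI)
  fix x y
  show "norm (f x - f y) \<le> max (2 * B) a"
    using norm_triangle_ineq4[of "f x" "f y"] assms(2)[of x] assms(2)[of y] by (simp add: le_max_iff_disj)
  have "norm (f x - f y) \<le> a * dOmega x y" using assms(1) by (simp add: lip_def)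
  also have "\<dots> \<le> max (2 * B) a * K * dOmega x y"
  proof (intro mult_right_mono dOmega_nonneg)
    have "a * 1 \<le> max (2 * B) a * K" using assms by (intro mult_mono) auto
    then show "a \<le> max (2 * B) a * K" by simp
  qed
  finally show "norm (f x - f y) \<le> max (2 * B) a * K * dOmega x y" .
qed

lemma trunc_lip_mono: "trunc_lip K c f \<Longrightarrow> c \<le> c' \<Longrightarrow> 0 \<le> K \<Longrightarrow> trunc_lip K c' f"
  unfolding trunc_lip_def by (smt (verit, ccfv_SIG) dOmega_nonneg mult_nonneg_nonneg mult_right_mono)

text \<open>Two weights differing by the distortion over \<open>diam\<close> share the mass \<open>overlap\<close>. A prefix of length
  \<open>block_len\<close> brings the points \<open>\<omega>x\<close> and \<open>\<omega>y\<close> within \<open>1 / 2\<close> in the truncated metric and divides their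
  distance by \<open>4\<close>; the factor \<open>4\<close> in \<open>metric_scale\<close> makes the change of weight equally small.\<close>

definition overlap :: "real \<Rightarrow> real" where "overlap l = exp (- (3 * l * diam)) / 2"
definition distortion_const :: "real \<Rightarrow> real" where "distortion_const l = 3 * l * exp (3 * l * diam)"
definition metric_scale :: "real \<Rightarrow> real" where "metric_scale l = 4 * distortion_const l + 1"
definition block_len :: "real \<Rightarrow> nat" where "block_len l = (SOME m. m \<ge> 1 \<and> (2::real) ^ m \<ge> max 4 (2 * metric_scale l * diam))"
definition contr_rate :: "real \<Rightarrow> real" where "contr_rate l = max (1 - overlap l / 2) (1 / 2)"

lemma block_len: "block_len l \<ge> 1" "(2::real) ^ block_len l \<ge> 4" "2 ^ block_len l \<ge> 2 * metric_scale l * diam"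
proof -
  obtain m where "(2::real) ^ m > max 4 (2 * metric_scale l * diam)"
    using real_arch_pow[of 2 "max 4 (2 * metric_scale l * diam)"] by auto
  moreover have "m \<ge> 1" using calculation by (cases m) auto
  ultimately have "\<exists>m. m \<ge> 1 \<and> (2::real) ^ m \<ge> max 4 (2 * metric_scale l * diam)" by (intro exI[of _ m]) auto
  from someI_ex[OF this] show "block_len l \<ge> 1" "(2::real) ^ block_len l \<ge> 4" "2 ^ block_len l \<ge> 2 * metric_scale l * diam"
    by (auto simp: block_len_def)
qed

lemma overlap: "0 < overlap l" "l \<ge> 0 \<Longrightarrow> overlap l \<le> 1 / 2"
  using diam_ge_1 by (auto simp: overlap_def)

lemma contr_rate: "0 < contr_rate l" "contr_rate l < 1" using overlap[of l] by (auto simp: contr_rate_def)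

lemma distortion_const_nonneg: "l \<ge> 0 \<Longrightarrow> distortion_const l \<ge> 0" by (simp add: distortion_const_def)

lemma metric_scale_ge_1: "l \<ge> 0 \<Longrightarrow> metric_scale l \<ge> 1" using distortion_const_nonneg[of l] by (simp add: metric_scale_def)

text \<open>For distant points, a share \<open>q\<close> of the mass is common to both weights and
  sees values at most \<open>c / 2\<close> apart, while the rest sees at most \<open>c\<close>; the
  total factor is \<open>1 - q / 2\<close>. For close points, moving the argument costs
  \<open>K / 4\<close> and changing the weight costs another \<open>K / 4\<close> per unit of
  \<open>c * dOmega x y\<close>; the total factor is \<open>1 / 2\<close>. \<open>contr_rate\<close>
  is the larger of the two.\<close>

lemma weighted_average_contraction:
  fixes f :: "(nat \<Rightarrow> 'a) \<Rightarrow> 'b::{banach, second_countable_topology}"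
  assumes l: "l \<ge> 0" and c: "c \<ge> 0"
    and b: "\<And>x. integrable Pr (\<lambda>\<omega>. b \<omega> x)" "\<And>\<omega> x. 0 \<le> b \<omega> x" "\<And>x. (\<integral>\<omega>. b \<omega> x \<partial>Pr) = 1"
    and bl: "\<And>\<omega> x y. b \<omega> x \<le> exp (3 * l * dOmega x y) * b \<omega> y"
    and f: "continuous_on UNIV f" "trunc_lip (metric_scale l) c f"
  shows "trunc_lip (metric_scale l) (contr_rate l * c) (\<lambda>x. \<integral>\<omega>. b \<omega> x *\<^sub>R f (comb_seq (block_len l) \<omega> x) \<partial>Pr)"
proof -
  define m where "m = block_len l"
  define q where "q = overlap l"
  define K where "K = metric_scale l"
  note block_len' = block_len[of l, folded m_def K_def]
  have K1: "K \<ge> 1" using metric_scale_ge_1[OF l] by (simp add: K_def)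
  have q: "0 < q" "q \<le> 1/2" using overlap[of l] l by (auto simp: q_def)
  obtain B where B: "\<And>x. norm (f x) \<le> B" using bounded_continuous[OF f(1)] by metis
  have [measurable]: "f \<in> borel_measurable borel" by (rule borel_measurable_cont[OF f(1)])
  have mf: "(\<lambda>\<omega>. f (comb_seq m \<omega> x)) \<in> borel_measurable borel" for x by measurable
  have fd: "norm (f x - f y) \<le> c" "norm (f x - f y) \<le> c * K * dOmega x y" for x y
    using trunc_lip_osc[OF f(2) c] trunc_lip_lip[OF f(2) c] by (auto simp: lip_def K_def)
  let ?F = "\<lambda>x. \<integral>\<omega>. b \<omega> x *\<^sub>R f (comb_seq m \<omega> x) \<partial>Pr"
  have ib: "integrable Pr (\<lambda>\<omega>. b \<omega> x *\<^sub>R f (comb_seq m \<omega> y))" for x y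
    by (rule integrable_scaleR_bounded[OF b(1) mf B])
  have d1: "norm (\<integral>\<omega>. b \<omega> y *\<^sub>R (f (comb_seq m \<omega> x) - f (comb_seq m \<omega> y)) \<partial>Pr) \<le> c * K * dOmega x y / 2 ^ m" for x y
  proof -
    have "norm (\<integral>\<omega>. b \<omega> y *\<^sub>R (f (comb_seq m \<omega> x) - f (comb_seq m \<omega> y)) \<partial>Pr)
      \<le> (\<integral>\<omega>. b \<omega> y \<partial>Pr) * (c * K * (dOmega x y / 2 ^ m))"
    proof (rule norm_integral_weight_le)
      show "norm (f (comb_seq m \<omega> x) - f (comb_seq m \<omega> y)) \<le> c * K * (dOmega x y / 2 ^ m)" for \<omega>
        using fd(2)[of "comb_seq m \<omega> x" "comb_seq m \<omega> y"] by (simp add: dOmega_comb)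
    qed (use b in auto)
    then show ?thesis by (simp add: b)
  qed
  show ?thesis
  proof (rule trunc_lipI)
    fix x y :: "nat \<Rightarrow> 'a"
    \<comment> \<open>The effect of moving the argument from \<open>x\<close> to \<open>y\<close>
      under the weight of \<open>y\<close>; it occurs in both decompositions of the
      difference.\<close>
    define E where "E = (\<integral>\<omega>. b \<omega> y *\<^sub>R (f (comb_seq m \<omega> x) - f (comb_seq m \<omega> y)) \<partial>Pr)"
    have Eeq: "E = (\<integral>\<omega>. b \<omega> y *\<^sub>R f (comb_seq m \<omega> x) \<partial>Pr) - ?F y"
      unfolding E_def scaleR_diff_right by (rule Bochner_Integration.integral_diff[OF ib ib])
    \<comment> \<open>The factor \<open>1 / 2\<close> in \<open>overlap\<close> leaves slack here:
      it keeps the remaining mass \<open>1 - q\<close> positive, as \<open>two_weights\<close>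
      requires.\<close>
    have qb: "q * b \<omega> y \<le> b \<omega> x" for \<omega>
    proof -
      have "b \<omega> y \<le> exp (3 * l * diam) * b \<omega> x"
        using bl[of \<omega> y x] mult_right_mono[OF _ b(2), of "exp (3 * l * dOmega y x)" "exp (3 * l * diam)" \<omega> x]
          mult_left_mono[OF dOmega_le_diam, of "3 * l" y x] l by auto
      then have "2 * q * b \<omega> y \<le> b \<omega> x" by (simp add: q_def overlap_def exp_minus field_simps)
      moreover have "q * b \<omega> y \<ge> 0" using q b(2) by simp
      ultimately show ?thesis by linarith
    qed
    \<comment> \<open>What remains of the two weights has equal mass \<open>1 - q\<close> but no
      useful matching, so only the oscillation of \<open>f\<close> is used.\<close>
    have S: "norm ((\<integral>\<omega>. (b \<omega> x - q * b \<omega> y) *\<^sub>R f (comb_seq m \<omega> x) \<partial>Pr) -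
        (\<integral>\<omega>. ((1 - q) * b \<omega> y) *\<^sub>R f (comb_seq m \<omega> y) \<partial>Pr)) \<le> (1 - q) * c"
    proof (rule two_weights[OF _ _ _ _ _ _ _ mf B mf B])
      show "integrable Pr (\<lambda>\<omega>. b \<omega> x - q * b \<omega> y)" using b(1) by simp
      show "(\<integral>\<omega>. b \<omega> x - q * b \<omega> y \<partial>Pr) = 1 - q" using b by simp
    qed (use b qb q fd in auto)
    have eq: "?F x - ?F y = q *\<^sub>R E + ((\<integral>\<omega>. (b \<omega> x - q * b \<omega> y) *\<^sub>R f (comb_seq m \<omega> x) \<partial>Pr) -
        (\<integral>\<omega>. ((1 - q) * b \<omega> y) *\<^sub>R f (comb_seq m \<omega> y) \<partial>Pr))"
    proof -
      have "(\<integral>\<omega>. (b \<omega> x - q * b \<omega> y) *\<^sub>R f (comb_seq m \<omega> x) \<partial>Pr) =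
          ?F x - q *\<^sub>R (\<integral>\<omega>. b \<omega> y *\<^sub>R f (comb_seq m \<omega> x) \<partial>Pr)"
        unfolding scaleR_diff_left scaleR_scaleR[symmetric] using ib by (simp del: scaleR_scaleR)
      moreover have "(\<integral>\<omega>. ((1 - q) * b \<omega> y) *\<^sub>R f (comb_seq m \<omega> y) \<partial>Pr) = (1 - q) *\<^sub>R ?F y"
        unfolding scaleR_scaleR[symmetric] using ib by (simp del: scaleR_scaleR)
      ultimately show ?thesis by (simp add: Eeq algebra_simps)
    qed
    have "norm (?F x - ?F y) \<le> q * (c * K * dOmega x y / 2 ^ m) + (1 - q) * c"
      unfolding eq
    proof (rule order_trans[OF norm_triangle_ineq add_mono[OF _ S]])
      show "norm (q *\<^sub>R E) \<le> q * (c * K * dOmega x y / 2 ^ m)"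
        unfolding norm_scaleR abs_of_pos[OF q(1)] E_def
        by (rule mult_left_mono[OF d1]) (use q in simp)
    qed
    also have "\<dots> \<le> q * (c / 2) + (1 - q) * c"
    proof -
      have "2 * (K * dOmega x y) \<le> 2 * (K * diam)"
        using K1 by (intro mult_left_mono dOmega_le_diam) auto
      also have "\<dots> \<le> 2 ^ m" using block_len' by simp
      finally have "c * (2 * (K * dOmega x y)) \<le> c * 2 ^ m" by (rule mult_left_mono[OF _ c])
      then have "c * K * dOmega x y / 2 ^ m \<le> c / 2" by (simp add: field_simps)
      then show ?thesis using q by (intro add_mono mult_left_mono) auto
    qed
    also have "\<dots> = (1 - q / 2) * c" by (simp add: algebra_simps)
    also have "\<dots> \<le> contr_rate l * c" using c by (intro mult_right_mono) (auto simp: contr_rate_def q_def)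
    finally show "norm ((\<integral>\<omega>. b \<omega> x *\<^sub>R f (comb_seq (block_len l) \<omega> x) \<partial>Pr) -
      (\<integral>\<omega>. b \<omega> y *\<^sub>R f (comb_seq (block_len l) \<omega> y) \<partial>Pr)) \<le> contr_rate l * c" by (simp add: m_def)
    define d where "d = dOmega x y"
    have d: "0 \<le> d" "d \<le> diam" using dOmega_le_diam by (auto simp: d_def)
    have bd: "\<bar>b \<omega> x - b \<omega> y\<bar> \<le> distortion_const l * d * b \<omega> y" for \<omega>
    proof -
      have e: "exp (3 * l * d) - 1 \<le> distortion_const l * d"
      proof -
        have "exp (3 * l * d) - exp 0 \<le> exp (3 * l * diam) * \<bar>3 * l * d - 0\<bar>"
          using exp_diff_le[of "3 * l * d" "3 * l * diam" 0] d l mult_left_mono[OF d(2), of "3 * l"] by auto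
        then show ?thesis using l d by (simp add: distortion_const_def algebra_simps)
      qed
      have e1: "1 \<le> exp (3 * l * d)" using l d by simp
      have x: "b \<omega> x \<le> exp (3 * l * d) * b \<omega> y" and y: "b \<omega> y \<le> exp (3 * l * d) * b \<omega> x"
        using bl[of \<omega> x y] bl[of \<omega> y x] by (auto simp: d_def dOmega_sym)
      have "b \<omega> x - b \<omega> y \<le> (exp (3 * l * d) - 1) * b \<omega> y" using x by (simp add: algebra_simps)
      also have "\<dots> \<le> distortion_const l * d * b \<omega> y" by (intro mult_right_mono e b)
      finally have 1: "b \<omega> x - b \<omega> y \<le> distortion_const l * d * b \<omega> y" .
      have "b \<omega> y - b \<omega> x \<le> distortion_const l * d * b \<omega> y"
      \<comment> \<open>Distortion bounds this difference by a multiple of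
        \<open>b \<omega> x\<close>, which may be replaced by \<open>b \<omega> y\<close> when the
        latter is larger; otherwise the difference is negative.\<close>
      proof (cases "b \<omega> x \<le> b \<omega> y")
        case True
        have "b \<omega> y - b \<omega> x \<le> (exp (3 * l * d) - 1) * b \<omega> x" using y by (simp add: algebra_simps)
        also have "\<dots> \<le> distortion_const l * d * b \<omega> y" using True e e1 b d distortion_const_nonneg[OF l] by (intro mult_mono) auto
        finally show ?thesis .
      next
        case False
        then show ?thesis using b(2)[of \<omega> y] d distortion_const_nonneg[OF l] by (smt (verit) mult_nonneg_nonneg)
      qed
      with 1 show ?thesis by linarith
    qed
    \<comment> \<open>An arbitrary reference point. Since \<open>b \<omega> x - b \<omega> y\<close>
      integrates to 0, subtracting the constant \<open>f ?z\<close> changes nothing and replaces the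
      size of \<open>f\<close> by its oscillation.\<close>
    let ?z = "comb_seq m x x"
    have eq2: "?F x - ?F y = E + (\<integral>\<omega>. (b \<omega> x - b \<omega> y) *\<^sub>R (f (comb_seq m \<omega> x) - f ?z) \<partial>Pr)"
    proof -
      have i: "integrable Pr (\<lambda>\<omega>. (b \<omega> x - b \<omega> y) *\<^sub>R f (comb_seq m \<omega> x))"
        using ib by (simp add: scaleR_diff_left)
      have "(\<integral>\<omega>. (b \<omega> x - b \<omega> y) *\<^sub>R (f (comb_seq m \<omega> x) - f ?z) \<partial>Pr) =
        (\<integral>\<omega>. (b \<omega> x - b \<omega> y) *\<^sub>R f (comb_seq m \<omega> x) \<partial>Pr) - (\<integral>\<omega>. (b \<omega> x - b \<omega> y) *\<^sub>R f ?z \<partial>Pr)"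
        unfolding scaleR_diff_right[of "b _ _ - b _ _"] using i b(1)
        by (intro Bochner_Integration.integral_diff) (auto intro!: integrable_scaleR_left)
      also have "(\<integral>\<omega>. (b \<omega> x - b \<omega> y) *\<^sub>R f ?z \<partial>Pr) = 0"
        using b by (subst integral_scaleR_left) auto
      also have "(\<integral>\<omega>. (b \<omega> x - b \<omega> y) *\<^sub>R f (comb_seq m \<omega> x) \<partial>Pr) =
          ?F x - (\<integral>\<omega>. b \<omega> y *\<^sub>R f (comb_seq m \<omega> x) \<partial>Pr)"
        unfolding scaleR_diff_left using ib by simp
      finally show ?thesis by (simp add: Eeq)
    qed
    have rb: "norm (\<integral>\<omega>. (b \<omega> x - b \<omega> y) *\<^sub>R (f (comb_seq m \<omega> x) - f ?z) \<partial>Pr) \<le>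
        (\<integral>\<omega>. distortion_const l * d * b \<omega> y \<partial>Pr) * c"
    proof (rule norm_integral_weight_le)
      show "integrable Pr (\<lambda>\<omega>. b \<omega> x - b \<omega> y)" "integrable Pr (\<lambda>\<omega>. distortion_const l * d * b \<omega> y)"
        using b(1) by auto
      show "(\<lambda>\<omega>. f (comb_seq m \<omega> x) - f ?z) \<in> borel_measurable borel" by measurable
    qed (fact fd bd)+
    have ib1: "(\<integral>\<omega>. distortion_const l * d * b \<omega> y \<partial>Pr) = distortion_const l * d" using b(3) by simp
    have "norm E \<le> c * K * d / 2 ^ m" unfolding E_def d_def by (rule d1)
    then have "norm (?F x - ?F y) \<le> c * K * d / 2 ^ m + distortion_const l * d * c"
      unfolding eq2 by (rule order_trans[OF norm_triangle_ineq add_mono[OF _ rb[unfolded ib1]]])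
    also have "\<dots> \<le> c * K * d / 4 + K / 4 * d * c"
    proof (intro add_mono mult_right_mono c d)
      show "distortion_const l \<le> K / 4" by (simp add: K_def metric_scale_def)
      show "c * K * d / 2 ^ m \<le> c * K * d / 4"
        using block_len' c K1 d by (intro divide_left_mono) auto
    qed
    also have "\<dots> = 1 / 2 * (c * K * d)" by simp
    also have "\<dots> \<le> contr_rate l * (c * K * d)" using c K1 d by (intro mult_right_mono) (auto simp: contr_rate_def)
    finally show "norm ((\<integral>\<omega>. b \<omega> x *\<^sub>R f (comb_seq (block_len l) \<omega> x) \<partial>Pr) -
      (\<integral>\<omega>. b \<omega> y *\<^sub>R f (comb_seq (block_len l) \<omega> y) \<partial>Pr)) \<le> contr_rate l * c * metric_scale l * dOmega x y"
      by (simp add: m_def K_def d_def mult_ac)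
  qed
qed

end

context full_shift
begin

subsection \<open>Normalised iterates\<close>

definition iter_one :: "nat \<Rightarrow> ((nat \<Rightarrow> 'a) \<Rightarrow> real) \<Rightarrow> (nat \<Rightarrow> 'a) \<Rightarrow> real" where
  "iter_one n \<phi> = iter_transfer n \<phi> (\<lambda>_. 1)"

definition norm_iter :: "nat \<Rightarrow> ((nat \<Rightarrow> 'a) \<Rightarrow> real) \<Rightarrow> ((nat \<Rightarrow> 'a) \<Rightarrow> 'b) \<Rightarrow> (nat \<Rightarrow> 'a) \<Rightarrow>
    'b::{banach, second_countable_topology}" where
  "norm_iter n \<phi> f x = iter_transfer n \<phi> f x /\<^sub>R iter_one n \<phi> x"

text \<open>The probability density of the random prefix of length \<open>m\<close> that leads from
  the normalised iterate \<open>n\<close> to the normalised iterate \<open>n + m\<close>. The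
  dependence on \<open>n\<close> is the price for normalising by \<open>iter_one\<close> and not by
  an eigenfunction.\<close>

definition branch_weight :: "nat \<Rightarrow> nat \<Rightarrow> ((nat \<Rightarrow> 'a) \<Rightarrow> real) \<Rightarrow> (nat \<Rightarrow> 'a) \<Rightarrow> (nat \<Rightarrow> 'a) \<Rightarrow> real" where
  "branch_weight n m \<phi> \<omega> x = exp (birkhoff_sum m \<phi> (comb_seq m \<omega> x)) * iter_one n \<phi> (comb_seq m \<omega> x) / iter_one (n + m) \<phi> x"

lemma iter_one_eq: "iter_one n \<phi> x = (\<integral>\<omega>. exp (birkhoff_sum n \<phi> (comb_seq n \<omega> x)) \<partial>Pr)"
  by (simp add: iter_one_def iter_transfer_def)

lemma iter_one_0 [simp]: "iter_one 0 \<phi> x = 1" by (simp add: iter_one_def)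

context
  fixes l :: real and \<phi> :: "(nat \<Rightarrow> 'a) \<Rightarrow> real"
  assumes l: "0 \<le> l" and \<phi>: "lip l \<phi>"
begin

lemma potential_continuous: "continuous_on UNIV \<phi>" by (rule lip_imp_continuous[OF \<phi>])

lemma cont_iter_one: "continuous_on UNIV (iter_one n \<phi>)"
  unfolding iter_one_def by (rule continuous_on_iter_transfer[OF potential_continuous]) auto

lemma iter_one_bounds:
  assumes M: "\<And>x. \<bar>\<phi> x\<bar> \<le> M"
  shows "exp (- (real n * M)) \<le> iter_one n \<phi> x" "iter_one n \<phi> x \<le> exp (real n * M)"
proof -
  have b: "\<bar>birkhoff_sum n \<phi> z\<bar> \<le> real n * M" for z by (rule birkhoff_sum_bound[OF M])
  have i: "integrable Pr (\<lambda>\<omega>. exp (birkhoff_sum n \<phi> (comb_seq n \<omega> x)))"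
    using integrable_weight[OF potential_continuous, of "\<lambda>_. 1::real" n x] by simp
  have "(\<integral>\<omega>. exp (- (real n * M)) \<partial>Pr) \<le> iter_one n \<phi> x"
    unfolding iter_one_eq
  proof (intro integral_mono i)
    show "exp (- (real n * M)) \<le> exp (birkhoff_sum n \<phi> (comb_seq n \<omega> x))" for \<omega>
      using b[of "comb_seq n \<omega> x"] by simp
  qed simp
  then show "exp (- (real n * M)) \<le> iter_one n \<phi> x" by (simp add: Pr.prob_space[simplified])
  have "iter_one n \<phi> x \<le> (\<integral>\<omega>. exp (real n * M) \<partial>Pr)"
    unfolding iter_one_eq using b by (intro integral_mono i) (auto simp: abs_le_iff)
  then show "iter_one n \<phi> x \<le> exp (real n * M)" by (simp add: Pr.prob_space[simplified])
qed

lemma iter_one_pos: "0 < iter_one n \<phi> x"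
proof -
  obtain M where "\<And>x. norm (\<phi> x) \<le> M" using bounded_continuous[OF potential_continuous] by metis
  then show ?thesis using iter_one_bounds(1)[of M n x] by (smt (verit) exp_gt_zero real_norm_def)
qed

lemma iter_one_distortion: "iter_one n \<phi> x \<le> exp (l * dOmega x y) * iter_one n \<phi> y"
proof -
  have i: "integrable Pr (\<lambda>\<omega>. exp (birkhoff_sum n \<phi> (comb_seq n \<omega> x)))" for x
    using integrable_weight[OF potential_continuous, of "\<lambda>_. 1::real" n x] by simp
  have "exp (birkhoff_sum n \<phi> (comb_seq n \<omega> x)) \<le> exp (l * dOmega x y) * exp (birkhoff_sum n \<phi> (comb_seq n \<omega> y))" for \<omega>
    using lip_birkhoff[OF \<phi> l, of n \<omega> x y] by (simp flip: exp_add)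
  then have "iter_one n \<phi> x \<le> (\<integral>\<omega>. exp (l * dOmega x y) * exp (birkhoff_sum n \<phi> (comb_seq n \<omega> y)) \<partial>Pr)"
    unfolding iter_one_eq by (intro integral_mono i) (use i in auto)
  then show ?thesis by (simp add: iter_one_eq)
qed

lemma iter_one_distortion_diam: "iter_one n \<phi> x \<le> exp (l * diam) * iter_one n \<phi> y"
proof -
  have "exp (l * dOmega x y) * iter_one n \<phi> y \<le> exp (l * diam) * iter_one n \<phi> y"
    using iter_one_pos[of n y] mult_left_mono[OF dOmega_le_diam l] by (intro mult_right_mono) auto
  then show ?thesis using iter_one_distortion[of n x y] by linarith
qed

lemma iter_one_add: "iter_one (n + m) \<phi> x = (\<integral>\<omega>. exp (birkhoff_sum m \<phi> (comb_seq m \<omega> x)) * iter_one n \<phi> (comb_seq m \<omega> x) \<partial>Pr)"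
  using iter_transfer_add[OF potential_continuous, of "\<lambda>_. 1::real" m n x] by (simp add: iter_one_def iter_transfer_def[of m] )

lemma branch_weight_integrable: "integrable Pr (\<lambda>\<omega>. branch_weight n m \<phi> \<omega> x)"
proof -
  have "integrable Pr (\<lambda>\<omega>. exp (birkhoff_sum m \<phi> (comb_seq m \<omega> x)) * iter_one n \<phi> (comb_seq m \<omega> x))"
    using integrable_weight[OF potential_continuous cont_iter_one] by simp
  then show ?thesis unfolding branch_weight_def by simp
qed

lemma branch_weight_pos: "0 < branch_weight n m \<phi> \<omega> x"
  using iter_one_pos by (simp add: branch_weight_def)

lemma branch_weight_integral: "(\<integral>\<omega>. branch_weight n m \<phi> \<omega> x \<partial>Pr) = 1"
  using iter_one_add[of n m x] iter_one_pos[of "n + m" x] by (simp add: branch_weight_def)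

text \<open>Each of the three factors, the exponential and the two values of
  \<open>iter_one\<close>, varies by at most \<open>exp (l * dOmega x y)\<close>; hence the constant
  \<open>3 * l\<close>.\<close>

lemma branch_weight_distortion: "branch_weight n m \<phi> \<omega> x \<le> exp (3 * l * dOmega x y) * branch_weight n m \<phi> \<omega> y"
proof -
  let ?d = "l * dOmega x y"
  have d: "?d \<ge> 0" using l by simp
  have 1: "exp (birkhoff_sum m \<phi> (comb_seq m \<omega> x)) \<le> exp ?d * exp (birkhoff_sum m \<phi> (comb_seq m \<omega> y))"
    using lip_birkhoff[OF \<phi> l, of m \<omega> x y] by (simp flip: exp_add)
  have "iter_one n \<phi> (comb_seq m \<omega> x) \<le> exp (l * (dOmega x y / 2 ^ m)) * iter_one n \<phi> (comb_seq m \<omega> y)"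
    using iter_one_distortion[of n "comb_seq m \<omega> x" "comb_seq m \<omega> y"] by (simp add: dOmega_comb)
  also have "\<dots> \<le> exp ?d * iter_one n \<phi> (comb_seq m \<omega> y)"
  proof -
    have "?d / 2 ^ m \<le> ?d / 1" by (rule divide_left_mono) (use d in auto)
    then show ?thesis using iter_one_pos[of n "comb_seq m \<omega> y"] by (intro mult_right_mono) auto
  qed
  finally have 2: "iter_one n \<phi> (comb_seq m \<omega> x) \<le> exp ?d * iter_one n \<phi> (comb_seq m \<omega> y)" .
  have "iter_one (n + m) \<phi> y \<le> exp ?d * iter_one (n + m) \<phi> x"
    using iter_one_distortion[of "n + m" y x] by (simp add: dOmega_sym)
  then have 3: "1 / iter_one (n + m) \<phi> x \<le> exp ?d * (1 / iter_one (n + m) \<phi> y)"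
    using iter_one_pos[of "n + m" x] iter_one_pos[of "n + m" y] by (simp add: field_simps)
  have "branch_weight n m \<phi> \<omega> x = exp (birkhoff_sum m \<phi> (comb_seq m \<omega> x)) * iter_one n \<phi> (comb_seq m \<omega> x) * (1 / iter_one (n + m) \<phi> x)"
    by (simp add: branch_weight_def)
  also have "\<dots> \<le> (exp ?d * exp (birkhoff_sum m \<phi> (comb_seq m \<omega> y))) * (exp ?d * iter_one n \<phi> (comb_seq m \<omega> y)) *
      (exp ?d * (1 / iter_one (n + m) \<phi> y))"
    by (intro mult_mono 1 2 3 mult_nonneg_nonneg) (use iter_one_pos in \<open>auto intro: less_imp_le\<close>)
  also have "\<dots> = (exp ?d * exp ?d * exp ?d) * branch_weight n m \<phi> \<omega> y" by (simp add: branch_weight_def)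
  also have "exp ?d * exp ?d * exp ?d = exp (3 * l * dOmega x y)" by (simp flip: exp_add)
  finally show ?thesis .
qed

lemma branch_weight_average:
  fixes f :: "(nat \<Rightarrow> 'a) \<Rightarrow> 'b::{banach, second_countable_topology}"
  shows "(\<integral>\<omega>. branch_weight n m \<phi> \<omega> x *\<^sub>R f (comb_seq m \<omega> x) \<partial>Pr) = iter_transfer m \<phi> (\<lambda>z. iter_one n \<phi> z *\<^sub>R f z) x /\<^sub>R iter_one (n + m) \<phi> x"
  unfolding iter_transfer_def integral_scaleR_right[symmetric] branch_weight_def by (simp add: divide_inverse mult_ac)

lemma norm_iter_add:
  fixes f :: "(nat \<Rightarrow> 'a) \<Rightarrow> 'b::{banach, second_countable_topology}"
  assumes f: "continuous_on UNIV f"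
  shows "norm_iter (n + m) \<phi> f x = (\<integral>\<omega>. branch_weight n m \<phi> \<omega> x *\<^sub>R norm_iter n \<phi> f (comb_seq m \<omega> x) \<partial>Pr)"
proof -
  have "(\<lambda>z. iter_one n \<phi> z *\<^sub>R norm_iter n \<phi> f z) = iter_transfer n \<phi> f"
    using iter_one_pos[of n] by (auto simp: norm_iter_def fun_eq_iff less_imp_neq[symmetric])
  then show ?thesis unfolding branch_weight_average using iter_transfer_add[OF potential_continuous f, of m n x] by (simp add: norm_iter_def)
qed

lemma cont_norm_iter:
  fixes f :: "(nat \<Rightarrow> 'a) \<Rightarrow> 'b::{banach, second_countable_topology}"
  assumes f: "continuous_on UNIV f"
  shows "continuous_on UNIV (norm_iter n \<phi> f)"
  unfolding norm_iter_def using iter_one_pos[of n]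
  by (intro continuous_intros cont_iter_one continuous_on_iter_transfer potential_continuous f) (auto simp: less_imp_neq[symmetric])

lemma norm_iter_0 [simp]: "norm_iter 0 \<phi> f = f" by (simp add: norm_iter_def fun_eq_iff)

lemma norm_iter_const: "norm_iter n \<phi> (\<lambda>_. c) x = c"
proof -
  have "iter_transfer n \<phi> (\<lambda>_. c) x = iter_one n \<phi> x *\<^sub>R c" unfolding iter_transfer_def iter_one_eq
    by (rule integral_scaleR_left) (use integrable_weight[OF potential_continuous, of "\<lambda>_. 1::real" n x] in simp)
  then show ?thesis using iter_one_pos[of n x] by (simp add: norm_iter_def)
qed

lemma average_contraction:
  fixes f :: "(nat \<Rightarrow> 'a) \<Rightarrow> 'b::{banach, second_countable_topology}"
  assumes "continuous_on UNIV f" "trunc_lip (metric_scale l) c f" "c \<ge> 0"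
  shows "trunc_lip (metric_scale l) (contr_rate l * c) (\<lambda>x. \<integral>\<omega>. branch_weight n (block_len l) \<phi> \<omega> x *\<^sub>R f (comb_seq (block_len l) \<omega> x) \<partial>Pr)"
  by (rule weighted_average_contraction[OF l assms(3)])
     (use branch_weight_integrable branch_weight_pos branch_weight_integral branch_weight_distortion assms in \<open>auto intro: less_imp_le\<close>)

lemma average_bound:
  fixes f :: "(nat \<Rightarrow> 'a) \<Rightarrow> 'b::{banach, second_countable_topology}"
  assumes f: "continuous_on UNIV f" "\<And>z. norm (f z - v) \<le> c"
  shows "norm ((\<integral>\<omega>. branch_weight n m \<phi> \<omega> x *\<^sub>R f (comb_seq m \<omega> x) \<partial>Pr) - v) \<le> c"
proof -
  obtain B where B: "\<And>x. norm (f x) \<le> B" using bounded_continuous[OF f(1)] by metis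
  have [measurable]: "f \<in> borel_measurable borel" by (rule borel_measurable_cont[OF f(1)])
  have "v = (\<integral>\<omega>. branch_weight n m \<phi> \<omega> x *\<^sub>R v \<partial>Pr)"
    using branch_weight_integral[of n m x] branch_weight_integrable[of n m x] by (subst integral_scaleR_left) auto
  then have "norm ((\<integral>\<omega>. branch_weight n m \<phi> \<omega> x *\<^sub>R f (comb_seq m \<omega> x) \<partial>Pr) - v) =
    norm ((\<integral>\<omega>. branch_weight n m \<phi> \<omega> x *\<^sub>R f (comb_seq m \<omega> x) \<partial>Pr) - (\<integral>\<omega>. branch_weight n m \<phi> \<omega> x *\<^sub>R v \<partial>Pr))" by simp
  also have "\<dots> \<le> 1 * c"
    by (rule two_weights[where Bf = B and Bg = "norm v"])
       (use B f branch_weight_integrable branch_weight_pos branch_weight_integral in \<open>auto intro: less_imp_le\<close>)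
  finally show ?thesis by simp
qed

lemma norm_iter_trunc_lip:
  fixes f :: "(nat \<Rightarrow> 'a) \<Rightarrow> 'b::{banach, second_countable_topology}"
  assumes f: "continuous_on UNIV f" "trunc_lip (metric_scale l) c f" "c \<ge> 0"
  shows "trunc_lip (metric_scale l) (contr_rate l ^ k * c) (norm_iter (k * block_len l) \<phi> f)"
proof (induction k)
  case (Suc k)
  have "norm_iter (Suc k * block_len l) \<phi> f = (\<lambda>x. \<integral>\<omega>. branch_weight (k * block_len l) (block_len l) \<phi> \<omega> x *\<^sub>R norm_iter (k * block_len l) \<phi> f (comb_seq (block_len l) \<omega> x) \<partial>Pr)"
    using norm_iter_add[OF f(1), of "k * block_len l" "block_len l"] by (simp add: add.commute fun_eq_iff)
  moreover have "trunc_lip (metric_scale l) (contr_rate l * (contr_rate l ^ k * c)) \<dots>"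
    using contr_rate(1)[of l] f(3) by (intro average_contraction cont_norm_iter f Suc) auto
  ultimately show ?case by (simp add: mult_ac)
qed (use f in simp)

text \<open>Contraction is only available after whole blocks. The letters beyond
  \<open>k * block_len l\<close> merely average the iterate reached there, and an average stays
  within its oscillation, so every larger \<open>n\<close> is covered.\<close>

lemma norm_iter_cauchy:
  fixes f :: "(nat \<Rightarrow> 'a) \<Rightarrow> 'b::{banach, second_countable_topology}"
  assumes f: "continuous_on UNIV f" "trunc_lip (metric_scale l) c f" "c \<ge> 0" and n: "n \<ge> k * block_len l"
  shows "norm (norm_iter n \<phi> f x - norm_iter (k * block_len l) \<phi> f y) \<le> contr_rate l ^ k * c"
proof -
  obtain j where j: "n = k * block_len l + j" using n le_Suc_ex by blast
  have "0 \<le> contr_rate l ^ k * c" using contr_rate(1)[of l] f(3) by simp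
  then have "norm (norm_iter (k * block_len l) \<phi> f z - norm_iter (k * block_len l) \<phi> f y) \<le> contr_rate l ^ k * c" for z
    by (rule trunc_lip_osc[OF norm_iter_trunc_lip[OF f]])
  then show ?thesis unfolding j norm_iter_add[OF f(1)] by (intro average_bound cont_norm_iter f)
qed

end

text \<open>The conformal measure as a functional, before it is known to be a measure. The base
  point \<open>undefined\<close> is arbitrary: the limit is the same everywhere by
  \<open>norm_iter_LIMSEQ\<close>.\<close>

definition limit_fun :: "((nat \<Rightarrow> 'a) \<Rightarrow> real) \<Rightarrow> ((nat \<Rightarrow> 'a) \<Rightarrow> real) \<Rightarrow> real" where
  "limit_fun \<phi> f = lim (\<lambda>n. norm_iter n \<phi> f (\<lambda>_. undefined))"

text \<open>The leading eigenvalue: \<open>iter_one (Suc n) / iter_one n\<close> is the normalised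
  iterate \<open>n\<close> of the image of 1, so its limit is the functional at that image.\<close>

definition growth :: "((nat \<Rightarrow> 'a) \<Rightarrow> real) \<Rightarrow> real" where "growth \<phi> = limit_fun \<phi> (iter_transfer 1 \<phi> (\<lambda>_. 1))"

context
  fixes l :: real and \<phi> :: "(nat \<Rightarrow> 'a) \<Rightarrow> real"
  assumes l: "0 \<le> l" and \<phi>: "lip l \<phi>"
begin

lemma norm_iter_cauchy2:
  fixes f :: "(nat \<Rightarrow> 'a) \<Rightarrow> 'b::{banach, second_countable_topology}"
  assumes f: "continuous_on UNIV f" "trunc_lip (metric_scale l) c f" "c \<ge> 0" and n: "n \<ge> k * block_len l" "n' \<ge> k * block_len l"
  shows "norm (norm_iter n \<phi> f x - norm_iter n' \<phi> f y) \<le> 2 * (contr_rate l ^ k * c)"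
  using norm_iter_cauchy[OF l \<phi> f n(1), of x x] norm_iter_cauchy[OF l \<phi> f n(2), of y x]
    norm_triangle_ineq4[of "norm_iter n \<phi> f x - norm_iter (k * block_len l) \<phi> f x" "norm_iter n' \<phi> f y - norm_iter (k * block_len l) \<phi> f x"]
  by simp

lemma contr_rate_eventually: "e > 0 \<Longrightarrow> \<exists>k. contr_rate l ^ k * c < e"
proof -
  assume "e > 0"
  have "(\<lambda>k. contr_rate l ^ k * c) \<longlonglongrightarrow> 0"
    using contr_rate[of l] by (intro tendsto_mult_left_zero LIMSEQ_realpow_zero) auto
  then have "\<forall>\<^sub>F k in sequentially. contr_rate l ^ k * c < e" using \<open>e > 0\<close> by (rule order_tendstoD)
  then show ?thesis by (auto simp: eventually_sequentially)
qed

lemma norm_iter_LIMSEQ_trunc_lip: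
  fixes f :: "(nat \<Rightarrow> 'a) \<Rightarrow> real"
  assumes f: "continuous_on UNIV f" "trunc_lip (metric_scale l) c f" "c \<ge> 0"
  shows "(\<lambda>n. norm_iter n \<phi> f x) \<longlonglongrightarrow> limit_fun \<phi> f"
    and "n \<ge> k * block_len l \<Longrightarrow> \<bar>norm_iter n \<phi> f x - limit_fun \<phi> f\<bar> \<le> 2 * (contr_rate l ^ k * c)"
proof -
  have c2: "\<bar>norm_iter n \<phi> f x - norm_iter n' \<phi> f y\<bar> \<le> 2 * (contr_rate l ^ k * c)" if "n \<ge> k * block_len l" "n' \<ge> k * block_len l" for n n' k x y
    using norm_iter_cauchy2[OF f that, of x y] by simp
  have "Cauchy (\<lambda>n. norm_iter n \<phi> f (\<lambda>_. undefined))"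
  proof (rule metric_CauchyI)
    fix e :: real assume "e > 0"
    then obtain k where "contr_rate l ^ k * (2 * c) < e" using contr_rate_eventually by blast
    then have k: "2 * (contr_rate l ^ k * c) < e" by (simp add: mult_ac)
    show "\<exists>M. \<forall>m\<ge>M. \<forall>n\<ge>M. dist (norm_iter m \<phi> f (\<lambda>_. undefined)) (norm_iter n \<phi> f (\<lambda>_. undefined)) < e"
      unfolding dist_real_def by (intro exI[of _ "k * block_len l"] allI impI le_less_trans[OF _ k] c2)
  qed
  then have L: "(\<lambda>n. norm_iter n \<phi> f (\<lambda>_. undefined)) \<longlonglongrightarrow> limit_fun \<phi> f"
    unfolding limit_fun_def by (simp add: Cauchy_convergent convergent_LIMSEQ_iff[symmetric])
  show r: "\<bar>norm_iter n \<phi> f x - limit_fun \<phi> f\<bar> \<le> 2 * (contr_rate l ^ k * c)" if "n \<ge> k * block_len l" for n k x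
  proof (rule tendsto_upperbound)
    show "(\<lambda>n'. \<bar>norm_iter n \<phi> f x - norm_iter n' \<phi> f (\<lambda>_. undefined)\<bar>) \<longlonglongrightarrow> \<bar>norm_iter n \<phi> f x - limit_fun \<phi> f\<bar>"
      by (intro tendsto_intros L)
    show "\<forall>\<^sub>F n' in sequentially. \<bar>norm_iter n \<phi> f x - norm_iter n' \<phi> f (\<lambda>_. undefined)\<bar> \<le> 2 * (contr_rate l ^ k * c)"
      using c2[OF that] by (auto simp: eventually_sequentially)
  qed auto
  show "(\<lambda>n. norm_iter n \<phi> f x) \<longlonglongrightarrow> limit_fun \<phi> f"
  proof (rule LIMSEQ_I)
    fix e :: real assume "e > 0"
    then obtain k where "contr_rate l ^ k * (2 * c) < e" using contr_rate_eventually by blast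
    then have k: "2 * (contr_rate l ^ k * c) < e" by (simp add: mult_ac)
    show "\<exists>no. \<forall>n\<ge>no. norm (norm_iter n \<phi> f x - limit_fun \<phi> f) < e"
      unfolding real_norm_def by (intro exI[of _ "k * block_len l"] allI impI le_less_trans[OF _ k] r)
  qed
qed

lemma lip_trunc_lip:
  assumes "lip a f"
  obtains c where "c \<ge> 0" "trunc_lip (metric_scale l) c f"
proof -
  obtain B where B: "B > 0" "\<And>x. norm (f x) \<le> B"
    using bounded_continuous[OF lip_imp_continuous[OF assms]] by metis
  have "lip \<bar>a\<bar> f" using assms by (rule lip_mono) auto
  then have "trunc_lip (metric_scale l) (max (2 * B) \<bar>a\<bar>) f" by (rule lip_imp_trunc_lip) (use B metric_scale_ge_1[OF l] in auto)
  then show ?thesis using that[of "max (2 * B) \<bar>a\<bar>"] by auto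
qed

lemma norm_iter_LIMSEQ:
  fixes f :: "(nat \<Rightarrow> 'a) \<Rightarrow> real"
  assumes f: "lip a f"
  shows "(\<lambda>n. norm_iter n \<phi> f x) \<longlonglongrightarrow> limit_fun \<phi> f"
proof -
  obtain c where "c \<ge> 0" "trunc_lip (metric_scale l) c f" using lip_trunc_lip[OF f] .
  then show ?thesis using norm_iter_LIMSEQ_trunc_lip(1)[OF lip_imp_continuous[OF f]] by blast
qed

text \<open>The constant is crude in \<open>n\<close>. For general \<open>n\<close> only its
  existence matters; for \<open>n = 1\<close> its explicit form gives uniformity over bounded sets
  of potentials.\<close>

lemma iter_transfer_lip:
  fixes f :: "(nat \<Rightarrow> 'a) \<Rightarrow> 'b::{banach, second_countable_topology}"
  assumes M: "\<And>x. \<bar>\<phi> x\<bar> \<le> M" and f: "lip a f" "\<And>x. norm (f x) \<le> B" "a \<ge> 0"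
  shows "lip (exp (real n * M) * (l * B + a)) (iter_transfer n \<phi> f)"
  unfolding lip_def
proof (intro allI)
  fix x y
  let ?S = "\<lambda>\<omega> x. birkhoff_sum n \<phi> (comb_seq n \<omega> x)"
  have b: "\<bar>birkhoff_sum n \<phi> z\<bar> \<le> real n * M" for z by (rule birkhoff_sum_bound[OF M])
  have cf: "continuous_on UNIV f" by (rule lip_imp_continuous[OF f(1)])
  note cp = lip_imp_continuous[OF \<phi>]
  have B0: "B \<ge> 0" using order_trans[OF norm_ge_zero f(2)] .
  have "iter_transfer n \<phi> f x - iter_transfer n \<phi> f y =
      (\<integral>\<omega>. exp (?S \<omega> x) *\<^sub>R f (comb_seq n \<omega> x) - exp (?S \<omega> y) *\<^sub>R f (comb_seq n \<omega> y) \<partial>Pr)"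
    unfolding iter_transfer_def by (rule Bochner_Integration.integral_diff[symmetric]; rule integrable_weight[OF cp cf])
  also have "norm \<dots> \<le> (\<integral>\<omega>. exp (real n * M) * (l * B + a) * dOmega x y \<partial>Pr)"
  proof (rule order_trans[OF integral_norm_bound integral_mono])
    show "integrable Pr (\<lambda>\<omega>. norm (exp (?S \<omega> x) *\<^sub>R f (comb_seq n \<omega> x) - exp (?S \<omega> y) *\<^sub>R f (comb_seq n \<omega> y)))"
      by (intro integrable_norm Bochner_Integration.integrable_diff integrable_weight[OF cp cf])
    fix \<omega>
    have eqd: "exp (?S \<omega> x) *\<^sub>R f (comb_seq n \<omega> x) - exp (?S \<omega> y) *\<^sub>R f (comb_seq n \<omega> y) =
      (exp (?S \<omega> x) - exp (?S \<omega> y)) *\<^sub>R f (comb_seq n \<omega> x) + exp (?S \<omega> y) *\<^sub>R (f (comb_seq n \<omega> x) - f (comb_seq n \<omega> y))"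
      by (simp add: algebra_simps)
    have "norm (exp (?S \<omega> x) *\<^sub>R f (comb_seq n \<omega> x) - exp (?S \<omega> y) *\<^sub>R f (comb_seq n \<omega> y))
       \<le> \<bar>exp (?S \<omega> x) - exp (?S \<omega> y)\<bar> * norm (f (comb_seq n \<omega> x)) +
       exp (?S \<omega> y) * norm (f (comb_seq n \<omega> x) - f (comb_seq n \<omega> y))"
      unfolding eqd by (rule order_trans[OF norm_triangle_ineq]) simp
    also have "\<dots> \<le> (exp (real n * M) * (l * dOmega x y)) * B + exp (real n * M) * (a * dOmega x y)"
    proof -
      have "\<bar>exp (?S \<omega> x) - exp (?S \<omega> y)\<bar> \<le> exp (real n * M) * \<bar>?S \<omega> x - ?S \<omega> y\<bar>"
        by (rule exp_diff_le) (use b[of "comb_seq n \<omega> x"] b[of "comb_seq n \<omega> y"] in linarith)+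
      also have "\<dots> \<le> exp (real n * M) * (l * dOmega x y)"
        by (rule mult_left_mono[OF lip_birkhoff[OF \<phi> l]]) simp
      finally have E1: "\<bar>exp (?S \<omega> x) - exp (?S \<omega> y)\<bar> \<le> exp (real n * M) * (l * dOmega x y)" .
      have "norm (f (comb_seq n \<omega> x) - f (comb_seq n \<omega> y)) \<le> a * (dOmega x y / 2 ^ n)"
        using f(1)[unfolded lip_def, rule_format, of "comb_seq n \<omega> x" "comb_seq n \<omega> y"] by (simp add: dOmega_comb)
      also have "\<dots> \<le> a * (dOmega x y / 1)"
        by (intro mult_left_mono divide_left_mono f) auto
      finally have E2: "norm (f (comb_seq n \<omega> x) - f (comb_seq n \<omega> y)) \<le> a * dOmega x y" by simp
      have E3: "exp (?S \<omega> y) \<le> exp (real n * M)" using b[of "comb_seq n \<omega> y"] by (simp add: abs_le_iff)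
      show ?thesis
        by (rule add_mono[OF mult_mono[OF E1 f(2)] mult_mono[OF E3 E2]]) (use l in auto)
    qed
    finally show "norm (exp (?S \<omega> x) *\<^sub>R f (comb_seq n \<omega> x) - exp (?S \<omega> y) *\<^sub>R f (comb_seq n \<omega> y)) \<le>
       exp (real n * M) * (l * B + a) * dOmega x y" by (simp add: algebra_simps)
  qed simp
  finally show "norm (iter_transfer n \<phi> f x - iter_transfer n \<phi> f y) \<le> exp (real n * M) * (l * B + a) * dOmega x y"
    by (simp add: Pr.prob_space[simplified])
qed

lemma iter_transfer_lip':
  fixes f :: "(nat \<Rightarrow> 'a) \<Rightarrow> 'b::{banach, second_countable_topology}"
  assumes f: "lip a f"
  obtains a' where "lip a' (iter_transfer n \<phi> f)"
proof -
  obtain M where M: "\<And>x. norm (\<phi> x) \<le> M" using bounded_continuous[OF lip_imp_continuous[OF \<phi>]] by metis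
  obtain B where B: "\<And>x. norm (f x) \<le> B" using bounded_continuous[OF lip_imp_continuous[OF f]] by metis
  have "lip \<bar>a\<bar> f" by (rule lip_mono[OF f]) simp
  from iter_transfer_lip[OF _ this B, of M n] M that show ?thesis by auto
qed

lemma iter_transfer_diff:
  fixes f g :: "(nat \<Rightarrow> 'a) \<Rightarrow> 'b::{banach, second_countable_topology}"
  assumes "continuous_on UNIV f" "continuous_on UNIV g"
  shows "iter_transfer n \<phi> (\<lambda>x. f x - g x) x = iter_transfer n \<phi> f x - iter_transfer n \<phi> g x"
  using integrable_weight[OF lip_imp_continuous[OF \<phi>] assms(1), of n x]
    integrable_weight[OF lip_imp_continuous[OF \<phi>] assms(2), of n x]
  by (simp add: iter_transfer_def scaleR_diff_right)

lemma iter_transfer_bound: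
  fixes f :: "(nat \<Rightarrow> 'a) \<Rightarrow> 'b::{banach, second_countable_topology}"
  assumes "continuous_on UNIV f" "\<And>x. norm (f x) \<le> B"
  shows "norm (iter_transfer n \<phi> f x) \<le> iter_one n \<phi> x * B"
  unfolding iter_transfer_def iter_one_eq
  by (rule norm_integral_weight_le)
     (use assms integrable_weight[OF lip_imp_continuous[OF \<phi>], of "\<lambda>_. 1::real" n x] borel_measurable_cont[OF assms(1)] in auto)

lemma norm_iter_bound:
  fixes f :: "(nat \<Rightarrow> 'a) \<Rightarrow> 'b::{banach, second_countable_topology}"
  assumes "continuous_on UNIV f" "\<And>x. norm (f x) \<le> B"
  shows "norm (norm_iter n \<phi> f x) \<le> B"
  using iter_transfer_bound[OF assms, of n x] iter_one_pos[OF l \<phi>, of n x] by (simp add: norm_iter_def field_simps)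

lemma norm_iter_diff:
  fixes f g :: "(nat \<Rightarrow> 'a) \<Rightarrow> 'b::{banach, second_countable_topology}"
  assumes "continuous_on UNIV f" "continuous_on UNIV g"
  shows "norm_iter n \<phi> (\<lambda>x. f x - g x) x = norm_iter n \<phi> f x - norm_iter n \<phi> g x"
  by (simp add: norm_iter_def iter_transfer_diff[OF assms] scaleR_diff_right)

lemma iter_one_Suc_ratio: "iter_one (Suc n) \<phi> x = norm_iter n \<phi> (iter_transfer 1 \<phi> (\<lambda>_. 1)) x * iter_one n \<phi> x"
proof -
  have "iter_transfer n \<phi> (iter_transfer 1 \<phi> (\<lambda>_. 1 :: real)) x = iter_one (1 + n) \<phi> x"
    unfolding iter_one_def by (rule iter_transfer_add[OF lip_imp_continuous[OF \<phi>]]) auto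
  then show ?thesis using iter_one_pos[OF l \<phi>, of n x] by (simp add: norm_iter_def)
qed

lemma lip_h1: obtains a where "lip a (iter_transfer 1 \<phi> (\<lambda>_. 1 :: real))"
  by (rule iter_transfer_lip'[of 0 "\<lambda>_. 1 :: real" 1]) (auto simp: lip_def)

lemma iter_one_ratio_LIMSEQ: "(\<lambda>n. iter_one (Suc n) \<phi> x / iter_one n \<phi> x) \<longlonglongrightarrow> growth \<phi>"
proof -
  obtain a where "lip a (iter_transfer 1 \<phi> (\<lambda>_. 1 :: real))" using lip_h1 .
  from norm_iter_LIMSEQ[OF this, of x] show ?thesis
    using iter_one_pos[OF l \<phi>] by (simp add: iter_one_Suc_ratio growth_def less_imp_neq[symmetric])
qed

text \<open>The normalised iterate \<open>n\<close> of the image of \<open>f\<close> is the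
  normalised iterate \<open>Suc n\<close> of \<open>f\<close> times the ratio of consecutive
  \<open>iter_one\<close>; the eigenvalue equation is the limit of this identity.\<close>

lemma limit_fun_transfer1:
  assumes f: "lip a f"
  shows "limit_fun \<phi> (iter_transfer 1 \<phi> f) = growth \<phi> * limit_fun \<phi> f"
proof (rule LIMSEQ_unique)
  note cp = lip_imp_continuous[OF \<phi>] and cf = lip_imp_continuous[OF f]
  let ?x = "\<lambda>_. undefined"
  obtain a' where "lip a' (iter_transfer 1 \<phi> f)" using iter_transfer_lip'[OF f] .
  then show "(\<lambda>n. norm_iter n \<phi> (iter_transfer 1 \<phi> f) ?x) \<longlonglongrightarrow> limit_fun \<phi> (iter_transfer 1 \<phi> f)" by (rule norm_iter_LIMSEQ)
  have "norm_iter n \<phi> (iter_transfer 1 \<phi> f) ?x = iter_one (Suc n) \<phi> ?x / iter_one n \<phi> ?x * norm_iter (Suc n) \<phi> f ?x" for n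
    using iter_transfer_add[OF cp cf, of n 1 ?x] iter_one_pos[OF l \<phi>, of n ?x] iter_one_pos[OF l \<phi>, of "Suc n" ?x]
    by (simp add: norm_iter_def field_simps)
  moreover have "(\<lambda>n. iter_one (Suc n) \<phi> ?x / iter_one n \<phi> ?x * norm_iter (Suc n) \<phi> f ?x) \<longlonglongrightarrow> growth \<phi> * limit_fun \<phi> f"
    by (intro tendsto_mult iter_one_ratio_LIMSEQ LIMSEQ_Suc[OF norm_iter_LIMSEQ[OF f]])
  ultimately show "(\<lambda>n. norm_iter n \<phi> (iter_transfer 1 \<phi> f) ?x) \<longlonglongrightarrow> growth \<phi> * limit_fun \<phi> f" by simp
qed

lemma limit_fun_iter_transfer:
  assumes f: "lip a f"
  shows "limit_fun \<phi> (iter_transfer n \<phi> f) = growth \<phi> ^ n * limit_fun \<phi> f"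
proof (induction n)
  case (Suc n)
  obtain a' where "lip a' (iter_transfer n \<phi> f)" using iter_transfer_lip'[OF f] .
  from limit_fun_transfer1[OF this] have "limit_fun \<phi> (iter_transfer 1 \<phi> (iter_transfer n \<phi> f)) = growth \<phi> * (growth \<phi> ^ n * limit_fun \<phi> f)" using Suc by simp
  moreover have "iter_transfer 1 \<phi> (iter_transfer n \<phi> f) = iter_transfer (n + 1) \<phi> f"
    using iter_transfer_add[OF lip_imp_continuous[OF \<phi>] lip_imp_continuous[OF f]] by auto
  ultimately show ?case by simp
qed simp

lemma limit_fun_const: "limit_fun \<phi> (\<lambda>_. c) = c"
  by (rule LIMSEQ_unique[OF norm_iter_LIMSEQ[of 0]]) (auto simp: lip_def norm_iter_const[OF l \<phi>])

text \<open>Started from index 0, \<open>norm_iter n \<phi> f\<close> is an average of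
  \<open>f\<close> itself with the probability weights \<open>branch_weight 0 n\<close>, so
  positivity is inherited by the limit.\<close>

lemma limit_fun_bounds:
  assumes f: "lip a f"
  shows "(\<And>x. f x \<le> B) \<Longrightarrow> limit_fun \<phi> f \<le> B" "(\<And>x. B \<le> f x) \<Longrightarrow> B \<le> limit_fun \<phi> f"
proof -
  note cp = lip_imp_continuous[OF \<phi>] and cf = lip_imp_continuous[OF f]
  have av: "norm_iter n \<phi> f x = (\<integral>\<omega>. branch_weight 0 n \<phi> \<omega> x *\<^sub>R f (comb_seq n \<omega> x) \<partial>Pr)" for n x
    using norm_iter_add[OF l \<phi> cf, of 0 n x] by (simp add: norm_iter_0[OF l \<phi>])
  have i: "integrable Pr (\<lambda>\<omega>. branch_weight 0 n \<phi> \<omega> x *\<^sub>R f (comb_seq n \<omega> x))" for n x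
  proof -
    obtain B where B: "\<And>x. norm (f x) \<le> B" using bounded_continuous[OF cf] by metis
    have [measurable]: "f \<in> borel_measurable borel" by (rule borel_measurable_cont[OF cf])
    show ?thesis by (rule integrable_scaleR_bounded[OF branch_weight_integrable[OF l \<phi>]]) (use B in auto)
  qed
  have m: "(\<integral>\<omega>. branch_weight 0 n \<phi> \<omega> x * B \<partial>Pr) = B" for n x using branch_weight_integral[OF l \<phi>, of 0 n x] by simp
  have im: "integrable Pr (\<lambda>\<omega>. branch_weight 0 n \<phi> \<omega> x * B)" for n x using branch_weight_integrable[OF l \<phi>, of 0 n x] by simp
  show "limit_fun \<phi> f \<le> B" if "\<And>x. f x \<le> B"
  proof (rule LIMSEQ_le_const2[OF norm_iter_LIMSEQ[OF f]], intro exI allI impI)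
    show "norm_iter n \<phi> f undefined \<le> B" for n
    proof -
      have "norm_iter n \<phi> f undefined \<le> (\<integral>\<omega>. branch_weight 0 n \<phi> \<omega> undefined * B \<partial>Pr)"
        unfolding av by (intro integral_mono i im)
          (use that branch_weight_pos[OF l \<phi>] in \<open>simp add: mult_left_mono less_imp_le\<close>)
      then show ?thesis by (simp only: m)
    qed
  qed
  show "B \<le> limit_fun \<phi> f" if "\<And>x. B \<le> f x"
  proof (rule LIMSEQ_le_const[OF norm_iter_LIMSEQ[OF f]], intro exI allI impI)
    show "B \<le> norm_iter n \<phi> f undefined" for n
    proof -
      have "(\<integral>\<omega>. branch_weight 0 n \<phi> \<omega> undefined * B \<partial>Pr) \<le> norm_iter n \<phi> f undefined"
        unfolding av by (intro integral_mono i im)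
          (use that branch_weight_pos[OF l \<phi>] in \<open>simp add: mult_left_mono less_imp_le\<close>)
      then show ?thesis by (simp only: m)
    qed
  qed
qed

lemma growth_pos: "0 < growth \<phi>"
proof -
  obtain M where M: "\<And>x. norm (\<phi> x) \<le> M" using bounded_continuous[OF lip_imp_continuous[OF \<phi>]] by metis
  obtain a where "lip a (iter_transfer 1 \<phi> (\<lambda>_. 1 :: real))" using lip_h1 .
  then have "exp (- M) \<le> growth \<phi>"
    unfolding growth_def by (rule limit_fun_bounds(2)) (use iter_one_bounds(1)[OF l \<phi>, of M 1] M in \<open>simp add: iter_one_def\<close>)
  then show ?thesis by (smt (verit) exp_gt_zero)
qed

text \<open>The functional takes the value \<open>growth \<phi> ^ n\<close> at
  \<open>iter_one n \<phi>\<close>, a function whose values differ by a factor of at most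
  \<open>exp (l * diam)\<close>; monotonicity then confines each value. This replaces bounds on an
  eigenfunction.\<close>

lemma iter_one_growth_bounds:
  shows "iter_one n \<phi> x \<le> exp (l * diam) * growth \<phi> ^ n" "growth \<phi> ^ n \<le> exp (l * diam) * iter_one n \<phi> x"
proof -
  have c: "lip 0 (\<lambda>_. 1 :: real)" by (simp add: lip_def)
  have e: "limit_fun \<phi> (iter_one n \<phi>) = growth \<phi> ^ n" unfolding iter_one_def using limit_fun_iter_transfer[OF c] limit_fun_const by simp
  obtain a where "lip a (iter_transfer n \<phi> (\<lambda>_. 1 :: real))" using iter_transfer_lip'[OF c] .
  then have a: "lip a (iter_one n \<phi>)" by (simp add: iter_one_def)
  show "growth \<phi> ^ n \<le> exp (l * diam) * iter_one n \<phi> x"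
    unfolding e[symmetric] by (rule limit_fun_bounds(1)[OF a]) (rule iter_one_distortion_diam[OF l \<phi>])
  have "exp (- (l * diam)) * iter_one n \<phi> x \<le> limit_fun \<phi> (iter_one n \<phi>)"
    by (rule limit_fun_bounds(2)[OF a])
       (use iter_one_distortion_diam[OF l \<phi>, of n x] in \<open>simp add: exp_minus field_simps\<close>)
  then show "iter_one n \<phi> x \<le> exp (l * diam) * growth \<phi> ^ n" unfolding e by (simp add: exp_minus field_simps)
qed

end

end

text \<open>Closed sets form an intersection-stable generator, and the indicator of a closed set is
  a pointwise limit of truncated distance functions.\<close>

lemma finite_measure_eqI_continuous:
  fixes M N :: "'b::metric_space measure"
  assumes "finite_measure M" "finite_measure N" and sM [measurable_cong]: "sets M = sets borel"
    and sN [measurable_cong]: "sets N = sets borel"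
    and eq: "\<And>f :: 'b \<Rightarrow> real. continuous_on UNIV f \<Longrightarrow> (\<And>x. 0 \<le> f x \<and> f x \<le> 1) \<Longrightarrow>
      (\<integral>x. f x \<partial>M) = (\<integral>x. f x \<partial>N)"
  shows "M = N"
proof (rule measure_eqI_generator_eq[where E = "Collect closed" and \<Omega> = UNIV and A = "\<lambda>_. UNIV"])
  interpret M: finite_measure M by fact
  interpret N: finite_measure N by fact
  show "Int_stable (Collect closed)" by (auto simp: Int_stable_def)
  show "sets M = sigma_sets UNIV (Collect closed)" "sets N = sigma_sets UNIV (Collect closed)"
    unfolding sM sN borel_eq_closed by (auto intro!: sets_measure_of)
  show "emeasure M UNIV \<noteq> \<infinity>" by (simp add: M.emeasure_finite)
  have closed_eq: "measure M C = measure N C" if C: "closed C" for C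
  proof (cases "C = {}")
    case False
    define g where "g k x = max 0 (1 - real k * infdist x C)" for k x
    have cg: "continuous_on UNIV (g k)" for k unfolding g_def by (intro continuous_intros)
    have g01: "0 \<le> g k x \<and> g k x \<le> 1" for k x by (auto simp: g_def infdist_nonneg)
    have lim: "(\<lambda>k. g k x) \<longlonglongrightarrow> indicator C x" for x
    proof (cases "x \<in> C")
      case False
      then have "infdist x C > 0" using C \<open>C \<noteq> {}\<close> in_closed_iff_infdist_zero[of C x] infdist_nonneg[of x C] by force
      then obtain n where n: "real n * infdist x C > 1" using reals_Archimedean3 by blast
      have "\<forall>\<^sub>F k in sequentially. g k x = indicator C x"
        using eventually_ge_at_top[of n]
      proof eventually_elim
        case (elim k)
        then have "real n * infdist x C \<le> real k * infdist x C" by (intro mult_right_mono) (auto simp: infdist_nonneg)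
        then show ?case using n False by (simp add: g_def)
      qed
      then show ?thesis by (rule tendsto_eventually)
    qed (simp add: g_def)
    have "(\<lambda>k. \<integral>x. g k x \<partial>M) \<longlonglongrightarrow> (\<integral>x. indicator C x \<partial>M)"
      by (rule integral_dominated_convergence[where w = "\<lambda>_. 1"])
         (use g01 lim C borel_measurable_continuous_onI[OF cg] in \<open>auto intro!: borel_measurable_indicator simp: sM sN\<close>)
    moreover have "(\<lambda>k. \<integral>x. g k x \<partial>N) \<longlonglongrightarrow> (\<integral>x. indicator C x \<partial>N)"
      by (rule integral_dominated_convergence[where w = "\<lambda>_. 1"])
         (use g01 lim C borel_measurable_continuous_onI[OF cg] in \<open>auto intro!: borel_measurable_indicator simp: sM sN\<close>)
    moreover have "(\<integral>x. g k x \<partial>M) = (\<integral>x. g k x \<partial>N)" for k by (rule eq[OF cg g01])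
    ultimately have "(\<integral>x. indicator C x \<partial>M) = (\<integral>x. indicator C x \<partial>N :: real)"
      using LIMSEQ_unique by fastforce
    then show ?thesis using C by simp
  qed simp
  then show "emeasure M X = emeasure N X" if "X \<in> Collect closed" for X
    using that by (simp add: M.emeasure_eq_measure N.emeasure_eq_measure)
qed auto

context full_shift
begin

subsection \<open>Lipschitz functions\<close>

lemma lip_const [simp]: "lip 0 (\<lambda>_. c)" by (simp add: lip_def)

lemma lip_add: "lip a f \<Longrightarrow> lip b g \<Longrightarrow> lip (a + b) (\<lambda>x. f x + g x)"
  unfolding lip_def by (metis add_diff_add add_mono distrib_right norm_triangle_mono)

lemma lip_mult:
  fixes f g :: "(nat \<Rightarrow> 'a) \<Rightarrow> real"
  assumes f: "lip a f" and g: "lip b g"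
  obtains c where "lip c (\<lambda>x. f x * g x)"
proof -
  obtain B where B: "\<And>x. norm (f x) \<le> B" using bounded_continuous[OF lip_imp_continuous[OF f]] by metis
  obtain C where C: "\<And>x. norm (g x) \<le> C" using bounded_continuous[OF lip_imp_continuous[OF g]] by metis
  have "lip (B * b + a * C) (\<lambda>x. f x * g x)"
    unfolding lip_def
  proof (intro allI)
    fix x y
    have 1: "\<bar>f x\<bar> * \<bar>g x - g y\<bar> \<le> B * (b * dOmega x y)"
      using B[of x] g by (intro mult_mono) (auto simp: lip_def intro: order_trans[OF abs_ge_zero])
    have 2: "\<bar>f x - f y\<bar> * \<bar>g y\<bar> \<le> (a * dOmega x y) * C"
      using C[of y] f by (intro mult_mono) (auto simp: lip_def intro: order_trans[OF abs_ge_zero])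
    have "f x * g x - f y * g y = f x * (g x - g y) + (f x - f y) * g y" by (simp add: algebra_simps)
    then have "\<bar>f x * g x - f y * g y\<bar> \<le> \<bar>f x\<bar> * \<bar>g x - g y\<bar> + \<bar>f x - f y\<bar> * \<bar>g y\<bar>"
      using abs_triangle_ineq[of "f x * (g x - g y)" "(f x - f y) * g y"] by (simp add: abs_mult)
    then show "norm (f x * g x - f y * g y) \<le> (B * b + a * C) * dOmega x y"
      using 1 2 by (simp add: algebra_simps)
  qed
  then show ?thesis by (rule that)
qed

lemma lip_exp:
  fixes f :: "(nat \<Rightarrow> 'a) \<Rightarrow> real"
  assumes f: "lip a f"
  obtains c where "lip c (\<lambda>x. exp (f x))"
proof -
  obtain B where B: "\<And>x. norm (f x) \<le> B" using bounded_continuous[OF lip_imp_continuous[OF f]] by metis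
  have "lip (exp B * a) (\<lambda>x. exp (f x))"
    unfolding lip_def
  proof (intro allI)
    fix x y
    have "\<bar>exp (f x) - exp (f y)\<bar> \<le> exp B * \<bar>f x - f y\<bar>"
      by (rule exp_diff_le) (use B[of x] B[of y] in auto)
    also have "\<dots> \<le> exp B * (a * dOmega x y)" using f by (intro mult_left_mono) (auto simp: lip_def)
    finally show "norm (exp (f x) - exp (f y)) \<le> exp B * a * dOmega x y" by simp
  qed
  then show ?thesis by (rule that)
qed

lemma dOmega_shift: "dOmega (shift x) (shift (y :: nat \<Rightarrow> 'a)) \<le> 2 * dOmega x y"
proof -
  have "dOmega x y = dist (x 0) (y 0) / 2 ^ (0 + 1) + (\<Sum>n. dist (x (Suc n)) (y (Suc n)) / 2 ^ (Suc n + 1))"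
    using suminf_split_head[OF dOmega_summable[of x y]] unfolding dOmega_def by simp
  also have "(\<Sum>n. dist (x (Suc n)) (y (Suc n)) / 2 ^ (Suc n + 1)) = (\<Sum>n. dist (shift x n) (shift y n) / 2 ^ (n + 1) / 2)"
    by (simp add: shift_def)
  also have "\<dots> = dOmega (shift x) (shift y) / 2"
    unfolding dOmega_def by (rule suminf_divide[OF dOmega_summable])
  finally show ?thesis by simp
qed

lemma lip_shift:
  assumes "lip a f" "0 \<le> a"
  shows "lip (2 * a) (\<lambda>x. f (shift x))"
  unfolding lip_def
proof (intro allI)
  fix x y
  have "norm (f (shift x) - f (shift y)) \<le> a * dOmega (shift x) (shift y)" using assms(1) by (simp add: lip_def)
  also have "\<dots> \<le> a * (2 * dOmega x y)" by (rule mult_left_mono[OF dOmega_shift assms(2)])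
  finally show "norm (f (shift x) - f (shift y)) \<le> 2 * a * dOmega x y" by simp
qed

text \<open>Unlike in \<open>lip_birkhoff\<close>, the first \<open>n\<close> letters may differ,
  the shift may double distances at each step, and the constant obtained grows with
  \<open>n\<close>. Only its existence is used.\<close>

lemma lip_birkhoff_sum:
  assumes \<phi>: "lip l \<phi>"
  obtains c where "c \<ge> 0" "lip c (birkhoff_sum n \<phi>)"
proof -
  have "\<exists>c\<ge>0. lip c (birkhoff_sum n \<phi>)"
  proof (induction n)
    case 0
    show ?case by (auto simp: lip_def birkhoff_sum_def intro!: exI[of _ 0])
  next
    case (Suc n)
    then obtain c where c: "c \<ge> 0" "lip c (birkhoff_sum n \<phi>)" by blast
    have "lip \<bar>l\<bar> \<phi>" by (rule lip_mono[OF \<phi>]) simp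
    from lip_add[OF this lip_shift[OF c(2,1)]]
    have "lip (\<bar>l\<bar> + 2 * c) (\<lambda>x. \<phi> x + birkhoff_sum n \<phi> (shift x))" .
    moreover have "birkhoff_sum (Suc n) \<phi> x = \<phi> x + birkhoff_sum n \<phi> (shift x)" for x
      using birkhoff_sum_add[of 1 n \<phi> x] by (simp add: birkhoff_sum_def)
    ultimately show ?case using c(1) by (intro exI[of _ "\<bar>l\<bar> + 2 * c"]) auto
  qed
  then show ?thesis using that by blast
qed

lemma lip_weight:
  fixes f :: "(nat \<Rightarrow> 'a) \<Rightarrow> real"
  assumes \<phi>: "lip l \<phi>" and f: "lip a f"
  obtains c where "lip c (\<lambda>x. exp (birkhoff_sum n \<phi> x) * f x)"
proof -
  obtain b where "lip b (birkhoff_sum n \<phi>)" using lip_birkhoff_sum[OF \<phi>] .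
  then obtain b' where "lip b' (\<lambda>x. exp (birkhoff_sum n \<phi> x))" by (rule lip_exp)
  then show ?thesis using lip_mult[OF _ f] that by blast
qed

lemma lip_comb:
  assumes "lip a f"
  shows "lip \<bar>a\<bar> (\<lambda>\<eta>. f (comb_seq n \<omega> \<eta>))"
  unfolding lip_def
proof (intro allI)
  fix x y
  have "norm (f (comb_seq n \<omega> x) - f (comb_seq n \<omega> y)) \<le> a * (dOmega x y / 2 ^ n)"
    using assms[unfolded lip_def, rule_format, of "comb_seq n \<omega> x" "comb_seq n \<omega> y"] by (simp add: dOmega_comb)
  also have "\<dots> \<le> \<bar>a\<bar> * (dOmega x y / 2 ^ n)" by (intro mult_right_mono) auto
  also have "\<dots> \<le> \<bar>a\<bar> * (dOmega x y / 1)" by (intro mult_left_mono divide_left_mono) auto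
  finally show "norm (f (comb_seq n \<omega> x) - f (comb_seq n \<omega> y)) \<le> \<bar>a\<bar> * dOmega x y" by simp
qed

text \<open>Lipschitz functions form an algebra containing the constants, and distances of single
  coordinates to a given letter separate points, so Stone-Weierstrass applies.\<close>

lemma lip_dense:
  fixes f :: "(nat \<Rightarrow> 'a) \<Rightarrow> real"
  assumes f: "continuous_on UNIV f" and e: "e > 0"
  obtains g a where "lip a g" "\<And>x. \<bar>f x - g x\<bar> < e"
proof -
  interpret R: function_ring_on "{g :: (nat \<Rightarrow> 'a) \<Rightarrow> real. \<exists>a. lip a g}" UNIV
  proof
    show "compact (UNIV :: (nat \<Rightarrow> 'a) set)" by (rule compact_UNIV_seq[OF compact_E])
  next
    fix f :: "(nat \<Rightarrow> 'a) \<Rightarrow> real" assume "f \<in> {g. \<exists>a. lip a g}"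
    then show "continuous_on UNIV f" using lip_imp_continuous by auto
  next
    fix f g :: "(nat \<Rightarrow> 'a) \<Rightarrow> real" assume fg: "f \<in> {g. \<exists>a. lip a g}" "g \<in> {g. \<exists>a. lip a g}"
    then show "(\<lambda>x. f x + g x) \<in> {g. \<exists>a. lip a g}" using lip_add by blast
    from fg show "(\<lambda>x. f x * g x) \<in> {g. \<exists>a. lip a g}" by (auto elim: lip_mult)
  next
    show "(\<lambda>_. c) \<in> {g :: (nat \<Rightarrow> 'a) \<Rightarrow> real. \<exists>a. lip a g}" for c by (auto intro: exI[of _ 0])
  next
    fix x y :: "nat \<Rightarrow> 'a" assume "x \<noteq> y"
    then obtain k where k: "x k \<noteq> y k" by auto
    have "lip (2 ^ (k + 1)) (\<lambda>z. dist (z k) (y k))"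
      unfolding lip_def
    proof (intro allI)
      fix u v :: "nat \<Rightarrow> 'a"
      have "(\<Sum>j\<in>{k}. dist (u j) (v j) / 2 ^ (j + 1)) \<le> dOmega u v"
        unfolding dOmega_def by (rule sum_le_suminf[OF dOmega_summable]) auto
      then have "dist (u k) (v k) \<le> 2 ^ (k + 1) * dOmega u v" by (simp add: field_simps)
      moreover have "\<bar>dist (u k) (y k) - dist (v k) (y k)\<bar> \<le> dist (u k) (v k)"
        using dist_triangle[of "u k" "y k" "v k"] dist_triangle[of "v k" "y k" "u k"]
        by (simp add: abs_le_iff dist_commute)
      ultimately show "norm (dist (u k) (y k) - dist (v k) (y k)) \<le> 2 ^ (k + 1) * dOmega u v" by simp
    qed
    then show "\<exists>f\<in>{g. \<exists>a. lip a g}. f x \<noteq> (f y :: real)"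
      using k by (intro bexI[of _ "\<lambda>z. dist (z k) (y k)"]) auto
  qed
  show ?thesis using R.Stone_Weierstrass_basic[OF f e] that by auto
qed

subsection \<open>The limiting functional\<close>

context
  fixes l :: real and \<phi> :: "(nat \<Rightarrow> 'a) \<Rightarrow> real"
  assumes l: "0 \<le> l" and \<phi>: "lip l \<phi>"
begin

lemma limit_fun_diff: "lip a f \<Longrightarrow> lip b g \<Longrightarrow> limit_fun \<phi> (\<lambda>x. f x - g x) = limit_fun \<phi> f - limit_fun \<phi> g"
proof -
  assume f: "lip a f" and g: "lip b g"
  have "lip (a + b) (\<lambda>x. f x + - g x)" by (rule lip_add[OF f]) (use g in \<open>simp add: lip_def abs_minus_commute\<close>)
  then have "lip (a + b) (\<lambda>x. f x - g x)" by simp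
  from norm_iter_LIMSEQ[OF l \<phi> this] have "(\<lambda>n. norm_iter n \<phi> f undefined - norm_iter n \<phi> g undefined) \<longlonglongrightarrow> limit_fun \<phi> (\<lambda>x. f x - g x)"
    by (simp add: norm_iter_diff[OF l \<phi> lip_imp_continuous[OF f] lip_imp_continuous[OF g]])
  moreover have "(\<lambda>n. norm_iter n \<phi> f undefined - norm_iter n \<phi> g undefined) \<longlonglongrightarrow> limit_fun \<phi> f - limit_fun \<phi> g"
    by (intro tendsto_diff norm_iter_LIMSEQ[OF l \<phi> f] norm_iter_LIMSEQ[OF l \<phi> g])
  ultimately show ?thesis by (rule LIMSEQ_unique)
qed

lemma limit_fun_mono:
  assumes f: "lip a f" and g: "lip b g" and le: "\<And>x. f x \<le> g x"
  shows "limit_fun \<phi> f \<le> limit_fun \<phi> g"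
proof -
  have "lip (b + a) (\<lambda>x. g x + - f x)" by (rule lip_add[OF g]) (use f in \<open>simp add: lip_def abs_minus_commute\<close>)
  then have "lip (b + a) (\<lambda>x. g x - f x)" by simp
  then have "0 \<le> limit_fun \<phi> (\<lambda>x. g x - f x)" by (rule limit_fun_bounds(2)[OF l \<phi>]) (use le in simp)
  then show ?thesis by (simp add: limit_fun_diff[OF g f])
qed

lemma limit_fun_cmult: "lip a f \<Longrightarrow> limit_fun \<phi> (\<lambda>x. c * f x) = c * limit_fun \<phi> f"
proof -
  assume f: "lip a f"
  obtain a' where "lip a' (\<lambda>x. c * f x)" using lip_mult[OF lip_const f] .
  from norm_iter_LIMSEQ[OF l \<phi> this] have "(\<lambda>n. c * norm_iter n \<phi> f undefined) \<longlonglongrightarrow> limit_fun \<phi> (\<lambda>x. c * f x)"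
    by (simp add: norm_iter_def iter_transfer_def mult.left_commute)
  moreover have "(\<lambda>n. c * norm_iter n \<phi> f undefined) \<longlonglongrightarrow> c * limit_fun \<phi> f"
    by (intro tendsto_intros norm_iter_LIMSEQ[OF l \<phi> f])
  ultimately show ?thesis by (rule LIMSEQ_unique)
qed

lemma norm_iter_eq_branch_weight:
  fixes f :: "(nat \<Rightarrow> 'a) \<Rightarrow> real"
  assumes f: "continuous_on UNIV f"
  shows "norm_iter n \<phi> f x = (\<integral>\<omega>. branch_weight 0 n \<phi> \<omega> x * f (comb_seq n \<omega> x) \<partial>Pr)"
  using norm_iter_add[OF l \<phi> f, of 0 n x] by (simp add: norm_iter_0[OF l \<phi>])

lemma branch_weight_measurable [measurable]: "(\<lambda>\<omega>. branch_weight 0 n \<phi> \<omega> x) \<in> borel_measurable borel"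
  using borel_measurable_integrable[OF branch_weight_integrable[OF l \<phi>, of 0 n x]] by (simp cong: measurable_cong_sets)

lemma norm_iter_comb_measurable:
  fixes g :: "(nat \<Rightarrow> 'a) \<Rightarrow> real"
  assumes g: "lip a g"
  shows "(\<lambda>\<omega>. norm_iter k \<phi> (\<lambda>\<eta>. g (comb_seq n \<omega> \<eta>)) x) \<in> borel_measurable borel"
proof -
  have [measurable]: "g \<in> borel_measurable borel" by (rule borel_measurable_cont[OF lip_imp_continuous[OF g]])
  have "norm_iter k \<phi> (\<lambda>\<eta>. g (comb_seq n \<omega> \<eta>)) x = (\<integral>\<omega>'. branch_weight 0 k \<phi> \<omega>' x * g (comb_seq n \<omega> (comb_seq k \<omega>' x)) \<partial>Pr)" for \<omega>
    by (rule norm_iter_eq_branch_weight[OF lip_imp_continuous[OF lip_comb[OF g]]])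
  then show ?thesis by simp
qed

lemma limit_fun_comb_measurable:
  fixes g :: "(nat \<Rightarrow> 'a) \<Rightarrow> real"
  assumes g: "lip a g"
  shows "(\<lambda>\<omega>. limit_fun \<phi> (\<lambda>\<eta>. g (comb_seq n \<omega> \<eta>))) \<in> borel_measurable borel"
proof (rule borel_measurable_LIMSEQ_real)
  show "(\<lambda>k. norm_iter k \<phi> (\<lambda>\<eta>. g (comb_seq n \<omega> \<eta>)) undefined) \<longlonglongrightarrow> limit_fun \<phi> (\<lambda>\<eta>. g (comb_seq n \<omega> \<eta>))" for \<omega>
    by (rule norm_iter_LIMSEQ[OF l \<phi> lip_comb[OF g]])
qed (rule norm_iter_comb_measurable[OF g])

lemma limit_fun_abs_le:
  assumes g: "lip a g" and B: "\<And>x. \<bar>g x\<bar> \<le> B"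
  shows "\<bar>limit_fun \<phi> g\<bar> \<le> B"
  using limit_fun_bounds(1)[OF l \<phi> g, of B] limit_fun_bounds(2)[OF l \<phi> g, of "- B"] B by (auto simp: abs_le_iff minus_le_iff)

lemma limit_fun_comb_integrable:
  assumes g: "lip a g"
  shows "integrable Pr (\<lambda>\<omega>. limit_fun \<phi> (\<lambda>\<eta>. g (comb_seq n \<omega> \<eta>)))"
proof -
  obtain B where B: "\<And>x. norm (g x) \<le> B" using bounded_continuous[OF lip_imp_continuous[OF g]] by metis
  show ?thesis
  proof (rule integrable_bounded_Pr[OF limit_fun_comb_measurable[OF g]])
    show "norm (limit_fun \<phi> (\<lambda>\<eta>. g (comb_seq n \<omega> \<eta>))) \<le> B" for \<omega>
      using limit_fun_abs_le[OF lip_comb[OF g]] B by simp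
  qed
qed

lemma lip_integral_comb:
  assumes g: "lip a (g :: _ \<Rightarrow> real)"
  shows "lip \<bar>a\<bar> (\<lambda>\<eta>. \<integral>\<omega>. g (comb_seq n \<omega> \<eta>) \<partial>Pr)"
  unfolding lip_def
proof (intro allI)
  fix x y
  have cg: "continuous_on UNIV g" by (rule lip_imp_continuous[OF g])
  have eq: "(\<integral>\<omega>. g (comb_seq n \<omega> x) \<partial>Pr) - (\<integral>\<omega>. g (comb_seq n \<omega> y) \<partial>Pr) =
    (\<integral>\<omega>. g (comb_seq n \<omega> x) - g (comb_seq n \<omega> y) \<partial>Pr)"
    by (rule Bochner_Integration.integral_diff[symmetric]; rule integrable_cont[OF cg])
  have "norm (\<integral>\<omega>. g (comb_seq n \<omega> x) - g (comb_seq n \<omega> y) \<partial>Pr) \<le> (\<integral>\<omega>. \<bar>a\<bar> * dOmega x y \<partial>Pr)"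
  proof (rule order_trans[OF integral_norm_bound integral_mono])
    show "integrable Pr (\<lambda>\<omega>. norm (g (comb_seq n \<omega> x) - g (comb_seq n \<omega> y)))"
      by (intro integrable_norm Bochner_Integration.integrable_diff integrable_cont[OF cg])
    show "norm (g (comb_seq n \<omega> x) - g (comb_seq n \<omega> y)) \<le> \<bar>a\<bar> * dOmega x y" for \<omega>
      using lip_comb[OF g, of n \<omega>] unfolding lip_def by blast
  qed simp
  then show "norm ((\<integral>\<omega>. g (comb_seq n \<omega> x) \<partial>Pr) - (\<integral>\<omega>. g (comb_seq n \<omega> y) \<partial>Pr)) \<le> \<bar>a\<bar> * dOmega x y"
    unfolding eq by (simp add: Pr.prob_space[simplified])
qed

text \<open>Fubini's theorem for a functional not yet known to be a measure: each
  \<open>norm_iter k\<close> is an integral and commutes with the other one, and dominated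
  convergence carries this to the limit.\<close>

lemma limit_fun_integral_comb:
  assumes g: "lip a g"
  shows "(\<integral>\<omega>. limit_fun \<phi> (\<lambda>\<eta>. g (comb_seq n \<omega> \<eta>)) \<partial>Pr) = limit_fun \<phi> (\<lambda>\<eta>. \<integral>\<omega>. g (comb_seq n \<omega> \<eta>) \<partial>Pr)"
proof (rule LIMSEQ_unique)
  interpret PP: pair_prob_space Pr Pr ..
  let ?x = undefined
  have cg: "continuous_on UNIV g" by (rule lip_imp_continuous[OF g])
  obtain B where B: "\<And>x. norm (g x) \<le> B" using bounded_continuous[OF cg] by metis
  have [measurable]: "g \<in> borel_measurable borel" by (rule borel_measurable_cont[OF cg])
  have UB: "norm (norm_iter k \<phi> (\<lambda>\<eta>. g (comb_seq n \<omega> \<eta>)) ?x) \<le> B" for k \<omega>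
    by (rule norm_iter_bound[OF l \<phi> lip_imp_continuous[OF lip_comb[OF g]]]) (rule B)
  show "(\<lambda>k. \<integral>\<omega>. norm_iter k \<phi> (\<lambda>\<eta>. g (comb_seq n \<omega> \<eta>)) ?x \<partial>Pr) \<longlonglongrightarrow> (\<integral>\<omega>. limit_fun \<phi> (\<lambda>\<eta>. g (comb_seq n \<omega> \<eta>)) \<partial>Pr)"
  proof (rule integral_dominated_convergence[where w = "\<lambda>_. B"])
    show "(\<lambda>\<omega>. norm_iter k \<phi> (\<lambda>\<eta>. g (comb_seq n \<omega> \<eta>)) ?x) \<in> borel_measurable Pr" for k
      using norm_iter_comb_measurable[OF g] by (simp cong: measurable_cong_sets)
    show "(\<lambda>\<omega>. limit_fun \<phi> (\<lambda>\<eta>. g (comb_seq n \<omega> \<eta>))) \<in> borel_measurable Pr"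
      using limit_fun_comb_measurable[OF g] by (simp cong: measurable_cong_sets)
    show "AE \<omega> in Pr. (\<lambda>k. norm_iter k \<phi> (\<lambda>\<eta>. g (comb_seq n \<omega> \<eta>)) ?x) \<longlonglongrightarrow> limit_fun \<phi> (\<lambda>\<eta>. g (comb_seq n \<omega> \<eta>))"
      using norm_iter_LIMSEQ[OF l \<phi> lip_comb[OF g]] by blast
    show "AE \<omega> in Pr. norm (norm_iter k \<phi> (\<lambda>\<eta>. g (comb_seq n \<omega> \<eta>)) ?x) \<le> B" for k using UB by blast
  qed simp
  have "(\<integral>\<omega>. norm_iter k \<phi> (\<lambda>\<eta>. g (comb_seq n \<omega> \<eta>)) ?x \<partial>Pr) = norm_iter k \<phi> (\<lambda>\<eta>. \<integral>\<omega>. g (comb_seq n \<omega> \<eta>) \<partial>Pr) ?x" for k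
  proof -
    have i: "integrable (Pr \<Otimes>\<^sub>M Pr) (\<lambda>(\<omega>, \<omega>'). branch_weight 0 k \<phi> \<omega>' ?x * g (comb_seq n \<omega> (comb_seq k \<omega>' ?x)))"
    proof -
      have "continuous_on UNIV (\<lambda>z. exp (birkhoff_sum k \<phi> z))"
        by (intro continuous_intros continuous_on_birkhoff_sum lip_imp_continuous[OF \<phi>])
      from bounded_continuous[OF this] obtain C where C: "\<And>z. norm (exp (birkhoff_sum k \<phi> z)) \<le> C" by metis
      have b: "\<bar>branch_weight 0 k \<phi> \<omega> ?x\<bar> \<le> C / iter_one k \<phi> ?x" for \<omega>
        using C[of "comb_seq k \<omega> ?x"] iter_one_pos[OF l \<phi>, of k ?x]
        by (simp add: branch_weight_def divide_right_mono)
      show ?thesis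
      proof (rule PP.integrable_const_bound)
        have "norm (branch_weight 0 k \<phi> \<omega>' ?x * g (comb_seq n \<omega> (comb_seq k \<omega>' ?x))) \<le> C / iter_one k \<phi> ?x * B" for \<omega> \<omega>'
          unfolding norm_mult by (rule mult_mono) (use b B order_trans[OF abs_ge_zero b] in auto)
        then show "AE z in Pr \<Otimes>\<^sub>M Pr. norm (case z of (\<omega>, \<omega>') \<Rightarrow> branch_weight 0 k \<phi> \<omega>' ?x * g (comb_seq n \<omega> (comb_seq k \<omega>' ?x))) \<le> C / iter_one k \<phi> ?x * B"
          by (auto simp: case_prod_beta)
        have "(\<lambda>z. branch_weight 0 k \<phi> (snd z) ?x) \<in> borel_measurable (Pr \<Otimes>\<^sub>M Pr)" by measurable
        then show "(\<lambda>(\<omega>, \<omega>'). branch_weight 0 k \<phi> \<omega>' ?x * g (comb_seq n \<omega> (comb_seq k \<omega>' ?x))) \<in> borel_measurable (Pr \<Otimes>\<^sub>M Pr)"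
          unfolding case_prod_beta by measurable
      qed
    qed
    have "(\<integral>\<omega>. norm_iter k \<phi> (\<lambda>\<eta>. g (comb_seq n \<omega> \<eta>)) ?x \<partial>Pr) =
      (\<integral>\<omega>. \<integral>\<omega>'. branch_weight 0 k \<phi> \<omega>' ?x * g (comb_seq n \<omega> (comb_seq k \<omega>' ?x)) \<partial>Pr \<partial>Pr)"
      by (simp only: norm_iter_eq_branch_weight[OF lip_imp_continuous[OF lip_comb[OF g]]])
    also have "\<dots> = (\<integral>\<omega>'. \<integral>\<omega>. branch_weight 0 k \<phi> \<omega>' ?x * g (comb_seq n \<omega> (comb_seq k \<omega>' ?x)) \<partial>Pr \<partial>Pr)"
      by (rule PP.Fubini_integral[OF i, symmetric])
    also have "\<dots> = norm_iter k \<phi> (\<lambda>\<eta>. \<integral>\<omega>. g (comb_seq n \<omega> \<eta>) \<partial>Pr) ?x"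
      by (simp add: norm_iter_eq_branch_weight[OF lip_imp_continuous[OF lip_integral_comb[OF g]]])
    finally show ?thesis .
  qed
  then show "(\<lambda>k. \<integral>\<omega>. norm_iter k \<phi> (\<lambda>\<eta>. g (comb_seq n \<omega> \<eta>)) ?x \<partial>Pr) \<longlonglongrightarrow> limit_fun \<phi> (\<lambda>\<eta>. \<integral>\<omega>. g (comb_seq n \<omega> \<eta>) \<partial>Pr)"
    using norm_iter_LIMSEQ[OF l \<phi> lip_integral_comb[OF g]] by simp
qed

end

end

section \<open>Construction of the conformal measure from cylinder densities\<close>

context full_shift
begin

text \<open>A conformal \<nu> satisfies \<open>growth \<phi> ^ n * \<nu>(f) = \<nu>(iter_transfer n
  \<phi> f)\<close>. For \<open>f\<close> depending on the first \<open>n\<close> letters this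
  identifies the density, with respect to \<open>Pr\<close>, of the law of these letters under
  \<nu>.\<close>

definition cyl_density :: "nat \<Rightarrow> ((nat \<Rightarrow> 'a) \<Rightarrow> real) \<Rightarrow> (nat \<Rightarrow> 'a) \<Rightarrow> real" where
  "cyl_density n \<phi> \<omega> = limit_fun \<phi> (\<lambda>\<eta>. exp (birkhoff_sum n \<phi> (comb_seq n \<omega> \<eta>))) / growth \<phi> ^ n"

context
  fixes l :: real and \<phi> :: "(nat \<Rightarrow> 'a) \<Rightarrow> real"
  assumes l: "0 \<le> l" and \<phi>: "lip l \<phi>"
begin

lemma lip_exp_birkhoff: obtains c where "lip c (\<lambda>x. exp (birkhoff_sum n \<phi> x))"
  using lip_birkhoff_sum[OF \<phi>, of n] by (metis lip_exp)

lemma cyl_density_measurable [measurable]: "cyl_density n \<phi> \<in> borel_measurable borel"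
proof -
  obtain c where "lip c (\<lambda>x. exp (birkhoff_sum n \<phi> x))" by (rule lip_exp_birkhoff)
  from limit_fun_comb_measurable[OF l \<phi> this, of n] show ?thesis unfolding cyl_density_def by simp
qed

lemma cyl_density_integrable: "integrable Pr (cyl_density n \<phi>)"
proof -
  obtain c where "lip c (\<lambda>x. exp (birkhoff_sum n \<phi> x))" by (rule lip_exp_birkhoff)
  from limit_fun_comb_integrable[OF l \<phi> this, of n] show ?thesis unfolding cyl_density_def by simp
qed

lemma cyl_density_nonneg: "0 \<le> cyl_density n \<phi> \<omega>"
proof -
  obtain c where "lip c (\<lambda>x. exp (birkhoff_sum n \<phi> x))" by (rule lip_exp_birkhoff)
  then have "0 \<le> limit_fun \<phi> (\<lambda>\<eta>. exp (birkhoff_sum n \<phi> (comb_seq n \<omega> \<eta>)))"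
    by (intro limit_fun_bounds(2)[OF l \<phi> lip_comb]) auto
  then show ?thesis using growth_pos[OF l \<phi>] by (simp add: cyl_density_def)
qed

text \<open>Integrating out the letters from \<open>n\<close> to \<open>n + k - 1\<close> applies
  the \<open>k\<close>-th iterate of the operator inside the functional, which costs exactly the
  factor \<open>growth \<phi> ^ k\<close> in the denominator.\<close>

lemma integral_cyl_density_comb: "(\<integral>\<gamma>. cyl_density (n + k) \<phi> (comb_seq n \<omega> \<gamma>) \<partial>Pr) = cyl_density n \<phi> \<omega>"
proof -
  obtain c where c: "lip c (\<lambda>x. exp (birkhoff_sum n \<phi> x))" by (rule lip_exp_birkhoff)
  let ?e = "\<lambda>\<eta>. exp (birkhoff_sum n \<phi> (comb_seq n \<omega> \<eta>))"
  have e: "lip \<bar>c\<bar> ?e" by (rule lip_comb[OF c])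
  obtain c' where g: "lip c' (\<lambda>\<eta>. exp (birkhoff_sum k \<phi> \<eta>) * ?e \<eta>)" using lip_weight[OF \<phi> e] .
  have "cyl_density (n + k) \<phi> (comb_seq n \<omega> \<gamma>) =
      limit_fun \<phi> (\<lambda>\<eta>. exp (birkhoff_sum k \<phi> (comb_seq k \<gamma> \<eta>)) * ?e (comb_seq k \<gamma> \<eta>)) / growth \<phi> ^ (n + k)" for \<gamma>
    by (simp add: cyl_density_def comb_seq_comb_seq[symmetric] birkhoff_sum_add exp_add mult.commute)
  then have "(\<integral>\<gamma>. cyl_density (n + k) \<phi> (comb_seq n \<omega> \<gamma>) \<partial>Pr) =
     limit_fun \<phi> (\<lambda>\<eta>. \<integral>\<gamma>. exp (birkhoff_sum k \<phi> (comb_seq k \<gamma> \<eta>)) * ?e (comb_seq k \<gamma> \<eta>) \<partial>Pr) / growth \<phi> ^ (n + k)"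
    using limit_fun_integral_comb[OF l \<phi> g, of k] by simp
  also have "(\<lambda>\<eta>. \<integral>\<gamma>. exp (birkhoff_sum k \<phi> (comb_seq k \<gamma> \<eta>)) * ?e (comb_seq k \<gamma> \<eta>) \<partial>Pr) = iter_transfer k \<phi> ?e"
    by (simp add: iter_transfer_def fun_eq_iff)
  finally show ?thesis
    using growth_pos[OF l \<phi>] by (simp add: limit_fun_iter_transfer[OF l \<phi> e] cyl_density_def power_add)
qed

lemma cyl_density_integral: "(\<integral>\<omega>. cyl_density n \<phi> \<omega> \<partial>Pr) = 1"
proof -
  have "limit_fun \<phi> (\<lambda>_. 1) = 1" by (rule limit_fun_const[OF l \<phi>])
  then have "cyl_density 0 \<phi> undefined = 1" by (simp add: cyl_density_def)
  then show ?thesis using integral_cyl_density_comb[of 0 n undefined] by (simp add: comb_seq_0)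
qed

lemma cyl_density_consistent:
  fixes G :: "(nat \<Rightarrow> 'a) \<Rightarrow> real"
  assumes [measurable]: "G \<in> borel_measurable borel" and G: "\<And>x. \<bar>G x\<bar> \<le> B"
    "\<And>\<omega> \<eta>. G (comb_seq n \<omega> \<eta>) = G \<omega>" and n: "n \<le> n'"
  shows "(\<integral>\<omega>. cyl_density n' \<phi> \<omega> * G \<omega> \<partial>Pr) = (\<integral>\<omega>. cyl_density n \<phi> \<omega> * G \<omega> \<partial>Pr)"
proof -
  obtain k where k: "n' = n + k" using n le_Suc_ex by blast
  obtain c where c: "lip c (\<lambda>x. exp (birkhoff_sum n' \<phi> x))" by (rule lip_exp_birkhoff)
  obtain C where C: "\<And>x. norm (exp (birkhoff_sum n' \<phi> x)) \<le> C" using bounded_continuous[OF lip_imp_continuous[OF c]] by metis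
  have "\<bar>limit_fun \<phi> (\<lambda>\<eta>. exp (birkhoff_sum n' \<phi> (comb_seq n' \<omega> \<eta>)))\<bar> \<le> C" for \<omega>
    by (rule limit_fun_abs_le[OF l \<phi> lip_comb[OF c]]) (use C in simp)
  then have dC: "\<bar>cyl_density n' \<phi> \<omega>\<bar> \<le> C / growth \<phi> ^ n'" for \<omega>
    using growth_pos[OF l \<phi>] by (simp add: cyl_density_def divide_right_mono)
  have "(\<integral>\<omega>. cyl_density n' \<phi> \<omega> * G \<omega> \<partial>Pr) = (\<integral>\<omega>. \<integral>\<gamma>. cyl_density n' \<phi> (comb_seq n \<omega> \<gamma>) * G (comb_seq n \<omega> \<gamma>) \<partial>Pr \<partial>Pr)"
  proof (rule integral_comb(1)[symmetric, where B = "C / growth \<phi> ^ n' * B"])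
    show "norm (cyl_density n' \<phi> x * G x) \<le> C / growth \<phi> ^ n' * B" for x
      unfolding norm_mult by (rule mult_mono) (use dC G(1) order_trans[OF abs_ge_zero dC] in auto)
  qed simp
  also have "\<dots> = (\<integral>\<omega>. cyl_density n \<phi> \<omega> * G \<omega> \<partial>Pr)"
    by (simp add: G(2) k integral_cyl_density_comb)
  finally show ?thesis .
qed

text \<open>Defined on whole sequences for convenience; only its marginal on the first
  \<open>n\<close> letters is that of the conformal measure.\<close>

definition cyl_measure :: "nat \<Rightarrow> (nat \<Rightarrow> 'a) measure" where
  "cyl_measure n = density Pr (\<lambda>\<omega>. ennreal (cyl_density n \<phi> \<omega>))"

lemma sets_cyl_measure [measurable_cong]: "sets (cyl_measure n) = sets borel"
  by (simp add: cyl_measure_def sets_Pr)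

lemma integral_cyl_measure:
  fixes G :: "(nat \<Rightarrow> 'a) \<Rightarrow> real"
  assumes [measurable]: "G \<in> borel_measurable borel"
  shows "(\<integral>\<omega>. G \<omega> \<partial>cyl_measure n) = (\<integral>\<omega>. cyl_density n \<phi> \<omega> * G \<omega> \<partial>Pr)"
proof -
  have "cyl_density n \<phi> \<in> borel_measurable Pr" "G \<in> borel_measurable Pr" by measurable
  then show ?thesis unfolding cyl_measure_def by (subst integral_density) (auto simp: cyl_density_nonneg)
qed

lemma prob_space_cyl_measure: "prob_space (cyl_measure n)"
proof
  have "emeasure (cyl_measure n) (space (cyl_measure n)) = (\<integral>\<^sup>+\<omega>. ennreal (cyl_density n \<phi> \<omega>) \<partial>Pr)"
    unfolding cyl_measure_def by (subst emeasure_density) (auto intro!: nn_integral_cong)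
  also have "\<dots> = ennreal (\<integral>\<omega>. cyl_density n \<phi> \<omega> \<partial>Pr)"
    by (rule nn_integral_eq_integral[OF cyl_density_integrable]) (simp add: cyl_density_nonneg)
  finally show "emeasure (cyl_measure n) (space (cyl_measure n)) = 1" by (simp add: cyl_density_integral)
qed

lemma measure_cyl_measure_consistent:
  assumes B: "B \<in> sets borel" "\<And>\<omega> \<eta>. comb_seq n \<omega> \<eta> \<in> B \<longleftrightarrow> \<omega> \<in> B" and n: "n \<le> n'"
  shows "emeasure (cyl_measure n') B = emeasure (cyl_measure n) B"
proof -
  interpret M: prob_space "cyl_measure k" for k by (rule prob_space_cyl_measure)
  have "(\<integral>\<omega>. indicator B \<omega> \<partial>cyl_measure n') = (\<integral>\<omega>. indicator B \<omega> \<partial>cyl_measure n :: real)"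
    using B by (subst (1 2) integral_cyl_measure, simp, simp, intro cyl_density_consistent[where B = 1] n)
      (auto simp: indicator_def)
  then have "measure (cyl_measure n') B = measure (cyl_measure n) B" using B(1) by (simp add: sets_cyl_measure)
  then show ?thesis by (simp add: M.emeasure_eq_measure)
qed

text \<open>Kolmogorov's theorem fixes \<nu> on functions of finitely many letters only. A Lipschitz
  function is within a geometrically small distance of such functions, and the functional is
  compared with the cylinder density by conformality.\<close>

lemma exists_limit_measure:
  obtains \<nu> where "prob_space \<nu>" "sets \<nu> = sets borel"
    "\<And>f a. lip a f \<Longrightarrow> (\<integral>\<omega>. f \<omega> \<partial>\<nu>) = limit_fun \<phi> f"
proof -
  \<comment> \<open>A prefix length covering all positions in \<open>J\<close>; the inserted 0 takes
    care of the empty set.\<close>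
  define N where "N J = Suc (Max (insert 0 J))" for J :: "nat set"
  have N: "j < N J" if "j \<in> J" "finite J" for j J using that by (simp add: N_def less_Suc_eq_le)
  have Nmono: "N J \<le> N H" if "J \<subseteq> H" "finite H" for J H
    unfolding N_def using that by (auto intro!: Max_mono)
  define PJ where "PJ J = distr (cyl_measure (N J)) (PiM J (\<lambda>_. borel)) (\<lambda>\<omega>. restrict \<omega> J)" for J
  have e: "sets (PiM UNIV (\<lambda>_::nat. borel :: 'a measure)) = sets borel" by (rule sets_PiM_equal_borel)
  have mr: "(\<lambda>\<omega>::nat \<Rightarrow> 'a. restrict \<omega> J) \<in> measurable borel (PiM J (\<lambda>_. borel))" for J
    using measurable_restrict_subset[of J UNIV "\<lambda>_::nat. borel :: 'a measure"] e
    by (simp cong: measurable_cong_sets)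
  have mr': "(\<lambda>\<omega>::nat \<Rightarrow> 'a. restrict \<omega> J) \<in> measurable (cyl_measure n) (PiM J (\<lambda>_. borel))" for J n
    using mr by (simp cong: measurable_cong_sets add: sets_cyl_measure)
  have "projective_family UNIV PJ (\<lambda>_. borel)"
  proof (rule projective_family.intro)
    fix J H :: "nat set" assume JH: "J \<subseteq> H" "finite H" "H \<subseteq> UNIV"
    have fJ: "finite J" using JH finite_subset by blast
    have "distr (PJ H) (PiM J (\<lambda>_. borel)) (\<lambda>f. restrict f J) =
        distr (cyl_measure (N H)) (PiM J (\<lambda>_. borel)) (\<lambda>\<omega>. restrict \<omega> J)"
      unfolding PJ_def
      by (subst distr_distr[OF measurable_restrict_subset[OF JH(1)] mr'])
         (use JH in \<open>auto intro!: distr_cong simp: o_def restrict_restrict Int_absorb1\<close>)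
    also have "\<dots> = PJ J"
    proof (rule measure_eqI)
      fix X assume "X \<in> sets (distr (cyl_measure (N H)) (PiM J (\<lambda>_. borel)) (\<lambda>\<omega>. restrict \<omega> J))"
      then have X: "X \<in> sets (PiM J (\<lambda>_. borel))" by simp
      have s: "space (cyl_measure n) = UNIV" for n using sets_eq_imp_space_eq[OF sets_cyl_measure] by simp
      let ?B = "(\<lambda>\<omega>. restrict \<omega> J) -` X"
      have "?B \<in> sets borel" using measurable_sets[OF mr X] by simp
      moreover have "comb_seq (N J) \<omega> \<eta> \<in> ?B \<longleftrightarrow> \<omega> \<in> ?B" for \<omega> \<eta>
      proof -
        have "restrict (comb_seq (N J) \<omega> \<eta>) J = restrict \<omega> J"
          using N[OF _ fJ] by (auto simp: restrict_def comb_seq_def fun_eq_iff)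
        then show ?thesis by simp
      qed
      ultimately have "emeasure (cyl_measure (N H)) ?B = emeasure (cyl_measure (N J)) ?B"
        by (rule measure_cyl_measure_consistent[OF _ _ Nmono[OF JH(1,2)]])
      then show "emeasure (distr (cyl_measure (N H)) (PiM J (\<lambda>_. borel)) (\<lambda>\<omega>. restrict \<omega> J)) X = emeasure (PJ J) X"
        unfolding PJ_def by (simp add: emeasure_distr[OF mr' X] s)
    qed (simp add: PJ_def)
    finally show "PJ J = distr (PJ H) (PiM J (\<lambda>_. borel)) (\<lambda>f. restrict f J)" by simp
  next
    fix J :: "nat set" assume "finite J"
    show "prob_space (PJ J)" unfolding PJ_def by (rule prob_space.prob_space_distr[OF prob_space_cyl_measure mr'])
  qed
  then interpret pp: polish_projective UNIV PJ by (simp add: polish_projective_def)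
  define \<nu> where "\<nu> = pp.lim"
  have s\<nu>: "sets \<nu> = sets borel" unfolding \<nu>_def by (simp add: pp.sets_lim e)
  have p\<nu>: "prob_space \<nu>" unfolding \<nu>_def by (rule pp.P.prob_space_axioms)
  interpret \<nu>: prob_space \<nu> by (rule p\<nu>)
  have sp\<nu>: "space \<nu> = UNIV" using sets_eq_imp_space_eq[OF s\<nu>] by simp
  have mr\<nu>: "(\<lambda>\<omega>::nat \<Rightarrow> 'a. restrict \<omega> J) \<in> measurable \<nu> (PiM J (\<lambda>_. borel))" for J
    using mr by (simp cong: measurable_cong_sets add: s\<nu>)
  have dist: "distr \<nu> (PiM J (\<lambda>_. borel)) (\<lambda>\<omega>. restrict \<omega> J) = PJ J" if J: "finite J" for J
  proof (rule measure_eqI)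
    fix X assume "X \<in> sets (distr \<nu> (PiM J (\<lambda>_. borel)) (\<lambda>\<omega>. restrict \<omega> J))"
    then have X: "X \<in> sets (PiM J (\<lambda>_. borel))" by simp
    have "emeasure (distr \<nu> (PiM J (\<lambda>_. borel)) (\<lambda>\<omega>. restrict \<omega> J)) X = emeasure \<nu> ((\<lambda>\<omega>. restrict \<omega> J) -` X)"
      by (simp add: emeasure_distr[OF mr\<nu> X] sp\<nu>)
    also have "(\<lambda>\<omega>. restrict \<omega> J) -` X = pp.emb UNIV J X"
      by (auto simp: prod_emb_def)
    also have "emeasure \<nu> \<dots> = emeasure (PJ J) X"
      unfolding \<nu>_def by (rule pp.emeasure_lim_emb[OF _ J X]) simp
    finally show "emeasure (distr \<nu> (PiM J (\<lambda>_. borel)) (\<lambda>\<omega>. restrict \<omega> J)) X = emeasure (PJ J) X" .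
  qed (simp add: PJ_def)
  \<comment> \<open>The index is \<open>Suc k\<close> because \<open>N {..k} = Suc k\<close>: the
    positions 0 to \<open>k\<close> are exactly the letters on which \<open>G\<close>
    depends.\<close>
  have int: "(\<integral>\<omega>. G \<omega> \<partial>\<nu>) = (\<integral>\<omega>. cyl_density (Suc k) \<phi> \<omega> * G \<omega> \<partial>Pr)"
    if Gm [measurable]: "G \<in> borel_measurable borel" and G: "\<And>\<omega> \<eta>. G (comb_seq (Suc k) \<omega> \<eta>) = G \<omega>"
    for G :: "(nat \<Rightarrow> 'a) \<Rightarrow> real" and k
  proof -
    let ?J = "{..k}"
    have NJ: "N ?J = Suc k"
    proof -
      have "insert 0 {..k} = {..k}" by auto
      moreover have "Max {..k} = k" by (rule Max_eqI) auto
      ultimately show ?thesis by (simp add: N_def)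
    qed
    let ?G = "\<lambda>y. G (comb_seq (Suc k) y undefined)"
    have "(\<lambda>y i. comb_seq (Suc k) y undefined i) \<in> measurable (PiM ?J (\<lambda>_. borel)) (PiM UNIV (\<lambda>_::nat. borel :: 'a measure))"
    proof (rule measurable_PiM_single')
      fix i :: nat
      show "(\<lambda>y. comb_seq (Suc k) y undefined i) \<in> borel_measurable (PiM ?J (\<lambda>_. borel :: 'a measure))"
        by (cases "i \<le> k") (auto simp: comb_seq_def)
    qed auto
    then have "(\<lambda>y. comb_seq (Suc k) y undefined) \<in> measurable (PiM ?J (\<lambda>_. borel)) (borel :: (nat \<Rightarrow> 'a) measure)"
      using e by (simp cong: measurable_cong_sets)
    then have mG: "?G \<in> borel_measurable (PiM ?J (\<lambda>_. borel))" by measurable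
    have Gr: "?G (restrict \<omega> ?J) = G \<omega>" for \<omega>
    proof -
      have "comb_seq (Suc k) (restrict \<omega> ?J) undefined = comb_seq (Suc k) \<omega> undefined"
        by (auto simp: comb_seq_def fun_eq_iff)
      then show ?thesis by (simp add: G)
    qed
    have "(\<integral>\<omega>. G \<omega> \<partial>\<nu>) = (\<integral>y. ?G y \<partial>PJ ?J)"
      unfolding dist[OF finite_atMost, symmetric] by (subst integral_distr[OF mr\<nu> mG]) (simp add: Gr)
    also have "\<dots> = (\<integral>\<omega>. G \<omega> \<partial>cyl_measure (Suc k))"
      unfolding PJ_def NJ by (subst integral_distr[OF mr' mG]) (simp add: Gr)
    finally show ?thesis by (simp add: integral_cyl_measure)
  qed
  have "(\<integral>\<omega>. f \<omega> \<partial>\<nu>) = limit_fun \<phi> f" if f: "lip a f" for f :: "(nat \<Rightarrow> 'a) \<Rightarrow> real" and a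
  proof (rule LIMSEQ_unique)
    have cf: "continuous_on UNIV f" by (rule lip_imp_continuous[OF f])
    obtain B where B: "\<And>x. norm (f x) \<le> B" using bounded_continuous[OF cf] by metis
    have [measurable]: "f \<in> borel_measurable borel" by (rule borel_measurable_cont[OF cf])
    \<comment> \<open>\<open>f\<close> with the tail after \<open>Suc k\<close> letters frozen at an
      arbitrary sequence; this depends on finitely many letters and is within \<delta> of
      \<open>f\<close>.\<close>
    define F where "F k \<omega> = f (comb_seq (Suc k) \<omega> undefined)" for k \<omega>
    have [measurable]: "F k \<in> borel_measurable borel" for k unfolding F_def by measurable
    define \<delta> where "\<delta> k = \<bar>a\<bar> * (diam / 2 ^ Suc k)" for k
    have "(\<lambda>k. \<bar>a\<bar> * diam * (1/2) ^ Suc k) \<longlonglongrightarrow> 0"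
      by (intro tendsto_mult_right_zero LIMSEQ_Suc LIMSEQ_realpow_zero) auto
    then have \<delta>0: "\<delta> \<longlonglongrightarrow> 0" by (simp add: \<delta>_def[abs_def] power_divide)
    have Ff: "\<bar>F k \<omega> - f (comb_seq (Suc k) \<omega> \<eta>)\<bar> \<le> \<delta> k" for k \<omega> \<eta>
    proof -
      have "norm (f (comb_seq (Suc k) \<omega> undefined) - f (comb_seq (Suc k) \<omega> \<eta>)) \<le> a * (dOmega undefined \<eta> / 2 ^ Suc k)"
        using f[unfolded lip_def, rule_format, of "comb_seq (Suc k) \<omega> undefined" "comb_seq (Suc k) \<omega> \<eta>"]
        unfolding dOmega_comb by simp
      also have "\<dots> \<le> \<bar>a\<bar> * (diam / 2 ^ Suc k)"
        by (intro mult_mono divide_right_mono dOmega_le_diam) auto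
      finally show ?thesis by (simp add: F_def \<delta>_def)
    qed
    have Flim: "(\<lambda>k. F k \<omega>) \<longlonglongrightarrow> f \<omega>" for \<omega>
    proof -
      have "\<bar>F k \<omega> - f \<omega>\<bar> \<le> \<delta> k" for k using Ff[of k \<omega> "(shift ^^ Suc k) \<omega>"] by (simp only: comb_seq_funpow_shift)
      then have "(\<lambda>k. F k \<omega> - f \<omega>) \<longlonglongrightarrow> 0" by (intro Lim_null_comparison[OF _ \<delta>0]) auto
      then show ?thesis by (simp add: LIM_zero_iff)
    qed
    show "(\<lambda>k. \<integral>\<omega>. F k \<omega> \<partial>\<nu>) \<longlonglongrightarrow> (\<integral>\<omega>. f \<omega> \<partial>\<nu>)"
      by (rule integral_dominated_convergence[where w = "\<lambda>_. B"])
         (use Flim B in \<open>auto simp: F_def s\<nu> cong: measurable_cong_sets\<close>)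
    have "\<bar>(\<integral>\<omega>. F k \<omega> \<partial>\<nu>) - limit_fun \<phi> f\<bar> \<le> \<delta> k" for k
    proof -
      define n where "n = Suc k"
      obtain c where c: "lip c (\<lambda>x. exp (birkhoff_sum n \<phi> x))" by (rule lip_exp_birkhoff)
      obtain c' where w: "lip c' (\<lambda>\<eta>. exp (birkhoff_sum n \<phi> \<eta>) * f \<eta>)" using lip_weight[OF \<phi> f] .
      let ?e = "\<lambda>\<omega> \<eta>. exp (birkhoff_sum n \<phi> (comb_seq n \<omega> \<eta>))"
      \<comment> \<open>The cylinder density with \<open>f\<close> placed inside the functional. It
        integrates to \<open>limit_fun \<phi> f\<close> by conformality and, since \<open>f\<close>
        on the cylinder stays within \<delta> of \<open>F k \<omega>\<close>, it differs from
        \<open>cyl_density n \<phi> \<omega> * F k \<omega>\<close> by at most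
        \<open>cyl_density n \<phi> \<omega> * \<delta> k\<close>.\<close>
      let ?T = "\<lambda>\<omega>. limit_fun \<phi> (\<lambda>\<eta>. ?e \<omega> \<eta> * f (comb_seq n \<omega> \<eta>)) / growth \<phi> ^ n"
      have rp: "growth \<phi> ^ n > 0" using growth_pos[OF l \<phi>] by simp
      have T: "(\<integral>\<omega>. ?T \<omega> \<partial>Pr) = limit_fun \<phi> f"
      proof -
        have "(\<integral>\<omega>. ?T \<omega> \<partial>Pr) = limit_fun \<phi> (\<lambda>\<eta>. \<integral>\<omega>. ?e \<omega> \<eta> * f (comb_seq n \<omega> \<eta>) \<partial>Pr) / growth \<phi> ^ n"
          using limit_fun_integral_comb[OF l \<phi> w, of n] by simp
        also have "(\<lambda>\<eta>. \<integral>\<omega>. ?e \<omega> \<eta> * f (comb_seq n \<omega> \<eta>) \<partial>Pr) = iter_transfer n \<phi> f" by (simp add: iter_transfer_def fun_eq_iff)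
        finally show ?thesis using growth_pos[OF l \<phi>] by (simp add: limit_fun_iter_transfer[OF l \<phi> f])
      qed
      have iT: "integrable Pr ?T" using limit_fun_comb_integrable[OF l \<phi> w, of n] by simp
      have diff: "\<bar>cyl_density n \<phi> \<omega> * F k \<omega> - ?T \<omega>\<bar> \<le> cyl_density n \<phi> \<omega> * \<delta> k" for \<omega>
      proof -
        have le: "lip \<bar>c\<bar> (?e \<omega>)" by (rule lip_comb[OF c])
        have lw: "lip \<bar>c'\<bar> (\<lambda>\<eta>. ?e \<omega> \<eta> * f (comb_seq n \<omega> \<eta>))" by (rule lip_comb[OF w])
        obtain c1 where l1: "lip c1 (\<lambda>\<eta>. (F k \<omega> - \<delta> k) * ?e \<omega> \<eta>)" using lip_mult[OF lip_const le] .
        obtain c2 where l2: "lip c2 (\<lambda>\<eta>. (F k \<omega> + \<delta> k) * ?e \<omega> \<eta>)" using lip_mult[OF lip_const le] .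
        have p: "f (comb_seq n \<omega> \<eta>) \<le> F k \<omega> + \<delta> k" "F k \<omega> - \<delta> k \<le> f (comb_seq n \<omega> \<eta>)" for \<eta>
          using Ff[of k \<omega> \<eta>] by (auto simp: n_def abs_le_iff)
        have "(F k \<omega> - \<delta> k) * limit_fun \<phi> (?e \<omega>) \<le> limit_fun \<phi> (\<lambda>\<eta>. ?e \<omega> \<eta> * f (comb_seq n \<omega> \<eta>))"
          unfolding limit_fun_cmult[OF l \<phi> le, symmetric]
          by (rule limit_fun_mono[OF l \<phi> l1 lw]) (use p in \<open>simp add: mult.commute\<close>)
        moreover have "limit_fun \<phi> (\<lambda>\<eta>. ?e \<omega> \<eta> * f (comb_seq n \<omega> \<eta>)) \<le> (F k \<omega> + \<delta> k) * limit_fun \<phi> (?e \<omega>)"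
          unfolding limit_fun_cmult[OF l \<phi> le, symmetric]
          by (rule limit_fun_mono[OF l \<phi> lw l2]) (use p in \<open>simp add: mult.commute\<close>)
        ultimately have "\<bar>limit_fun \<phi> (?e \<omega>) * F k \<omega> - limit_fun \<phi> (\<lambda>\<eta>. ?e \<omega> \<eta> * f (comb_seq n \<omega> \<eta>))\<bar> \<le> limit_fun \<phi> (?e \<omega>) * \<delta> k"
          by (simp add: abs_le_iff algebra_simps)
        then have "\<bar>limit_fun \<phi> (?e \<omega>) * F k \<omega> - limit_fun \<phi> (\<lambda>\<eta>. ?e \<omega> \<eta> * f (comb_seq n \<omega> \<eta>))\<bar> / growth \<phi> ^ n \<le> limit_fun \<phi> (?e \<omega>) * \<delta> k / growth \<phi> ^ n"
          using rp by (intro divide_right_mono) auto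
        moreover have "\<bar>cyl_density n \<phi> \<omega> * F k \<omega> - ?T \<omega>\<bar> = \<bar>limit_fun \<phi> (?e \<omega>) * F k \<omega> - limit_fun \<phi> (\<lambda>\<eta>. ?e \<omega> \<eta> * f (comb_seq n \<omega> \<eta>))\<bar> / growth \<phi> ^ n"
          using rp by (simp add: cyl_density_def abs_divide flip: diff_divide_distrib)
        ultimately show ?thesis by (simp add: cyl_density_def)
      qed
      have iF: "integrable Pr (\<lambda>\<omega>. cyl_density n \<phi> \<omega> * F k \<omega>)"
        using integrable_scaleR_bounded[OF cyl_density_integrable, of "F k" B n] B by (simp add: F_def)
      have Fi: "(\<integral>\<omega>. F k \<omega> \<partial>\<nu>) = (\<integral>\<omega>. cyl_density n \<phi> \<omega> * F k \<omega> \<partial>Pr)"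
        unfolding n_def by (rule int) (auto simp: F_def)
      have "(\<integral>\<omega>. F k \<omega> \<partial>\<nu>) - limit_fun \<phi> f = (\<integral>\<omega>. cyl_density n \<phi> \<omega> * F k \<omega> - ?T \<omega> \<partial>Pr)"
        unfolding Bochner_Integration.integral_diff[OF iF iT] T Fi ..
      then have "\<bar>(\<integral>\<omega>. F k \<omega> \<partial>\<nu>) - limit_fun \<phi> f\<bar> \<le> (\<integral>\<omega>. \<bar>cyl_density n \<phi> \<omega> * F k \<omega> - ?T \<omega>\<bar> \<partial>Pr)"
        using integral_abs_bound by simp
      also have "\<dots> \<le> (\<integral>\<omega>. cyl_density n \<phi> \<omega> * \<delta> k \<partial>Pr)"
        using diff by (intro integral_mono integrable_abs Bochner_Integration.integrable_diff iF iT) (auto simp: cyl_density_integrable)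
      finally show ?thesis by (simp add: cyl_density_integral)
    qed
    then have "(\<lambda>k. (\<integral>\<omega>. F k \<omega> \<partial>\<nu>) - limit_fun \<phi> f) \<longlonglongrightarrow> 0" by (intro Lim_null_comparison[OF _ \<delta>0]) auto
    then show "(\<lambda>k. \<integral>\<omega>. F k \<omega> \<partial>\<nu>) \<longlonglongrightarrow> limit_fun \<phi> f" by (simp add: LIM_zero_iff)
  qed
  then show ?thesis using that[OF p\<nu> s\<nu>] by blast
qed

end

end

section \<open>The spectral radius and uniqueness of the conformal measure\<close>

context full_shift
begin

lemma Omega_full [simp]: "Omega (\<lambda>_ _ :: 'a. 1) = UNIV" by (simp add: Omega_def)

lemma C0_UNIV: "f \<in> C0 UNIV \<longleftrightarrow> continuous_on UNIV f" by (simp add: C0_def)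

context
  fixes l :: real and \<phi> :: "(nat \<Rightarrow> 'a) \<Rightarrow> real"
  assumes l: "0 \<le> l" and \<phi>: "lip l \<phi>"
begin

text \<open>Both \<open>norm_iter n \<phi>\<close> and integration by \<nu> are bounded by the
  supremum norm, so passing from \<open>f\<close> to a Lipschitz \<open>g\<close> costs
  \<open>e\<close> twice. The potential enters the bound only through \<open>l\<close>, which yields
  uniformity over families of potentials later.\<close>

lemma norm_iter_approx:
  fixes f g :: "(nat \<Rightarrow> 'a) \<Rightarrow> real"
  assumes \<nu>: "prob_space \<nu>" "sets \<nu> = sets borel" "\<And>f a. lip a f \<Longrightarrow> (\<integral>\<omega>. f \<omega> \<partial>\<nu>) = limit_fun \<phi> f"
    and f: "continuous_on UNIV f" and g: "lip a g" "\<And>x. \<bar>f x - g x\<bar> \<le> e"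
    and c: "c \<ge> 0" "trunc_lip (metric_scale l) c g" and n: "n \<ge> k * block_len l"
  shows "\<bar>norm_iter n \<phi> f x - (\<integral>\<omega>. f \<omega> \<partial>\<nu>)\<bar> \<le> 2 * e + 2 * (contr_rate l ^ k * c)"
proof -
  interpret \<nu>: prob_space \<nu> by fact
  have cg: "continuous_on UNIV g" by (rule lip_imp_continuous[OF g(1)])
  have i: "integrable \<nu> h" if h: "continuous_on UNIV h" for h :: "(nat \<Rightarrow> 'a) \<Rightarrow> real"
  proof -
    obtain B where B: "\<And>x. norm (h x) \<le> B" using bounded_continuous[OF h] by metis
    show ?thesis by (rule \<nu>.integrable_const_bound[where B = B])
      (use B borel_measurable_cont[OF h] in \<open>auto simp: \<nu>(2) cong: measurable_cong_sets\<close>)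
  qed
  have cfg: "continuous_on UNIV (\<lambda>x. f x - g x)" by (intro continuous_intros f cg)
  have "\<bar>norm_iter n \<phi> (\<lambda>x. f x - g x) x\<bar> \<le> e"
    using norm_iter_bound[OF l \<phi> cfg, of e n x] g(2) by simp
  then have 1: "\<bar>norm_iter n \<phi> f x - norm_iter n \<phi> g x\<bar> \<le> e" by (simp add: norm_iter_diff[OF l \<phi> f cg])
  have 2: "\<bar>norm_iter n \<phi> g x - limit_fun \<phi> g\<bar> \<le> 2 * (contr_rate l ^ k * c)"
    by (rule norm_iter_LIMSEQ_trunc_lip(2)[OF l \<phi> cg c(2,1) n])
  have "\<bar>(\<integral>\<omega>. f \<omega> - g \<omega> \<partial>\<nu>)\<bar> \<le> (\<integral>\<omega>. e \<partial>\<nu>)"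
    by (rule order_trans[OF integral_abs_bound integral_mono])
       (use i[OF cfg] g(2) in auto)
  then have 3: "\<bar>(\<integral>\<omega>. f \<omega> \<partial>\<nu>) - limit_fun \<phi> g\<bar> \<le> e"
    using i[OF f] i[OF cg] \<nu>(3)[OF g(1)] \<nu>.prob_space by simp
  show ?thesis using 1 2 3 by linarith
qed

lemma integral_transfer1_eq:
  fixes f :: "(nat \<Rightarrow> 'a) \<Rightarrow> real"
  assumes \<nu>: "prob_space \<nu>" "sets \<nu> = sets borel" "\<And>f a. lip a f \<Longrightarrow> (\<integral>\<omega>. f \<omega> \<partial>\<nu>) = limit_fun \<phi> f"
    and f: "continuous_on UNIV f"
  shows "(\<integral>\<omega>. iter_transfer 1 \<phi> f \<omega> \<partial>\<nu>) = growth \<phi> * (\<integral>\<omega>. f \<omega> \<partial>\<nu>)"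
proof -
  interpret \<nu>: prob_space \<nu> by fact
  note cp = lip_imp_continuous[OF \<phi>]
  have i: "integrable \<nu> h" if h: "continuous_on UNIV h" for h :: "(nat \<Rightarrow> 'a) \<Rightarrow> real"
  proof -
    obtain B where B: "\<And>x. norm (h x) \<le> B" using bounded_continuous[OF h] by metis
    show ?thesis by (rule \<nu>.integrable_const_bound[where B = B])
      (use B borel_measurable_cont[OF h] in \<open>auto simp: \<nu>(2) cong: measurable_cong_sets\<close>)
  qed
  have bnd: "\<bar>\<integral>\<omega>. h \<omega> \<partial>\<nu>\<bar> \<le> B" if h: "continuous_on UNIV h" "\<And>x. \<bar>h x\<bar> \<le> B" for h :: "(nat \<Rightarrow> 'a) \<Rightarrow> real" and B
  proof -
    have "\<bar>\<integral>\<omega>. h \<omega> \<partial>\<nu>\<bar> \<le> (\<integral>\<omega>. B \<partial>\<nu>)"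
      by (rule order_trans[OF integral_abs_bound integral_mono]) (use i[OF h(1)] h(2) in auto)
    then show ?thesis using \<nu>.prob_space by simp
  qed
  \<comment> \<open>The sum of a bound for the operator in the supremum norm and of the eigenvalue:
    an approximation of \<open>f\<close> up to \<open>e / C\<close> then costs \<open>e\<close> in
    total.\<close>
  define C where "C = exp (l * diam) * growth \<phi> ^ 1 + growth \<phi>"
  have C: "C > 0" using growth_pos[OF l \<phi>] by (simp add: C_def add_pos_pos)
  have "\<bar>(\<integral>\<omega>. iter_transfer 1 \<phi> f \<omega> \<partial>\<nu>) - growth \<phi> * (\<integral>\<omega>. f \<omega> \<partial>\<nu>)\<bar> \<le> 0 + e" if e: "e > 0" for e
  proof -
    have "e / C > 0" using e C by simp
    then obtain g a where g: "lip a g" "\<And>x. \<bar>f x - g x\<bar> < e / C" using lip_dense[OF f] by blast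
    have cg: "continuous_on UNIV g" by (rule lip_imp_continuous[OF g(1)])
    have cfg: "continuous_on UNIV (\<lambda>x. f x - g x)" by (intro continuous_intros f cg)
    obtain a' where "lip a' (iter_transfer 1 \<phi> g)" using iter_transfer_lip'[OF l \<phi> g(1)] .
    then have eq: "(\<integral>\<omega>. iter_transfer 1 \<phi> g \<omega> \<partial>\<nu>) = growth \<phi> * (\<integral>\<omega>. g \<omega> \<partial>\<nu>)"
      using \<nu>(3) g(1) limit_fun_transfer1[OF l \<phi> g(1)] by simp
    have "\<bar>\<integral>\<omega>. iter_transfer 1 \<phi> (\<lambda>x. f x - g x) \<omega> \<partial>\<nu>\<bar> \<le> exp (l * diam) * growth \<phi> ^ 1 * (e / C)"
    proof (rule bnd[OF continuous_on_iter_transfer[OF cp cfg]])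
      fix x
      have "\<bar>iter_transfer 1 \<phi> (\<lambda>x. f x - g x) x\<bar> \<le> iter_one 1 \<phi> x * (e / C)"
        using iter_transfer_bound[OF l \<phi> cfg, of "e / C" 1 x] g(2) by (simp add: less_imp_le)
      also have "\<dots> \<le> exp (l * diam) * growth \<phi> ^ 1 * (e / C)"
        by (intro mult_right_mono iter_one_growth_bounds(1)[OF l \<phi>]) (use e C in simp)
      finally show "\<bar>iter_transfer 1 \<phi> (\<lambda>x. f x - g x) x\<bar> \<le> exp (l * diam) * growth \<phi> ^ 1 * (e / C)" .
    qed
    moreover have "iter_transfer 1 \<phi> (\<lambda>x. f x - g x) = (\<lambda>x. iter_transfer 1 \<phi> f x - iter_transfer 1 \<phi> g x)"
      using iter_transfer_diff[OF l \<phi> f cg] by auto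
    ultimately have 1: "\<bar>(\<integral>\<omega>. iter_transfer 1 \<phi> f \<omega> \<partial>\<nu>) - (\<integral>\<omega>. iter_transfer 1 \<phi> g \<omega> \<partial>\<nu>)\<bar> \<le> exp (l * diam) * growth \<phi> ^ 1 * (e / C)"
      using i[OF continuous_on_iter_transfer[OF cp f]] i[OF continuous_on_iter_transfer[OF cp cg]] by simp
    have "\<bar>\<integral>\<omega>. f \<omega> - g \<omega> \<partial>\<nu>\<bar> \<le> e / C" by (rule bnd[OF cfg]) (use g(2) in \<open>simp add: less_imp_le\<close>)
    then have "\<bar>(\<integral>\<omega>. f \<omega> \<partial>\<nu>) - (\<integral>\<omega>. g \<omega> \<partial>\<nu>)\<bar> \<le> e / C" using i[OF f] i[OF cg] by simp
    then have "growth \<phi> * \<bar>(\<integral>\<omega>. f \<omega> \<partial>\<nu>) - (\<integral>\<omega>. g \<omega> \<partial>\<nu>)\<bar> \<le> growth \<phi> * (e / C)"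
      using growth_pos[OF l \<phi>] by (intro mult_left_mono) auto
    then have 2: "\<bar>growth \<phi> * (\<integral>\<omega>. f \<omega> \<partial>\<nu>) - growth \<phi> * (\<integral>\<omega>. g \<omega> \<partial>\<nu>)\<bar> \<le> growth \<phi> * (e / C)"
      using growth_pos[OF l \<phi>] by (simp add: abs_mult flip: right_diff_distrib)
    have "exp (l * diam) * growth \<phi> ^ 1 * (e / C) + growth \<phi> * (e / C) = C * (e / C)" by (simp only: C_def distrib_right)
    also have "\<dots> = e" using C by simp
    finally show ?thesis using 1 2 eq by linarith
  qed
  then have "\<bar>(\<integral>\<omega>. iter_transfer 1 \<phi> f \<omega> \<partial>\<nu>) - growth \<phi> * (\<integral>\<omega>. f \<omega> \<partial>\<nu>)\<bar> \<le> 0" by (rule field_le_epsilon)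
  then show ?thesis by simp
qed

lemma iter_transfer_cmult_complex:
  fixes f :: "(nat \<Rightarrow> 'a) \<Rightarrow> complex"
  shows "iter_transfer n \<phi> (\<lambda>x. c * f x) x = c * iter_transfer n \<phi> f x"
  unfolding iter_transfer_def by (subst integral_mult_right_zero[symmetric]) (simp add: mult.left_commute)

text \<open>An eigenfunction for \<open>z\<close> would grow like \<open>cmod z ^ n\<close> under
  iteration, whereas the iterates are at most a constant times
  \<open>growth \<phi> ^ n\<close>.\<close>

lemma resolvent_inj:
  fixes f :: "(nat \<Rightarrow> 'a) \<Rightarrow> complex"
  assumes f: "continuous_on UNIV f" and z: "cmod z > growth \<phi>" and eq: "\<And>x. iter_transfer 1 \<phi> f x = z * f x"
  shows "f x = 0"
proof (rule ccontr)
  assume nz: "f x \<noteq> 0"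
  note cp = lip_imp_continuous[OF \<phi>]
  have it: "iter_transfer n \<phi> f = (\<lambda>x. z ^ n * f x)" for n
  proof (induction n)
    case (Suc n)
    have e1: "iter_transfer (Suc n) \<phi> f y = iter_transfer n \<phi> (iter_transfer 1 \<phi> f) y" for y using iter_transfer_add[OF cp f, of n 1 y] by simp
    have e2: "iter_transfer 1 \<phi> f = (\<lambda>x. z * f x)" using eq by auto
    show ?case by (rule ext) (simp only: e1 e2 iter_transfer_cmult_complex Suc power_Suc mult.assoc)
  qed simp
  obtain B where B: "B > 0" "\<And>x. norm (f x) \<le> B" using bounded_continuous[OF f] by metis
  define q where "q = cmod z / growth \<phi>"
  have q: "q > 1" using z growth_pos[OF l \<phi>] by (simp add: q_def)
  have "q ^ n * cmod (f x) \<le> exp (l * diam) * B" for n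
  proof -
    have "cmod z ^ n * cmod (f x) \<le> iter_one n \<phi> x * B"
      using iter_transfer_bound[OF l \<phi> f B(2), of n x] by (simp add: it norm_mult norm_power)
    also have "\<dots> \<le> exp (l * diam) * growth \<phi> ^ n * B"
      by (intro mult_right_mono iter_one_growth_bounds[OF l \<phi>]) (use B in simp)
    finally show ?thesis using growth_pos[OF l \<phi>] by (simp add: q_def power_divide field_simps)
  qed
  moreover obtain n where "q ^ n > exp (l * diam) * B / cmod (f x)" using real_arch_pow[OF q] by blast
  ultimately show False using nz by (metis divide_less_eq not_le zero_less_norm_iff)
qed

text \<open>The solution is the Neumann series with terms
  \<open>iter_transfer n \<phi> g x / z ^ Suc n\<close>, whose uniform convergence follows from
  \<open>iter_one_growth_bounds\<close>.\<close>

lemma resolvent_surj: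
  fixes g :: "(nat \<Rightarrow> 'a) \<Rightarrow> complex"
  assumes g: "continuous_on UNIV g" and z: "cmod z > growth \<phi>"
  obtains f where "continuous_on UNIV f" "\<And>x. z * f x - iter_transfer 1 \<phi> f x = g x"
proof -
  note cp = lip_imp_continuous[OF \<phi>] and r = growth_pos[OF l \<phi>]
  have z0: "z \<noteq> 0" using z r by auto
  obtain B where B: "B > 0" "\<And>x. norm (g x) \<le> B" using bounded_continuous[OF g] by metis
  define u where "u n x = iter_transfer n \<phi> g x / z ^ Suc n" for n x
  define M where "M n = exp (l * diam) * B / cmod z * (growth \<phi> / cmod z) ^ n" for n
  have uM: "norm (u n x) \<le> M n" for n x
  proof -
    have "norm (iter_transfer n \<phi> g x) \<le> iter_one n \<phi> x * B" by (rule iter_transfer_bound[OF l \<phi> g B(2)])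
    also have "\<dots> \<le> exp (l * diam) * growth \<phi> ^ n * B"
      by (intro mult_right_mono iter_one_growth_bounds[OF l \<phi>]) (use B in simp)
    finally have "norm (iter_transfer n \<phi> g x) / cmod z ^ Suc n \<le> exp (l * diam) * growth \<phi> ^ n * B / cmod z ^ Suc n"
      by (rule divide_right_mono) simp
    then show ?thesis by (simp add: u_def M_def norm_divide norm_mult norm_power power_divide field_simps)
  qed
  have "norm (growth \<phi> / cmod z) < 1" using z r by (simp add: divide_less_eq)
  then have sM: "summable M" unfolding M_def by (intro summable_mult summable_geometric)
  define f where "f x = (\<Sum>n. u n x)" for x
  define F where "F N x = (\<Sum>n<N. u n x)" for N x
  have ul: "uniform_limit UNIV F f sequentially"
    unfolding F_def f_def by (rule Weierstrass_m_test[OF uM sM])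
  have cF: "continuous_on UNIV (F N)" for N
    unfolding F_def u_def by (intro continuous_intros continuous_on_iter_transfer cp g) (use z0 in auto)
  have cf: "continuous_on UNIV f"
    by (rule uniform_limit_theorem[OF _ ul]) (use cF in auto)
  \<comment> \<open>The operator shifts the series by one index, so the equation holds for partial
    sums up to replacing \<open>N\<close> by \<open>Suc N\<close>, and passes to the limit.\<close>
  have LF: "iter_transfer 1 \<phi> (F N) x = z * F (Suc N) x - g x" for N x
  proof -
    have E1: "iter_transfer 1 \<phi> (F N) x = (\<Sum>n<N. iter_transfer 1 \<phi> (u n) x)"
    proof -
      have cu: "continuous_on UNIV (u n)" for n
        unfolding u_def by (intro continuous_intros continuous_on_iter_transfer cp g) (use z0 in auto)
      show ?thesis unfolding iter_transfer_def F_def scaleR_sum_right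
        by (rule Bochner_Integration.integral_sum) (rule integrable_weight[OF cp cu])
    qed
    have E2: "iter_transfer 1 \<phi> (u n) x = z * u (Suc n) x" for n
    proof -
      have "iter_transfer 1 \<phi> (u n) x = iter_transfer 1 \<phi> (\<lambda>x. inverse (z ^ Suc n) * iter_transfer n \<phi> g x) x"
        unfolding u_def by (simp add: field_simps)
      also have "\<dots> = inverse (z ^ Suc n) * iter_transfer (n + 1) \<phi> g x"
        unfolding iter_transfer_cmult_complex iter_transfer_add[OF cp g] ..
      finally show ?thesis using z0 by (simp add: u_def field_simps)
    qed
    have E3: "(\<Sum>n<N. z * u (Suc n) x) = z * (F (Suc N) x - u 0 x)"
      unfolding F_def sum.lessThan_Suc_shift by (simp add: sum_distrib_left)
    have E4: "z * (F (Suc N) x - u 0 x) = z * F (Suc N) x - g x" using z0 by (simp add: u_def algebra_simps)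
    show ?thesis unfolding E1 E2 E3 E4 ..
  qed
  have "z * f x - iter_transfer 1 \<phi> f x = g x" for x
  proof -
    have Fl: "(\<lambda>N. F N y) \<longlonglongrightarrow> f y" for y by (rule tendsto_uniform_limitI[OF ul]) simp
    have "(\<lambda>N. iter_transfer 1 \<phi> (F N) x) \<longlonglongrightarrow> iter_transfer 1 \<phi> f x"
    proof (rule tendstoI)
      fix e :: real assume e: "e > 0"
      define e' where "e' = e / (2 * iter_one 1 \<phi> x)"
      have h: "iter_one 1 \<phi> x > 0" by (rule iter_one_pos[OF l \<phi>])
      have "e' > 0" using e h by (simp add: e'_def)
      then have "\<forall>\<^sub>F N in sequentially. \<forall>y\<in>UNIV. dist (F N y) (f y) < e'" using ul by (simp add: uniform_limit_iff)
      then show "\<forall>\<^sub>F N in sequentially. dist (iter_transfer 1 \<phi> (F N) x) (iter_transfer 1 \<phi> f x) < e"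
      proof eventually_elim
        case (elim N)
        have "norm (iter_transfer 1 \<phi> (\<lambda>y. F N y - f y) x) \<le> iter_one 1 \<phi> x * e'"
          by (rule iter_transfer_bound[OF l \<phi>]) (use elim cF cf in \<open>auto intro!: continuous_intros simp: dist_norm less_imp_le\<close>)
        also have "\<dots> < e" using h e by (simp add: e'_def)
        finally show ?case by (simp add: iter_transfer_diff[OF l \<phi> cF cf] dist_norm)
      qed
    qed
    moreover have "(\<lambda>N. iter_transfer 1 \<phi> (F N) x) \<longlonglongrightarrow> z * f x - g x"
      unfolding LF by (intro tendsto_intros LIMSEQ_Suc[OF Fl])
    ultimately have "iter_transfer 1 \<phi> f x = z * f x - g x" by (rule LIMSEQ_unique)
    then show ?thesis by simp
  qed
  then show ?thesis using that cf by blast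
qed

text \<open>Outside the disc of radius \<open>growth \<phi>\<close> the resolvent exists. The number
  \<open>growth \<phi>\<close> itself is in the spectrum because the constant 1 is not attained:
  integrating the real part of the equation against the conformal measure would give
  \<open>0 = 1\<close>.\<close>

lemma spec_rad_eq: "spec_rad \<rho> (\<lambda>_ _. 1) \<phi> = growth \<phi>"
proof -
  note cp = lip_imp_continuous[OF \<phi>] and r = growth_pos[OF l \<phi>]
  define T where "T = spectrum_C0 (UNIV :: (nat \<Rightarrow> 'a) set) (transfer \<rho> (\<lambda>_ _. 1) \<phi>)"
  have tr: "transfer \<rho> (\<lambda>_ _. 1) \<phi> f = iter_transfer 1 \<phi> f" if "continuous_on UNIV f" for f :: "(nat \<Rightarrow> 'a) \<Rightarrow> complex"
    by (rule transfer_eq_iter_transfer[OF cp that])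
  have T: "z \<in> T \<longleftrightarrow> \<not> bij_betw (\<lambda>f x. z * f x - iter_transfer 1 \<phi> f x) {f. continuous_on UNIV f} {f. continuous_on UNIV f}" for z
  proof -
    have C: "C0 UNIV = {f :: (nat \<Rightarrow> 'a) \<Rightarrow> complex. continuous_on UNIV f}" by (auto simp: C0_UNIV)
    show ?thesis unfolding T_def spectrum_C0_def mem_Collect_eq C
      by (intro arg_cong[where f = Not] bij_betw_cong) (auto simp: tr fun_eq_iff)
  qed
  have le: "cmod z \<le> growth \<phi>" if "z \<in> T" for z
  proof (rule ccontr)
    assume "\<not> cmod z \<le> growth \<phi>"
    then have z: "cmod z > growth \<phi>" by simp
    have "bij_betw (\<lambda>f x. z * f x - iter_transfer 1 \<phi> f x) {f. continuous_on UNIV f} {f. continuous_on UNIV f}"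
      unfolding bij_betw_def
    proof (intro conjI inj_onI)
      fix f g :: "(nat \<Rightarrow> 'a) \<Rightarrow> complex"
      assume f: "f \<in> {f. continuous_on UNIV f}" and g: "g \<in> {f. continuous_on UNIV f}"
        and eq: "(\<lambda>x. z * f x - iter_transfer 1 \<phi> f x) = (\<lambda>x. z * g x - iter_transfer 1 \<phi> g x)"
      have "f x - g x = 0" for x
      proof (rule resolvent_inj[OF _ z])
        show "continuous_on UNIV (\<lambda>x. f x - g x)" using f g by (intro continuous_intros) auto
        show "iter_transfer 1 \<phi> (\<lambda>x. f x - g x) y = z * (f y - g y)" for y
          using fun_cong[OF eq, of y] f g by (simp add: iter_transfer_diff[OF l \<phi>] algebra_simps)
      qed
      then show "f = g" by auto
    next
      show "(\<lambda>f x. z * f x - iter_transfer 1 \<phi> f x) ` {f. continuous_on UNIV f} = {f. continuous_on UNIV f}"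
      proof (intro equalityI subsetI)
        fix g :: "(nat \<Rightarrow> 'a) \<Rightarrow> complex" assume "g \<in> {f. continuous_on UNIV f}"
        then obtain f where "continuous_on UNIV f" "\<And>x. z * f x - iter_transfer 1 \<phi> f x = g x"
          using resolvent_surj[OF _ z] by blast
        then show "g \<in> (\<lambda>f x. z * f x - iter_transfer 1 \<phi> f x) ` {f. continuous_on UNIV f}"
          by (intro image_eqI[of _ _ f]) auto
      qed (auto intro!: continuous_intros continuous_on_iter_transfer[OF cp])
    qed
    with that T show False by blast
  qed
  have mem: "complex_of_real (growth \<phi>) \<in> T"
  proof (rule ccontr)
    assume "complex_of_real (growth \<phi>) \<notin> T"
    then have "bij_betw (\<lambda>f x. complex_of_real (growth \<phi>) * f x - iter_transfer 1 \<phi> f x) {f. continuous_on UNIV f} {f. continuous_on UNIV f}"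
      using T by blast
    then have "(\<lambda>_. 1) \<in> (\<lambda>f x. complex_of_real (growth \<phi>) * f x - iter_transfer 1 \<phi> f x) ` {f. continuous_on UNIV f}"
      unfolding bij_betw_def by (auto simp: continuous_on_const)
    then obtain f where f: "continuous_on UNIV f" and eq: "\<And>x. complex_of_real (growth \<phi>) * f x - iter_transfer 1 \<phi> f x = 1"
      by (auto simp: fun_eq_iff)
    have cR: "continuous_on UNIV (\<lambda>x. Re (f x))" using f by (intro continuous_intros)
    have "Re (iter_transfer 1 \<phi> f x) = iter_transfer 1 \<phi> (\<lambda>x. Re (f x)) x" for x
      unfolding iter_transfer_def by (subst integral_Re[symmetric]) (use integrable_weight[OF cp f, of 1 x] in simp_all)
    then have eqR: "iter_transfer 1 \<phi> (\<lambda>x. Re (f x)) x = growth \<phi> * Re (f x) - 1" for x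
      using arg_cong[OF eq[of x], of Re] by simp
    obtain \<nu> where \<nu>: "prob_space \<nu>" "sets \<nu> = sets borel" "\<And>f a. lip a f \<Longrightarrow> (\<integral>\<omega>. f \<omega> \<partial>\<nu>) = limit_fun \<phi> f"
      using exists_limit_measure[OF l \<phi>] by blast
    interpret \<nu>: prob_space \<nu> by fact
    obtain B where B: "\<And>x. norm (Re (f x)) \<le> B" using bounded_continuous[OF cR] by metis
    have i: "integrable \<nu> (\<lambda>x. Re (f x))" by (rule \<nu>.integrable_const_bound[where B = B])
      (use B borel_measurable_cont[OF cR] in \<open>auto simp: \<nu>(2) cong: measurable_cong_sets\<close>)
    have "(\<integral>\<omega>. iter_transfer 1 \<phi> (\<lambda>x. Re (f x)) \<omega> \<partial>\<nu>) = growth \<phi> * (\<integral>\<omega>. Re (f \<omega>) \<partial>\<nu>)"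
      by (rule integral_transfer1_eq[OF \<nu>(1,2) _ cR]) (rule \<nu>(3))
    then show False unfolding eqR using i \<nu>.prob_space by simp
  qed
  have "spec_rad \<rho> (\<lambda>_ _. 1) \<phi> = Sup (cmod ` T)" by (simp add: spec_rad_def T_def)
  also have "\<dots> = growth \<phi>"
    by (rule cSup_eq_maximum) (use mem le r in \<open>force+\<close>)
  finally show ?thesis .
qed

text \<open>From right to left this is the eigenvalue equation of the functional. Conversely,
  iterating conformality gives \<open>growth \<phi> ^ n * \<nu>(f)\<close> as the \<nu>-integral of
  \<open>norm_iter n \<phi> f\<close> times \<open>iter_one n \<phi>\<close>; the first factor is
  uniformly close to \<open>limit_fun \<phi> f\<close>, the second integrates to
  \<open>growth \<phi> ^ n\<close>.\<close>

lemma is_conformal_iff: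
  "is_conformal \<rho> (\<lambda>_ _. 1) \<phi> \<nu> \<longleftrightarrow> prob_space \<nu> \<and> sets \<nu> = sets borel \<and>
     (\<forall>f a. lip a f \<longrightarrow> (\<integral>\<omega>. f \<omega> \<partial>\<nu>) = limit_fun \<phi> f)" (is "_ \<longleftrightarrow> ?R")
proof
  note cp = lip_imp_continuous[OF \<phi>] and r = growth_pos[OF l \<phi>]
  assume ?R
  then have \<nu>: "prob_space \<nu>" "sets \<nu> = sets borel" "\<And>f a. lip a f \<Longrightarrow> (\<integral>\<omega>. f \<omega> \<partial>\<nu>) = limit_fun \<phi> f" by auto
  show "is_conformal \<rho> (\<lambda>_ _. 1) \<phi> \<nu>"
    unfolding is_conformal_def using \<nu>(1,2) integral_transfer1_eq[OF \<nu>]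
    by (simp add: C0_UNIV transfer_eq_iter_transfer[OF cp] spec_rad_eq)
next
  note cp = lip_imp_continuous[OF \<phi>] and r = growth_pos[OF l \<phi>]
  assume "is_conformal \<rho> (\<lambda>_ _. 1) \<phi> \<nu>"
  then have \<nu>: "prob_space \<nu>" "sets \<nu> = sets borel"
    and c: "\<And>f :: (nat \<Rightarrow> 'a) \<Rightarrow> real. continuous_on UNIV f \<Longrightarrow> (\<integral>\<omega>. iter_transfer 1 \<phi> f \<omega> \<partial>\<nu>) = growth \<phi> * (\<integral>\<omega>. f \<omega> \<partial>\<nu>)"
    by (auto simp: is_conformal_def C0_UNIV transfer_eq_iter_transfer[OF cp] spec_rad_eq)
  interpret \<nu>: prob_space \<nu> by fact
  have i: "integrable \<nu> h" if h: "continuous_on UNIV h" for h :: "(nat \<Rightarrow> 'a) \<Rightarrow> real"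
  proof -
    obtain B where B: "\<And>x. norm (h x) \<le> B" using bounded_continuous[OF h] by metis
    show ?thesis by (rule \<nu>.integrable_const_bound[where B = B])
      (use B borel_measurable_cont[OF h] in \<open>auto simp: \<nu>(2) cong: measurable_cong_sets\<close>)
  qed
  have cn: "(\<integral>\<omega>. iter_transfer n \<phi> f \<omega> \<partial>\<nu>) = growth \<phi> ^ n * (\<integral>\<omega>. f \<omega> \<partial>\<nu>)" if f: "continuous_on UNIV f" for n and f :: "(nat \<Rightarrow> 'a) \<Rightarrow> real"
  proof (induction n)
    case (Suc n)
    have "iter_transfer (n + 1) \<phi> f = iter_transfer 1 \<phi> (iter_transfer n \<phi> f)" using iter_transfer_add[OF cp f] by auto
    then show ?case using Suc c[OF continuous_on_iter_transfer[OF cp f]] by simp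
  qed simp
  have "(\<integral>\<omega>. f \<omega> \<partial>\<nu>) = limit_fun \<phi> f" if f: "lip a f" for f a
  proof -
    have cf: "continuous_on UNIV f" by (rule lip_imp_continuous[OF f])
    obtain k where k: "k \<ge> 0" "trunc_lip (metric_scale l) k f" using lip_trunc_lip[OF l \<phi> f] .
    have b: "\<bar>(\<integral>\<omega>. f \<omega> \<partial>\<nu>) - limit_fun \<phi> f\<bar> \<le> 2 * (contr_rate l ^ j * k)" for j
    proof -
      define n where "n = j * block_len l"
      have h: "iter_one n \<phi> x > 0" for x by (rule iter_one_pos[OF l \<phi>])
      have ch: "continuous_on UNIV (iter_one n \<phi>)" by (rule cont_iter_one[OF l \<phi>])
      have ih: "(\<integral>\<omega>. iter_one n \<phi> \<omega> \<partial>\<nu>) = growth \<phi> ^ n" using cn[of "\<lambda>_. 1" n] \<nu>.prob_space by (simp add: iter_one_def)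
      have "growth \<phi> ^ n * ((\<integral>\<omega>. f \<omega> \<partial>\<nu>) - limit_fun \<phi> f) = (\<integral>\<omega>. iter_transfer n \<phi> f \<omega> - limit_fun \<phi> f * iter_one n \<phi> \<omega> \<partial>\<nu>)"
        using cn[OF cf, of n] ih i[OF continuous_on_iter_transfer[OF cp cf]] i[OF ch] by (simp add: algebra_simps)
      also have "\<bar>\<dots>\<bar> \<le> (\<integral>\<omega>. 2 * (contr_rate l ^ j * k) * iter_one n \<phi> \<omega> \<partial>\<nu>)"
      proof (rule order_trans[OF integral_abs_bound integral_mono])
        show "integrable \<nu> (\<lambda>\<omega>. \<bar>iter_transfer n \<phi> f \<omega> - limit_fun \<phi> f * iter_one n \<phi> \<omega>\<bar>)"
          by (intro i continuous_intros continuous_on_iter_transfer[OF cp cf] ch)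
        show "integrable \<nu> (\<lambda>\<omega>. 2 * (contr_rate l ^ j * k) * iter_one n \<phi> \<omega>)" using i[OF ch] by simp
        fix x
        have "\<bar>norm_iter n \<phi> f x - limit_fun \<phi> f\<bar> \<le> 2 * (contr_rate l ^ j * k)"
          by (rule norm_iter_LIMSEQ_trunc_lip(2)[OF l \<phi> cf k(2,1)]) (simp add: n_def)
        then have "\<bar>norm_iter n \<phi> f x - limit_fun \<phi> f\<bar> * iter_one n \<phi> x \<le> 2 * (contr_rate l ^ j * k) * iter_one n \<phi> x"
          using h[of x] by (intro mult_right_mono) auto
        moreover have "\<bar>norm_iter n \<phi> f x - limit_fun \<phi> f\<bar> * iter_one n \<phi> x = \<bar>(norm_iter n \<phi> f x - limit_fun \<phi> f) * iter_one n \<phi> x\<bar>"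
          using h[of x] by (simp add: abs_mult)
        moreover have "(norm_iter n \<phi> f x - limit_fun \<phi> f) * iter_one n \<phi> x = iter_transfer n \<phi> f x - limit_fun \<phi> f * iter_one n \<phi> x"
          using h[of x] by (simp add: norm_iter_def field_simps)
        ultimately show "\<bar>iter_transfer n \<phi> f x - limit_fun \<phi> f * iter_one n \<phi> x\<bar> \<le> 2 * (contr_rate l ^ j * k) * iter_one n \<phi> x" by simp
      qed
      also have "\<dots> = growth \<phi> ^ n * (2 * (contr_rate l ^ j * k))" using ih by simp
      finally show ?thesis using r by (simp add: abs_mult)
    qed
    have "(\<lambda>j. 2 * (contr_rate l ^ j * k)) \<longlonglongrightarrow> 0"
      using contr_rate[of l] by (intro tendsto_mult_right_zero tendsto_mult_left_zero LIMSEQ_realpow_zero) auto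
    then have "\<bar>(\<integral>\<omega>. f \<omega> \<partial>\<nu>) - limit_fun \<phi> f\<bar> \<le> 0" by (rule LIMSEQ_le_const) (use b in auto)
    then show ?thesis by simp
  qed
  then show ?R using \<nu> by blast
qed

text \<open>For a continuous function both integrals are approximated by one and the same value of a
  normalised iterate.\<close>

lemma is_conformal_unique:
  assumes "is_conformal \<rho> (\<lambda>_ _. 1) \<phi> \<nu>" "is_conformal \<rho> (\<lambda>_ _. 1) \<phi> \<nu>'"
  shows "\<nu> = \<nu>'"
proof -
  have 1: "prob_space \<nu>" "sets \<nu> = sets borel" "\<And>f a. lip a f \<Longrightarrow> (\<integral>\<omega>. f \<omega> \<partial>\<nu>) = limit_fun \<phi> f"
    using assms(1) by (auto simp: is_conformal_iff)
  have 2: "prob_space \<nu>'" "sets \<nu>' = sets borel" "\<And>f a. lip a f \<Longrightarrow> (\<integral>\<omega>. f \<omega> \<partial>\<nu>') = limit_fun \<phi> f"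
    using assms(2) by (auto simp: is_conformal_iff)
  show ?thesis
  proof (rule finite_measure_eqI_continuous)
    fix f :: "(nat \<Rightarrow> 'a) \<Rightarrow> real" assume f: "continuous_on UNIV f"
    have "\<bar>(\<integral>\<omega>. f \<omega> \<partial>\<nu>) - (\<integral>\<omega>. f \<omega> \<partial>\<nu>')\<bar> \<le> 0 + e" if e: "e > 0" for e
    proof -
      have "e / 8 > 0" using e by simp
      then obtain g a where g: "lip a g" "\<And>x. \<bar>f x - g x\<bar> < e / 8" using lip_dense[OF f] by blast
      obtain c where c: "c \<ge> 0" "trunc_lip (metric_scale l) c g" using lip_trunc_lip[OF l \<phi> g(1)] .
      obtain k where k: "contr_rate l ^ k * c < e / 8" using contr_rate_eventually[OF l \<phi>, of "e / 8" c] e by auto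
      have "\<bar>norm_iter (k * block_len l) \<phi> f undefined - (\<integral>\<omega>. f \<omega> \<partial>\<nu>)\<bar> \<le> 2 * (e / 8) + 2 * (contr_rate l ^ k * c)"
        by (rule norm_iter_approx[OF 1 f g(1) less_imp_le[OF g(2)] c order_refl])
      moreover have "\<bar>norm_iter (k * block_len l) \<phi> f undefined - (\<integral>\<omega>. f \<omega> \<partial>\<nu>')\<bar> \<le> 2 * (e / 8) + 2 * (contr_rate l ^ k * c)"
        by (rule norm_iter_approx[OF 2 f g(1) less_imp_le[OF g(2)] c order_refl])
      ultimately show ?thesis using k by linarith
    qed
    then have "\<bar>(\<integral>\<omega>. f \<omega> \<partial>\<nu>) - (\<integral>\<omega>. f \<omega> \<partial>\<nu>')\<bar> \<le> 0" by (rule field_le_epsilon)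
    then show "(\<integral>\<omega>. f \<omega> \<partial>\<nu>) = (\<integral>\<omega>. f \<omega> \<partial>\<nu>')" by simp
  qed (use 1 2 prob_space.finite_measure in auto)
qed

lemma is_conformal_conformal_measure:
  "is_conformal \<rho> (\<lambda>_ _. 1) \<phi> (conformal_measure \<rho> (\<lambda>_ _. 1) \<phi>)"
proof -
  obtain \<nu> where \<nu>: "prob_space \<nu>" "sets \<nu> = sets borel" "\<And>f a. lip a f \<Longrightarrow> (\<integral>\<omega>. f \<omega> \<partial>\<nu>) = limit_fun \<phi> f"
    using exists_limit_measure[OF l \<phi>] by blast
  then have c\<nu>: "is_conformal \<rho> (\<lambda>_ _. 1) \<phi> \<nu>" unfolding is_conformal_iff by blast
  then show ?thesis unfolding conformal_measure_def
    by (rule theI) (rule is_conformal_unique[OF _ c\<nu>])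
qed

lemma conformal_measure:
  shows "prob_space (conformal_measure \<rho> (\<lambda>_ _. 1) \<phi>)"
    and "sets (conformal_measure \<rho> (\<lambda>_ _. 1) \<phi>) = sets borel"
    and "lip a f \<Longrightarrow> (\<integral>\<omega>. f \<omega> \<partial>conformal_measure \<rho> (\<lambda>_ _. 1) \<phi>) = limit_fun \<phi> f"
  using is_conformal_conformal_measure unfolding is_conformal_iff by blast+

end

end

section \<open>Tilted masses and their uniform asymptotics\<close>

lemma summable_power_div:
  assumes "0 < \<theta>" "\<theta> < (1::real)" "m \<ge> (1::nat)"
  shows "summable (\<lambda>n. \<theta> ^ (n div m))"
proof -
  \<comment> \<open>The rate per letter, with \<open>m\<close>-th power \<theta>; the quotient by
    \<theta> below absorbs an incomplete block.\<close>
  define \<eta> where "\<eta> = \<theta> powr (1 / real m)"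
  have m: "real m > 0" using assms by simp
  have \<eta>: "0 < \<eta>" "\<eta> < 1" using assms m powr_less_mono2[of "1 / real m" \<theta> 1] by (auto simp: \<eta>_def)
  have "\<theta> ^ (n div m) \<le> \<eta> ^ n / \<theta>" for n
  proof -
    have "real n = real (n div m) * real m + real (n mod m)" by (metis div_mult_mod_eq of_nat_add of_nat_mult)
    moreover have "real (n mod m) \<le> real m" using assms(3) by (simp add: less_imp_le)
    ultimately have "real n / real m \<le> real (n div m) + 1" using m by (simp add: field_simps)
    then have "\<theta> powr (real (n div m) + 1) \<le> \<theta> powr (real n / real m)"
      using assms by (intro powr_mono') auto
    then have "\<theta> ^ (n div m) * \<theta> \<le> \<theta> powr (real n / real m)" using assms by (simp add: powr_add powr_realpow)
    also have "\<theta> powr (real n / real m) = \<eta> ^ n"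
      unfolding \<eta>_def using assms by (simp add: powr_powr powr_realpow[symmetric])
    finally show ?thesis using assms by (simp add: field_simps)
  qed
  then have b: "norm (\<theta> ^ (n div m)) \<le> \<eta> ^ n / \<theta>" for n using assms(1) by simp
  have "norm \<eta> < 1" using \<eta> by simp
  then have "summable (\<lambda>n. \<eta> ^ n / \<theta>)" by (intro summable_divide summable_geometric)
  then show ?thesis by (rule summable_comparison_test'[where N = 0]) (rule b)
qed

locale shift_potentials = full_shift \<rho> for \<rho> :: "'a::polish_space measure" +
  fixes \<psi> :: "'q::finite \<Rightarrow> (nat \<Rightarrow> 'a) \<Rightarrow> real" and L M :: real
  assumes L: "0 \<le> L" "\<And>i. lip L (\<psi> i)" and M: "\<And>i x. \<bar>\<psi> i x\<bar> \<le> M"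
begin

definition pot_lip :: "real" where "pot_lip = real CARD('q) * L"
definition pot_bound :: "real" where "pot_bound = real CARD('q) * M"

lemma M_nonneg: "0 \<le> M" using order_trans[OF abs_ge_zero M] .

lemma pot_lip_nonneg: "0 \<le> pot_lip" and pot_bound_nonneg: "0 \<le> pot_bound" using L M_nonneg by (auto simp: pot_lip_def pot_bound_def)

lemma lip_pot: "lip (norm s * pot_lip) (lin_comb s \<psi>)"
  unfolding lip_def
proof (intro allI)
  fix x y
  have "\<bar>lin_comb s \<psi> x - lin_comb s \<psi> y\<bar> \<le> (\<Sum>i\<in>UNIV. \<bar>s $ i * (\<psi> i x - \<psi> i y)\<bar>)"
    unfolding lin_comb_def by (simp add: sum_subtractf[symmetric] right_diff_distrib[symmetric] sum_abs)
  also have "\<dots> \<le> (\<Sum>i\<in>(UNIV::'q set). norm s * (L * dOmega x y))"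
    using L(2) component_le_norm_cart[of s] by (intro sum_mono) (auto simp: abs_mult lip_def intro!: mult_mono)
  finally show "norm (lin_comb s \<psi> x - lin_comb s \<psi> y) \<le> norm s * pot_lip * dOmega x y"
    by (simp add: pot_lip_def mult_ac)
qed

lemma bound_pot: "\<bar>lin_comb s \<psi> x\<bar> \<le> norm s * pot_bound"
proof -
  have "\<bar>lin_comb s \<psi> x\<bar> \<le> (\<Sum>i\<in>UNIV. \<bar>s $ i * \<psi> i x\<bar>)"
    unfolding lin_comb_def by (rule sum_abs)
  also have "\<dots> \<le> (\<Sum>i\<in>(UNIV::'q set). norm s * M)"
    using M component_le_norm_cart[of s] by (intro sum_mono) (auto simp: abs_mult intro!: mult_mono)
  finally show ?thesis by (simp add: pot_bound_def mult_ac)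
qed

lemma lip_pot_le: "norm s \<le> R \<Longrightarrow> lip (R * pot_lip) (lin_comb s \<psi>)"
  by (rule lip_mono[OF lip_pot]) (intro mult_right_mono pot_lip_nonneg)

lemma cont_pot: "continuous_on UNIV (lin_comb s \<psi>)"
  by (rule lip_imp_continuous[OF lip_pot])

lemma birkhoff_pot: "birkhoff_sum n (lin_comb s \<psi>) x = s \<bullet> (\<chi> i. birkhoff_sum n (\<psi> i) x)"
  unfolding lin_comb_def birkhoff_sum_linear inner_vec_def by simp

text \<open>The quantity over which the Gaussian of the Hubbard-Stratonovich transformation is
  integrated, at the parameter \<open>\<beta> *\<^sub>R t\<close>.\<close>

definition tilted_mass :: "nat \<Rightarrow> ((nat \<Rightarrow> 'a) \<Rightarrow> real) \<Rightarrow> real ^ 'q \<Rightarrow> real" where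
  "tilted_mass n f s = (\<integral>\<omega>. exp (birkhoff_sum n (lin_comb s \<psi>) \<omega>) * f \<omega> \<partial>Pr)"

lemma tilted_mass_iter_transfer: "continuous_on UNIV f \<Longrightarrow> tilted_mass n f s = (\<integral>\<omega>. iter_transfer n (lin_comb s \<psi>) f \<omega> \<partial>Pr)"
  unfolding tilted_mass_def using integral_iter_transfer[OF cont_pot, of f n s] by simp

lemma tilted_mass_continuous:
  assumes f: "continuous_on UNIV f"
  shows "continuous_on UNIV (tilted_mass n f)"
proof (clarsimp simp: continuous_on_sequentially)
  fix X :: "nat \<Rightarrow> real ^ 'q" and s assume X: "X \<longlonglongrightarrow> s"
  obtain B where B: "B > 0" "\<And>x. norm (f x) \<le> B" using bounded_continuous[OF f] by metis
  have "Bseq X" using X convergentI convergent_imp_Bseq by blast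
  then obtain R where R: "\<And>k. norm (X k) \<le> R" by (auto simp: Bseq_def)
  have mw: "(\<lambda>\<omega>. exp (birkhoff_sum n (lin_comb s \<psi>) \<omega>) * f \<omega>) \<in> borel_measurable Pr" for s
    using borel_measurable_cont[OF continuous_on_weight[OF cont_pot f, of n s]] by (simp cong: measurable_cong_sets)
  have "(\<lambda>k. tilted_mass n f (X k)) \<longlonglongrightarrow> tilted_mass n f s"
    unfolding tilted_mass_def
  proof (rule integral_dominated_convergence[where w = "\<lambda>_. exp (real n * (R * pot_bound)) * B"])
    have "(\<lambda>k. exp (birkhoff_sum n (lin_comb (X k) \<psi>) \<omega>) * f \<omega>) \<longlonglongrightarrow> exp (birkhoff_sum n (lin_comb s \<psi>) \<omega>) * f \<omega>" for \<omega>
      unfolding birkhoff_pot by (intro tendsto_intros X)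
    then show "AE \<omega> in Pr. (\<lambda>k. exp (birkhoff_sum n (lin_comb (X k) \<psi>) \<omega>) * f \<omega>) \<longlonglongrightarrow> exp (birkhoff_sum n (lin_comb s \<psi>) \<omega>) * f \<omega>"
      by simp
    have "norm (exp (birkhoff_sum n (lin_comb (X k) \<psi>) \<omega>) * f \<omega>) \<le> exp (real n * (R * pot_bound)) * B" for k \<omega>
    proof -
      have "\<bar>birkhoff_sum n (lin_comb (X k) \<psi>) \<omega>\<bar> \<le> real n * (norm (X k) * pot_bound)"
        by (rule birkhoff_sum_bound[OF bound_pot])
      also have "\<dots> \<le> real n * (R * pot_bound)" by (intro mult_left_mono mult_right_mono R pot_bound_nonneg) simp
      finally show ?thesis unfolding norm_mult using B by (intro mult_mono) auto
    qed
    then show "AE \<omega> in Pr. norm (exp (birkhoff_sum n (lin_comb (X k) \<psi>) \<omega>) * f \<omega>) \<le> exp (real n * (R * pot_bound)) * B" for k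
      by simp
  qed (use mw in auto)
  then show "(tilted_mass n f \<circ> X) \<longlonglongrightarrow> tilted_mass n f s" by (simp add: o_def)
qed

abbreviation growth_at :: "real ^ 'q \<Rightarrow> real" where "growth_at s \<equiv> growth (lin_comb s \<psi>)"

lemma norm_pot_lip_nonneg: "0 \<le> norm s * pot_lip" using pot_lip_nonneg by simp

lemma growth_at_pos: "0 < growth_at s" by (rule growth_pos[OF norm_pot_lip_nonneg lip_pot])

lemma tilted_mass_1: "tilted_mass n (\<lambda>_. 1) s = (\<integral>\<omega>. iter_one n (lin_comb s \<psi>) \<omega> \<partial>Pr)"
  unfolding iter_one_def by (rule tilted_mass_iter_transfer) simp

lemma iter_one_integrable: "integrable Pr (iter_one n (lin_comb s \<psi>))"
  by (rule integrable_cont(1)[OF cont_iter_one[OF norm_pot_lip_nonneg lip_pot]])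

lemma tilted_mass_1_bounds:
  "tilted_mass n (\<lambda>_. 1) s \<le> exp (norm s * pot_lip * diam) * growth_at s ^ n"
  "growth_at s ^ n \<le> exp (norm s * pot_lip * diam) * tilted_mass n (\<lambda>_. 1) s"
proof -
  have "tilted_mass n (\<lambda>_. 1) s \<le> (\<integral>\<omega>. exp (norm s * pot_lip * diam) * growth_at s ^ n \<partial>Pr)"
    unfolding tilted_mass_1 by (intro integral_mono iter_one_integrable iter_one_growth_bounds(1)[OF norm_pot_lip_nonneg lip_pot]) simp
  then show "tilted_mass n (\<lambda>_. 1) s \<le> exp (norm s * pot_lip * diam) * growth_at s ^ n" by (simp add: Pr.prob_space[simplified])
  have "(\<integral>\<omega>. growth_at s ^ n \<partial>Pr) \<le> (\<integral>\<omega>. exp (norm s * pot_lip * diam) * iter_one n (lin_comb s \<psi>) \<omega> \<partial>Pr)"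
    by (intro integral_mono iter_one_growth_bounds(2)[OF norm_pot_lip_nonneg lip_pot]) (auto intro: iter_one_integrable)
  then show "growth_at s ^ n \<le> exp (norm s * pot_lip * diam) * tilted_mass n (\<lambda>_. 1) s" by (simp add: tilted_mass_1 Pr.prob_space[simplified])
qed

lemma tilted_mass_1_pos: "0 < tilted_mass n (\<lambda>_. 1) s"
proof -
  have "0 < exp (norm s * pot_lip * diam) * tilted_mass n (\<lambda>_. 1) s"
    using less_le_trans[OF zero_less_power[OF growth_at_pos] tilted_mass_1_bounds(2)] .
  then show ?thesis by (simp add: zero_less_mult_iff)
qed

lemma growth_at_bounds: "growth_at s \<le> exp (norm s * pot_bound)" "exp (- (norm s * pot_bound)) \<le> growth_at s"
proof -
  obtain a where a: "lip a (iter_transfer 1 (lin_comb s \<psi>) (\<lambda>_. 1 :: real))" using lip_h1[OF norm_pot_lip_nonneg lip_pot] .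
  have b: "exp (- (norm s * pot_bound)) \<le> iter_transfer 1 (lin_comb s \<psi>) (\<lambda>_. 1) x" "iter_transfer 1 (lin_comb s \<psi>) (\<lambda>_. 1) x \<le> exp (norm s * pot_bound)" for x
    using iter_one_bounds[OF norm_pot_lip_nonneg[of s] lip_pot[of s] bound_pot[of s], of 1 x] by (simp_all add: iter_one_def)
  show "growth_at s \<le> exp (norm s * pot_bound)" "exp (- (norm s * pot_bound)) \<le> growth_at s"
    unfolding growth_def by (rule limit_fun_bounds[OF norm_pot_lip_nonneg lip_pot a], rule b)+
qed

text \<open>One constant serves all parameters in a ball, for the metric scale belonging to the
  largest Lipschitz constant there. The uniform convergence in \<open>s\<close> rests on
  this.\<close>

lemma h1_trunc_lip:
  obtains c where "c \<ge> 0" "\<And>s. norm s \<le> R \<Longrightarrow> trunc_lip (metric_scale (R * pot_lip)) c (iter_transfer 1 (lin_comb s \<psi>) (\<lambda>_. 1 :: real))"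
proof (cases "R \<ge> 0")
  case True
  let ?l = "R * pot_lip" and ?m = "R * pot_bound"
  have l: "?l \<ge> 0" using True pot_lip_nonneg by simp
  define a where "a = exp (real 1 * ?m) * (?l * 1 + 0)"
  have a: "a \<ge> 0" using l by (simp add: a_def)
  have "trunc_lip (metric_scale ?l) (max (2 * exp (real 1 * ?m)) a) (iter_transfer 1 (lin_comb s \<psi>) (\<lambda>_. 1 :: real))" if s: "norm s \<le> R" for s
  proof (rule lip_imp_trunc_lip)
    have b: "\<bar>lin_comb s \<psi> x\<bar> \<le> ?m" for x
      by (rule order_trans[OF bound_pot mult_right_mono[OF s pot_bound_nonneg]])
    show "lip a (iter_transfer 1 (lin_comb s \<psi>) (\<lambda>_. 1 :: real))"
      unfolding a_def by (rule iter_transfer_lip[OF l lip_pot_le[OF s] b]) auto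
    show "norm (iter_transfer 1 (lin_comb s \<psi>) (\<lambda>_. 1 :: real) x) \<le> exp (real 1 * ?m)" for x
      using iter_one_bounds(2)[OF l lip_pot_le[OF s] b, of 1 x] iter_one_pos[OF l lip_pot_le[OF s], of 1 x] by (simp add: iter_one_def)
  qed (use a metric_scale_ge_1[OF l] in auto)
  then show ?thesis using that[of "max (2 * exp (real 1 * ?m)) a"] by (auto simp: le_max_iff_disj)
next
  case False
  then have "\<not> norm s \<le> R" for s :: "real ^ 'q" using norm_ge_zero[of s] by linarith
  then show ?thesis using that[of 0] by blast
qed

text \<open>The difference is the integral of \<open>iter_one n\<close> times the deviation of a
  normalised iterate from its limit, which is exponentially small uniformly on the ball.\<close>

lemma tilted_mass_ratio:
  assumes "R \<ge> 0"
  obtains c where "c \<ge> 0" "\<And>s n. norm s \<le> R \<Longrightarrow>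
    \<bar>tilted_mass (Suc n) (\<lambda>_. 1) s - growth_at s * tilted_mass n (\<lambda>_. 1) s\<bar> \<le> c * contr_rate (R * pot_lip) ^ (n div block_len (R * pot_lip)) * tilted_mass n (\<lambda>_. 1) s"
proof -
  let ?l = "R * pot_lip" and ?\<theta> = "contr_rate (R * pot_lip)" and ?m = "block_len (R * pot_lip)"
  have l: "?l \<ge> 0" using assms pot_lip_nonneg by simp
  obtain c where c: "c \<ge> 0" "\<And>s. norm s \<le> R \<Longrightarrow> trunc_lip (metric_scale (R * pot_lip)) c (iter_transfer 1 (lin_comb s \<psi>) (\<lambda>_. 1 :: real))"
    using h1_trunc_lip[of R] by blast
  have "\<bar>tilted_mass (Suc n) (\<lambda>_. 1) s - growth_at s * tilted_mass n (\<lambda>_. 1) s\<bar> \<le> 2 * c * ?\<theta> ^ (n div ?m) * tilted_mass n (\<lambda>_. 1) s"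
    if s: "norm s \<le> R" for s n
  proof -
    let ?h = "iter_one n (lin_comb s \<psi>)" and ?u = "norm_iter n (lin_comb s \<psi>) (iter_transfer 1 (lin_comb s \<psi>) (\<lambda>_. 1 :: real))"
    have cL: "continuous_on UNIV (iter_transfer 1 (lin_comb s \<psi>) (\<lambda>_. 1 :: real))" by (rule continuous_on_iter_transfer[OF cont_pot]) simp
    have u: "\<bar>?u x - growth_at s\<bar> \<le> 2 * (?\<theta> ^ (n div ?m) * c)" for x
      unfolding growth_def by (rule norm_iter_LIMSEQ_trunc_lip(2)[OF l lip_pot_le[OF s] cL c(2)[OF s] c(1)]) simp
    have h: "?h x > 0" for x by (rule iter_one_pos[OF norm_pot_lip_nonneg lip_pot])
    have eq: "iter_one (Suc n) (lin_comb s \<psi>) x - growth_at s * ?h x = (?u x - growth_at s) * ?h x" for x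
      unfolding iter_one_Suc_ratio[OF norm_pot_lip_nonneg lip_pot] by (simp add: left_diff_distrib)
    have "tilted_mass (Suc n) (\<lambda>_. 1) s - growth_at s * tilted_mass n (\<lambda>_. 1) s = (\<integral>x. iter_one (Suc n) (lin_comb s \<psi>) x - growth_at s * ?h x \<partial>Pr)"
      unfolding tilted_mass_1 using iter_one_integrable[of "Suc n" s] iter_one_integrable[of n s] by simp
    then have "\<bar>tilted_mass (Suc n) (\<lambda>_. 1) s - growth_at s * tilted_mass n (\<lambda>_. 1) s\<bar> \<le> (\<integral>x. \<bar>iter_one (Suc n) (lin_comb s \<psi>) x - growth_at s * ?h x\<bar> \<partial>Pr)"
      using integral_abs_bound by simp
    also have "\<dots> \<le> (\<integral>x. 2 * (?\<theta> ^ (n div ?m) * c) * ?h x \<partial>Pr)"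
    proof (rule integral_mono)
      show "integrable Pr (\<lambda>x. \<bar>iter_one (Suc n) (lin_comb s \<psi>) x - growth_at s * ?h x\<bar>)"
        using iter_one_integrable[of "Suc n" s] iter_one_integrable[of n s] by simp
      show "integrable Pr (\<lambda>x. 2 * (?\<theta> ^ (n div ?m) * c) * ?h x)" using iter_one_integrable[of n s] by simp
      show "\<bar>iter_one (Suc n) (lin_comb s \<psi>) x - growth_at s * ?h x\<bar> \<le> 2 * (?\<theta> ^ (n div ?m) * c) * ?h x" for x
        unfolding eq abs_mult abs_of_pos[OF h] using h[of x] by (intro mult_right_mono u) simp
    qed
    finally show ?thesis by (simp add: tilted_mass_1 mult_ac)
  qed
  then show ?thesis using that[of "2 * c"] c(1) by simp
qed

definition norm_mass :: "nat \<Rightarrow> ((nat \<Rightarrow> 'a) \<Rightarrow> real) \<Rightarrow> real ^ 'q \<Rightarrow> real" where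
  "norm_mass n f s = tilted_mass n f s / growth_at s ^ n"

lemma norm_mass_1_bounds: "norm_mass n (\<lambda>_. 1) s \<le> exp (norm s * pot_lip * diam)" "exp (- (norm s * pot_lip * diam)) \<le> norm_mass n (\<lambda>_. 1) s"
  using tilted_mass_1_bounds(1)[of n s] tilted_mass_1_bounds(2)[of s n] growth_at_pos[of s] by (simp_all add: norm_mass_def exp_minus field_simps)

text \<open>The growth in \<open>s\<close> is only exponential in the norm; this supplies the
  majorant outside compact sets in Laplace's method.\<close>

lemma norm_mass_bound:
  assumes f: "continuous_on UNIV f" "\<And>x. \<bar>f x\<bar> \<le> B"
  shows "\<bar>norm_mass n f s\<bar> \<le> B * exp (norm s * pot_lip * diam)"
proof -
  have w: "integrable Pr (\<lambda>\<omega>. exp (birkhoff_sum n (lin_comb s \<psi>) \<omega>) * g \<omega>)" if "continuous_on UNIV g" for g :: "_ \<Rightarrow> real"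
    using integrable_cont(1)[OF continuous_on_weight[OF cont_pot that]] by simp
  have B: "0 \<le> B" using order_trans[OF abs_ge_zero f(2)] .
  have "\<bar>tilted_mass n f s\<bar> \<le> (\<integral>\<omega>. exp (birkhoff_sum n (lin_comb s \<psi>) \<omega>) * B \<partial>Pr)"
    unfolding tilted_mass_def
    by (rule order_trans[OF integral_abs_bound integral_mono])
       (use integrable_abs[OF w[OF f(1)]] w[of "\<lambda>_. 1"] f(2) in \<open>auto simp: abs_mult\<close>)
  also have "\<dots> = B * tilted_mass n (\<lambda>_. 1) s" by (simp add: tilted_mass_def)
  also have "\<dots> \<le> B * (exp (norm s * pot_lip * diam) * growth_at s ^ n)" by (intro mult_left_mono tilted_mass_1_bounds B)
  finally show ?thesis using growth_at_pos[of s] by (simp add: norm_mass_def abs_divide field_simps)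
qed

text \<open>The ratios of consecutive tilted masses are continuous and converge to
  \<open>growth_at\<close> uniformly on balls.\<close>

lemma growth_at_continuous: "continuous_on UNIV growth_at"
proof -
  have "continuous_on (cball 0 R) growth_at" if R: "R \<ge> 0" for R
  proof -
    let ?l = "R * pot_lip"
    have l: "?l \<ge> 0" using R pot_lip_nonneg by simp
    obtain c where c: "c \<ge> 0" "\<And>s n. norm s \<le> R \<Longrightarrow>
      \<bar>tilted_mass (Suc n) (\<lambda>_. 1) s - growth_at s * tilted_mass n (\<lambda>_. 1) s\<bar> \<le> c * contr_rate ?l ^ (n div block_len ?l) * tilted_mass n (\<lambda>_. 1) s"
      using tilted_mass_ratio[OF R] by metis
    show ?thesis
    proof (rule uniform_limit_theorem)
      show "\<forall>\<^sub>F n in sequentially. continuous_on (cball 0 R) (\<lambda>s. tilted_mass (Suc n) (\<lambda>_. 1) s / tilted_mass n (\<lambda>_. 1) s)"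
        using tilted_mass_1_pos
        by (intro always_eventually allI continuous_on_divide continuous_on_subset[OF tilted_mass_continuous])
           (auto simp: less_imp_neq[symmetric])
      have lim: "(\<lambda>n. c * contr_rate ?l ^ (n div block_len ?l)) \<longlonglongrightarrow> 0"
        using summable_power_div[of "contr_rate ?l" "block_len ?l"] contr_rate[of ?l] block_len(1)[of ?l]
        by (intro tendsto_mult_right_zero summable_LIMSEQ_zero) auto
      show "uniform_limit (cball 0 R) (\<lambda>n s. tilted_mass (Suc n) (\<lambda>_. 1) s / tilted_mass n (\<lambda>_. 1) s) growth_at sequentially"
      proof (rule uniform_limitI)
        fix e :: real assume "e > 0"
        then have "\<forall>\<^sub>F n in sequentially. c * contr_rate ?l ^ (n div block_len ?l) < e" using order_tendstoD(2)[OF lim] by simp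
        then show "\<forall>\<^sub>F n in sequentially. \<forall>s\<in>cball 0 R. dist (tilted_mass (Suc n) (\<lambda>_. 1) s / tilted_mass n (\<lambda>_. 1) s) (growth_at s) < e"
        proof eventually_elim
          case (elim n)
          show ?case
          proof
            fix s :: "real ^ 'q" assume "s \<in> cball 0 R"
            then have s: "norm s \<le> R" by simp
            have z: "tilted_mass n (\<lambda>_. 1) s > 0" by (rule tilted_mass_1_pos)
            have "dist (tilted_mass (Suc n) (\<lambda>_. 1) s / tilted_mass n (\<lambda>_. 1) s) (growth_at s) =
              \<bar>tilted_mass (Suc n) (\<lambda>_. 1) s - growth_at s * tilted_mass n (\<lambda>_. 1) s\<bar> / tilted_mass n (\<lambda>_. 1) s"
              using z by (simp add: dist_real_def field_simps abs_divide flip: abs_mult_pos)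
            also have "\<dots> \<le> c * contr_rate ?l ^ (n div block_len ?l)" using c(2)[OF s, of n] z by (simp add: divide_le_eq)
            finally show "dist (tilted_mass (Suc n) (\<lambda>_. 1) s / tilted_mass n (\<lambda>_. 1) s) (growth_at s) < e" using elim by simp
          qed
        qed
      qed
    qed simp
  qed
  then have "continuous_on (ball 0 R) growth_at" if "R \<ge> 0" for R using that continuous_on_subset[OF _ ball_subset_cball] by blast
  then have "isCont growth_at s" for s
  proof -
    have "s \<in> ball 0 (norm s + 1)" by simp
    moreover have "continuous_on (ball 0 (norm s + 1)) growth_at" by (rule \<open>\<And>R. 0 \<le> R \<Longrightarrow> continuous_on (ball 0 R) growth_at\<close>) simp
    ultimately show ?thesis by (simp add: continuous_on_eq_continuous_at)
  qed
  then show ?thesis by (simp add: continuous_on_eq_continuous_at)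
qed

lemma norm_mass_continuous: "continuous_on UNIV f \<Longrightarrow> continuous_on UNIV (norm_mass n f)"
  unfolding norm_mass_def using growth_at_pos
  by (intro continuous_on_divide tilted_mass_continuous continuous_on_power growth_at_continuous) (auto simp: less_imp_neq[symmetric])

abbreviation nu :: "real ^ 'q \<Rightarrow> (nat \<Rightarrow> 'a) measure" where
  "nu s \<equiv> conformal_measure \<rho> (\<lambda>_ _. 1) (lin_comb s \<psi>)"

text \<open>In spectral terms this is the integral, with respect to the product measure, of the
  eigenfunction normalised against the conformal measure. It becomes a factor of the limiting
  coefficients.\<close>

definition mass_limit :: "real ^ 'q \<Rightarrow> real" where "mass_limit s = lim (\<lambda>n. norm_mass n (\<lambda>_. 1) s)"

lemma norm_mass_1_uniform_limit:
  assumes R: "R \<ge> 0"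
  shows "uniform_limit (cball 0 R) (\<lambda>n. norm_mass n (\<lambda>_. 1)) mass_limit sequentially"
proof -
  let ?l = "R * pot_lip"
  have l: "?l \<ge> 0" using R pot_lip_nonneg by simp
  obtain c where c: "c \<ge> 0" "\<And>s n. norm s \<le> R \<Longrightarrow>
    \<bar>tilted_mass (Suc n) (\<lambda>_. 1) s - growth_at s * tilted_mass n (\<lambda>_. 1) s\<bar> \<le> c * contr_rate ?l ^ (n div block_len ?l) * tilted_mass n (\<lambda>_. 1) s"
    using tilted_mass_ratio[OF R] by metis
  \<comment> \<open>The factor \<open>exp (?l * diam)\<close> bounds the normalised mass and
    \<open>exp (R * pot_bound)\<close> the reciprocal of the growth on the ball.\<close>
  define C where "C n = c * exp (?l * diam) * exp (R * pot_bound) * contr_rate ?l ^ (n div block_len ?l)" for n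
  have sC: "summable C"
    unfolding C_def using contr_rate[of ?l] block_len(1)[of ?l] by (intro summable_mult summable_power_div) auto
  have d: "norm (norm_mass (Suc n) (\<lambda>_. 1) s - norm_mass n (\<lambda>_. 1) s) \<le> C n" if "s \<in> cball 0 R" for s n
  proof -
    from that have s: "norm s \<le> R" by simp
    have r: "growth_at s > 0" by (rule growth_at_pos)
    have "norm_mass (Suc n) (\<lambda>_. 1) s - norm_mass n (\<lambda>_. 1) s = (tilted_mass (Suc n) (\<lambda>_. 1) s - growth_at s * tilted_mass n (\<lambda>_. 1) s) / growth_at s ^ Suc n"
      using r by (simp add: norm_mass_def field_simps)
    then have "norm (norm_mass (Suc n) (\<lambda>_. 1) s - norm_mass n (\<lambda>_. 1) s) = \<bar>tilted_mass (Suc n) (\<lambda>_. 1) s - growth_at s * tilted_mass n (\<lambda>_. 1) s\<bar> / growth_at s ^ Suc n"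
      using r by (simp add: abs_divide)
    also have "\<dots> \<le> c * contr_rate ?l ^ (n div block_len ?l) * tilted_mass n (\<lambda>_. 1) s / growth_at s ^ Suc n"
      using r by (intro divide_right_mono c s) simp
    also have "\<dots> = c * contr_rate ?l ^ (n div block_len ?l) * (norm_mass n (\<lambda>_. 1) s * (1 / growth_at s))"
      using r by (simp add: norm_mass_def field_simps)
    also have "\<dots> \<le> c * contr_rate ?l ^ (n div block_len ?l) * (exp (?l * diam) * exp (R * pot_bound))"
    proof (intro mult_left_mono mult_mono)
      have e: "norm s * pot_lip * diam \<le> ?l * diam" using s pot_lip_nonneg diam_ge_1 by (intro mult_right_mono) auto
      show "norm_mass n (\<lambda>_. 1) s \<le> exp (?l * diam)" using norm_mass_1_bounds(1)[of n s] e by (meson exp_le_cancel_iff order_trans)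
      have "norm s * pot_bound \<le> R * pot_bound" using s pot_bound_nonneg by (intro mult_right_mono) auto
      then have "exp (- (R * pot_bound)) \<le> growth_at s" using growth_at_bounds(2)[of s] by (meson exp_le_cancel_iff neg_le_iff_le order_trans)
      then show "1 / growth_at s \<le> exp (R * pot_bound)" using r by (simp add: exp_minus field_simps)
    qed (use c contr_rate[of ?l] r in \<open>auto intro!: mult_nonneg_nonneg\<close>)
    finally show ?thesis by (simp add: C_def mult_ac)
  qed
  have "uniform_limit (cball 0 R) (\<lambda>n s. \<Sum>k<n. norm_mass (Suc k) (\<lambda>_. 1) s - norm_mass k (\<lambda>_. 1) s)
      (\<lambda>s. \<Sum>k. norm_mass (Suc k) (\<lambda>_. 1) s - norm_mass k (\<lambda>_. 1) s) sequentially"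
    by (rule Weierstrass_m_test[OF d sC])
  moreover have "(\<Sum>k<n. norm_mass (Suc k) (\<lambda>_. 1) s - norm_mass k (\<lambda>_. 1) s) = norm_mass n (\<lambda>_. 1) s - 1" for n s
  proof -
    have "norm_mass 0 (\<lambda>_. 1) s = 1" by (simp add: norm_mass_def tilted_mass_def Pr.prob_space[simplified])
    then show ?thesis using sum_lessThan_telescope[of "\<lambda>k. norm_mass k (\<lambda>_. 1) s" n] by simp
  qed
  ultimately have "uniform_limit (cball 0 R) (\<lambda>n s. norm_mass n (\<lambda>_. 1) s - 1)
      (\<lambda>s. \<Sum>k. norm_mass (Suc k) (\<lambda>_. 1) s - norm_mass k (\<lambda>_. 1) s) sequentially" by simp
  from uniform_limit_add[OF this uniform_limit_const[where c = "\<lambda>_. 1"]]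
  have ul: "uniform_limit (cball 0 R) (\<lambda>n s. norm_mass n (\<lambda>_. 1) s) (\<lambda>s. (\<Sum>k. norm_mass (Suc k) (\<lambda>_. 1) s - norm_mass k (\<lambda>_. 1) s) + 1) sequentially"
    by simp
  have mass_limit: "mass_limit s = (\<Sum>k. norm_mass (Suc k) (\<lambda>_. 1) s - norm_mass k (\<lambda>_. 1) s) + 1" if "s \<in> cball 0 R" for s
    unfolding mass_limit_def by (rule limI) (rule tendsto_uniform_limitI[OF ul that])
  have "uniform_limit (cball 0 R) (\<lambda>n. norm_mass n (\<lambda>_. 1)) mass_limit sequentially \<longleftrightarrow>
    uniform_limit (cball 0 R) (\<lambda>n s. norm_mass n (\<lambda>_. 1) s) (\<lambda>s. (\<Sum>k. norm_mass (Suc k) (\<lambda>_. 1) s - norm_mass k (\<lambda>_. 1) s) + 1) sequentially"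
    by (rule uniform_limit_cong') (use mass_limit in auto)
  with ul show ?thesis by simp
qed

text \<open>The mass of \<open>f\<close> is split into the mass of 1 times the conformal integral of
  \<open>f\<close>, and an error that averages the deviation of the normalised iterate of
  \<open>f\<close> from that integral. Both parts are uniform on balls.\<close>

lemma norm_mass_uniform_limit:
  assumes R: "R \<ge> 0" and f: "continuous_on UNIV f"
  shows "uniform_limit (cball 0 R) (\<lambda>n. norm_mass n f) (\<lambda>s. mass_limit s * (\<integral>\<omega>. f \<omega> \<partial>nu s)) sequentially"
proof -
  let ?l = "R * pot_lip"
  have l: "?l \<ge> 0" using R pot_lip_nonneg by simp
  obtain B where B: "B > 0" "\<And>x. norm (f x) \<le> B" using bounded_continuous[OF f] by metis
  define E where "E = exp (?l * diam)"
  have E: "E > 0" by (simp add: E_def)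
  have V1: "\<bar>norm_mass n (\<lambda>_. 1) s\<bar> \<le> E" if "norm s \<le> R" for s n
  proof -
    have "norm s * pot_lip * diam \<le> ?l * diam" using that pot_lip_nonneg diam_ge_1 by (intro mult_right_mono) auto
    then have "exp (norm s * pot_lip * diam) \<le> E" by (simp add: E_def)
    moreover have "0 \<le> norm_mass n (\<lambda>_. 1) s" by (rule order_trans[OF _ norm_mass_1_bounds(2)]) simp
    ultimately show ?thesis using norm_mass_1_bounds(1)[of n s] by linarith
  qed
  have 1: "uniform_limit (cball 0 R) (\<lambda>n s. norm_mass n (\<lambda>_. 1) s * (\<integral>\<omega>. f \<omega> \<partial>nu s)) (\<lambda>s. mass_limit s * (\<integral>\<omega>. f \<omega> \<partial>nu s)) sequentially"
  proof (rule uniform_limitI)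
    fix e :: real assume e: "e > 0"
    have N: "\<bar>\<integral>\<omega>. f \<omega> \<partial>nu s\<bar> \<le> B" for s
    proof -
      interpret n: prob_space "nu s" by (rule conformal_measure(1)[OF norm_pot_lip_nonneg lip_pot])
      have "\<bar>\<integral>\<omega>. f \<omega> \<partial>nu s\<bar> \<le> (\<integral>\<omega>. B \<partial>nu s)"
      proof (rule order_trans[OF integral_abs_bound integral_mono])
        have "integrable (nu s) f" by (rule n.integrable_const_bound[where B = B])
          (use B borel_measurable_cont[OF f] in \<open>auto simp: conformal_measure(2)[OF norm_pot_lip_nonneg lip_pot] cong: measurable_cong_sets\<close>)
        then show "integrable (nu s) (\<lambda>\<omega>. \<bar>f \<omega>\<bar>)" by simp
      qed (use B in auto)
      then show ?thesis using n.prob_space by simp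
    qed
    have "\<forall>\<^sub>F n in sequentially. \<forall>s\<in>cball 0 R. dist (norm_mass n (\<lambda>_. 1) s) (mass_limit s) < e / B"
      using norm_mass_1_uniform_limit[OF R] e B by (simp add: uniform_limit_iff)
    then show "\<forall>\<^sub>F n in sequentially. \<forall>s\<in>cball 0 R. dist (norm_mass n (\<lambda>_. 1) s * (\<integral>\<omega>. f \<omega> \<partial>nu s)) (mass_limit s * (\<integral>\<omega>. f \<omega> \<partial>nu s)) < e"
    proof eventually_elim
      case (elim n)
      show ?case
      proof
        fix s :: "real ^ 'q" assume s: "s \<in> cball 0 R"
        have "dist (norm_mass n (\<lambda>_. 1) s * (\<integral>\<omega>. f \<omega> \<partial>nu s)) (mass_limit s * (\<integral>\<omega>. f \<omega> \<partial>nu s)) =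
          dist (norm_mass n (\<lambda>_. 1) s) (mass_limit s) * \<bar>\<integral>\<omega>. f \<omega> \<partial>nu s\<bar>"
          by (simp add: dist_real_def flip: abs_mult left_diff_distrib)
        also have "\<dots> \<le> dist (norm_mass n (\<lambda>_. 1) s) (mass_limit s) * B" by (intro mult_left_mono N) simp
        also have "\<dots> < e" using elim s B by (simp add: less_divide_eq)
        finally show "dist (norm_mass n (\<lambda>_. 1) s * (\<integral>\<omega>. f \<omega> \<partial>nu s)) (mass_limit s * (\<integral>\<omega>. f \<omega> \<partial>nu s)) < e" .
      qed
    qed
  qed
  have 2: "uniform_limit (cball 0 R) (\<lambda>n s. norm_mass n f s - norm_mass n (\<lambda>_. 1) s * (\<integral>\<omega>. f \<omega> \<partial>nu s)) (\<lambda>_. 0) sequentially"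
  proof (rule uniform_limitI)
    fix e :: real assume e: "e > 0"
    \<comment> \<open>The approximation of \<open>f\<close> and the contraction each contribute
      \<open>2 * e'\<close>, and the masses are at most \<open>E\<close>, which makes
      \<open>4 * e' * E = e / 2\<close>.\<close>
    define e' where "e' = e / (8 * E)"
    have e': "e' > 0" using e E by (simp add: e'_def)
    obtain g a where g: "lip a g" "\<And>x. \<bar>f x - g x\<bar> < e'" using lip_dense[OF f e'] by blast
    have cg: "continuous_on UNIV g" by (rule lip_imp_continuous[OF g(1)])
    \<comment> \<open>The constants \<open>c\<close> and \<open>k\<close> involve only the bound
      \<open>?l\<close> and \<open>g\<close>, so the potential for \<open>s = 0\<close> may stand
      for all parameters of the ball.\<close>
    obtain c where c: "c \<ge> 0" "trunc_lip (metric_scale ?l) c g"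
      using lip_trunc_lip[OF l lip_pot_le[of 0], of a g] g(1) R by auto
    obtain k where k: "contr_rate ?l ^ k * c < e'" using contr_rate_eventually[OF l lip_pot_le[of 0] e', of c] R by auto
    show "\<forall>\<^sub>F n in sequentially. \<forall>s\<in>cball 0 R. dist (norm_mass n f s - norm_mass n (\<lambda>_. 1) s * (\<integral>\<omega>. f \<omega> \<partial>nu s)) 0 < e"
      using eventually_ge_at_top[of "k * block_len ?l"]
    proof eventually_elim
      case (elim n)
      show ?case
      proof
        fix s :: "real ^ 'q" assume "s \<in> cball 0 R"
        then have s: "norm s \<le> R" by simp
        let ?h = "iter_one n (lin_comb s \<psi>)" and ?I = "\<integral>\<omega>. f \<omega> \<partial>nu s"
        have h: "?h x > 0" for x by (rule iter_one_pos[OF norm_pot_lip_nonneg lip_pot])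
        have u: "\<bar>norm_iter n (lin_comb s \<psi>) f x - ?I\<bar> \<le> 4 * e'" for x
        proof -
          have "\<bar>norm_iter n (lin_comb s \<psi>) f x - ?I\<bar> \<le> 2 * e' + 2 * (contr_rate ?l ^ k * c)"
            by (rule norm_iter_approx[OF l lip_pot_le[OF s] conformal_measure(1,2)[OF norm_pot_lip_nonneg lip_pot] _ f g(1) less_imp_le[OF g(2)] c elim])
               (rule conformal_measure(3)[OF norm_pot_lip_nonneg lip_pot])
          then show ?thesis using k by simp
        qed
        have iL: "integrable Pr (iter_transfer n (lin_comb s \<psi>) f)" by (rule integrable_cont(1)[OF continuous_on_iter_transfer[OF cont_pot f]])
        have "tilted_mass n f s - tilted_mass n (\<lambda>_. 1) s * ?I = (\<integral>x. iter_transfer n (lin_comb s \<psi>) f x - ?h x * ?I \<partial>Pr)"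
          unfolding tilted_mass_1 tilted_mass_iter_transfer[OF f] using iL iter_one_integrable[of n s] by simp
        then have "\<bar>tilted_mass n f s - tilted_mass n (\<lambda>_. 1) s * ?I\<bar> \<le> (\<integral>x. \<bar>iter_transfer n (lin_comb s \<psi>) f x - ?h x * ?I\<bar> \<partial>Pr)"
          using integral_abs_bound by simp
        also have "\<dots> \<le> (\<integral>x. 4 * e' * ?h x \<partial>Pr)"
        proof (rule integral_mono)
          show "integrable Pr (\<lambda>x. \<bar>iter_transfer n (lin_comb s \<psi>) f x - ?h x * ?I\<bar>)" using iL iter_one_integrable[of n s] by simp
          show "integrable Pr (\<lambda>x. 4 * e' * ?h x)" using iter_one_integrable[of n s] by simp
          fix x
          have "iter_transfer n (lin_comb s \<psi>) f x - ?h x * ?I = (norm_iter n (lin_comb s \<psi>) f x - ?I) * ?h x"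
            using h[of x] by (simp add: norm_iter_def field_simps)
          then show "\<bar>iter_transfer n (lin_comb s \<psi>) f x - ?h x * ?I\<bar> \<le> 4 * e' * ?h x"
            using u[of x] h[of x] by (simp add: abs_mult mult_right_mono)
        qed
        also have "\<dots> = 4 * e' * tilted_mass n (\<lambda>_. 1) s" by (simp add: tilted_mass_1)
        finally have "\<bar>tilted_mass n f s - tilted_mass n (\<lambda>_. 1) s * ?I\<bar> / growth_at s ^ n \<le> 4 * e' * tilted_mass n (\<lambda>_. 1) s / growth_at s ^ n"
          using growth_at_pos[of s] by (intro divide_right_mono) auto
        then have "\<bar>norm_mass n f s - norm_mass n (\<lambda>_. 1) s * ?I\<bar> \<le> 4 * e' * norm_mass n (\<lambda>_. 1) s"
          using growth_at_pos[of s] by (simp add: norm_mass_def abs_divide diff_divide_distrib[symmetric])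
        also have "\<dots> \<le> 4 * e' * E" using V1[OF s, of n] e' by (intro mult_left_mono) auto
        also have "\<dots> < e" using e E by (simp add: e'_def)
        finally show "dist (norm_mass n f s - norm_mass n (\<lambda>_. 1) s * ?I) 0 < e" by simp
      qed
    qed
  qed
  from uniform_limit_add[OF 1 2] show ?thesis by simp
qed

lemma mass_limit_pos: "0 < mass_limit s"
proof -
  have "(\<lambda>n. norm_mass n (\<lambda>_. 1) s) \<longlonglongrightarrow> mass_limit s"
    by (rule tendsto_uniform_limitI[OF norm_mass_1_uniform_limit[of "norm s"]]) auto
  then have "exp (- (norm s * pot_lip * diam)) \<le> mass_limit s"
    by (rule LIMSEQ_le_const) (use norm_mass_1_bounds(2) in auto)
  then show ?thesis by (smt (verit) exp_gt_zero)
qed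

lemma norm_mass_limit_continuous:
  assumes f: "continuous_on UNIV f"
  shows "isCont (\<lambda>s. mass_limit s * (\<integral>\<omega>. f \<omega> \<partial>nu s)) s"
proof -
  have "continuous_on (cball 0 (norm s + 1)) (\<lambda>s. mass_limit s * (\<integral>\<omega>. f \<omega> \<partial>nu s))"
    by (rule uniform_limit_theorem[OF _ norm_mass_uniform_limit])
       (auto intro!: always_eventually continuous_on_subset[OF norm_mass_continuous] f)
  then have "continuous_on (ball 0 (norm s + 1)) (\<lambda>s. mass_limit s * (\<integral>\<omega>. f \<omega> \<partial>nu s))"
    using continuous_on_subset ball_subset_cball by blast
  then show ?thesis by (simp add: continuous_on_eq_continuous_at)
qed

end

subsection \<open>Laplace's method\<close>

lemma nn_integral_exp_abs:
  assumes c: "c > (0::real)"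
  shows "(\<integral>\<^sup>+x. ennreal (exp (- (c * \<bar>x\<bar>))) \<partial>lborel) < \<infinity>"
proof -
  let ?d = "exponential_density c"
  interpret E: prob_space "density lborel ?d" by (rule prob_space_exponential_density[OF c])
  have 1: "(\<integral>\<^sup>+x. ennreal (?d x) \<partial>lborel) = 1"
    using E.emeasure_space_1 by (subst (asm) emeasure_density) auto
  have 2: "(\<integral>\<^sup>+x. ennreal (?d (- x)) \<partial>lborel) = 1"
    using nn_integral_real_affine[of "\<lambda>x. ennreal (?d x)" "-1" 0] 1 by simp
  have "(\<integral>\<^sup>+x. ennreal (exp (- (c * \<bar>x\<bar>))) \<partial>lborel) \<le> (\<integral>\<^sup>+x. ennreal (1 / c) * (ennreal (?d x) + ennreal (?d (- x))) \<partial>lborel)"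
    using c by (intro nn_integral_mono)
      (auto simp: exponential_density_def mult.commute ennreal_plus[symmetric] ennreal_mult[symmetric]
        simp del: ennreal_plus split: if_splits intro!: ennreal_leI)
  also have "\<dots> = ennreal (1 / c) * (1 + 1)"
    using 1 2 by (subst nn_integral_cmult) (auto simp: nn_integral_add)
  also have "\<dots> < \<infinity>" by (simp add: ennreal_mult_less_top)
  finally show ?thesis .
qed

lemma integrable_exp_neg_norm:
  assumes c: "c > (0::real)"
  shows "integrable lborel (\<lambda>y::'v::euclidean_space. exp (- (c * norm y)))"
proof (rule integrableI_bounded)
  \<comment> \<open>Each coordinate is at most the norm, so with this share per coordinate the
    integrand is dominated by a product of one-dimensional ones.\<close>
  define c' where "c' = c / DIM('v)"
  have c': "c' > 0" using c by (simp add: c'_def)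
  have "(\<integral>\<^sup>+y. ennreal (norm (exp (- (c * norm (y::'v))))) \<partial>lborel) \<le>
      (\<integral>\<^sup>+y. (\<Prod>b\<in>Basis. ennreal (exp (- (c' * \<bar>(y::'v) \<bullet> b\<bar>)))) \<partial>lborel)"
  proof (rule nn_integral_mono)
    fix y :: 'v
    have "(\<Sum>b\<in>(Basis::'v set). c' * \<bar>y \<bullet> b\<bar>) \<le> (\<Sum>b\<in>(Basis::'v set). c' * norm y)"
      using c' by (intro sum_mono mult_left_mono Basis_le_norm) auto
    also have "\<dots> = c * norm y" by (simp add: c'_def)
    finally have "exp (- (c * norm y)) \<le> exp (- (\<Sum>b\<in>(Basis::'v set). c' * \<bar>y \<bullet> b\<bar>))" by simp
    also have "\<dots> = (\<Prod>b\<in>Basis. exp (- (c' * \<bar>y \<bullet> b\<bar>)))"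
      by (simp add: exp_sum sum_negf[symmetric])
    finally show "ennreal (norm (exp (- (c * norm y)))) \<le> (\<Prod>b\<in>Basis. ennreal (exp (- (c' * \<bar>y \<bullet> b\<bar>))))"
      by (simp add: prod_ennreal ennreal_leI)
  qed
  also have "\<dots> = (\<Prod>b\<in>(Basis::'v set). \<integral>\<^sup>+x. ennreal (exp (- (c' * \<bar>x\<bar>))) \<partial>lborel)"
    by (rule nn_integral_lborel_prod) auto
  also have "\<dots> < \<infinity>"
  proof -
    obtain r where "0 \<le> r" "(\<integral>\<^sup>+x. ennreal (exp (- (c' * \<bar>x\<bar>))) \<partial>lborel) = ennreal r"
      using nn_integral_exp_abs[OF c'] by (cases "\<integral>\<^sup>+x. ennreal (exp (- (c' * \<bar>x\<bar>))) \<partial>lborel") auto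
    then show ?thesis by (simp add: ennreal_power)
  qed
  finally show "(\<integral>\<^sup>+y. ennreal (norm (exp (- (c * norm (y::'v))))) \<partial>lborel) < \<infinity>" .
qed auto

lemma integrable_exp_neg_norm_power:
  assumes c: "c > (0::real)" and k: "k \<ge> 1"
  shows "integrable lborel (\<lambda>y::'v::euclidean_space. exp (- (c * norm y ^ k)))"
proof (rule Bochner_Integration.integrable_bound)
  show "integrable lborel (\<lambda>y::'v. exp c * exp (- (c * norm y)))" using integrable_exp_neg_norm[OF c] by simp
  have "exp (- (c * norm y ^ k)) \<le> exp c * exp (- (c * norm y))" for y :: 'v
  proof -
    have "norm y \<le> norm y ^ k + 1"
    proof (cases "norm y \<ge> 1")
      case True
      then show ?thesis using self_le_power[of "norm y" k] k by simp
    qed (use zero_le_power[of "norm y" k] norm_ge_zero[of y] in linarith)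
    then have "c * norm y \<le> c * (norm y ^ k + 1)" using c by (intro mult_left_mono) auto
    then show ?thesis by (simp add: algebra_simps flip: exp_add)
  qed
  then show "AE y in lborel. norm (exp (- (c * norm (y::'v) ^ k))) \<le> norm (exp c * exp (- (c * norm y)))" by simp
qed simp

lemma integral_lborel_affine:
  fixes f :: "'v::euclidean_space \<Rightarrow> real"
  assumes c: "c > 0" and [measurable]: "f \<in> borel_measurable borel"
  shows "(\<integral>x. f x \<partial>lborel) = c ^ DIM('v) * (\<integral>x. f (t + c *\<^sub>R x) \<partial>lborel)"
proof -
  have "(\<integral>x. f x \<partial>lborel) = (\<integral>x. f x \<partial>density (distr lborel borel (\<lambda>x. t + c *\<^sub>R x)) (\<lambda>_. ennreal (c ^ DIM('v))))"
    using lborel_affine[of c t] c by (simp add: ennreal_power)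
  also have "\<dots> = (\<integral>x. c ^ DIM('v) *\<^sub>R f x \<partial>distr lborel borel (\<lambda>x. t + c *\<^sub>R x))"
    by (rule integral_density) (use c in auto)
  also have "\<dots> = (\<integral>x. c ^ DIM('v) *\<^sub>R f (t + c *\<^sub>R x) \<partial>lborel)"
    by (rule integral_distr) auto
  finally show ?thesis by simp
qed

text \<open>\<open>Q\<close> is the leading term of \<open>\<phi> p - \<phi> (p + h)\<close>, of degree \<open>k\<close>, seen at the scale
  \<open>h = y / n powr (1 / k)\<close> at which the mass of \<open>exp (n * \<phi>)\<close> near \<open>p\<close> concentrates.\<close>

definition peak :: "('v::euclidean_space \<Rightarrow> real) \<Rightarrow> 'v \<Rightarrow> nat \<Rightarrow> ('v \<Rightarrow> real) \<Rightarrow> real \<Rightarrow> real \<Rightarrow> bool" where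
  "peak \<phi> p k Q c \<delta> \<longleftrightarrow> k \<ge> 1 \<and> c > 0 \<and> \<delta> > 0 \<and>
     (\<forall>h. norm h < \<delta> \<longrightarrow> c * norm h ^ k \<le> \<phi> p - \<phi> (p + h)) \<and>
     (\<forall>y. (\<lambda>n. real n * (\<phi> p - \<phi> (p + (real n powr (- 1 / k)) *\<^sub>R y))) \<longlonglongrightarrow> Q y)"

lemma powr_scale:
  assumes "n \<ge> 1" "k \<ge> (1::nat)"
  shows "real n * (real n powr (- 1 / real k)) ^ k = 1"
proof -
  have "(real n powr (- 1 / real k)) ^ k = (real n powr (- 1 / real k)) powr (real k)"
    using assms by (simp add: powr_realpow)
  also have "\<dots> = real n powr (- 1)" using assms by (simp add: powr_powr)
  finally show ?thesis using assms by (simp add: powr_minus field_simps)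
qed

lemma powr_scale_tendsto: "k \<ge> (1::nat) \<Longrightarrow> (\<lambda>n. real n powr (- 1 / real k)) \<longlonglongrightarrow> 0"
  using tendsto_neg_powr[of "- 1 / real k" "\<lambda>n. real n" sequentially] filterlim_real_sequentially by simp

context
  fixes \<phi> :: "'v::euclidean_space \<Rightarrow> real" and p k Q c \<delta>
  assumes pk: "peak \<phi> p k Q c \<delta>" and \<phi>: "continuous_on UNIV \<phi>"
begin

text \<open>The lower bound in \<open>peak\<close> is homogeneous of degree \<open>k\<close>, hence
  invariant under the rescaling, and passes to the limit. It makes \<open>exp (- Q y)\<close>
  integrable.\<close>

lemma peak_Q_ge: "c * norm y ^ k \<le> Q y"
proof (rule LIMSEQ_le_const)
  have k: "k \<ge> 1" and d: "\<delta> > 0" using pk by (auto simp: peak_def)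
  have lower: "\<And>h. norm h < \<delta> \<Longrightarrow> c * norm h ^ k \<le> \<phi> p - \<phi> (p + h)" using pk unfolding peak_def by blast
  show "(\<lambda>n. real n * (\<phi> p - \<phi> (p + (real n powr (- 1 / k)) *\<^sub>R y))) \<longlonglongrightarrow> Q y" using pk by (simp add: peak_def)
  have "(\<lambda>n. norm ((real n powr (- 1 / k)) *\<^sub>R y)) \<longlonglongrightarrow> 0"
    using tendsto_mult_left_zero[OF powr_scale_tendsto[OF k], of "norm y"] by simp
  then have "\<forall>\<^sub>F n in sequentially. norm ((real n powr (- 1 / k)) *\<^sub>R y) < \<delta>" using d by (rule order_tendstoD)
  then have "\<forall>\<^sub>F n in sequentially. c * norm y ^ k \<le> real n * (\<phi> p - \<phi> (p + (real n powr (- 1 / k)) *\<^sub>R y))"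
    using eventually_ge_at_top[of 1]
  proof eventually_elim
    case (elim n)
    let ?s = "real n powr (- 1 / k)"
    have "c * norm (?s *\<^sub>R y) ^ k \<le> \<phi> p - \<phi> (p + ?s *\<^sub>R y)" by (rule lower[OF elim(1)])
    then have "real n * (c * norm (?s *\<^sub>R y) ^ k) \<le> real n * (\<phi> p - \<phi> (p + ?s *\<^sub>R y))" by (rule mult_left_mono) simp
    moreover have "real n * (c * norm (?s *\<^sub>R y) ^ k) = c * norm y ^ k"
    proof -
      have "real n * (c * norm (?s *\<^sub>R y) ^ k) = (real n * ?s ^ k) * (c * norm y ^ k)"
        by (simp add: power_mult_distrib)
      then show ?thesis unfolding powr_scale[OF elim(2) k] by simp
    qed
    ultimately show ?case by (simp only:)
  qed
  then show "\<exists>N. \<forall>n\<ge>N. c * norm y ^ k \<le> real n * (\<phi> p - \<phi> (p + (real n powr (- 1 / k)) *\<^sub>R y))"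
    by (simp add: eventually_sequentially)
qed

lemma peak_Q_measurable: "Q \<in> borel_measurable borel"
proof (rule borel_measurable_LIMSEQ_real)
  show "(\<lambda>n. real n * (\<phi> p - \<phi> (p + (real n powr (- 1 / k)) *\<^sub>R y))) \<longlonglongrightarrow> Q y" for y
    using pk by (simp add: peak_def)
  have [measurable]: "\<phi> \<in> borel_measurable borel" using \<phi> by (rule borel_measurable_continuous_onI)
  show "(\<lambda>y. real n * (\<phi> p - \<phi> (p + (real n powr (- 1 / k)) *\<^sub>R y))) \<in> borel_measurable borel" for n by measurable
qed

lemma peak_integrable: "integrable lborel (\<lambda>y. exp (- Q y))"
proof (rule Bochner_Integration.integrable_bound)
  show "integrable lborel (\<lambda>y::'v. exp (- (c * norm y ^ k)))"
    using pk by (intro integrable_exp_neg_norm_power) (auto simp: peak_def)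
  show "(\<lambda>y. exp (- Q y)) \<in> borel_measurable lborel" using peak_Q_measurable by simp
qed (use peak_Q_ge in auto)

lemma peak_integral_pos: "0 < (\<integral>y. exp (- Q y) \<partial>lborel)"
proof -
  have "(\<integral>y. exp (- Q y) \<partial>lborel) \<noteq> 0"
  proof
    assume "(\<integral>y. exp (- Q y) \<partial>lborel) = 0"
    then have "AE y in (lborel :: 'v measure). exp (- Q y) = 0"
      using integral_nonneg_eq_0_iff_AE[OF peak_integrable] by simp
    then have "AE y in (lborel :: 'v measure). False" by simp
    then have "emeasure lborel (UNIV :: 'v set) = 0" by (subst (asm) AE_iff_measurable[of UNIV]) auto
    then show False by simp
  qed
  moreover have "0 \<le> (\<integral>y. exp (- Q y) \<partial>lborel)" by simp
  ultimately show ?thesis by linarith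
qed

text \<open>The substitution \<open>t = p + (n powr (- 1 / k)) *\<^sub>R y\<close> has Jacobian
  \<open>n powr (- DIM / k)\<close>. The exponents then converge to \<open>- Q y\<close>, and the
  lower bound in \<open>peak\<close> dominates all of them by
  \<open>- c * norm y ^ k\<close>.\<close>

lemma laplace_peak:
  fixes v :: "nat \<Rightarrow> 'v \<Rightarrow> real"
  assumes v: "\<And>n. continuous_on UNIV (v n)" and B: "\<And>n t. t \<in> ball p \<delta> \<Longrightarrow> \<bar>v n t\<bar> \<le> B"
    and ul: "uniform_limit (ball p \<delta>) v w sequentially" and w: "isCont w p"
  shows "(\<lambda>n. real n powr (DIM('v) / k) *
      (\<integral>t. indicator (ball p \<delta>) t * (exp (real n * (\<phi> t - \<phi> p)) * v n t) \<partial>lborel))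
      \<longlonglongrightarrow> w p * (\<integral>y. exp (- Q y) \<partial>lborel)"
proof -
  have k: "k \<ge> 1" and d: "\<delta> > 0" and c: "c > 0" using pk by (auto simp: peak_def)
  have lower: "\<And>h. norm h < \<delta> \<Longrightarrow> c * norm h ^ k \<le> \<phi> p - \<phi> (p + h)" using pk unfolding peak_def by blast
  have [measurable]: "ball p \<delta> \<in> sets borel" by simp
  have [measurable]: "\<phi> \<in> borel_measurable borel" using \<phi> by (rule borel_measurable_continuous_onI)
  have [measurable]: "v n \<in> borel_measurable borel" for n using v by (rule borel_measurable_continuous_onI)
  have [measurable]: "Q \<in> borel_measurable borel" by (rule peak_Q_measurable)
  define s where "s n = real n powr (- 1 / real k)" for n :: nat
  have s0: "s \<longlonglongrightarrow> 0" using powr_scale_tendsto[OF k] by (simp add: s_def[abs_def])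
  define g where "g n t = indicator (ball p \<delta>) t * (exp (real n * (\<phi> t - \<phi> p)) * v n t)" for n t
  have [measurable]: "g n \<in> borel_measurable borel" for n unfolding g_def by measurable
  have B0: "B \<ge> 0" using B[of p 0] d abs_ge_zero[of "v 0 p"] by (metis centre_in_ball order_trans)
  \<comment> \<open>The index starts at 1 because the scale \<open>s 0\<close> is 0 and the
    substitution degenerates there.\<close>
  have "(\<lambda>n. \<integral>y. g (Suc n) (p + s (Suc n) *\<^sub>R y) \<partial>lborel) \<longlonglongrightarrow> (\<integral>y. w p * exp (- Q y) \<partial>lborel)"
  proof (rule integral_dominated_convergence[where w = "\<lambda>y. B * exp (- (c * norm y ^ k))"])
    show "integrable lborel (\<lambda>y::'v. B * exp (- (c * norm y ^ k)))"
      by (rule integrable_mult_right) (rule integrable_exp_neg_norm_power[OF c k])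
    have "(\<lambda>n. g n (p + s n *\<^sub>R y)) \<longlonglongrightarrow> w p * exp (- Q y)" for y
    proof -
      have pt: "(\<lambda>n. p + s n *\<^sub>R y) \<longlonglongrightarrow> p" using tendsto_add[OF tendsto_const tendsto_scaleR[OF s0 tendsto_const]] by simp
      have ev: "\<forall>\<^sub>F n in sequentially. p + s n *\<^sub>R y \<in> ball p \<delta>"
        using topological_tendstoD[OF pt open_ball, of p \<delta>] d by simp
      have "(\<lambda>n. v n (p + s n *\<^sub>R y)) \<longlonglongrightarrow> w p"
      proof (rule tendstoI)
        fix e :: real assume e: "e > 0"
        have "(\<lambda>n. w (p + s n *\<^sub>R y)) \<longlonglongrightarrow> w p" by (rule isCont_tendsto_compose[OF w pt])
        then have "\<forall>\<^sub>F n in sequentially. dist (w (p + s n *\<^sub>R y)) (w p) < e / 2" by (rule tendstoD) (use e in simp)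
        moreover have "\<forall>\<^sub>F n in sequentially. \<forall>x\<in>ball p \<delta>. dist (v n x) (w x) < e / 2" by (rule uniform_limitD[OF ul]) (use e in simp)
        ultimately show "\<forall>\<^sub>F n in sequentially. dist (v n (p + s n *\<^sub>R y)) (w p) < e" using ev
        proof eventually_elim
          case (elim n)
          then have "dist (v n (p + s n *\<^sub>R y)) (w (p + s n *\<^sub>R y)) < e / 2" by blast
          then show ?case using elim(1) dist_triangle[of "v n (p + s n *\<^sub>R y)" "w p" "w (p + s n *\<^sub>R y)"] by linarith
        qed
      qed
      moreover have "(\<lambda>n. real n * (\<phi> p - \<phi> (p + s n *\<^sub>R y))) \<longlonglongrightarrow> Q y" using pk by (simp add: peak_def s_def)
      ultimately have "(\<lambda>n. v n (p + s n *\<^sub>R y) * exp (- (real n * (\<phi> p - \<phi> (p + s n *\<^sub>R y))))) \<longlonglongrightarrow> w p * exp (- Q y)"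
        by (intro tendsto_intros)
      moreover have "\<forall>\<^sub>F n in sequentially. v n (p + s n *\<^sub>R y) * exp (- (real n * (\<phi> p - \<phi> (p + s n *\<^sub>R y)))) = g n (p + s n *\<^sub>R y)"
        using ev by eventually_elim (simp add: g_def algebra_simps)
      ultimately show ?thesis by (rule Lim_transform_eventually)
    qed
    then show "AE y in lborel. (\<lambda>n. g (Suc n) (p + s (Suc n) *\<^sub>R y)) \<longlonglongrightarrow> w p * exp (- Q y)"
      by (intro AE_I2 LIMSEQ_Suc) auto
    have "norm (g (Suc n) (p + s (Suc n) *\<^sub>R y)) \<le> B * exp (- (c * norm y ^ k))" for n y
    proof (cases "p + s (Suc n) *\<^sub>R y \<in> ball p \<delta>")
      case True
      let ?n = "Suc n" and ?t = "p + s (Suc n) *\<^sub>R y"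
      have "norm (s ?n *\<^sub>R y) < \<delta>" using True by (simp add: dist_norm)
      then have "c * norm (s ?n *\<^sub>R y) ^ k \<le> \<phi> p - \<phi> ?t" by (rule lower)
      then have "real ?n * (c * norm (s ?n *\<^sub>R y) ^ k) \<le> real ?n * (\<phi> p - \<phi> ?t)" by (rule mult_left_mono) simp
      moreover have "real ?n * (c * norm (s ?n *\<^sub>R y) ^ k) = c * norm y ^ k"
      proof -
        have "real ?n * s ?n ^ k = 1" unfolding s_def by (rule powr_scale[OF _ k]) simp
        moreover have "real ?n * (c * norm (s ?n *\<^sub>R y) ^ k) = (real ?n * s ?n ^ k) * (c * norm y ^ k)"
          by (simp add: power_mult_distrib s_def del: of_nat_Suc)
        ultimately show ?thesis by (simp only: mult_1)
      qed
      ultimately have "c * norm y ^ k \<le> real ?n * (\<phi> p - \<phi> ?t)" by (simp only:)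
      then have "exp (real ?n * (\<phi> ?t - \<phi> p)) \<le> exp (- (c * norm y ^ k))" by (simp add: algebra_simps)
      then have "exp (real ?n * (\<phi> ?t - \<phi> p)) * \<bar>v ?n ?t\<bar> \<le> exp (- (c * norm y ^ k)) * B"
        by (intro mult_mono B True) auto
      then show ?thesis using True by (simp add: g_def abs_mult mult.commute)
    qed (use B0 in \<open>simp add: g_def\<close>)
    then show "AE y in lborel. norm (g (Suc n) (p + s (Suc n) *\<^sub>R y)) \<le> B * exp (- (c * norm y ^ k))" for n by simp
  qed auto
  moreover have "(\<integral>y. g (Suc n) (p + s (Suc n) *\<^sub>R y) \<partial>lborel) = real (Suc n) powr (DIM('v) / k) * (\<integral>t. g (Suc n) t \<partial>lborel)" for n
  proof -
    have sp: "s (Suc n) > 0" by (simp add: s_def)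
    have "(\<integral>t. g (Suc n) t \<partial>lborel) = s (Suc n) ^ DIM('v) * (\<integral>y. g (Suc n) (p + s (Suc n) *\<^sub>R y) \<partial>lborel)"
      by (rule integral_lborel_affine[OF sp]) simp
    moreover have "real (Suc n) powr (DIM('v) / k) * s (Suc n) ^ DIM('v) = 1"
      unfolding s_def by (simp add: powr_realpow[symmetric] powr_powr powr_add[symmetric])
    ultimately show ?thesis by (metis mult.assoc mult_1)
  qed
  ultimately have "(\<lambda>n. real (Suc n) powr (DIM('v) / k) * (\<integral>t. g (Suc n) t \<partial>lborel)) \<longlonglongrightarrow> w p * (\<integral>y. exp (- Q y) \<partial>lborel)" by simp
  then show ?thesis unfolding g_def by (rule LIMSEQ_imp_Suc)
qed

end

lemma peak_mono: "peak \<phi> p k Q c \<delta> \<Longrightarrow> 0 < \<delta>' \<Longrightarrow> \<delta>' \<le> \<delta> \<Longrightarrow> peak \<phi> p k Q c \<delta>'"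
  by (auto simp: peak_def)

text \<open>A peak of order \<open>k p\<close> below the maximal order contributes
  \<open>n powr (- DIM / k p)\<close>, negligible against the power of the flattest peaks. Away from
  the peaks one of the \<open>n\<close> factors \<open>exp (\<phi> t - m)\<close> is kept for
  integrability, while the others decay exponentially in \<open>n\<close>.\<close>

lemma laplace_method:
  fixes \<phi> :: "'v::euclidean_space \<Rightarrow> real" and v :: "nat \<Rightarrow> 'v \<Rightarrow> real"
  assumes \<phi>: "continuous_on UNIV \<phi>"
    and M: "finite M" "M \<noteq> {}" "\<And>p. p \<in> M \<Longrightarrow> \<phi> p = m" "\<And>t. t \<notin> M \<Longrightarrow> \<phi> t < m"
    and R: "\<And>t. norm t > R \<Longrightarrow> \<phi> t \<le> m - 1"
    and pk: "\<And>p. p \<in> M \<Longrightarrow> peak \<phi> p (k p) (Q p) (c p) (\<delta> p)"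
    and v: "\<And>n. continuous_on UNIV (v n)" and B: "\<And>n t. \<bar>v n t\<bar> \<le> B t" "continuous_on UNIV B"
    and iB: "integrable lborel (\<lambda>t. exp (\<phi> t) * B t)"
    and ul: "\<And>r. r \<ge> 0 \<Longrightarrow> uniform_limit (cball 0 r) v w sequentially"
    and w: "\<And>p. isCont w p"
  shows "(\<lambda>n. real n powr (DIM('v) / real (Max (k ` M))) * (\<integral>t. exp (real n * (\<phi> t - m)) * v n t \<partial>lborel))
    \<longlonglongrightarrow> (\<Sum>p\<in>M. if k p = Max (k ` M) then w p * (\<integral>y. exp (- Q p y) \<partial>lborel) else 0)"
proof -
  define K where "K = Max (k ` M)"
  have K: "k p \<le> K" "k p \<ge> 1" if "p \<in> M" for p
    using that M(1) pk[OF that] unfolding K_def peak_def by auto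
  then have K1: "K \<ge> 1" using M(2) order_trans by blast
  have [measurable]: "\<phi> \<in> borel_measurable borel" using \<phi> by (rule borel_measurable_continuous_onI)
  have [measurable]: "v n \<in> borel_measurable borel" for n using v by (rule borel_measurable_continuous_onI)
  have [measurable]: "B \<in> borel_measurable borel" using B(2) by (rule borel_measurable_continuous_onI)
  have B0: "B t \<ge> 0" for t using order_trans[OF abs_ge_zero B(1)] .
  obtain e where e: "e > 0" "\<And>p q. p \<in> M \<Longrightarrow> q \<in> M \<Longrightarrow> p \<noteq> q \<Longrightarrow> e \<le> dist p q"
  proof -
    have fin: "finite ((\<lambda>(p, q). dist p q) ` (M \<times> M) - {0})" using M(1) by simp
    define e where "e = Min (insert 1 ((\<lambda>(p, q). dist p q) ` (M \<times> M) - {0}))"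
    have "e > 0" unfolding e_def using fin by (subst Min_gr_iff) auto
    moreover have "e \<le> dist p q" if "p \<in> M" "q \<in> M" "p \<noteq> q" for p q
      unfolding e_def using fin that by (intro Min_le) auto
    ultimately show ?thesis using that by blast
  qed
  \<comment> \<open>Half the mutual distance makes the balls disjoint; \<open>insert\<close> also
    covers a single maximum point.\<close>
  define d where "d = Min (insert (e / 2) (\<delta> ` M))"
  have \<delta>: "\<delta> p > 0" if "p \<in> M" for p using pk[OF that] unfolding peak_def by blast
  have d: "d > 0" unfolding d_def using M(1) e(1) \<delta> by (subst Min_gr_iff) auto
  have d2: "d \<le> e / 2" unfolding d_def using M(1) by (intro Min_le) auto
  have d3: "d \<le> \<delta> p" if "p \<in> M" for p unfolding d_def using M(1) that by (intro Min_le) auto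
  have pkd: "peak \<phi> p (k p) (Q p) (c p) d" if "p \<in> M" for p using peak_mono[OF pk[OF that] d d3[OF that]] .
  have disj: "ball p d \<inter> ball q d = {}" if "p \<in> M" "q \<in> M" "p \<noteq> q" for p q
  proof (rule ccontr)
    assume "ball p d \<inter> ball q d \<noteq> {}"
    then obtain x where "dist p x < d" "dist q x < d" by auto
    then show False using e(2)[OF that] d2 dist_triangle[of p q x] by (simp add: dist_commute)
  qed
  define U where "U = (\<Union>p\<in>M. ball p d)"
  \<comment> \<open>The gap below the maximum away from the peaks: by compactness inside the ball of
    radius \<open>R\<close>, by the hypothesis on \<open>R\<close> outside it.\<close>
  obtain \<eta> where \<eta>: "\<eta> > 0" "\<And>t. t \<notin> U \<Longrightarrow> \<phi> t \<le> m - \<eta>"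
  proof (cases "cball 0 R - U = {}")
    case True
    have "\<phi> t \<le> m - 1" if "t \<notin> U" for t
    proof (rule R)
      have "t \<notin> cball 0 R" using True that by blast
      then show "R < norm t" by simp
    qed
    then show ?thesis using that[of 1] by auto
  next
    case False
    have "compact (cball 0 R - U)" unfolding U_def by (intro compact_diff compact_cball open_UN ballI open_ball)
    from continuous_attains_sup[OF this False continuous_on_subset[OF \<phi>]]
    obtain x where x: "x \<in> cball 0 R - U" "\<And>t. t \<in> cball 0 R - U \<Longrightarrow> \<phi> t \<le> \<phi> x" by auto
    have "x \<notin> M" using x d by (auto simp: U_def)
    then have lt: "\<phi> x < m" by (rule M(4))
    have "\<phi> t \<le> m - min 1 (m - \<phi> x)" if "t \<notin> U" for t
      using R[of t] x(2)[of t] that by (cases "norm t > R") auto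
    then show ?thesis using that[of "min 1 (m - \<phi> x)"] lt by auto
  qed
  define F where "F n t = exp (real n * (\<phi> t - m)) * v n t" for n t
  have [measurable]: "F n \<in> borel_measurable borel" for n unfolding F_def by measurable
  have le_m: "\<phi> t \<le> m" for t using M(3,4)[of t] by (cases "t \<in> M") auto
  have Fb: "\<bar>F n t\<bar> \<le> exp (\<phi> t - m) * B t" if "n \<ge> 1" for n t
  proof -
    have "real n * (\<phi> t - m) \<le> 1 * (\<phi> t - m)" using that le_m[of t] by (intro mult_right_mono_neg) auto
    then have "exp (real n * (\<phi> t - m)) \<le> exp (\<phi> t - m)" by simp
    then have "exp (real n * (\<phi> t - m)) * \<bar>v n t\<bar> \<le> exp (\<phi> t - m) * B t" by (intro mult_mono B) auto
    then show ?thesis by (simp add: F_def abs_mult)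
  qed
  have iB': "integrable lborel (\<lambda>t. exp (\<phi> t - m) * B t)"
    using integrable_mult_right[OF iB, of "exp (- m)"] by (simp add: exp_diff exp_minus field_simps)
  have iF: "integrable lborel (\<lambda>t. indicator S t * F n t)" if "n \<ge> 1" "S \<in> sets borel" for n and S :: "'v set"
  proof (rule Bochner_Integration.integrable_bound[OF iB'])
    show "(\<lambda>t. indicator S t * F n t) \<in> borel_measurable lborel" using that(2) by measurable
  qed (use Fb[OF that(1)] B0 in \<open>auto simp: indicator_def\<close>)
  have Uo: "open U" unfolding U_def by (intro open_UN ballI open_ball)
  have decomp: "(\<integral>t. F n t \<partial>lborel) = (\<Sum>p\<in>M. \<integral>t. indicator (ball p d) t * F n t \<partial>lborel) +
      (\<integral>t. indicator (- U) t * F n t \<partial>lborel)" if n: "n \<ge> 1" for n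
  proof -
    have "F n t = (\<Sum>p\<in>M. indicator (ball p d) t * F n t) + indicator (- U) t * F n t" for t
    proof -
      have "(\<Sum>p\<in>M. indicator (ball p d) t) = (indicator U t :: real)"
      proof -
        have "disjoint_family_on (\<lambda>p. ball p d) M" using disj by (simp add: disjoint_family_on_def)
        then show ?thesis unfolding U_def by (rule indicator_UN_disjoint[OF M(1), symmetric])
      qed
      then show ?thesis by (simp add: sum_distrib_right[symmetric] indicator_def)
    qed
    then have "(\<integral>t. F n t \<partial>lborel) = (\<integral>t. (\<Sum>p\<in>M. indicator (ball p d) t * F n t) + indicator (- U) t * F n t \<partial>lborel)"
      by (intro Bochner_Integration.integral_cong) auto
    also have "\<dots> = (\<integral>t. (\<Sum>p\<in>M. indicator (ball p d) t * F n t) \<partial>lborel) + (\<integral>t. indicator (- U) t * F n t \<partial>lborel)"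
      using Uo by (intro Bochner_Integration.integral_add Bochner_Integration.integrable_sum iF n) auto
    also have "(\<integral>t. (\<Sum>p\<in>M. indicator (ball p d) t * F n t) \<partial>lborel) = (\<Sum>p\<in>M. \<integral>t. indicator (ball p d) t * F n t \<partial>lborel)"
      by (intro Bochner_Integration.integral_sum iF n) auto
    finally show ?thesis .
  qed
  have local_lim: "(\<lambda>n. real n powr (DIM('v) / K) * (\<integral>t. indicator (ball p d) t * F n t \<partial>lborel))
      \<longlonglongrightarrow> (if k p = K then w p * (\<integral>y. exp (- Q p y) \<partial>lborel) else 0)" if p: "p \<in> M" for p
  proof -
    have "bounded (B ` cball p d)" by (intro compact_imp_bounded compact_continuous_image continuous_on_subset[OF B(2)]) auto
    then obtain b where b: "\<And>t. t \<in> cball p d \<Longrightarrow> \<bar>B t\<bar> \<le> b" unfolding bounded_iff by fastforce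
    have "uniform_limit (cball 0 (norm p + d)) v w sequentially" by (rule ul) (use d in auto)
    moreover have "ball p d \<subseteq> cball 0 (norm p + d)"
      using norm_triangle_sub by (auto simp: dist_norm norm_minus_commute) (smt (verit) norm_minus_commute norm_triangle_sub)
    ultimately have ulb: "uniform_limit (ball p d) v w sequentially" by (rule uniform_limit_on_subset)
    have vb: "\<bar>v n t\<bar> \<le> b" if "t \<in> ball p d" for n t
      using B(1)[of n t] b[of t] that by auto
    have L: "(\<lambda>n. real n powr (DIM('v) / k p) * (\<integral>t. indicator (ball p d) t * F n t \<partial>lborel))
        \<longlonglongrightarrow> w p * (\<integral>y. exp (- Q p y) \<partial>lborel)"
      using laplace_peak[OF pkd[OF p] \<phi> v vb ulb w] by (simp add: F_def M(3)[OF p])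
    show ?thesis
    proof (cases "k p = K")
      case False
      then have lt: "k p < K" "k p > 0" using K[OF p] by auto
      have "real (DIM('v)) / K < DIM('v) / k p" using lt by (intro divide_strict_left_mono) auto
      then have neg: "DIM('v) / K - DIM('v) / k p < 0" by simp
      have "(\<lambda>n. real n powr (DIM('v) / K - DIM('v) / k p)) \<longlonglongrightarrow> 0"
        by (rule tendsto_neg_powr[OF neg filterlim_real_sequentially])
      from tendsto_mult[OF this L] show ?thesis using False
        by (simp add: mult.assoc[symmetric] powr_add[symmetric])
    qed (use L in simp)
  qed
  have outside: "(\<lambda>n. real n powr (DIM('v) / K) * (\<integral>t. indicator (- U) t * F n t \<partial>lborel)) \<longlonglongrightarrow> 0"
  proof -
    define C where "C = (\<integral>t. exp (\<phi> t - m) * B t \<partial>lborel)"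
    have bd: "\<bar>\<integral>t. indicator (- U) t * F n t \<partial>lborel\<bar> \<le> exp (\<eta>) * exp (- (\<eta> * real n)) * C" if n: "n \<ge> 1" for n
    proof -
      have "\<bar>\<integral>t. indicator (- U) t * F n t \<partial>lborel\<bar> \<le> (\<integral>t. exp (\<eta>) * exp (- (\<eta> * real n)) * (exp (\<phi> t - m) * B t) \<partial>lborel)"
      proof (rule order_trans[OF integral_abs_bound integral_mono])
        show "integrable lborel (\<lambda>t. \<bar>indicator (- U) t * F n t\<bar>)" using Uo by (intro integrable_abs iF n) auto
        show "integrable lborel (\<lambda>t. exp \<eta> * exp (- (\<eta> * real n)) * (exp (\<phi> t - m) * B t))" using iB' by simp
        fix t
        show "\<bar>indicator (- U) t * F n t\<bar> \<le> exp \<eta> * exp (- (\<eta> * real n)) * (exp (\<phi> t - m) * B t)"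
        proof (cases "t \<in> U")
          case False
          have "(real n - 1) * (\<phi> t - m) \<le> (real n - 1) * (- \<eta>)"
            using \<eta>(2)[OF False] n by (intro mult_left_mono) auto
          then have "real n * (\<phi> t - m) \<le> \<eta> - \<eta> * real n + (\<phi> t - m)" by (simp add: algebra_simps)
          then have "exp (real n * (\<phi> t - m)) \<le> exp \<eta> * exp (- (\<eta> * real n)) * exp (\<phi> t - m)"
            by (simp flip: exp_add)
          then have "exp (real n * (\<phi> t - m)) * \<bar>v n t\<bar> \<le> (exp \<eta> * exp (- (\<eta> * real n)) * exp (\<phi> t - m)) * B t"
            by (intro mult_mono B) auto
          then show ?thesis using False by (simp add: F_def abs_mult mult.assoc)
        qed (use B0 in simp)
      qed
      then show ?thesis by (simp add: C_def)
    qed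
    have l0: "(\<lambda>n. real n powr (DIM('v) / K) * exp (- (\<eta> * real n))) \<longlonglongrightarrow> 0"
      using \<eta>(1) by real_asymp
    have "(\<lambda>n. exp \<eta> * C * (real n powr (DIM('v) / K) * exp (- (\<eta> * real n)))) \<longlonglongrightarrow> 0"
      by (rule tendsto_mult_right_zero[OF l0])
    moreover have "\<forall>\<^sub>F n in sequentially. norm (real n powr (DIM('v) / K) * (\<integral>t. indicator (- U) t * F n t \<partial>lborel)) \<le>
      exp \<eta> * C * (real n powr (DIM('v) / K) * exp (- (\<eta> * real n)))"
      using eventually_ge_at_top[of 1]
    proof eventually_elim
      case (elim n)
      from mult_left_mono[OF bd[OF elim], of "real n powr (DIM('v) / K)"]
      show ?case by (simp add: abs_mult mult_ac)
    qed
    ultimately show ?thesis by (rule Lim_null_comparison[rotated])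
  qed
  have "(\<lambda>n. (\<Sum>p\<in>M. real n powr (DIM('v) / K) * (\<integral>t. indicator (ball p d) t * F n t \<partial>lborel)) +
      real n powr (DIM('v) / K) * (\<integral>t. indicator (- U) t * F n t \<partial>lborel))
      \<longlonglongrightarrow> (\<Sum>p\<in>M. if k p = K then w p * (\<integral>y. exp (- Q p y) \<partial>lborel) else 0) + 0"
    by (intro tendsto_add tendsto_sum local_lim outside)
  moreover have "\<forall>\<^sub>F n in sequentially. (\<Sum>p\<in>M. real n powr (DIM('v) / K) * (\<integral>t. indicator (ball p d) t * F n t \<partial>lborel)) +
      real n powr (DIM('v) / K) * (\<integral>t. indicator (- U) t * F n t \<partial>lborel) = real n powr (DIM('v) / K) * (\<integral>t. F n t \<partial>lborel)"
    using eventually_ge_at_top[of 1] by eventually_elim (simp add: decomp distrib_left sum_distrib_left)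
  ultimately show ?thesis unfolding F_def K_def by (simp add: Lim_transform_eventually)
qed

subsection \<open>Second order expansions\<close>

text \<open>A leading term that is homogeneous of degree \<open>k\<close> and positive away from 0
  suffices. Near \<open>p\<close> half of \<open>c\<close> absorbs the remainder, and homogeneity
  makes the rescaled differences converge to the leading term itself.\<close>

lemma peakI:
  fixes \<phi> :: "'v::euclidean_space \<Rightarrow> real"
  assumes k: "k \<ge> 1" and c: "c > 0" and hom: "\<And>s h. s > 0 \<Longrightarrow> q (s *\<^sub>R h) = s ^ k * q h"
    and ge: "\<And>h. c * norm h ^ k \<le> q h"
    and lim: "((\<lambda>h. (\<phi> p - \<phi> (p + h) - q h) / norm h ^ k) \<longlongrightarrow> 0) (at 0)"
  obtains \<delta> where "peak \<phi> p k q (c / 2) \<delta>"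
proof -
  have "\<forall>\<^sub>F h in at 0. \<bar>(\<phi> p - \<phi> (p + h) - q h) / norm h ^ k\<bar> < c / 2"
    using tendstoD[OF lim, of "c / 2"] c by simp
  then obtain \<delta> where \<delta>: "\<delta> > 0"
    and d: "\<And>h. h \<noteq> 0 \<Longrightarrow> norm h < \<delta> \<Longrightarrow> \<bar>(\<phi> p - \<phi> (p + h) - q h) / norm h ^ k\<bar> < c / 2"
    unfolding eventually_at by (metis UNIV_I dist_0_norm dist_commute)
  have low: "c / 2 * norm h ^ k \<le> \<phi> p - \<phi> (p + h)" if h: "norm h < \<delta>" for h
  proof (cases "h = 0")
    case False
    then have n: "norm h ^ k > 0" by simp
    have "\<bar>\<phi> p - \<phi> (p + h) - q h\<bar> / norm h ^ k < c / 2" using d[OF False h] by (simp add: abs_divide)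
    then have "\<bar>\<phi> p - \<phi> (p + h) - q h\<bar> < c / 2 * norm h ^ k" using n by (simp add: divide_less_eq)
    then show ?thesis using ge[of h] by linarith
  qed (use k in \<open>simp add: power_0_left\<close>)
  have "(\<lambda>n. real n * (\<phi> p - \<phi> (p + (real n powr (- 1 / k)) *\<^sub>R y))) \<longlonglongrightarrow> q y" for y
  proof (cases "y = 0")
    case True
    \<comment> \<open>Homogeneity is only available for positive factors, so \<open>q 0 = 0\<close>
      is read off from scaling by 2.\<close>
    have "q (2 *\<^sub>R 0) = 2 ^ k * q 0" by (rule hom) simp
    moreover have "(2::real) ^ k \<noteq> 1" using k by (metis one_less_numeral_iff one_less_power order_less_irrefl semiring_norm(76) less_le_trans zero_less_one)
    ultimately have "q 0 = 0" by simp
    then show ?thesis using True by simp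
  next
    case False
    define s where "s n = real n powr (- 1 / real k)" for n :: nat
    have s0: "s \<longlonglongrightarrow> 0" using powr_scale_tendsto[OF k] by (simp add: s_def[abs_def])
    have "(\<lambda>n. s n *\<^sub>R y) \<longlonglongrightarrow> 0" using tendsto_scaleR[OF s0 tendsto_const, of y] by simp
    moreover have "\<forall>\<^sub>F n in sequentially. s n *\<^sub>R y \<noteq> 0"
      using eventually_ge_at_top[of 1] by eventually_elim (use False in \<open>simp add: s_def\<close>)
    ultimately have "filterlim (\<lambda>n. s n *\<^sub>R y) (at 0) sequentially" by (simp add: filterlim_at)
    from filterlim_compose[OF lim this]
    have "(\<lambda>n. (\<phi> p - \<phi> (p + s n *\<^sub>R y) - q (s n *\<^sub>R y)) / norm (s n *\<^sub>R y) ^ k) \<longlonglongrightarrow> 0" .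
    from tendsto_add[OF tendsto_mult_right_zero[OF this, of "norm y ^ k"] tendsto_const[of "q y"]]
    have "(\<lambda>n. norm y ^ k * ((\<phi> p - \<phi> (p + s n *\<^sub>R y) - q (s n *\<^sub>R y)) / norm (s n *\<^sub>R y) ^ k) + q y) \<longlonglongrightarrow> q y" by simp
    moreover have "\<forall>\<^sub>F n in sequentially. norm y ^ k * ((\<phi> p - \<phi> (p + s n *\<^sub>R y) - q (s n *\<^sub>R y)) / norm (s n *\<^sub>R y) ^ k) + q y
       = real n * (\<phi> p - \<phi> (p + s n *\<^sub>R y))"
      using eventually_ge_at_top[of 1]
    proof eventually_elim
      case (elim n)
      have sp: "s n > 0" using elim by (simp add: s_def)
      define D where "D = \<phi> p - \<phi> (p + s n *\<^sub>R y)"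
      have ns: "real n * s n ^ k = 1" unfolding s_def by (rule powr_scale[OF elim k])
      then have sk: "1 / s n ^ k = real n" using sp by (simp add: field_simps)
      have "norm y ^ k * ((D - q (s n *\<^sub>R y)) / norm (s n *\<^sub>R y) ^ k) = (D - s n ^ k * q y) * (1 / s n ^ k)"
        using sp False by (simp add: hom[OF sp] power_mult_distrib field_simps)
      also have "\<dots> = real n * D - (real n * s n ^ k) * q y" unfolding sk by (simp add: algebra_simps)
      finally show ?case unfolding ns by (simp add: D_def)
    qed
    ultimately show ?thesis unfolding s_def by (rule Lim_transform_eventually)
  qed
  then have "peak \<phi> p k q (c / 2) \<delta>" using k c \<delta> low by (simp add: peak_def)
  then show ?thesis by (rule that)
qed

context
  fixes f :: "'v::euclidean_space \<Rightarrow> real" and g H t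
  assumes f: "\<forall>\<^sub>F s in nhds t. GDERIV f s :> g s" and H: "(g has_derivative H) (at t)"
begin

interpretation H: bounded_linear H by (rule has_derivative_bounded_linear[OF H])

text \<open>The mean value theorem for \<open>f\<close> minus its would-be Taylor polynomial of degree two along a
  segment. The last summand vanishes on rays, which gives Peano's expansion; a segment between two
  rays then shows that it vanishes identically, i.e. that \<open>H\<close> is symmetric.\<close>

lemma segment_mvt:
  assumes e: "e > 0"
  obtains r where "r > 0" "\<And>v w. norm v < r \<Longrightarrow> norm (v + w) < r \<Longrightarrow>
    \<bar>(f (t + v + w) - g t \<bullet> (v + w) - H (v + w) \<bullet> (v + w) / 2) - (f (t + v) - g t \<bullet> v - H v \<bullet> v / 2)
      - (H v \<bullet> w - H w \<bullet> v) / 2\<bar> \<le> e * (norm v + norm w) * norm w"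
proof -
  obtain r1 where r1: "r1 > 0" "\<And>s. dist s t < r1 \<Longrightarrow> GDERIV f s :> g s"
    using f unfolding eventually_nhds_metric by blast
  have "\<forall>e>0. \<exists>d>0. \<forall>y. norm (y - t) < d \<longrightarrow> norm (g y - g t - H (y - t)) \<le> e * norm (y - t)"
    using H unfolding has_derivative_at_alt by blast
  then obtain r2 where r2: "r2 > 0" "\<And>y. norm (y - t) < r2 \<Longrightarrow> norm (g y - g t - H (y - t)) \<le> e * norm (y - t)"
    using e by blast
  define r where "r = min r1 r2"
  show ?thesis
  proof (rule that[of r])
    show "r > 0" using r1 r2 by (simp add: r_def)
    fix v w :: 'v assume v: "norm v < r" and vw: "norm (v + w) < r"
    define F where "F u = f (t + v + u *\<^sub>R w) - g t \<bullet> (v + u *\<^sub>R w) - H (v + u *\<^sub>R w) \<bullet> (v + u *\<^sub>R w) / 2" for u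
    define F' where "F' u = (g (t + v + u *\<^sub>R w) - g t - H (v + u *\<^sub>R w)) \<bullet> w + (H v \<bullet> w - H w \<bullet> v) / 2" for u
    have nb: "norm (v + u *\<^sub>R w) < r" if u: "0 \<le> u" "u \<le> 1" for u
    proof -
      have "v + u *\<^sub>R w = (1 - u) *\<^sub>R v + u *\<^sub>R (v + w)" by (simp add: algebra_simps)
      then have "norm (v + u *\<^sub>R w) \<le> (1 - u) * norm v + u * norm (v + w)"
        using u norm_triangle_ineq[of "(1 - u) *\<^sub>R v" "u *\<^sub>R (v + w)"] by simp
      also have "\<dots> < r" using u v vw by (intro convex_bound_lt) auto
      finally show ?thesis .
    qed
    have der: "(F has_real_derivative F' u) (at u)" if u: "0 \<le> u" "u \<le> 1" for u
    proof -
      have "dist (t + v + u *\<^sub>R w) t < r1" using nb[OF u] by (simp add: dist_norm r_def add.assoc)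
      then have "(f has_derivative (\<lambda>h. h \<bullet> g (t + v + u *\<^sub>R w))) (at (t + v + u *\<^sub>R w))"
        using r1(2) by (simp add: gderiv_def)
      moreover have "((\<lambda>u. t + v + u *\<^sub>R w) has_derivative (\<lambda>h. h *\<^sub>R w)) (at u)"
        by (auto intro!: derivative_eq_intros)
      ultimately have fd: "((\<lambda>u. f (t + v + u *\<^sub>R w)) has_derivative (\<lambda>h. (h *\<^sub>R w) \<bullet> g (t + v + u *\<^sub>R w))) (at u)"
        by (intro has_derivative_compose[of "\<lambda>u. t + v + u *\<^sub>R w" "\<lambda>h. h *\<^sub>R w" u UNIV f])
      have Hu: "H (v + u *\<^sub>R w) = H v + u *\<^sub>R H w" for u by (simp add: H.add H.scaleR)
      have qd: "((\<lambda>u. g t \<bullet> (v + u *\<^sub>R w) + H (v + u *\<^sub>R w) \<bullet> (v + u *\<^sub>R w) / 2) has_derivative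
         (\<lambda>h. h * (g t \<bullet> w + (H w \<bullet> (v + u *\<^sub>R w) + H (v + u *\<^sub>R w) \<bullet> w) / 2))) (at u)"
        unfolding Hu by (auto intro!: derivative_eq_intros simp: fun_eq_iff inner_add_left inner_add_right algebra_simps)
      have "(F has_derivative (\<lambda>h. (h *\<^sub>R w) \<bullet> g (t + v + u *\<^sub>R w) -
          h * (g t \<bullet> w + (H w \<bullet> (v + u *\<^sub>R w) + H (v + u *\<^sub>R w) \<bullet> w) / 2))) (at u)"
        unfolding F_def diff_diff_eq by (rule has_derivative_diff[OF fd qd])
      moreover have "(\<lambda>h. (h *\<^sub>R w) \<bullet> g (t + v + u *\<^sub>R w) -
          h * (g t \<bullet> w + (H w \<bullet> (v + u *\<^sub>R w) + H (v + u *\<^sub>R w) \<bullet> w) / 2)) = (*) (F' u)"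
        unfolding F'_def Hu by (rule ext) (simp add: inner_add_left inner_add_right inner_diff_left inner_diff_right inner_commute field_simps)
      ultimately show ?thesis by (simp add: has_field_derivative_def)
    qed
    obtain u where u: "0 < u" "u < 1" "F 1 - F 0 = (1 - 0) * F' u"
      using MVT2[of 0 1 F F'] der by auto
    have nu: "norm (t + v + u *\<^sub>R w - t) < r2" using nb[of u] u by (simp add: r_def add.assoc)
    have "\<bar>(g (t + v + u *\<^sub>R w) - g t - H (v + u *\<^sub>R w)) \<bullet> w\<bar> \<le> norm (g (t + v + u *\<^sub>R w) - g t - H (v + u *\<^sub>R w)) * norm w"
      by (rule Cauchy_Schwarz_ineq2)
    also have "\<dots> \<le> e * norm (v + u *\<^sub>R w) * norm w"
      using r2(2)[OF nu] by (intro mult_right_mono) (auto simp: add.assoc)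
    also have "\<dots> \<le> e * (norm v + norm w) * norm w"
    proof (intro mult_right_mono mult_left_mono)
      have "norm (v + u *\<^sub>R w) \<le> norm v + u * norm w" using norm_triangle_ineq[of v "u *\<^sub>R w"] u by simp
      also have "u * norm w \<le> 1 * norm w" using u by (intro mult_right_mono) auto
      finally show "norm (v + u *\<^sub>R w) \<le> norm v + norm w" by simp
    qed (use e in auto)
    finally have "\<bar>F 1 - F 0 - (H v \<bullet> w - H w \<bullet> v) / 2\<bar> \<le> e * (norm v + norm w) * norm w"
      using u(3) by (simp add: F'_def)
    then show "\<bar>(f (t + v + w) - g t \<bullet> (v + w) - H (v + w) \<bullet> (v + w) / 2) - (f (t + v) - g t \<bullet> v - H v \<bullet> v / 2)
      - (H v \<bullet> w - H w \<bullet> v) / 2\<bar> \<le> e * (norm v + norm w) * norm w"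
      by (simp add: F_def)
  qed
qed

lemma peano:
  assumes e: "e > 0"
  obtains r where "r > 0" "\<And>h. norm h < r \<Longrightarrow> \<bar>f (t + h) - f t - g t \<bullet> h - H h \<bullet> h / 2\<bar> \<le> e * (norm h)\<^sup>2"
proof -
  obtain r where r: "r > 0" "\<And>v w. norm v < r \<Longrightarrow> norm (v + w) < r \<Longrightarrow>
    \<bar>(f (t + v + w) - g t \<bullet> (v + w) - H (v + w) \<bullet> (v + w) / 2) - (f (t + v) - g t \<bullet> v - H v \<bullet> v / 2)
      - (H v \<bullet> w - H w \<bullet> v) / 2\<bar> \<le> e * (norm v + norm w) * norm w" using segment_mvt[OF e] by blast
  show ?thesis
  proof (rule that[OF r(1)])
    fix h :: 'v assume "norm h < r"
    then show "\<bar>f (t + h) - f t - g t \<bullet> h - H h \<bullet> h / 2\<bar> \<le> e * (norm h)\<^sup>2"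
      using r(2)[of 0 h] r(1) by (simp add: H.zero power2_eq_square algebra_simps)
  qed
qed

lemma second_derivative_symmetric: "H h \<bullet> k = H k \<bullet> h"
proof -
  define \<omega> where "\<omega> = (H h \<bullet> k - H k \<bullet> h) / 2"
  define S where "S = norm h + norm k + 1"
  have S: "S \<ge> 1" by (simp add: S_def)
  have "\<bar>\<omega>\<bar> \<le> 0 + e'" if e': "e' > 0" for e'
  proof -
    \<comment> \<open>One error \<open>e * (s * S)\<^sup>2\<close> for each ray and two for the
      connecting segment, compared with \<open>s\<^sup>2 * \<omega>\<close>, leave
      \<open>4 * e * S\<^sup>2 = e' / 2\<close>.\<close>
    define e where "e = e' / (8 * S\<^sup>2)"
    have e: "e > 0" using e' S by (simp add: e_def)
    obtain r where r: "r > 0" "\<And>v w. norm v < r \<Longrightarrow> norm (v + w) < r \<Longrightarrow>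
      \<bar>(f (t + v + w) - g t \<bullet> (v + w) - H (v + w) \<bullet> (v + w) / 2) - (f (t + v) - g t \<bullet> v - H v \<bullet> v / 2)
        - (H v \<bullet> w - H w \<bullet> v) / 2\<bar> \<le> e * (norm v + norm w) * norm w" using segment_mvt[OF e] by blast
    define s where "s = r / (2 * S)"
    have s: "s > 0" using r(1) S by (simp add: s_def)
    have sS: "s * S < r" using r(1) S by (simp add: s_def)
    define E where "E v = f (t + v) - g t \<bullet> v - H v \<bullet> v / 2" for v
    have nh: "norm (s *\<^sub>R h) \<le> s * S" "norm (s *\<^sub>R k) \<le> s * S"
      using s by (auto simp: S_def intro!: mult_left_mono)
    have nhk: "norm (s *\<^sub>R (k - h)) \<le> s * S"
      using s norm_triangle_ineq4[of k h] by (auto simp: S_def intro!: mult_left_mono)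
    have ray: "\<bar>E x - E 0\<bar> \<le> e * (s * S)\<^sup>2" if x: "norm x \<le> s * S" for x
    proof -
      have "\<bar>E x - E 0\<bar> \<le> e * (norm x * norm x)" using r(2)[of 0 x] x sS r(1) by (simp add: E_def H.zero mult.assoc)
      also have "\<dots> \<le> e * (s * S)\<^sup>2" unfolding power2_eq_square using x e by (intro mult_left_mono mult_mono) (auto intro: order_trans[OF norm_ge_zero])
      finally show ?thesis .
    qed
    have "\<bar>E (s *\<^sub>R k) - E (s *\<^sub>R h) - s\<^sup>2 * \<omega>\<bar> \<le> e * (2 * (s * S)\<^sup>2)"
    proof -
      let ?v = "s *\<^sub>R h" and ?w = "s *\<^sub>R (k - h)"
      have vw: "?v + ?w = s *\<^sub>R k" by (simp add: algebra_simps)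
      have "\<bar>E (s *\<^sub>R k) - E ?v - (H ?v \<bullet> ?w - H ?w \<bullet> ?v) / 2\<bar> \<le> e * (norm ?v + norm ?w) * norm ?w"
        using r(2)[of ?v ?w] nh sS unfolding vw add.assoc by (auto simp: E_def)
      also have "\<dots> \<le> e * (s * S + s * S) * (s * S)"
        using e nh nhk s S by (intro mult_mono add_mono mult_left_mono) auto
      finally show ?thesis
        by (simp add: H.scaleR H.diff \<omega>_def inner_diff_left inner_diff_right power2_eq_square field_simps)
    qed
    with ray[OF nh(1)] ray[OF nh(2)] have "\<bar>s\<^sup>2 * \<omega>\<bar> \<le> 4 * (e * (s * S)\<^sup>2)" by linarith
    then have "s\<^sup>2 * \<bar>\<omega>\<bar> \<le> s\<^sup>2 * (4 * e * S\<^sup>2)" by (simp add: abs_mult power_mult_distrib mult_ac)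
    then have "\<bar>\<omega>\<bar> \<le> 4 * e * S\<^sup>2" using s by simp
    also have "\<dots> = e' / 2" using S by (simp add: e_def)
    finally show ?thesis using e' by simp
  qed
  then have "\<bar>\<omega>\<bar> \<le> 0" by (rule field_le_epsilon)
  then show ?thesis by (simp add: \<omega>_def)
qed

text \<open>At a maximum the gradient vanishes and the form \<open>q\<close> is nonnegative. A null
  vector of a nonnegative symmetric form lies in the kernel of \<open>H\<close>, so bijectivity
  makes \<open>q\<close> positive definite, and its minimum on the unit sphere is the constant of
  the peak.\<close>

lemma nondegenerate_maximum_peak:
  assumes bij: "bij H" and mx: "\<And>s. f s \<le> f t"
  obtains Q c \<delta> where "peak f t 2 Q c \<delta>"
proof -
  define q where "q h = - (H h \<bullet> h) / 2" for h
  have g0: "g t = 0"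
  proof -
    have "(f has_derivative (\<lambda>h. h \<bullet> g t)) (at t)"
      using eventually_nhds_x_imp_x[OF f] by (simp add: gderiv_def)
    then have "(\<lambda>h. h \<bullet> g t) = (\<lambda>h. 0)"
      by (rule differential_zero_maxmin[of t UNIV, rotated 2]) (use mx in auto)
    then show ?thesis by (metis inner_eq_zero_iff)
  qed
  have hom: "q (s *\<^sub>R h) = s ^ 2 * q h" for s h by (simp add: q_def H.scaleR power2_eq_square)
  have q0: "0 \<le> q h" for h
  proof (rule ccontr)
    assume "\<not> 0 \<le> q h"
    then have neg: "q h < 0" by simp
    then have h: "h \<noteq> 0" by (auto simp: q_def)
    \<comment> \<open>With this error Peano's expansion still leaves a gain of half of
      \<open>- q\<close> in the direction \<open>h\<close>, contradicting maximality.\<close>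
    define e where "e = - q h / (2 * (norm h)\<^sup>2)"
    have e: "e > 0" using neg h by (simp add: e_def divide_neg_pos)
    obtain r where r: "r > 0" "\<And>h. norm h < r \<Longrightarrow> \<bar>f (t + h) - f t - g t \<bullet> h - H h \<bullet> h / 2\<bar> \<le> e * (norm h)\<^sup>2"
      using peano[OF e] by blast
    define s where "s = r / (2 * norm h)"
    have s: "s > 0" "norm (s *\<^sub>R h) < r" using r(1) h by (auto simp: s_def)
    have "\<bar>f (t + s *\<^sub>R h) - f t + q (s *\<^sub>R h)\<bar> \<le> e * (norm (s *\<^sub>R h))\<^sup>2" using r(2)[OF s(2)] g0 by (simp add: q_def)
    then have "- (s\<^sup>2 * q h) \<le> e * (norm (s *\<^sub>R h))\<^sup>2" using mx[of "t + s *\<^sub>R h"] hom[of s h] by simp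
    also have "e * (norm (s *\<^sub>R h))\<^sup>2 = s\<^sup>2 * (- q h / 2)" using h s by (simp add: e_def power_mult_distrib)
    finally have "s\<^sup>2 * (- q h) \<le> s\<^sup>2 * (- q h / 2)" by simp
    then show False using s neg by simp
  qed
  have qpos: "0 < q h" if h: "h \<noteq> 0" for h
  proof (rule ccontr)
    assume "\<not> 0 < q h"
    then have qh: "H h \<bullet> h = 0" using q0[of h] by (simp add: q_def)
    have "H h \<bullet> k = 0" for k
    proof (rule ccontr)
      assume nz: "H h \<bullet> k \<noteq> 0"
      define b where "b = H h \<bullet> k"
      define a where "a = H k \<bullet> k"
      have ineq: "2 * s * b + s\<^sup>2 * a \<le> 0" for s
        using q0[of "h + s *\<^sub>R k"] qh second_derivative_symmetric[of k h]
        by (simp add: q_def H.add H.scaleR inner_add_left inner_add_right power2_eq_square a_def b_def inner_commute algebra_simps)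
      have a: "a \<le> 0" using q0[of k] by (simp add: q_def a_def)
      \<comment> \<open>Any small multiple of \<open>b\<close> would make
        \<open>q (h + s *\<^sub>R k)\<close> negative; the denominator is positive because
        \<open>a \<le> 0\<close>, and \<open>2 * s * b + s\<^sup>2 * a\<close> becomes
        \<open>s\<^sup>2 * (2 - a)\<close>.\<close>
      define s where "s = b / (1 - a)"
      have "b = s * (1 - a)" using a by (simp add: s_def)
      then have "2 * s * b = 2 * s * (s * (1 - a))" by (rule arg_cong)
      then have "2 * s * b + s\<^sup>2 * a = s\<^sup>2 * (2 - a)"
        by (simp add: power2_eq_square algebra_simps)
      moreover have "s\<^sup>2 * (2 - a) > 0" using nz a by (intro mult_pos_pos) (auto simp: b_def s_def)
      ultimately show False using ineq[of s] by linarith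
    qed
    then have "H h = 0" by (metis inner_eq_zero_iff)
    then have "H h = H 0" by (simp add: H.zero)
    then have "h = 0" using bij by (auto simp only: bij_def dest: injD)
    with h show False by simp
  qed
  have overlap: "continuous_on UNIV q"
    unfolding q_def by (intro continuous_intros H.continuous_on) auto
  obtain c where c: "c > 0" "\<And>h. c * norm h ^ 2 \<le> q h"
  proof -
    have "(sphere 0 1 :: 'v set) \<noteq> {}" by simp
    from continuous_attains_inf[OF compact_sphere this continuous_on_subset[OF overlap]]
    obtain x where x: "x \<in> sphere 0 1" "\<And>y. y \<in> sphere 0 1 \<Longrightarrow> q x \<le> q y" by auto
    have "q x * norm h ^ 2 \<le> q h" for h
    proof (cases "h = 0")
      case False
      have "q x \<le> q (h /\<^sub>R norm h)" by (rule x(2)) (use False in simp)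
      also have "\<dots> = q h / norm h ^ 2" unfolding hom by (simp add: power_divide field_simps)
      finally show ?thesis using False by (simp add: field_simps)
    qed (simp add: q_def)
    moreover have "q x > 0" by (rule qpos) (use x in auto)
    ultimately show ?thesis using that by blast
  qed
  have "((\<lambda>h. (f t - f (t + h) - q h) / norm h ^ 2) \<longlongrightarrow> 0) (at 0)"
  proof (rule tendstoI)
    fix e :: real assume e: "e > 0"
    obtain r where r: "r > 0" "\<And>h. norm h < r \<Longrightarrow> \<bar>f (t + h) - f t - g t \<bullet> h - H h \<bullet> h / 2\<bar> \<le> e / 2 * (norm h)\<^sup>2"
      using peano[of "e / 2"] e by auto
    have "\<bar>(f t - f (t + h) - q h) / norm h ^ 2\<bar> < e" if h: "h \<noteq> 0" "norm h < r" for h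
    proof -
      have "\<bar>f t - f (t + h) - q h\<bar> \<le> e / 2 * (norm h)\<^sup>2" using r(2)[OF h(2)] g0 by (simp add: q_def abs_if split: if_splits)
      then have "\<bar>(f t - f (t + h) - q h) / norm h ^ 2\<bar> \<le> e / 2" using h by (simp add: abs_divide divide_le_eq)
      then show ?thesis using e by linarith
    qed
    then show "\<forall>\<^sub>F h in at 0. dist ((f t - f (t + h) - q h) / norm h ^ 2) 0 < e"
      unfolding eventually_at using r(1) by (auto intro!: exI[of _ r])
  qed
  from peakI[OF _ c(1) hom c(2) this] that show ?thesis by auto
qed

end

subsection \<open>Analyticity of the pressure\<close>

lemma norm_exp_diff_le:
  fixes a b :: complex
  assumes "norm a \<le> M" "norm b \<le> M"
  shows "norm (exp a - exp b) \<le> exp M * norm (a - b)"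
proof (rule field_differentiable_bound[of "cball 0 M" exp exp])
  show "(exp has_field_derivative exp z) (at z within cball 0 M)" for z :: complex
    by (rule DERIV_subset[OF DERIV_exp]) auto
  show "norm (exp z) \<le> exp M" if "z \<in> cball 0 M" for z :: complex
    using norm_exp[of z] that by (meson exp_le_cancel_iff mem_cball_0 order_trans)
qed (use assms in auto)

text \<open>The zero of the holomorphic extension at 0 has a finite order \<open>n\<close> unless
  the extension is constant. As \<open>D\<close> is nonnegative, absolute values turn the
  factorisation into a leading coefficient \<open>norm (g 0)\<close>, without discussing the parity
  of \<open>n\<close>.\<close>

lemma nonneg_analytic_leading_term:
  fixes D :: "real \<Rightarrow> real"
  assumes H: "H holomorphic_on ball 0 \<delta>" "\<delta> > 0" and D: "\<And>x. 0 \<le> D x" "D 0 = 0"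
    and HD: "\<And>x. \<bar>x\<bar> < \<delta> \<Longrightarrow> H (complex_of_real x) = complex_of_real (D x)"
  shows "(\<forall>x. \<bar>x\<bar> < \<delta> \<longrightarrow> D x = 0) \<or> (\<exists>k c. k \<ge> 1 \<and> c > 0 \<and> ((\<lambda>x. D x / \<bar>x\<bar> ^ k) \<longlongrightarrow> c) (at 0))"
proof (cases "H constant_on ball 0 \<delta>")
  case True
  then obtain z where z: "\<And>w. w \<in> ball 0 \<delta> \<Longrightarrow> H w = z" by (auto simp: constant_on_def)
  have "complex_of_real (D x) = complex_of_real (D 0)" if "\<bar>x\<bar> < \<delta>" for x
    using HD[OF that] HD[of 0] z[of "complex_of_real x"] z[of 0] that H(2) by simp
  then show ?thesis using D(2) by (simp del: of_real_0)
next
  case False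
  have H0: "H 0 = 0" using HD[of 0] H(2) D(2) by simp
  have c0: "(0::complex) \<in> ball 0 \<delta>" using H(2) by simp
  obtain g r n where g: "0 < n" "0 < r" "ball (0::complex) r \<subseteq> ball 0 \<delta>" "g holomorphic_on ball 0 r"
    "\<And>w. w \<in> ball 0 r \<Longrightarrow> H w = (w - 0) ^ n * g w" "\<And>w. w \<in> ball 0 r \<Longrightarrow> g w \<noteq> 0"
  proof (rule holomorphic_factor_zero_nonconstant[OF H(1) open_ball connected_ball c0 H0 False])
    fix g r n
    assume A: "0 < n" "0 < r" "ball (0::complex) r \<subseteq> ball 0 \<delta>" "g holomorphic_on ball 0 r"
      "\<And>w. w \<in> ball 0 r \<Longrightarrow> H w = (w - 0) ^ n * g w" "\<And>w. w \<in> ball 0 r \<Longrightarrow> g w \<noteq> 0"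
    show thesis by (rule that[OF A(1-4)]) (rule A(5), assumption, rule A(6), assumption)
  qed
  have "isCont g 0"
    using holomorphic_on_imp_continuous_on[OF g(4)] g(2) by (simp add: continuous_on_eq_continuous_at)
  then have "((\<lambda>x. norm (g (complex_of_real x))) \<longlongrightarrow> norm (g 0)) (at 0)"
    by (intro tendsto_norm isCont_tendsto_compose[of 0 g]) (auto intro!: tendsto_eq_intros)
  moreover have "\<forall>\<^sub>F x in at 0. norm (g (complex_of_real x)) = D x / \<bar>x\<bar> ^ n"
  proof -
    have "norm (g (complex_of_real x)) = D x / \<bar>x\<bar> ^ n" if x: "x \<noteq> 0" "\<bar>x\<bar> < r" for x
    proof -
      have mem: "complex_of_real x \<in> ball 0 r" using x by simp
      have lt: "\<bar>x\<bar> < \<delta>" using subsetD[OF g(3) mem] by simp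
      have "complex_of_real (D x) = complex_of_real x ^ n * g (complex_of_real x)"
        using HD[OF lt] g(5)[OF mem] by simp
      then have "norm (complex_of_real (D x)) = norm (complex_of_real x ^ n * g (complex_of_real x))" by simp
      then have "D x = \<bar>x\<bar> ^ n * norm (g (complex_of_real x))" using D(1)[of x] by (simp add: norm_mult norm_power)
      then show ?thesis using x by simp
    qed
    then show ?thesis unfolding eventually_at using g(2) by (auto intro!: exI[of _ r] simp: dist_real_def)
  qed
  ultimately have "((\<lambda>x. D x / \<bar>x\<bar> ^ n) \<longlongrightarrow> norm (g 0)) (at 0)" by (rule Lim_transform_eventually)
  moreover have "norm (g 0) > 0" using g(6)[of 0] g(2) by simp
  ultimately show ?thesis using g(1) by (intro disjI2 exI[of _ n] exI[of _ "norm (g 0)"]) auto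
qed

context full_shift
begin

text \<open>The exponential series is integrated term by term, with the majorant
  \<open>C * exp (A * norm w)\<close>, and yields a power series in \<open>w\<close>.\<close>

lemma holomorphic_exp_integral:
  fixes S :: "(nat \<Rightarrow> 'a) \<Rightarrow> real" and c :: "(nat \<Rightarrow> 'a) \<Rightarrow> real"
  assumes [measurable]: "S \<in> borel_measurable borel" "c \<in> borel_measurable borel"
    and A: "\<And>x. \<bar>S x\<bar> \<le> A" and C: "\<And>x. \<bar>c x\<bar> \<le> C"
  shows "(\<lambda>w. \<integral>x. c x *\<^sub>R exp (w * complex_of_real (S x)) \<partial>Pr) holomorphic_on ball 0 r"
proof (rule power_series_holomorphic)
  fix w :: complex assume "w \<in> ball 0 r"
  define u where "u n x = c x *\<^sub>R (complex_of_real (S x) ^ n /\<^sub>R fact n)" for n x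
  have A0: "A \<ge> 0" using order_trans[OF abs_ge_zero A] .
  have [measurable]: "u n \<in> borel_measurable borel" for n unfolding u_def by measurable
  have iu: "integrable Pr (u n)" for n
  proof (rule integrable_bounded_Pr)
    show "norm (u n x) \<le> C * (A ^ n / fact n)" for x
      unfolding u_def norm_scaleR using order_trans[OF abs_ge_zero C] A[of x]
      by (intro mult_mono C) (auto simp: norm_power divide_inverse mult.commute intro!: mult_right_mono power_mono)
  qed simp
  show "(\<lambda>n. (\<integral>x. u n x \<partial>Pr) * (w - 0) ^ n) sums (\<integral>x. c x *\<^sub>R exp (w * complex_of_real (S x)) \<partial>Pr)"
    unfolding sums_def
  proof -
    define P where "P N x = (\<Sum>n<N. u n x * w ^ n)" for N x
    have [measurable]: "P N \<in> borel_measurable borel" for N unfolding P_def by measurable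
    have "(\<lambda>N. \<integral>x. P N x \<partial>Pr) \<longlonglongrightarrow> (\<integral>x. c x *\<^sub>R exp (w * complex_of_real (S x)) \<partial>Pr)"
    proof (rule integral_dominated_convergence[where w = "\<lambda>_. C * exp (A * norm w)"])
      have un: "u n x * w ^ n = c x *\<^sub>R ((w * complex_of_real (S x)) ^ n /\<^sub>R fact n)" for n x
        by (simp add: u_def power_mult_distrib mult.commute)
      have "(\<lambda>N. P N x) \<longlonglongrightarrow> c x *\<^sub>R exp (w * complex_of_real (S x))" for x
      proof -
        have "(\<lambda>n. (w * complex_of_real (S x)) ^ n /\<^sub>R fact n) sums exp (w * complex_of_real (S x))" by (rule exp_converges)
        from sums_scaleR_right[OF this, of "c x"] show ?thesis unfolding P_def un sums_def .
      qed
      then show "AE x in Pr. (\<lambda>N. P N x) \<longlonglongrightarrow> c x *\<^sub>R exp (w * complex_of_real (S x))" by simp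
      have "norm (P N x) \<le> C * exp (A * norm w)" for N x
      proof -
        have "norm (P N x) \<le> (\<Sum>n<N. norm (u n x * w ^ n))" unfolding P_def by (rule norm_sum)
        also have "\<dots> \<le> (\<Sum>n<N. C * ((A * norm w) ^ n /\<^sub>R fact n))"
        proof (rule sum_mono)
          fix n
          have "norm (w * complex_of_real (S x)) \<le> A * norm w"
            using mult_left_mono[OF A[of x], of "norm w"] by (simp add: norm_mult mult.commute)
          then have "norm ((w * complex_of_real (S x)) ^ n) \<le> (A * norm w) ^ n"
            unfolding norm_power by (intro power_mono) auto
          then have "norm ((w * complex_of_real (S x)) ^ n /\<^sub>R fact n) \<le> (A * norm w) ^ n /\<^sub>R fact n"
            by (simp add: divide_right_mono field_simps)
          then show "norm (u n x * w ^ n) \<le> C * ((A * norm w) ^ n /\<^sub>R fact n)"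
            unfolding un norm_scaleR[of "c x"] using order_trans[OF abs_ge_zero C] by (intro mult_mono C) auto
        qed
        also have "\<dots> = C * (\<Sum>n<N. (A * norm w) ^ n /\<^sub>R fact n)" by (simp add: sum_distrib_left)
        also have "\<dots> \<le> C * exp (A * norm w)"
        proof (rule mult_left_mono)
          show "(\<Sum>n<N. (A * norm w) ^ n /\<^sub>R fact n) \<le> exp (A * norm w)"
            unfolding exp_def using A0 by (intro sum_le_suminf summable_exp_generic) auto
        qed (use order_trans[OF abs_ge_zero C] in auto)
        finally show ?thesis .
      qed
      then show "AE x in Pr. norm (P N x) \<le> C * exp (A * norm w)" for N by simp
    qed auto
    moreover have "(\<integral>x. P N x \<partial>Pr) = (\<Sum>n<N. (\<integral>x. u n x \<partial>Pr) * (w - 0) ^ n)" for N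
      unfolding P_def using iu by (subst Bochner_Integration.integral_sum) auto
    ultimately show "(\<lambda>N. \<Sum>n<N. (\<integral>x. u n x \<partial>Pr) * (w - 0) ^ n) \<longlonglongrightarrow> (\<integral>x. c x *\<^sub>R exp (w * complex_of_real (S x)) \<partial>Pr)" by simp
  qed
qed

context
  fixes l :: real and \<phi> :: "(nat \<Rightarrow> 'a) \<Rightarrow> real"
  assumes l: "0 \<le> l" and \<phi>: "lip l \<phi>"
begin

text \<open>The set of \<open>f\<close> with \<open>trunc_lip K (\<epsilon> * norm (f x\<^sub>0)) f\<close> is a complex cone which every averaging operator
  maps well inside itself, hence also its small complex perturbations: this keeps the perturbed
  iterates away from \<open>0\<close>.\<close>

definition cone_aperture :: real where "cone_aperture = (1 - contr_rate l) / 4"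

lemma cone_aperture: "0 < cone_aperture" "cone_aperture < 1 / 4" "contr_rate l = 1 - 4 * cone_aperture"
  using contr_rate[of l] by (auto simp: cone_aperture_def field_simps)

text \<open>With \<open>e\<close> the aperture and \<open>N = norm (f x0)\<close>, multiplying by
  \<open>E\<close> enlarges the constant of \<open>f\<close> from \<open>e * N\<close> to at most
  \<open>N * (e + e\<^sup>2 * (1 + 2 * e))\<close>, while the value at \<open>x0\<close> stays at
  least \<open>N * (1 - e - e\<^sup>2 * (1 + e))\<close>. The contraction rate
  \<open>1 - 4 * e\<close> compensates both losses. The last conclusion keeps the ratio away from
  the branch cut of the logarithm.\<close>

lemma complex_cone_step:
  fixes f E :: "(nat \<Rightarrow> 'a) \<Rightarrow> complex" and n :: nat
  defines "F \<equiv> \<lambda>x. \<integral>\<omega>. branch_weight n (block_len l) \<phi> \<omega> x *\<^sub>R (E (comb_seq (block_len l) \<omega> x) * f (comb_seq (block_len l) \<omega> x)) \<partial>Pr"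
  assumes f: "continuous_on UNIV f" "trunc_lip (metric_scale l) (cone_aperture * norm (f x0)) f" "f x0 \<noteq> 0"
    and E: "continuous_on UNIV E" "trunc_lip (metric_scale l) (cone_aperture\<^sup>2) E" "\<And>x. norm (E x - 1) \<le> cone_aperture\<^sup>2"
  shows "trunc_lip (metric_scale l) (cone_aperture * norm (F x0)) F" "F x0 \<noteq> 0" "norm (F x0 / f x0 - 1) < 1 / 2"
proof -
  define N where "N = norm (f x0)"
  define e where "e = cone_aperture"
  have e: "0 < e" "e < 1 / 4" using cone_aperture by (auto simp: e_def)
  have N: "N > 0" using f(3) by (simp add: N_def)
  have K: "metric_scale l \<ge> 1" by (rule metric_scale_ge_1[OF l])
  have osc: "norm (f x - f y) \<le> e * N" for x y
    by (rule trunc_lip_osc[OF f(2)[folded N_def e_def]]) (use e N in simp)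
  have fb: "norm (f x) \<le> (1 + e) * N" for x
    using norm_triangle_sub[of "f x" "f x0"] osc[of x x0] by (simp add: N_def algebra_simps)
  have cEf: "continuous_on UNIV (\<lambda>x. E x * f x)" by (intro continuous_intros E f)
  have e2: "e\<^sup>2 \<ge> 0" by simp
  define c where "c = N * (e + e\<^sup>2 * (1 + 2 * e))"
  have c0: "c \<ge> 0" unfolding c_def using N e by (intro mult_nonneg_nonneg add_nonneg_nonneg) auto
  have dEf: "trunc_lip (metric_scale l) c (\<lambda>x. E x * f x)"
    unfolding trunc_lip_def
  proof (intro allI)
    fix x y :: "nat \<Rightarrow> 'a"
    define d where "d = min 1 (metric_scale l * dOmega x y)"
    have "0 \<le> metric_scale l * dOmega x y" using K by (intro mult_nonneg_nonneg) auto
    then have d: "d \<ge> 0" by (simp add: d_def)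
    have eq: "E x * f x - E y * f y = (f x - f y) + ((E x - 1) * (f x - f y) + (E x - E y) * f y)"
      by (simp add: algebra_simps)
    have "norm ((E x - 1) * (f x - f y) + (E x - E y) * f y) \<le> norm (E x - 1) * norm (f x - f y) + norm (E x - E y) * norm (f y)"
      using norm_triangle_ineq[of "(E x - 1) * (f x - f y)" "(E x - E y) * f y"] by (simp only: norm_mult)
    then have "norm (E x * f x - E y * f y) \<le> norm (f x - f y) + (norm (E x - 1) * norm (f x - f y) + norm (E x - E y) * norm (f y))"
      unfolding eq by (rule order_trans[OF norm_triangle_ineq add_left_mono])
    also have "\<dots> \<le> e * N * d + (e\<^sup>2 * (e * N * d) + (e\<^sup>2 * d) * ((1 + e) * N))"
    proof (intro add_mono mult_mono fb)
      show "norm (f x - f y) \<le> e * N * d" using f(2) by (simp add: trunc_lip_def d_def e_def N_def)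
      then show "norm (f x - f y) \<le> e * N * d" .
      show "norm (E x - 1) \<le> e\<^sup>2" using E(3) by (simp add: e_def)
      show "norm (E x - E y) \<le> e\<^sup>2 * d" using E(2) by (simp add: trunc_lip_def d_def e_def)
    qed (use d in auto)
    also have "\<dots> = c * d" by (simp add: c_def algebra_simps)
    finally show "norm (E x * f x - E y * f y) \<le> c * min 1 (metric_scale l * dOmega x y)" by (simp add: d_def)
  qed
  have F1: "trunc_lip (metric_scale l) (contr_rate l * c) F"
    unfolding F_def by (rule average_contraction[OF l \<phi> cEf dEf c0])
  have "norm (E z * f z - f x0) \<le> e\<^sup>2 * ((1 + e) * N) + e * N" for z
  proof -
    have eq: "E z * f z - f x0 = (E z - 1) * f z + (f z - f x0)" by (simp add: algebra_simps)
    have "norm (E z * f z - f x0) \<le> norm (E z - 1) * norm (f z) + norm (f z - f x0)"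
      unfolding eq using norm_triangle_ineq[of "(E z - 1) * f z" "f z - f x0"] by (simp only: norm_mult)
    also have "\<dots> \<le> e\<^sup>2 * ((1 + e) * N) + e * N"
      by (intro add_mono mult_mono fb osc) (use E(3) in \<open>auto simp: e_def\<close>)
    finally show ?thesis .
  qed
  then have F2: "norm (F x0 - f x0) \<le> e\<^sup>2 * ((1 + e) * N) + e * N"
    unfolding F_def by (intro average_bound[OF l \<phi> cEf])
  have small: "e\<^sup>2 * (1 + e) + e < 1 / 2"
  proof -
    have "e\<^sup>2 * (1 + e) \<le> (1/4) * (1/4) * (1 + 1/4)" unfolding power2_eq_square using e by (intro mult_mono) auto
    then show ?thesis using e by simp
  qed
  have F3: "N * (1 - (e\<^sup>2 * (1 + e) + e)) \<le> norm (F x0)"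
    using F2 norm_triangle_ineq2[of "f x0" "F x0"] by (simp add: N_def norm_minus_commute algebra_simps)
  have "0 < N * (1 - (e\<^sup>2 * (1 + e) + e))" using N small by (intro mult_pos_pos) auto
  then show nz: "F x0 \<noteq> 0" using F3 by auto
  have "contr_rate l * c \<le> cone_aperture * norm (F x0)"
  proof -
    have "contr_rate l * c = N * ((1 - 4 * e) * (e + e\<^sup>2 * (1 + 2 * e)))" using cone_aperture(3) by (simp add: c_def e_def)
    also have "\<dots> \<le> N * (e * (1 - (e\<^sup>2 * (1 + e) + e)))"
    proof (rule mult_left_mono)
      have "e * (1 - (e\<^sup>2 * (1 + e) + e)) - (1 - 4 * e) * (e + e\<^sup>2 * (1 + 2 * e)) = 2 * e\<^sup>2 + e ^ 3 + 7 * e ^ 4"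
        by (simp add: algebra_simps power2_eq_square power3_eq_cube power4_eq_xxxx)
      moreover have "0 \<le> 2 * e\<^sup>2 + e ^ 3 + 7 * e ^ 4" using e by simp
      ultimately show "(1 - 4 * e) * (e + e\<^sup>2 * (1 + 2 * e)) \<le> e * (1 - (e\<^sup>2 * (1 + e) + e))" by linarith
    qed (use N in simp)
    also have "\<dots> = e * (N * (1 - (e\<^sup>2 * (1 + e) + e)))" by simp
    also have "\<dots> \<le> e * norm (F x0)" by (rule mult_left_mono[OF F3]) (use e in simp)
    finally show ?thesis by (simp add: e_def)
  qed
  then show "trunc_lip (metric_scale l) (cone_aperture * norm (F x0)) F" by (rule trunc_lip_mono[OF F1]) (use K in simp)
  have "F x0 / f x0 - 1 = (F x0 - f x0) / f x0" using f(3) by (simp add: diff_divide_distrib)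
  then have "norm (F x0 / f x0 - 1) = norm (F x0 - f x0) / N" by (simp add: norm_divide N_def)
  also have "\<dots> \<le> (e\<^sup>2 * ((1 + e) * N) + e * N) / N" by (rule divide_right_mono[OF F2]) (use N in simp)
  also have "\<dots> = e\<^sup>2 * (1 + e) + e" using N by (simp add: field_simps)
  finally show "norm (F x0 / f x0 - 1) < 1 / 2" using small by simp
qed

lemma ln_iter_one_limit: "(\<lambda>n. ln (iter_one n \<phi> x) / real n) \<longlonglongrightarrow> ln (growth \<phi>)"
proof -
  have r: "growth \<phi> > 0" by (rule growth_pos[OF l \<phi>])
  have b: "\<bar>ln (iter_one n \<phi> x) - real n * ln (growth \<phi>)\<bar> \<le> l * diam" for n
  proof -
    have h: "iter_one n \<phi> x > 0" by (rule iter_one_pos[OF l \<phi>])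
    have "ln (iter_one n \<phi> x) \<le> ln (exp (l * diam) * growth \<phi> ^ n)"
      using iter_one_growth_bounds(1)[OF l \<phi>, of n x] h by (intro ln_mono) auto
    moreover have "ln (growth \<phi> ^ n) \<le> ln (exp (l * diam) * iter_one n \<phi> x)"
      using iter_one_growth_bounds(2)[OF l \<phi>, of n x] r by (intro ln_mono) auto
    ultimately show ?thesis using r h by (simp add: ln_mult ln_realpow abs_le_iff)
  qed
  have "(\<lambda>n. ln (iter_one n \<phi> x) / real n - ln (growth \<phi>)) \<longlonglongrightarrow> 0"
  proof (rule Lim_null_comparison)
    show "(\<lambda>n. l * diam / real n) \<longlonglongrightarrow> 0" by (rule lim_const_over_n)
    show "\<forall>\<^sub>F n in sequentially. norm (ln (iter_one n \<phi> x) / real n - ln (growth \<phi>)) \<le> l * diam / real n"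
      using eventually_gt_at_top[of 0]
    proof eventually_elim
      case (elim n)
      have "ln (iter_one n \<phi> x) / real n - ln (growth \<phi>) = (ln (iter_one n \<phi> x) - real n * ln (growth \<phi>)) / real n"
        using elim by (simp add: diff_divide_distrib)
      then show ?case using b[of n] elim by (simp add: abs_divide divide_right_mono)
    qed
  qed
  then show ?thesis by (simp add: LIM_zero_iff)
qed

end

text \<open>The logarithm of the perturbed iterate is built from the ratios of consecutive iterates:
  each lies within \<open>1 / 2\<close> of 1, so its principal logarithm is holomorphic and bounded
  by 1. Dividing their sum by the number of letters gives a bounded family, whose values on the real
  axis are differences of finite-volume pressures.\<close>

lemma analytic_pressure:
  fixes l l' X :: real and \<phi> \<kappa> :: "(nat \<Rightarrow> 'a) \<Rightarrow> real"
  assumes l: "0 \<le> l" and \<phi>: "lip l \<phi>" and l': "0 \<le> l'" and \<kappa>: "lip l' \<kappa>"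
  obtains \<delta> F where "\<delta> > 0" "F holomorphic_on ball 0 \<delta>"
    "\<And>x. \<bar>x\<bar> < \<delta> \<Longrightarrow> F (complex_of_real x) = complex_of_real (ln (growth (\<lambda>\<omega>. \<phi> \<omega> + x * \<kappa> \<omega>)) - ln (growth \<phi>))"
proof -
  define m where "m = block_len l"
  define x0 :: "nat \<Rightarrow> 'a" where "x0 = undefined"
  have m1: "m \<ge> 1" using block_len(1) by (simp add: m_def)
  note c\<phi> = lip_imp_continuous[OF \<phi>] and c\<kappa> = lip_imp_continuous[OF \<kappa>]
  have h: "iter_one n \<phi> x > 0" for n x by (rule iter_one_pos[OF l \<phi>])
  define S where "S n = birkhoff_sum n \<kappa>" for n
  have cS: "continuous_on UNIV (S n)" for n unfolding S_def by (rule continuous_on_birkhoff_sum[OF c\<kappa>])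
  define EE where "EE n w x = exp (w * complex_of_real (S n x))" for n w x
  have cE: "continuous_on UNIV (EE n w)" for n w unfolding EE_def by (intro continuous_intros cS)
  define G where "G k w = norm_iter (k * m) \<phi> (EE (k * m) w)" for k w
  have cG: "continuous_on UNIV (G k w)" for k w unfolding G_def by (rule cont_norm_iter[OF l \<phi> cE])
  \<comment> \<open>The cocycle property of Birkhoff sums lets one more block act as multiplication
    by \<open>EE m w\<close> followed by averaging, the form treated by
    \<open>complex_cone_step\<close>.\<close>
  have rec: "G (Suc k) w = (\<lambda>x. \<integral>\<omega>. branch_weight (k * m) m \<phi> \<omega> x *\<^sub>R (EE m w (comb_seq m \<omega> x) * G k w (comb_seq m \<omega> x)) \<partial>Pr)" for k w
  proof
    fix x
    have "norm_iter (k * m) \<phi> (EE (k * m + m) w) y = EE m w y * G k w y" for y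
    proof -
      have "EE (k * m + m) w (comb_seq (k * m) \<omega> y) = EE m w y * EE (k * m) w (comb_seq (k * m) \<omega> y)" for \<omega>
        by (simp add: EE_def S_def birkhoff_sum_add distrib_left exp_add mult.commute)
      then have "iter_transfer (k * m) \<phi> (EE (k * m + m) w) y = EE m w y * iter_transfer (k * m) \<phi> (EE (k * m) w) y"
        unfolding iter_transfer_def by (subst integral_mult_right_zero[symmetric]) simp
      then show ?thesis by (simp add: norm_iter_def G_def)
    qed
    then have U: "norm_iter (k * m) \<phi> (EE (k * m + m) w) = (\<lambda>y. EE m w y * G k w y)" by (rule ext)
    have "Suc k * m = k * m + m" by simp
    then show "G (Suc k) w x = (\<integral>\<omega>. branch_weight (k * m) m \<phi> \<omega> x *\<^sub>R (EE m w (comb_seq m \<omega> x) * G k w (comb_seq m \<omega> x)) \<partial>Pr)"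
      using norm_iter_add[OF l \<phi> cE, of "k * m" m "k * m + m" w x] unfolding U by (simp only: G_def)
  qed
  obtain a where a: "a \<ge> 0" "lip a (S m)" using lip_birkhoff_sum[OF \<kappa>, of m] unfolding S_def .
  obtain A where A: "A > 0" "\<And>x. norm (S m x) \<le> A" using bounded_continuous[OF cS] by metis
  define \<epsilon> where "\<epsilon> = cone_aperture l"
  have \<epsilon>: "\<epsilon> > 0" using cone_aperture[OF l \<phi>] by (simp add: \<epsilon>_def)
  \<comment> \<open>Values of \<open>EE m w\<close> differ by at most \<open>exp A * norm w\<close>
    times the variation of \<open>S m\<close>, which is bounded by \<open>2 * A\<close> and by
    \<open>a * dOmega x y\<close>; both products have to stay below
    \<open>\<epsilon>\<^sup>2\<close>. The minimum with 1 keeps the exponents bounded by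
    \<open>A\<close>.\<close>
  define \<delta> where "\<delta> = min 1 (\<epsilon>\<^sup>2 / (exp A * (2 * A + a)))"
  have \<delta>: "\<delta> > 0" using \<epsilon> A a by (simp add: \<delta>_def add_pos_nonneg)
  have wE: "trunc_lip (metric_scale l) (\<epsilon>\<^sup>2) (EE m w)" "norm (EE m w x - 1) \<le> \<epsilon>\<^sup>2" if w: "norm w < \<delta>" for w x
  proof -
    have nw: "norm (w * complex_of_real (S m x)) \<le> A" for x
    proof -
      have "norm w * \<bar>S m x\<bar> \<le> 1 * A" using w A(2)[of x] by (intro mult_mono) (auto simp: \<delta>_def)
      then show ?thesis by (simp add: norm_mult)
    qed
    have pos: "exp A * (2 * A + a) > 0" using A a by (simp add: add_pos_nonneg)
    have "norm w < \<epsilon>\<^sup>2 / (exp A * (2 * A + a))" using w by (simp add: \<delta>_def)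
    then have "norm w * (exp A * (2 * A + a)) < \<epsilon>\<^sup>2" using pos by (simp add: less_divide_eq)
    then have key: "exp A * norm w * (2 * A) \<le> \<epsilon>\<^sup>2" "exp A * norm w * a \<le> \<epsilon>\<^sup>2"
    proof -
      have z: "0 \<le> exp A * norm w * a" "0 \<le> exp A * norm w * (2 * A)" using A a by auto
      have "norm w * (exp A * (2 * A + a)) = exp A * norm w * (2 * A) + exp A * norm w * a" by (simp add: algebra_simps)
      with z \<open>norm w * (exp A * (2 * A + a)) < \<epsilon>\<^sup>2\<close> show "exp A * norm w * (2 * A) \<le> \<epsilon>\<^sup>2" "exp A * norm w * a \<le> \<epsilon>\<^sup>2" by linarith+
    qed
    have d: "norm (EE m w x - EE m w y) \<le> exp A * norm w * \<bar>S m x - S m y\<bar>" for x y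
    proof -
      have "norm (EE m w x - EE m w y) \<le> exp A * norm (w * complex_of_real (S m x) - w * complex_of_real (S m y))"
        unfolding EE_def by (rule norm_exp_diff_le[OF nw nw])
      also have "w * complex_of_real (S m x) - w * complex_of_real (S m y) = w * complex_of_real (S m x - S m y)"
        by (simp add: algebra_simps)
      finally show ?thesis by (simp only: norm_mult norm_of_real mult.assoc)
    qed
    show "trunc_lip (metric_scale l) (\<epsilon>\<^sup>2) (EE m w)"
    proof (rule trunc_lipI)
      fix x y
      have "\<bar>S m x - S m y\<bar> \<le> 2 * A" using A(2)[of x] A(2)[of y] by simp
      then have "exp A * norm w * \<bar>S m x - S m y\<bar> \<le> exp A * norm w * (2 * A)" by (intro mult_left_mono) auto
      then show "norm (EE m w x - EE m w y) \<le> \<epsilon>\<^sup>2" using d[of x y] key by linarith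
      have "\<bar>S m x - S m y\<bar> \<le> a * dOmega x y" using a(2) by (simp add: lip_def)
      then have "exp A * norm w * \<bar>S m x - S m y\<bar> \<le> exp A * norm w * (a * dOmega x y)" by (intro mult_left_mono) auto
      also have "\<dots> = (exp A * norm w * a) * dOmega x y" by simp
      also have "\<dots> \<le> \<epsilon>\<^sup>2 * metric_scale l * dOmega x y"
      proof (rule mult_right_mono)
        have "exp A * norm w * a \<le> \<epsilon>\<^sup>2 * 1" using key by simp
        also have "\<dots> \<le> \<epsilon>\<^sup>2 * metric_scale l" using metric_scale_ge_1[OF l] by (intro mult_left_mono) auto
        finally show "exp A * norm w * a \<le> \<epsilon>\<^sup>2 * metric_scale l" .
      qed simp
      finally show "norm (EE m w x - EE m w y) \<le> \<epsilon>\<^sup>2 * metric_scale l * dOmega x y" using d[of x y] by linarith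
    qed
    have "norm (EE m w x - exp 0) \<le> exp A * norm (w * complex_of_real (S m x) - 0)"
      unfolding EE_def by (rule norm_exp_diff_le[OF nw]) (use A in simp)
    also have "\<dots> = exp A * norm w * \<bar>S m x\<bar>" by (simp add: norm_mult)
    also have "\<dots> \<le> exp A * norm w * (2 * A)" using A(2)[of x] A(1) by (intro mult_left_mono) auto
    finally show "norm (EE m w x - 1) \<le> \<epsilon>\<^sup>2" using key by simp
  qed
  have cone: "trunc_lip (metric_scale l) (\<epsilon> * norm (G k w x0)) (G k w) \<and> G k w x0 \<noteq> 0" if w: "norm w < \<delta>" for k w
  proof (induction k)
    case 0
    have "G 0 w = (\<lambda>_. 1)" by (simp add: G_def norm_iter_0[OF l \<phi>] EE_def[abs_def] S_def)
    then show ?case using \<epsilon> metric_scale_ge_1[OF l] by (simp add: trunc_lip_def)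
  next
    case (Suc k)
    from complex_cone_step(1,2)[OF l \<phi> cG[of k w] _ _ cE[of m w] wE(1)[OF w, unfolded \<epsilon>_def] wE(2)[OF w, unfolded \<epsilon>_def], where n = "k * m"] Suc
    show ?case unfolding rec \<epsilon>_def m_def by blast
  qed
  have ratio: "norm (G (Suc k) w x0 / G k w x0 - 1) < 1 / 2" if w: "norm w < \<delta>" for k w
    using complex_cone_step(3)[OF l \<phi> cG[of k w] _ _ cE[of m w] wE(1)[OF w, unfolded \<epsilon>_def] wE(2)[OF w, unfolded \<epsilon>_def], where n = "k * m"]
      cone[OF w, of k] unfolding rec \<epsilon>_def m_def by blast
  have hol: "(\<lambda>w. G k w x0) holomorphic_on ball 0 \<delta>" for k
  proof -
    let ?n = "k * m"
    have cw: "continuous_on UNIV (\<lambda>z. exp (birkhoff_sum ?n \<phi> z))"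
      by (intro continuous_intros continuous_on_birkhoff_sum c\<phi>)
    obtain C where C: "\<And>z. norm (exp (birkhoff_sum ?n \<phi> z)) \<le> C" using bounded_continuous[OF cw] by metis
    obtain A' where A': "\<And>z. norm (S ?n z) \<le> A'" using bounded_continuous[OF cS] by metis
    have [measurable]: "(\<lambda>z. exp (birkhoff_sum ?n \<phi> z)) \<in> borel_measurable borel" "S ?n \<in> borel_measurable borel"
      using cw cS by (auto intro: borel_measurable_cont)
    have "(\<lambda>w. \<integral>\<omega>. exp (birkhoff_sum ?n \<phi> (comb_seq ?n \<omega> x0)) *\<^sub>R exp (w * complex_of_real (S ?n (comb_seq ?n \<omega> x0))) \<partial>Pr)
        holomorphic_on ball 0 \<delta>"
      by (rule holomorphic_exp_integral[where A = A' and C = C]) (use A' C in auto)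
    then have "(\<lambda>w. iter_transfer ?n \<phi> (EE ?n w) x0) holomorphic_on ball 0 \<delta>" by (simp add: iter_transfer_def EE_def)
    then have "(\<lambda>w. complex_of_real (inverse (iter_one ?n \<phi> x0)) * iter_transfer ?n \<phi> (EE ?n w) x0) holomorphic_on ball 0 \<delta>"
      by (intro holomorphic_intros)
    then show ?thesis by (simp add: G_def norm_iter_def scaleR_conv_of_real)
  qed
  \<comment> \<open>Summing logarithms of ratios avoids a logarithm of \<open>G k w x0\<close>
    itself, whose argument may wind around 0.\<close>
  define F where "F k w = (\<Sum>j<k. Ln (G (Suc j) w x0 / G j w x0)) / of_nat (k * m)" for k w
  have Fhol: "F k holomorphic_on ball 0 \<delta>" for k
    unfolding F_def
  proof (cases "k = 0")
    case False
    show "(\<lambda>w. (\<Sum>j<k. Ln (G (Suc j) w x0 / G j w x0)) / of_nat (k * m)) holomorphic_on ball 0 \<delta>"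
    proof (intro holomorphic_intros hol)
      show "of_nat (k * m) \<noteq> (0 :: complex)" using False m1 by simp
      show "G j w x0 \<noteq> 0" if "w \<in> ball 0 \<delta>" for j w using cone[of w j] that by simp
      fix j w assume w: "w \<in> ball (0 :: complex) \<delta>"
      have "norm (G (Suc j) w x0 / G j w x0 - 1) < 1 / 2" using ratio w by simp
      then have "Re (G (Suc j) w x0 / G j w x0) > 0"
        using abs_Re_le_cmod[of "G (Suc j) w x0 / G j w x0 - 1"] by (simp add: abs_if split: if_splits)
      then show "G (Suc j) w x0 / G j w x0 \<notin> \<real>\<^sub>\<le>\<^sub>0" by (auto simp: complex_nonpos_Reals_iff)
    qed
  qed simp
  have Fb: "norm (F k w) \<le> 1" if w: "w \<in> ball 0 \<delta>" for k w
  proof (cases "k = 0")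
    case False
    have "norm (Ln (G (Suc j) w x0 / G j w x0)) \<le> 1" for j
    proof -
      have q: "norm (G (Suc j) w x0 / G j w x0 - 1) < 1 / 2" using ratio w by simp
      from norm_Ln_le[OF q] q show ?thesis by simp
    qed
    then have "norm (\<Sum>j<k. Ln (G (Suc j) w x0 / G j w x0)) \<le> (\<Sum>j<k. 1)"
      by (intro sum_norm_le) auto
    also have "\<dots> \<le> real (k * m)"
    proof -
      have "k * 1 \<le> k * m" using m1 by (intro mult_le_mono) auto
      then have "real k \<le> real (k * m)" by (simp only: of_nat_le_iff mult_1_right)
      then show ?thesis by simp
    qed
    finally show ?thesis using False m1 by (simp add: F_def norm_divide divide_le_eq norm_mult)
  qed (simp add: F_def)
  \<comment> \<open>A subsequence is enough: on the real axis the whole sequence converges, which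
    identifies the limit there.\<close>
  obtain g r where g: "g holomorphic_on ball 0 \<delta>" "strict_mono (r :: nat \<Rightarrow> nat)"
    "\<And>x. x \<in> ball 0 \<delta> \<Longrightarrow> (\<lambda>n. F (r n) x) \<longlonglongrightarrow> g x"
  proof (rule Montel[of "ball 0 \<delta>" "{h. h holomorphic_on ball 0 \<delta> \<and> (\<forall>z\<in>ball 0 \<delta>. norm (h z) \<le> 1)}" F])
    show "\<exists>B. \<forall>h\<in>{h. h holomorphic_on ball 0 \<delta> \<and> (\<forall>z\<in>ball 0 \<delta>. norm (h z) \<le> 1)}. \<forall>z\<in>K. norm (h z) \<le> B"
      if "compact K" "K \<subseteq> ball 0 \<delta>" for K using that by (intro exI[of _ 1]) auto
  qed (use Fhol Fb in auto)
  have "g (complex_of_real x) = complex_of_real (ln (growth (\<lambda>\<omega>. \<phi> \<omega> + x * \<kappa> \<omega>)) - ln (growth \<phi>))" if x: "\<bar>x\<bar> < \<delta>" for x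
  proof (rule LIMSEQ_unique)
    define \<phi>' where "\<phi>' \<omega> = \<phi> \<omega> + x * \<kappa> \<omega>" for \<omega>
    define lx where "lx = l + \<bar>x\<bar> * l'"
    have lx: "0 \<le> lx" using l l' by (simp add: lx_def)
    have \<phi>': "lip lx \<phi>'"
      unfolding lip_def
    proof (intro allI)
      fix u v
      have "\<bar>x * \<kappa> u - x * \<kappa> v\<bar> \<le> \<bar>x\<bar> * (l' * dOmega u v)"
        using \<kappa> by (simp add: lip_def abs_mult mult_left_mono flip: right_diff_distrib)
      moreover have "\<bar>\<phi> u - \<phi> v\<bar> \<le> l * dOmega u v" using \<phi> by (simp add: lip_def)
      ultimately show "norm (\<phi>' u - \<phi>' v) \<le> lx * dOmega u v" by (simp add: \<phi>'_def lx_def algebra_simps)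
    qed
    have h': "iter_one n \<phi>' x > 0" for n x by (rule iter_one_pos[OF lx \<phi>'])
    show "(\<lambda>n. F (r n) (complex_of_real x)) \<longlonglongrightarrow> g (complex_of_real x)" by (rule g(3)) (use x in simp)
    have Gx: "G k (complex_of_real x) x0 = complex_of_real (iter_one (k * m) \<phi>' x0 / iter_one (k * m) \<phi> x0)" for k
    proof -
      have "iter_transfer (k * m) \<phi> (EE (k * m) (complex_of_real x)) x0 = complex_of_real (iter_one (k * m) \<phi>' x0)"
      proof -
        have "birkhoff_sum n \<phi>' z = birkhoff_sum n \<phi> z + x * birkhoff_sum n \<kappa> z" for n z
          by (simp add: birkhoff_sum_def \<phi>'_def sum.distrib sum_distrib_left)
        then have "exp (birkhoff_sum n \<phi> z) *\<^sub>R EE n (complex_of_real x) z = complex_of_real (exp (birkhoff_sum n \<phi>' z))" for n z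
          by (simp add: EE_def S_def scaleR_conv_of_real exp_add exp_of_real[symmetric])
        then show ?thesis by (simp add: iter_transfer_def iter_one_eq)
      qed
      then show ?thesis by (simp add: G_def norm_iter_def scaleR_conv_of_real divide_inverse mult.commute)
    qed
    have Fx: "F k (complex_of_real x) = complex_of_real ((ln (iter_one (k * m) \<phi>' x0) / real (k * m)) - (ln (iter_one (k * m) \<phi> x0) / real (k * m)))" for k
    proof -
      define q where "q j = iter_one (j * m) \<phi>' x0 / iter_one (j * m) \<phi> x0" for j
      have q: "q j > 0" for j using h h' by (simp add: q_def)
      have "Ln (G (Suc j) (complex_of_real x) x0 / G j (complex_of_real x) x0) = complex_of_real (ln (q (Suc j)) - ln (q j))" for j
      proof -
        have "G (Suc j) (complex_of_real x) x0 / G j (complex_of_real x) x0 = complex_of_real (q (Suc j) / q j)"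
          unfolding Gx q_def by simp
        moreover have "q (Suc j) / q j > 0" using q by simp
        ultimately have "Ln (G (Suc j) (complex_of_real x) x0 / G j (complex_of_real x) x0) = complex_of_real (ln (q (Suc j) / q j))"
          using Ln_of_real by metis
        then show ?thesis using q[of j] q[of "Suc j"] by (simp add: ln_div)
      qed
      \<comment> \<open>For real arguments the ratios are positive and the sum of logarithms
        telescopes.\<close>
      then have "F k (complex_of_real x) = complex_of_real ((\<Sum>j<k. ln (q (Suc j)) - ln (q j)) / real (k * m))"
        by (simp add: F_def)
      also have "(\<Sum>j<k. ln (q (Suc j)) - ln (q j)) = ln (q k) - ln (q 0)" by (rule sum_lessThan_telescope)
      also have "q 0 = 1" by (simp add: q_def)
      also have "ln (q k) = ln (iter_one (k * m) \<phi>' x0) - ln (iter_one (k * m) \<phi> x0)" unfolding q_def using h[of "k * m" x0] h'[of "k * m" x0] by (simp add: ln_div)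
      finally show ?thesis by (simp add: diff_divide_distrib)
    qed
    have sm: "filterlim (\<lambda>n. r n * m) at_top sequentially"
    proof (rule filterlim_at_top_mono[OF filterlim_subseq[OF g(2)]])
      show "\<forall>\<^sub>F n in sequentially. r n \<le> r n * m" using m1 by simp
    qed
    have "(\<lambda>n. complex_of_real ((ln (iter_one (r n * m) \<phi>' x0) / real (r n * m)) - (ln (iter_one (r n * m) \<phi> x0) / real (r n * m)))) \<longlonglongrightarrow>
      complex_of_real (ln (growth \<phi>') - ln (growth \<phi>))"
      by (intro tendsto_of_real tendsto_diff filterlim_compose[OF ln_iter_one_limit[OF lx \<phi>'] sm] filterlim_compose[OF ln_iter_one_limit[OF l \<phi>] sm])
    then show "(\<lambda>n. F (r n) (complex_of_real x)) \<longlonglongrightarrow> complex_of_real (ln (growth (\<lambda>\<omega>. \<phi> \<omega> + x * \<kappa> \<omega>)) - ln (growth \<phi>))"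
      unfolding Fx \<phi>'_def .
  qed
  then show ?thesis using that[OF \<delta> g(1)] by blast
qed

end

section \<open>Integration with respect to mixtures\<close>

lemma nn_integral_mixture:
  assumes \<nu>: "\<And>t. t \<in> T \<Longrightarrow> sets (\<nu> t) = sets (restrict_space borel \<Omega>)" and T: "finite T"
    and f: "f \<in> borel_measurable (restrict_space borel \<Omega>)"
  shows "(\<integral>\<^sup>+x. f x \<partial>mixture \<Omega> T c \<nu>) = (\<Sum>t\<in>T. ennreal (c t) * (\<integral>\<^sup>+x. f x \<partial>\<nu> t))"
proof -
  have sp: "space (restrict_space borel \<Omega>) = \<Omega>" by (simp add: space_restrict_space)
  have sa: "sigma_algebra \<Omega> (sets (restrict_space borel \<Omega>))"
    using sets.sigma_algebra_axioms[of "restrict_space borel \<Omega>"] sp by simp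
  have s: "sets (mixture \<Omega> T c \<nu>) = sets (restrict_space borel \<Omega>)"
    unfolding mixture_def using sa by (simp add: sigma_algebra.sets_measure_of_eq)
  have m: "g \<in> borel_measurable (mixture \<Omega> T c \<nu>) \<longleftrightarrow> g \<in> borel_measurable (restrict_space borel \<Omega>)"
    "t \<in> T \<Longrightarrow> g \<in> borel_measurable (\<nu> t) \<longleftrightarrow> g \<in> borel_measurable (restrict_space borel \<Omega>)" for g :: "_ \<Rightarrow> ennreal" and t
    using s \<nu> by (auto cong: measurable_cong_sets)
  show ?thesis using f
  proof (induction rule: borel_measurable_induct)
    case (cong f g)
    have "space (mixture \<Omega> T c \<nu>) = \<Omega>" using sets_eq_imp_space_eq[OF s] sp by simp
    moreover have "space (\<nu> t) = \<Omega>" if "t \<in> T" for t using sets_eq_imp_space_eq[OF \<nu>[OF that]] sp by simp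
    ultimately show ?case using cong(3,4) sp
      by (simp cong: nn_integral_cong_simp sum.cong)
  next
    case (set A)
    then show ?case using emeasure_mixture[OF \<nu>, where B = A and c = c] s \<nu> by (simp add: nn_integral_indicator)
  next
    case (mult u a)
    then show ?case using m by (simp add: nn_integral_cmult sum_distrib_left mult.left_commute)
  next
    case (add u v)
    then show ?case using m by (simp add: nn_integral_add sum.distrib distrib_left)
  next
    case (seq U)
    have "(\<integral>\<^sup>+x. (SUP i. U i) x \<partial>mixture \<Omega> T c \<nu>) = (SUP i. \<integral>\<^sup>+x. U i x \<partial>mixture \<Omega> T c \<nu>)"
      unfolding SUP_apply using seq m by (intro nn_integral_monotone_convergence_SUP) auto
    also have "\<dots> = (SUP i. \<Sum>t\<in>T. ennreal (c t) * (\<integral>\<^sup>+x. U i x \<partial>\<nu> t))" using seq by simp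
    also have "\<dots> = (\<Sum>t\<in>T. SUP i. ennreal (c t) * (\<integral>\<^sup>+x. U i x \<partial>\<nu> t))"
      by (rule ennreal_SUP_sum) (use seq in \<open>auto simp: incseq_def le_fun_def intro!: mult_left_mono nn_integral_mono\<close>)
    also have "\<dots> = (\<Sum>t\<in>T. ennreal (c t) * (\<integral>\<^sup>+x. (SUP i. U i) x \<partial>\<nu> t))"
      unfolding SUP_apply using seq m
      by (intro sum.cong refl) (simp add: SUP_mult_left_ennreal[symmetric] nn_integral_monotone_convergence_SUP)
    finally show ?case .
  qed
qed

lemma integral_mixture:
  fixes f :: "_ \<Rightarrow> real"
  assumes \<nu>: "\<And>t. t \<in> T \<Longrightarrow> sets (\<nu> t) = sets (restrict_space borel \<Omega>)" "\<And>t. t \<in> T \<Longrightarrow> prob_space (\<nu> t)"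
    and T: "finite T" and c: "\<And>t. t \<in> T \<Longrightarrow> 0 \<le> c t"
    and f: "f \<in> borel_measurable (restrict_space borel \<Omega>)" and B: "\<And>x. \<bar>f x\<bar> \<le> B"
  shows "(\<integral>x. f x \<partial>mixture \<Omega> T c \<nu>) = (\<Sum>t\<in>T. c t * (\<integral>x. f x \<partial>\<nu> t))"
proof -
  have sp: "space (restrict_space borel \<Omega>) = \<Omega>" by (simp add: space_restrict_space)
  have sa: "sigma_algebra \<Omega> (sets (restrict_space borel \<Omega>))"
    using sets.sigma_algebra_axioms[of "restrict_space borel \<Omega>"] sp by simp
  have s: "sets (mixture \<Omega> T c \<nu>) = sets (restrict_space borel \<Omega>)"
    unfolding mixture_def using sa by (simp add: sigma_algebra.sets_measure_of_eq)
  have fm: "f \<in> borel_measurable (mixture \<Omega> T c \<nu>)" using f s by (simp cong: measurable_cong_sets)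
  have f\<nu>: "f \<in> borel_measurable (\<nu> t)" if "t \<in> T" for t using f \<nu>(1)[OF that] by (simp cong: measurable_cong_sets)
  have pos: "(\<integral>\<^sup>+x. ennreal (g x) \<partial>mixture \<Omega> T c \<nu>) = ennreal (\<Sum>t\<in>T. c t * (\<integral>x. g x \<partial>\<nu> t))"
    if g: "g \<in> borel_measurable (restrict_space borel \<Omega>)" "\<And>x. 0 \<le> g x" "\<And>x. g x \<le> B" for g :: "_ \<Rightarrow> real"
  proof -
    have "(\<integral>\<^sup>+x. ennreal (g x) \<partial>\<nu> t) = ennreal (\<integral>x. g x \<partial>\<nu> t)" if t: "t \<in> T" for t
    proof (rule nn_integral_eq_integral)
      interpret prob_space "\<nu> t" by (rule \<nu>(2)[OF t])
      show "integrable (\<nu> t) g"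
        by (rule integrable_const_bound[where B = B]) (use g \<nu>(1)[OF t] in \<open>auto cong: measurable_cong_sets\<close>)
    qed (use g in simp)
    then have "(\<integral>\<^sup>+x. ennreal (g x) \<partial>mixture \<Omega> T c \<nu>) = (\<Sum>t\<in>T. ennreal (c t) * ennreal (\<integral>x. g x \<partial>\<nu> t))"
      using g(1) by (subst nn_integral_mixture[OF \<nu>(1) T]) auto
    also have "\<dots> = ennreal (\<Sum>t\<in>T. c t * (\<integral>x. g x \<partial>\<nu> t))"
      using c g(2) by (simp add: ennreal_mult[symmetric] sum_ennreal)
    finally show ?thesis .
  qed
  have B0: "0 \<le> B" using order_trans[OF abs_ge_zero B] .
  have up: "(\<integral>\<^sup>+x. ennreal (f x) \<partial>mixture \<Omega> T c \<nu>) = ennreal (\<Sum>t\<in>T. c t * (\<integral>x. max 0 (f x) \<partial>\<nu> t))"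
  proof -
    have "(\<integral>\<^sup>+x. ennreal (f x) \<partial>mixture \<Omega> T c \<nu>) = (\<integral>\<^sup>+x. ennreal (max 0 (f x)) \<partial>mixture \<Omega> T c \<nu>)"
      by (intro nn_integral_cong) (auto simp: max_def ennreal_neg)
    also have "\<dots> = ennreal (\<Sum>t\<in>T. c t * (\<integral>x. max 0 (f x) \<partial>\<nu> t))"
      by (rule pos) (use f B B0 in \<open>auto simp: abs_le_iff\<close>)
    finally show ?thesis .
  qed
  have dn: "(\<integral>\<^sup>+x. ennreal (- f x) \<partial>mixture \<Omega> T c \<nu>) = ennreal (\<Sum>t\<in>T. c t * (\<integral>x. max 0 (- f x) \<partial>\<nu> t))"
  proof -
    have "(\<integral>\<^sup>+x. ennreal (- f x) \<partial>mixture \<Omega> T c \<nu>) = (\<integral>\<^sup>+x. ennreal (max 0 (- f x)) \<partial>mixture \<Omega> T c \<nu>)"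
      by (intro nn_integral_cong) (auto simp: max_def ennreal_neg)
    also have "\<dots> = ennreal (\<Sum>t\<in>T. c t * (\<integral>x. max 0 (- f x) \<partial>\<nu> t))"
      by (rule pos) (use f B B0 in \<open>auto simp: abs_le_iff\<close>)
    finally show ?thesis .
  qed
  have nn: "0 \<le> (\<Sum>t\<in>T. c t * (\<integral>x. max 0 (g x) \<partial>\<nu> t))" for g :: "_ \<Rightarrow> real"
    using c by (intro sum_nonneg mult_nonneg_nonneg integral_nonneg_AE) auto
  have i: "integrable (mixture \<Omega> T c \<nu>) f"
    unfolding real_integrable_def using fm up dn by simp
  have "(\<integral>x. f x \<partial>mixture \<Omega> T c \<nu>) = (\<Sum>t\<in>T. c t * (\<integral>x. max 0 (f x) \<partial>\<nu> t)) - (\<Sum>t\<in>T. c t * (\<integral>x. max 0 (- f x) \<partial>\<nu> t))"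
    unfolding real_lebesgue_integral_def[OF i] up dn using nn[of f] nn[of "\<lambda>x. - f x"] by simp
  also have "\<dots> = (\<Sum>t\<in>T. c t * ((\<integral>x. max 0 (f x) \<partial>\<nu> t) - (\<integral>x. max 0 (- f x) \<partial>\<nu> t)))"
    by (simp add: sum_subtractf right_diff_distrib)
  also have "\<dots> = (\<Sum>t\<in>T. c t * (\<integral>x. f x \<partial>\<nu> t))"
  proof (intro sum.cong refl)
    fix t assume t: "t \<in> T"
    interpret prob_space "\<nu> t" by (rule \<nu>(2)[OF t])
    have "integrable (\<nu> t) (\<lambda>x. max 0 (f x))" "integrable (\<nu> t) (\<lambda>x. max 0 (- f x))"
      using f\<nu>[OF t] B B0 by (auto intro!: integrable_const_bound[where B = B] simp: abs_le_iff)
    then have "(\<integral>x. max 0 (f x) \<partial>\<nu> t) - (\<integral>x. max 0 (- f x) \<partial>\<nu> t) = (\<integral>x. max 0 (f x) - max 0 (- f x) \<partial>\<nu> t)" by simp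
    also have "\<dots> = (\<integral>x. f x \<partial>\<nu> t)" by (intro Bochner_Integration.integral_cong) auto
    finally show "c t * ((\<integral>x. max 0 (f x) \<partial>\<nu> t) - (\<integral>x. max 0 (- f x) \<partial>\<nu> t)) = c t * (\<integral>x. f x \<partial>\<nu> t)" by simp
  qed
  finally show ?thesis .
qed

lemma integrable_exp_quadratic:
  assumes a: "a > (0::real)"
  shows "integrable lborel (\<lambda>t::'v::euclidean_space. exp (- a * (norm t)\<^sup>2 + b * norm t))"
proof (rule Bochner_Integration.integrable_bound)
  \<comment> \<open>Completing the square: \<open>K\<close> is the maximum of
    \<open>- a * r\<^sup>2 + (b + 1) * r\<close>, which leaves a surplus decay of
    \<open>exp (- norm t)\<close>.\<close>
  define K where "K = (b + 1)\<^sup>2 / (4 * a)"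
  show "integrable lborel (\<lambda>t::'v. exp K * exp (- (1 * norm t)))" using integrable_exp_neg_norm[of 1] by simp
  have "- a * (norm t)\<^sup>2 + b * norm t \<le> K - norm t" for t :: 'v
  proof -
    have "0 \<le> a * (norm t - (b + 1) / (2 * a))\<^sup>2" using a by simp
    also have "\<dots> = a * (norm t)\<^sup>2 - (b + 1) * norm t + K"
      using a by (simp add: K_def power2_eq_square field_simps)
    finally show ?thesis by (simp add: algebra_simps)
  qed
  then show "AE t in lborel. norm (exp (- a * (norm (t::'v))\<^sup>2 + b * norm t)) \<le> norm (exp K * exp (- (1 * norm t)))"
    by (simp flip: exp_add)
qed simp

section \<open>Triviality of the transition function\<close>

context full_shift
begin

lemma restrict_Pr: "restrict_space Pr UNIV = Pr"
proof (rule measure_eqI)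
  show "emeasure (restrict_space Pr UNIV) A = emeasure Pr A" if "A \<in> sets (restrict_space Pr UNIV)" for A
    using that by (subst emeasure_restrict_space) (auto simp: sets_restrict_space)
qed (simp add: sets_restrict_space)

lemma Pr_coordinate: "B \<in> sets borel \<Longrightarrow> measure Pr {\<omega>. \<omega> 0 \<in> B} = measure \<rho> B"
proof -
  assume B: "B \<in> sets borel"
  have "distr Pr \<rho> (\<lambda>\<omega>. \<omega> 0) = \<rho>"
    unfolding product_measure_def by (rule sq.PiM_component) simp
  then have "measure \<rho> B = measure (distr Pr \<rho> (\<lambda>\<omega>. \<omega> 0)) B" by simp
  also have "\<dots> = measure Pr {\<omega>. \<omega> 0 \<in> B}"
  proof -
    have "(\<lambda>\<omega>. \<omega> 0) \<in> measurable Pr \<rho>" unfolding product_measure_def by measurable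
    from measure_distr[OF this, of B] show ?thesis using B by (simp add: sets_rho vimage_def)
  qed
  finally show ?thesis by simp
qed

text \<open>If \<open>A\<close> vanished somewhere, it would vanish on an open rectangle \<open>U \<times> V\<close>, which almost every
  sequence visits at some pair of positions \<open>(2k, 2k + 1)\<close>.\<close>

lemma transition_trivial:
  fixes A :: "'a \<Rightarrow> 'a \<Rightarrow> real"
  assumes supp: "\<And>U. open U \<Longrightarrow> U \<noteq> {} \<Longrightarrow> measure \<rho> U > 0"
    and A: "continuous_on UNIV (\<lambda>(x, y). A x y)" "\<And>x y. A x y \<in> {0, 1}"
    and pos: "emeasure Pr (Omega A) > 0"
  shows "A = (\<lambda>_ _. 1)"
proof (rule ccontr)
  assume "A \<noteq> (\<lambda>_ _. 1)"
  then obtain a b where ab: "A a b \<noteq> 1" by (auto simp: fun_eq_iff)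
  then have "A a b = 0" using A(2)[of a b] by auto
  define G where "G = (\<lambda>(x, y). A x y) -` {..<1}"
  have "open G" unfolding G_def using A(1) by (intro open_vimage) auto
  moreover have "(a, b) \<in> G" using \<open>A a b = 0\<close> by (simp add: G_def)
  ultimately obtain U V where UV: "open U" "open V" "a \<in> U" "b \<in> V" "U \<times> V \<subseteq> G"
    by (metis open_prod_elim mem_Times_iff fst_conv snd_conv)
  have A0: "A x y = 0" if "x \<in> U" "y \<in> V" for x y
    using UV(5) that A(2)[of x y] by (auto simp: G_def)
  have [measurable]: "U \<in> sets borel" "V \<in> sets borel" using UV by auto
  have [measurable]: "(\<lambda>\<omega> :: nat \<Rightarrow> 'a. \<omega> i) \<in> borel_measurable borel" for i
    by (intro borel_measurable_continuous_onI continuous_on_product_coordinates)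
  \<comment> \<open>The pairs of positions are disjoint, so the \<open>n\<close> events of missing
    the rectangle are independent and the measure of \<open>E n\<close> is a power.\<close>
  define E where "E n = {\<omega> :: nat \<Rightarrow> 'a. \<forall>k<n. \<not> (\<omega> (2 * k) \<in> U \<and> \<omega> (2 * k + 1) \<in> V)}" for n :: nat
  have [measurable]: "E n \<in> sets borel" for n unfolding E_def by measurable
  have ind: "measure Pr B = (\<integral>\<omega>. indicator B \<omega> \<partial>Pr)" if "B \<in> sets borel" for B
    using that by (simp add: sets_Pr)
  have E1: "measure Pr (E 1) = 1 - measure \<rho> U * measure \<rho> V"
  proof -
    define W where "W = {\<omega> :: nat \<Rightarrow> 'a. \<omega> 0 \<in> U \<and> \<omega> 1 \<in> V}"
    have [measurable]: "W \<in> sets borel" unfolding W_def by measurable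
    have "E 1 = UNIV - W" by (auto simp: E_def W_def)
    then have "measure Pr (E 1) = 1 - measure Pr W"
      using Pr.prob_compl[of W] by (simp add: sets_Pr)
    also have "measure Pr W = (\<integral>\<omega>. \<integral>\<eta>. indicator W (comb_seq 1 \<omega> \<eta>) \<partial>Pr \<partial>Pr)"
      by (subst ind, simp, rule integral_comb(1)[symmetric, where B = 1]) (auto simp: indicator_def)
    also have "\<dots> = (\<integral>\<omega>. \<integral>\<eta>. indicator {\<omega>. \<omega> 0 \<in> U} \<omega> * indicator {\<eta>. \<eta> 0 \<in> V} \<eta> \<partial>Pr \<partial>Pr)"
      by (intro Bochner_Integration.integral_cong refl) (auto simp: W_def indicator_def comb_seq_def)
    also have "\<dots> = measure Pr {\<omega>. \<omega> 0 \<in> U} * measure Pr {\<eta>. \<eta> 0 \<in> V}"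
      by (subst (1 2) ind) (simp_all add: mult.commute)
    finally show ?thesis by (simp add: Pr_coordinate)
  qed
  have En: "measure Pr (E n) = measure Pr (E 1) ^ n" for n
  proof (induction n)
    case 0
    have "E 0 = UNIV" by (auto simp: E_def)
    then show ?case using Pr.prob_space by simp
  next
    case (Suc n)
    \<comment> \<open>The first two letters decide the pair with \<open>k = 0\<close>, and the
      remaining pairs are those of the sequence shifted by two; hence a factor \<open>E 1\<close>
      and a factor \<open>E n\<close>.\<close>
    have split: "comb_seq 2 \<omega> \<eta> \<in> E (Suc n) \<longleftrightarrow> \<omega> \<in> E 1 \<and> \<eta> \<in> E n" for \<omega> \<eta>
    proof -
      have "comb_seq 2 \<omega> \<eta> (2 * Suc k) = \<eta> (2 * k)" "comb_seq 2 \<omega> \<eta> (2 * Suc k + 1) = \<eta> (2 * k + 1)" for k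
        by (simp_all add: comb_seq_def)
      moreover have "comb_seq 2 \<omega> \<eta> 0 = \<omega> 0" "comb_seq 2 \<omega> \<eta> 1 = \<omega> 1" by (simp_all add: comb_seq_def)
      ultimately show ?thesis unfolding E_def mem_Collect_eq
        by (simp add: All_less_Suc2)
    qed
    have "measure Pr (E (Suc n)) = (\<integral>\<omega>. \<integral>\<eta>. indicator (E (Suc n)) (comb_seq 2 \<omega> \<eta>) \<partial>Pr \<partial>Pr)"
      by (subst ind, simp, rule integral_comb(1)[symmetric, where B = 1]) (auto simp: indicator_def)
    also have "\<dots> = (\<integral>\<omega>. \<integral>\<eta>. indicator (E 1) \<omega> * indicator (E n) \<eta> \<partial>Pr \<partial>Pr)"
      by (intro Bochner_Integration.integral_cong refl) (auto simp: split indicator_def)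
    also have "\<dots> = measure Pr (E 1) * measure Pr (E n)"
      by (subst (1 2) ind) (simp_all add: mult.commute)
    finally show ?case using Suc by simp
  qed
  have "measure \<rho> U * measure \<rho> V > 0" using UV supp by (intro mult_pos_pos) auto
  then have lt: "measure Pr (E 1) < 1" using E1 by simp
  have sub: "Omega A \<subseteq> E n" for n
  proof
    fix \<omega> assume "\<omega> \<in> Omega A"
    then have p: "A (\<omega> (2 * k)) (\<omega> (2 * k + 1)) > 0" for k by (simp add: Omega_def)
    have "\<not> (\<omega> (2 * k) \<in> U \<and> \<omega> (2 * k + 1) \<in> V)" for k
      using p[of k] A0[of "\<omega> (2 * k)" "\<omega> (2 * k + 1)"] by linarith
    then show "\<omega> \<in> E n" by (simp add: E_def)
  qed
  have le: "measure Pr (Omega A) \<le> measure Pr (E 1) ^ n" for n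
    unfolding En[symmetric] by (rule Pr.finite_measure_mono[OF sub]) (simp add: sets_Pr)
  have "(\<lambda>n. measure Pr (E 1) ^ n) \<longlonglongrightarrow> 0" using lt by (intro LIMSEQ_realpow_zero) auto
  then have "measure Pr (Omega A) \<le> 0" by (rule LIMSEQ_le_const) (use le in auto)
  then have "emeasure Pr (Omega A) = 0" using measure_nonneg[of Pr "Omega A"] by (simp add: Pr.emeasure_eq_measure)
  with pos show False by simp
qed

end

subsection \<open>Convergence of the probabilistic Gibbs measures\<close>

context shift_potentials
begin

definition Phi :: "real \<Rightarrow> real ^ 'q \<Rightarrow> real" where "Phi \<beta> = phi_beta \<rho> (\<lambda>_ _. 1) \<psi> \<beta>"

lemma Phi_eq: "Phi \<beta> t = - (\<beta> / 2) * (norm t)\<^sup>2 + ln (growth_at (\<beta> *\<^sub>R t))"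
  unfolding Phi_def phi_beta_def spec_rad_eq[OF norm_pot_lip_nonneg lip_pot] ..

lemma Phi_continuous: "continuous_on UNIV (Phi \<beta>)"
proof -
  have "continuous_on UNIV (\<lambda>t. growth_at (\<beta> *\<^sub>R t))"
    by (rule continuous_on_compose2[OF growth_at_continuous]) (auto intro!: continuous_intros)
  then show ?thesis unfolding Phi_eq[abs_def] using growth_at_pos
    by (intro continuous_intros) (auto simp: less_imp_neq[symmetric])
qed

lemma Phi_le: "0 \<le> \<beta> \<Longrightarrow> Phi \<beta> t \<le> - (\<beta> / 2) * (norm t)\<^sup>2 + \<beta> * norm t * pot_bound"
proof -
  assume "0 \<le> \<beta>"
  have "ln (growth_at (\<beta> *\<^sub>R t)) \<le> ln (exp (norm (\<beta> *\<^sub>R t) * pot_bound))"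
    using growth_at_bounds(1)[of "\<beta> *\<^sub>R t"] growth_at_pos[of "\<beta> *\<^sub>R t"] by (intro ln_mono) auto
  then show ?thesis using \<open>0 \<le> \<beta>\<close> by (simp add: Phi_eq)
qed

context
  fixes \<beta> :: real
  assumes \<beta>: "0 < \<beta>"
begin

lemma Phi_superlevel_bounded:
  obtains R where "\<And>t. norm t > R \<Longrightarrow> Phi \<beta> t \<le> m - 1"
proof -
  \<comment> \<open>\<open>Phi \<beta> t\<close> is at most
    \<open>- (\<beta> / 2) * norm t * (norm t - 2 * pot_bound)\<close>. Beyond \<open>R\<close> the
    factor \<open>norm t\<close> is at least 1 and the last factor at least
    \<open>2 * \<bar>m - 1\<bar> / \<beta>\<close>.\<close>
  define R where "R = 2 * pot_bound + 1 + 2 * \<bar>m - 1\<bar> / \<beta>"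
  have "Phi \<beta> t \<le> m - 1" if t: "norm t > R" for t
  proof -
    have d: "2 * \<bar>m - 1\<bar> / \<beta> \<ge> 0" using \<beta> by simp
    have n1: "norm t \<ge> 1" and n2: "norm t - 2 * pot_bound \<ge> 2 * \<bar>m - 1\<bar> / \<beta>" using t pot_bound_nonneg d by (auto simp: R_def)
    have "1 * (2 * \<bar>m - 1\<bar> / \<beta>) \<le> norm t * (norm t - 2 * pot_bound)" by (intro mult_mono n1 n2) (use d n1 in auto)
    then have "\<beta> / 2 * (2 * \<bar>m - 1\<bar> / \<beta>) \<le> \<beta> / 2 * (norm t * (norm t - 2 * pot_bound))" using \<beta> by (intro mult_left_mono) auto
    then have "\<bar>m - 1\<bar> \<le> \<beta> / 2 * (norm t * (norm t - 2 * pot_bound))" using \<beta> by simp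
    moreover have "Phi \<beta> t \<le> - (\<beta> / 2 * (norm t * (norm t - 2 * pot_bound)))"
      using Phi_le[of \<beta> t] \<beta> by (simp add: power2_eq_square algebra_simps)
    ultimately show ?thesis by linarith
  qed
  then show ?thesis by (rule that)
qed

lemma maximizers_Phi:
  shows "maximizers (Phi \<beta>) \<noteq> {}" "compact (maximizers (Phi \<beta>))"
proof -
  obtain R where R: "\<And>t. norm t > R \<Longrightarrow> Phi \<beta> t \<le> Phi \<beta> 0 - 1" using Phi_superlevel_bounded by blast
  have R0: "R \<ge> 0" using R[of 0] by fastforce
  have "\<exists>p\<in>cball 0 R. \<forall>t\<in>cball 0 R. Phi \<beta> t \<le> Phi \<beta> p"
    by (rule continuous_attains_sup[OF compact_cball _ continuous_on_subset[OF Phi_continuous]]) (use R0 in auto)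
  then obtain p where p: "p \<in> cball 0 R" "\<And>t. t \<in> cball 0 R \<Longrightarrow> Phi \<beta> t \<le> Phi \<beta> p" by blast
  have "Phi \<beta> t \<le> Phi \<beta> p" for t
  proof (cases "norm t > R")
    case True
    then show ?thesis using R[OF True] p(2)[of 0] R0 by simp
  qed (use p in auto)
  then have pm: "p \<in> maximizers (Phi \<beta>)" by (simp add: maximizers_def)
  then show "maximizers (Phi \<beta>) \<noteq> {}" by auto
  have "maximizers (Phi \<beta>) = Phi \<beta> -` {Phi \<beta> p ..}"
    using pm by (auto simp: maximizers_def intro: order_trans)
  moreover have "closed (Phi \<beta> -` {Phi \<beta> p ..})" using Phi_continuous by (intro closed_vimage) auto
  moreover have "maximizers (Phi \<beta>) \<subseteq> cball 0 R"
  proof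
    fix t assume "t \<in> maximizers (Phi \<beta>)"
    then have "Phi \<beta> 0 \<le> Phi \<beta> t" by (simp add: maximizers_def)
    then show "t \<in> cball 0 R" using R[of t] by fastforce
  qed
  ultimately show "compact (maximizers (Phi \<beta>))" by (metis bounded_cball bounded_subset compact_eq_bounded_closed)
qed

lemma peak_isolated:
  assumes "peak (Phi \<beta>) p k Q c \<delta>" "h \<noteq> 0" "norm h < \<delta>"
  shows "p + h \<notin> maximizers (Phi \<beta>)"
proof -
  have "c * norm h ^ k \<le> Phi \<beta> p - Phi \<beta> (p + h)" using assms unfolding peak_def by blast
  moreover have "0 < c * norm h ^ k" using assms unfolding peak_def by simp
  ultimately have "Phi \<beta> (p + h) < Phi \<beta> p" by linarith
  then show ?thesis by (auto simp: maximizers_def not_le intro!: exI[of _ p])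
qed

text \<open>A peak is a strict local maximum, hence isolated among the maximum points, and a compact
  set of isolated points is finite.\<close>

lemma finite_maximizers:
  assumes "\<And>p. p \<in> maximizers (Phi \<beta>) \<Longrightarrow> \<exists>k Q c \<delta>. peak (Phi \<beta>) p k Q c \<delta>"
  shows "finite (maximizers (Phi \<beta>))"
proof (rule ccontr)
  assume "infinite (maximizers (Phi \<beta>))"
  then obtain p where p: "p \<in> maximizers (Phi \<beta>)" "p islimpt maximizers (Phi \<beta>)"
    using Heine_Borel_imp_Bolzano_Weierstrass[OF maximizers_Phi(2) _ order_refl] by blast
  obtain k Q c \<delta> where pk: "peak (Phi \<beta>) p k Q c \<delta>" using assms[OF p(1)] by blast
  have "\<delta> > 0" using pk unfolding peak_def by blast
  then obtain t where t: "t \<in> maximizers (Phi \<beta>)" "t \<noteq> p" "dist t p < \<delta>"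
    using p(2) unfolding islimpt_approachable by blast
  then show False using peak_isolated[OF pk, of "t - p"] by (simp add: dist_norm)
qed

definition gibbs_mass :: "nat \<Rightarrow> ((nat \<Rightarrow> 'a) \<Rightarrow> real) \<Rightarrow> real" where
  "gibbs_mass n f = (\<integral>\<omega>. gibbs_weight \<psi> \<beta> n \<omega> * f \<omega> \<partial>Pr)"

abbreviation birkhoff_vec :: "nat \<Rightarrow> (nat \<Rightarrow> 'a) \<Rightarrow> real ^ 'q" where
  "birkhoff_vec n \<omega> \<equiv> \<chi> i. birkhoff_sum n (\<psi> i) \<omega>"

lemma birkhoff_vec_continuous: "continuous_on UNIV (birkhoff_vec n)"
  by (intro continuous_on_vec_lambda continuous_on_birkhoff_sum lip_imp_continuous[OF L(2)])

lemma gibbs_weight_continuous: "continuous_on UNIV (gibbs_weight \<psi> \<beta> n)"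
  unfolding gibbs_weight_def[abs_def] by (intro continuous_intros birkhoff_vec_continuous)

text \<open>The Hubbard-Stratonovich transformation: completing the square in \<open>t\<close> linearises the
  quadratic interaction.\<close>

lemma hubbard_stratonovich:
  assumes f: "continuous_on UNIV f" and n: "n \<ge> 1"
  shows "(\<integral>t. exp (- (real n * \<beta> / 2) * (norm t)\<^sup>2) * tilted_mass n f (\<beta> *\<^sub>R t) \<partial>lborel) =
    (\<integral>t. exp (- (real n * \<beta> / 2) * (norm (t :: real ^ 'q))\<^sup>2) \<partial>lborel) * gibbs_mass n f"
proof -
  interpret LP: pair_sigma_finite "lborel :: (real ^ 'q) measure" Pr ..
  define a where "a = real n * \<beta> / 2"
  have a: "a > 0" using n \<beta> by (simp add: a_def)
  obtain B where B: "B > 0" "\<And>x. norm (f x) \<le> B" using bounded_continuous[OF f] by metis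
  obtain C where C: "C > 0" "\<And>x. norm (birkhoff_vec n x) \<le> C" using bounded_continuous[OF birkhoff_vec_continuous] by metis
  have [measurable]: "f \<in> borel_measurable borel" "birkhoff_vec n \<in> borel_measurable borel"
    by (rule borel_measurable_cont[OF f], rule borel_measurable_cont[OF birkhoff_vec_continuous])
  define g where "g t \<omega> = exp (- a * (norm t)\<^sup>2 + \<beta> * (t \<bullet> birkhoff_vec n \<omega>)) * f \<omega>" for t \<omega>
  have gm [measurable]: "(\<lambda>(t, \<omega>). g t \<omega>) \<in> borel_measurable (lborel \<Otimes>\<^sub>M Pr)"
    unfolding g_def by measurable
  have gb: "norm (g t \<omega>) \<le> exp (- a * (norm t)\<^sup>2 + (\<beta> * C) * norm t) * B" for t \<omega>
  proof -
    have "t \<bullet> birkhoff_vec n \<omega> \<le> norm t * norm (birkhoff_vec n \<omega>)" by (rule norm_cauchy_schwarz)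
    also have "\<dots> \<le> norm t * C" by (intro mult_left_mono C) auto
    finally have "\<beta> * (t \<bullet> birkhoff_vec n \<omega>) \<le> \<beta> * (norm t * C)" using \<beta> by (intro mult_left_mono) auto
    then show ?thesis unfolding g_def norm_mult using B
      by (intro mult_mono) (auto simp: mult_ac)
  qed
  have ih: "integrable lborel (\<lambda>t :: real ^ 'q. exp (- a * (norm t)\<^sup>2 + (\<beta> * C) * norm t) * B)"
    by (rule integrable_mult_left) (rule integrable_exp_quadratic[OF a])
  have gPr: "integrable Pr (g t)" for t
    by (rule Pr.integrable_const_bound[where B = "exp (- a * (norm t)\<^sup>2 + (\<beta> * C) * norm t) * B"]) (use gb in \<open>auto simp: g_def\<close>)
  have ig: "integrable (lborel \<Otimes>\<^sub>M Pr) (\<lambda>(t, \<omega>). g t \<omega>)"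
  proof (rule LP.Fubini_integrable[OF gm])
    show "AE t in lborel. integrable Pr (\<lambda>\<omega>. case (t, \<omega>) of (t, \<omega>) \<Rightarrow> g t \<omega>)" using gPr by simp
    show "integrable lborel (\<lambda>t. \<integral>\<omega>. norm (case (t, \<omega>) of (t, \<omega>) \<Rightarrow> g t \<omega>) \<partial>Pr)"
    proof (rule Bochner_Integration.integrable_bound[OF ih])
      have "(\<integral>\<omega>. norm (g t \<omega>) \<partial>Pr) \<le> (\<integral>\<omega>. exp (- a * (norm t)\<^sup>2 + (\<beta> * C) * norm t) * B \<partial>Pr)" for t
        by (intro integral_mono integrable_norm gPr gb) simp
      then show "AE t in lborel. norm (\<integral>\<omega>. norm (case (t, \<omega>) of (t, \<omega>) \<Rightarrow> g t \<omega>) \<partial>Pr) \<le> norm (exp (- a * (norm t)\<^sup>2 + (\<beta> * C) * norm t) * B)"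
        using B(1) by (simp add: Pr.prob_space[simplified])
    qed measurable
  qed
  have sq: "(\<integral>t. g t \<omega> \<partial>lborel) = (\<integral>t. exp (- a * (norm (t :: real ^ 'q))\<^sup>2) \<partial>lborel) * (gibbs_weight \<psi> \<beta> n \<omega> * f \<omega>)" for \<omega>
  proof -
    \<comment> \<open>The centre of the Gaussian: the point \<open>t\<close> at which \<open>- a *
      (norm t)\<^sup>2 + \<beta> * (t \<bullet> birkhoff_vec n \<omega>)\<close> is maximal.\<close>
    let ?u = "(1 / real n) *\<^sub>R birkhoff_vec n \<omega>"
    have eq1: "g (?u + 1 *\<^sub>R t) \<omega> = exp (- a * (norm t)\<^sup>2) * (gibbs_weight \<psi> \<beta> n \<omega> * f \<omega>)" for t
    proof -
      have "(norm (?u + t))\<^sup>2 = (norm (birkhoff_vec n \<omega>))\<^sup>2 / (real n)\<^sup>2 + 2 / real n * (t \<bullet> birkhoff_vec n \<omega>) + (norm t)\<^sup>2"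
        by (simp only: power2_norm_eq_inner inner_add_left inner_add_right inner_scaleR_left inner_scaleR_right)
           (simp add: inner_commute power2_eq_square add_divide_distrib)
      moreover have "(?u + t) \<bullet> birkhoff_vec n \<omega> = (norm (birkhoff_vec n \<omega>))\<^sup>2 / real n + t \<bullet> birkhoff_vec n \<omega>"
        by (simp only: power2_norm_eq_inner inner_add_left inner_scaleR_left) simp
      ultimately have "- a * (norm (?u + t))\<^sup>2 + \<beta> * ((?u + t) \<bullet> birkhoff_vec n \<omega>) = - a * (norm t)\<^sup>2 + \<beta> / (2 * real n) * (norm (birkhoff_vec n \<omega>))\<^sup>2"
        using n by (simp only: a_def) (simp add: field_simps power2_eq_square)
      then show ?thesis unfolding g_def scaleR_one gibbs_weight_def by (simp only: exp_add mult.assoc)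
    qed
    have "(\<integral>t. g t \<omega> \<partial>lborel) = 1 ^ DIM(real ^ 'q) * (\<integral>t. g (?u + 1 *\<^sub>R t) \<omega> \<partial>lborel)"
      by (rule integral_lborel_affine) (auto simp: g_def)
    then show ?thesis unfolding eq1 by (simp only: power_one mult_1 integral_mult_left_zero)
  qed
  have "(\<integral>t. exp (- a * (norm t)\<^sup>2) * tilted_mass n f (\<beta> *\<^sub>R t) \<partial>lborel) = (\<integral>t. \<integral>\<omega>. g t \<omega> \<partial>Pr \<partial>lborel)"
  proof (rule Bochner_Integration.integral_cong[OF refl])
    fix t
    show "exp (- a * (norm t)\<^sup>2) * tilted_mass n f (\<beta> *\<^sub>R t) = (\<integral>\<omega>. g t \<omega> \<partial>Pr)"
      unfolding tilted_mass_def birkhoff_pot g_def integral_mult_right_zero[symmetric] exp_add inner_scaleR_left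
      by (simp only: mult.assoc)
  qed
  also have "\<dots> = (\<integral>\<omega>. \<integral>t. g t \<omega> \<partial>lborel \<partial>Pr)" by (rule LP.Fubini_integral[OF ig, symmetric])
  also have "\<dots> = (\<integral>t. exp (- a * (norm (t :: real ^ 'q))\<^sup>2) \<partial>lborel) * gibbs_mass n f"
    unfolding sq gibbs_mass_def by simp
  finally show ?thesis by (simp only: a_def)
qed

lemma gibbs_mass_1_pos: "0 < gibbs_mass n (\<lambda>_. 1)"
proof -
  have "(\<integral>\<omega>. 1 \<partial>Pr) \<le> (\<integral>\<omega>. gibbs_weight \<psi> \<beta> n \<omega> * 1 \<partial>Pr)"
  proof (rule integral_mono)
    show "integrable Pr (\<lambda>\<omega>. gibbs_weight \<psi> \<beta> n \<omega> * 1)" using integrable_cont(1)[OF gibbs_weight_continuous] by simp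
    show "1 \<le> gibbs_weight \<psi> \<beta> n \<omega> * 1" for \<omega> using \<beta> by (simp add: gibbs_weight_def)
  qed simp
  then show ?thesis by (simp add: gibbs_mass_def Pr.prob_space[simplified])
qed

lemma integral_gibbs_measure:
  assumes f: "continuous_on UNIV f"
  shows "(\<integral>\<omega>. f \<omega> \<partial>gibbs_measure \<rho> (\<lambda>_ _. 1) \<psi> \<beta> n) = gibbs_mass n f / gibbs_mass n (\<lambda>_. 1)"
proof -
  have Z: "partition_function \<rho> (\<lambda>_ _. 1) \<psi> \<beta> n = gibbs_mass n (\<lambda>_. 1)"
    by (simp add: partition_function_def gibbs_mass_def restrict_Pr)
  have [measurable]: "f \<in> borel_measurable borel" "gibbs_weight \<psi> \<beta> n \<in> borel_measurable borel"
    by (rule borel_measurable_cont[OF f], rule borel_measurable_cont[OF gibbs_weight_continuous])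
  have nn: "0 \<le> gibbs_weight \<psi> \<beta> n \<omega> / gibbs_mass n (\<lambda>_. 1)" for \<omega>
    using gibbs_mass_1_pos[of n] by (simp add: gibbs_weight_def)
  have "(\<integral>\<omega>. f \<omega> \<partial>gibbs_measure \<rho> (\<lambda>_ _. 1) \<psi> \<beta> n) = (\<integral>\<omega>. (gibbs_weight \<psi> \<beta> n \<omega> / gibbs_mass n (\<lambda>_. 1)) *\<^sub>R f \<omega> \<partial>Pr)"
    unfolding gibbs_measure_def Z Omega_full restrict_Pr
    by (rule integral_density) (use nn in auto)
  also have "\<dots> = (\<integral>\<omega>. gibbs_weight \<psi> \<beta> n \<omega> * f \<omega> / gibbs_mass n (\<lambda>_. 1) \<partial>Pr)" by simp
  also have "\<dots> = gibbs_mass n f / gibbs_mass n (\<lambda>_. 1)" unfolding gibbs_mass_def by (rule integral_divide_zero)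
  finally show ?thesis .
qed

text \<open>Numerator and denominator of the Gibbs integral undergo the same Gaussian transformation
  and have Laplace asymptotics of the same order, so the Gaussian constant, the factor
  \<open>exp (- (real n * m))\<close> and the power of \<open>n\<close> cancel. Existence of a peak
  at every maximum point is all that is assumed of them.\<close>

lemma gibbs_converges:
  assumes pk: "\<And>p. p \<in> maximizers (Phi \<beta>) \<Longrightarrow> \<exists>k Q c \<delta>. peak (Phi \<beta>) p k Q c \<delta>"
  shows "\<exists>c. (\<forall>t \<in> maximizers (Phi \<beta>). c t \<ge> 0) \<and> (\<Sum>t \<in> maximizers (Phi \<beta>). c t) = 1 \<and>
    converges_weakly UNIV (gibbs_measure \<rho> (\<lambda>_ _. 1) \<psi> \<beta>) (mixture UNIV (maximizers (Phi \<beta>)) c (\<lambda>t. nu (\<beta> *\<^sub>R t)))"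
proof -
  define M where "M = maximizers (Phi \<beta>)"
  have M: "finite M" "M \<noteq> {}" using finite_maximizers[OF pk] maximizers_Phi(1) by (auto simp: M_def)
  have "\<forall>p. \<exists>k Q c \<delta>. p \<in> M \<longrightarrow> peak (Phi \<beta>) p k Q c \<delta>" using pk by (auto simp: M_def)
  then obtain k Q c \<delta> where pk': "\<And>p. p \<in> M \<Longrightarrow> peak (Phi \<beta>) p (k p) (Q p) (c p) (\<delta> p)" by metis
  obtain p0 where p0: "p0 \<in> M" using M by auto
  define m where "m = Phi \<beta> p0"
  have le: "Phi \<beta> t \<le> m" for t using p0 by (simp add: M_def m_def maximizers_def)
  have Mm: "Phi \<beta> p = m" if "p \<in> M" for p
    using le[of p] that by (intro antisym) (simp_all add: M_def m_def maximizers_def)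
  have nM: "Phi \<beta> t < m" if t: "t \<notin> M" for t
  proof -
    obtain s where "\<not> Phi \<beta> s \<le> Phi \<beta> t" using t by (auto simp: M_def maximizers_def)
    then show ?thesis using le[of s] by linarith
  qed
  obtain R where R: "\<And>t. norm t > R \<Longrightarrow> Phi \<beta> t \<le> m - 1" using Phi_superlevel_bounded by blast
  define K where "K = Max (k ` M)"
  define I where "I p = (\<integral>y. exp (- Q p y) \<partial>lborel)" for p
  have I: "I p > 0" if "p \<in> M" for p unfolding I_def by (rule peak_integral_pos[OF pk'[OF that] Phi_continuous])
  \<comment> \<open>The Gaussian integral of the tilted mass with
    \<open>growth_at (\<beta> *\<^sub>R t) ^ n\<close> moved into the exponent, where it completes
    \<open>real n * Phi \<beta> t\<close>.\<close>
  define J where "J n f = (\<integral>t. exp (real n * (Phi \<beta> t - m)) * norm_mass n f (\<beta> *\<^sub>R t) \<partial>lborel)" for n f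
  have Jlim: "(\<lambda>n. real n powr (DIM(real ^ 'q) / real K) * J n f) \<longlonglongrightarrow>
      (\<Sum>p\<in>M. if k p = K then mass_limit (\<beta> *\<^sub>R p) * (\<integral>\<omega>. f \<omega> \<partial>nu (\<beta> *\<^sub>R p)) * I p else 0)"
    if f: "continuous_on UNIV f" for f
  proof -
    obtain B where B: "B > 0" "\<And>x. norm (f x) \<le> B" using bounded_continuous[OF f] by metis
    show ?thesis
      unfolding J_def K_def I_def
    proof (rule laplace_method[OF Phi_continuous M Mm nM R pk'])
      show "continuous_on UNIV (\<lambda>t. norm_mass n f (\<beta> *\<^sub>R t))" for n
        by (rule continuous_on_compose2[OF norm_mass_continuous[OF f]]) (auto intro!: continuous_intros)
      show "\<bar>norm_mass n f (\<beta> *\<^sub>R t)\<bar> \<le> B * exp (norm (\<beta> *\<^sub>R t) * pot_lip * diam)" for n t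
        by (rule norm_mass_bound[OF f]) (use B in simp)
      show "continuous_on UNIV (\<lambda>t. B * exp (norm (\<beta> *\<^sub>R t) * pot_lip * diam))" by (intro continuous_intros)
      \<comment> \<open>The Gaussian decay of \<open>exp (Phi \<beta> t)\<close> absorbs the
        exponential growth of the bound on the normalised masses.\<close>
      show "integrable lborel (\<lambda>t. exp (Phi \<beta> t) * (B * exp (norm (\<beta> *\<^sub>R t) * pot_lip * diam)))"
      proof (rule Bochner_Integration.integrable_bound)
        show "integrable lborel (\<lambda>t :: real ^ 'q. B * exp (- (\<beta> / 2) * (norm t)\<^sup>2 + (\<beta> * pot_bound + \<beta> * pot_lip * diam) * norm t))"
          by (rule integrable_mult_right) (rule integrable_exp_quadratic, use \<beta> in simp)
        have [measurable]: "Phi \<beta> \<in> borel_measurable borel" by (rule borel_measurable_continuous_onI[OF Phi_continuous])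
        show "(\<lambda>t. exp (Phi \<beta> t) * (B * exp (norm (\<beta> *\<^sub>R t) * pot_lip * diam))) \<in> borel_measurable lborel" by measurable
        have "exp (Phi \<beta> t) * (B * exp (norm (\<beta> *\<^sub>R t) * pot_lip * diam)) \<le> B * exp (- (\<beta> / 2) * (norm t)\<^sup>2 + (\<beta> * pot_bound + \<beta> * pot_lip * diam) * norm t)" for t
        proof -
          have "Phi \<beta> t + norm (\<beta> *\<^sub>R t) * pot_lip * diam \<le> - (\<beta> / 2) * (norm t)\<^sup>2 + (\<beta> * pot_bound + \<beta> * pot_lip * diam) * norm t"
            using Phi_le[of \<beta> t] \<beta> by (simp add: algebra_simps)
          then have "exp (Phi \<beta> t + norm (\<beta> *\<^sub>R t) * pot_lip * diam) \<le> exp (- (\<beta> / 2) * (norm t)\<^sup>2 + (\<beta> * pot_bound + \<beta> * pot_lip * diam) * norm t)" by simp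
          from mult_left_mono[OF this, of B] B show ?thesis by (simp add: exp_add mult_ac)
        qed
        then show "AE t in lborel. norm (exp (Phi \<beta> t) * (B * exp (norm (\<beta> *\<^sub>R t) * pot_lip * diam))) \<le> norm (B * exp (- (\<beta> / 2) * (norm t)\<^sup>2 + (\<beta> * pot_bound + \<beta> * pot_lip * diam) * norm t))"
          using B by (simp add: abs_mult)
      qed
      show "uniform_limit (cball 0 r) (\<lambda>n t. norm_mass n f (\<beta> *\<^sub>R t)) (\<lambda>t. mass_limit (\<beta> *\<^sub>R t) * (\<integral>\<omega>. f \<omega> \<partial>nu (\<beta> *\<^sub>R t))) sequentially" if r: "r \<ge> 0" for r
      proof (rule uniform_limitI)
        fix e :: real assume e: "e > 0"
        have "\<forall>\<^sub>F n in sequentially. \<forall>s\<in>cball 0 (\<beta> * r). dist (norm_mass n f s) (mass_limit s * (\<integral>\<omega>. f \<omega> \<partial>nu s)) < e"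
          by (rule uniform_limitD[OF norm_mass_uniform_limit[OF _ f] e]) (use \<beta> r in simp)
        then show "\<forall>\<^sub>F n in sequentially. \<forall>t\<in>cball 0 r. dist (norm_mass n f (\<beta> *\<^sub>R t)) (mass_limit (\<beta> *\<^sub>R t) * (\<integral>\<omega>. f \<omega> \<partial>nu (\<beta> *\<^sub>R t))) < e"
        proof eventually_elim
          case (elim n)
          show ?case
          proof
            fix t :: "real ^ 'q" assume "t \<in> cball 0 r"
            then have "\<beta> *\<^sub>R t \<in> cball 0 (\<beta> * r)" using \<beta> by simp
            then show "dist (norm_mass n f (\<beta> *\<^sub>R t)) (mass_limit (\<beta> *\<^sub>R t) * (\<integral>\<omega>. f \<omega> \<partial>nu (\<beta> *\<^sub>R t))) < e" using elim by blast
          qed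
        qed
      qed
      show "isCont (\<lambda>t. mass_limit (\<beta> *\<^sub>R t) * (\<integral>\<omega>. f \<omega> \<partial>nu (\<beta> *\<^sub>R t))) p" for p
        using isCont_o2[of p "\<lambda>t. \<beta> *\<^sub>R t" "\<lambda>s. mass_limit s * (\<integral>\<omega>. f \<omega> \<partial>nu s)"] norm_mass_limit_continuous[OF f] by (simp add: continuous_intros)
    qed
  qed
  have JN: "J n f / J n (\<lambda>_. 1) = gibbs_mass n f / gibbs_mass n (\<lambda>_. 1)" if f: "continuous_on UNIV f" and n: "n \<ge> 1" for f n
  proof -
    define C where "C = (\<integral>t. exp (- (real n * \<beta> / 2) * (norm (t :: real ^ 'q))\<^sup>2) \<partial>lborel)"
    have Jg: "J n g = exp (- (real n * m)) * (C * gibbs_mass n g)" if g: "continuous_on UNIV g" for g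
    proof -
      have "exp (real n * (Phi \<beta> t - m)) * norm_mass n g (\<beta> *\<^sub>R t) = exp (- (real n * m)) * (exp (- (real n * \<beta> / 2) * (norm t)\<^sup>2) * tilted_mass n g (\<beta> *\<^sub>R t))" for t
      proof -
        have r: "growth_at (\<beta> *\<^sub>R t) > 0" by (rule growth_at_pos)
        have "real n * (Phi \<beta> t - m) = - (real n * m) + (- (real n * \<beta> / 2) * (norm t)\<^sup>2) + real n * ln (growth_at (\<beta> *\<^sub>R t))"
          by (simp add: Phi_eq algebra_simps)
        then have "exp (real n * (Phi \<beta> t - m)) = exp (- (real n * m)) * exp (- (real n * \<beta> / 2) * (norm t)\<^sup>2) * exp (real n * ln (growth_at (\<beta> *\<^sub>R t)))"
          by (simp only: exp_add)
        also have "exp (real n * ln (growth_at (\<beta> *\<^sub>R t))) = growth_at (\<beta> *\<^sub>R t) ^ n"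
          using r by (simp add: exp_of_nat_mult)
        finally show ?thesis using r by (simp add: norm_mass_def)
      qed
      then show ?thesis unfolding J_def C_def hubbard_stratonovich[OF g n, symmetric] by simp
    qed
    have "C \<noteq> 0"
    proof
      assume C0: "C = 0"
      have i: "integrable lborel (\<lambda>t :: real ^ 'q. exp (- (real n * \<beta> / 2) * (norm t)\<^sup>2))"
        using integrable_exp_quadratic[of "real n * \<beta> / 2" 0] n \<beta> by simp
      have "AE t in (lborel :: (real ^ 'q) measure). exp (- (real n * \<beta> / 2) * (norm t)\<^sup>2) = 0"
        using integral_nonneg_eq_0_iff_AE[OF i] C0 by (simp add: C_def)
      then have "AE t in (lborel :: (real ^ 'q) measure). False" by simp
      then have "emeasure lborel (UNIV :: (real ^ 'q) set) = 0" by (subst (asm) AE_iff_measurable[of UNIV]) auto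
      then show False by simp
    qed
    then show ?thesis by (simp add: Jg[OF f] Jg[of "\<lambda>_. 1"])
  qed
  define W where "W = (\<Sum>p\<in>M. if k p = K then mass_limit (\<beta> *\<^sub>R p) * I p else 0)"
  have W: "W > 0"
  proof -
    have "K \<in> k ` M" unfolding K_def by (rule Max_in) (use M in auto)
    then obtain p where p: "p \<in> M" "k p = K" by auto
    show ?thesis unfolding W_def
      by (rule sum_pos2[OF M(1) p(1)]) (use p I mass_limit_pos in \<open>auto intro!: mult_pos_pos mult_nonneg_nonneg less_imp_le\<close>)
  qed
  \<comment> \<open>The coefficient of a maximum point: 0 unless its order is maximal, and otherwise
    proportional to the limiting mass times the integral of its profile
    \<open>exp (- Q p y)\<close>.\<close>
  define cc where "cc p = (if k p = K then mass_limit (\<beta> *\<^sub>R p) * I p / W else 0)" for p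
  have cc0: "cc p \<ge> 0" if "p \<in> M" for p using I[OF that] mass_limit_pos W by (simp add: cc_def less_imp_le)
  have cc1: "(\<Sum>p\<in>M. cc p) = 1"
  proof -
    have "(\<Sum>p\<in>M. cc p) = (\<Sum>p\<in>M. (if k p = K then mass_limit (\<beta> *\<^sub>R p) * I p else 0) / W)"
      by (intro sum.cong refl) (simp add: cc_def)
    also have "\<dots> = W / W" by (simp only: sum_divide_distrib[symmetric] W_def[symmetric])
    finally have "(\<Sum>p\<in>M. cc p) = W / W" .
    then show ?thesis using W by simp
  qed
  have nu1: "(\<integral>\<omega>. 1 \<partial>nu s) = (1 :: real)" for s
    using prob_space.prob_space[OF conformal_measure(1)[OF norm_pot_lip_nonneg lip_pot[of s]]] by simp
  have "converges_weakly UNIV (gibbs_measure \<rho> (\<lambda>_ _. 1) \<psi> \<beta>) (mixture UNIV M cc (\<lambda>t. nu (\<beta> *\<^sub>R t)))"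
    unfolding converges_weakly_def
  proof (intro allI impI)
    fix f :: "(nat \<Rightarrow> 'a) \<Rightarrow> real" assume "f \<in> C0 UNIV"
    then have f: "continuous_on UNIV f" by (simp add: C0_UNIV)
    obtain B where B: "\<And>x. norm (f x) \<le> B" using bounded_continuous[OF f] by metis
    have mix: "(\<integral>\<omega>. f \<omega> \<partial>mixture UNIV M cc (\<lambda>t. nu (\<beta> *\<^sub>R t))) = (\<Sum>t\<in>M. cc t * (\<integral>\<omega>. f \<omega> \<partial>nu (\<beta> *\<^sub>R t)))"
      by (rule integral_mixture[where B = B])
         (use M cc0 B borel_measurable_cont[OF f] conformal_measure(1,2)[OF norm_pot_lip_nonneg lip_pot] in auto)
    have J1: "(\<lambda>n. real n powr (DIM(real ^ 'q) / real K) * J n (\<lambda>_. 1)) \<longlonglongrightarrow> W"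
      using Jlim[of "\<lambda>_. 1"] unfolding W_def nu1 mult_1_right by simp
    have "(\<lambda>n. (real n powr (DIM(real ^ 'q) / real K) * J n f) / (real n powr (DIM(real ^ 'q) / real K) * J n (\<lambda>_. 1))) \<longlonglongrightarrow>
      (\<Sum>p\<in>M. if k p = K then mass_limit (\<beta> *\<^sub>R p) * (\<integral>\<omega>. f \<omega> \<partial>nu (\<beta> *\<^sub>R p)) * I p else 0) / W"
      by (rule tendsto_divide[OF Jlim[OF f] J1]) (use W in simp)
    moreover have "(\<Sum>p\<in>M. if k p = K then mass_limit (\<beta> *\<^sub>R p) * (\<integral>\<omega>. f \<omega> \<partial>nu (\<beta> *\<^sub>R p)) * I p else 0) / W =
      (\<Sum>t\<in>M. cc t * (\<integral>\<omega>. f \<omega> \<partial>nu (\<beta> *\<^sub>R t)))"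
      unfolding sum_divide_distrib by (intro sum.cong refl) (simp add: cc_def)
    moreover have "\<forall>\<^sub>F n in sequentially. (real n powr (DIM(real ^ 'q) / real K) * J n f) / (real n powr (DIM(real ^ 'q) / real K) * J n (\<lambda>_. 1)) =
        (\<integral>\<omega>. f \<omega> \<partial>gibbs_measure \<rho> (\<lambda>_ _. 1) \<psi> \<beta> n)"
      using eventually_ge_at_top[of 1]
    proof eventually_elim
      case (elim n)
      then show ?case by (simp add: integral_gibbs_measure[OF f] JN[OF f, symmetric])
    qed
    ultimately show "(\<lambda>n. \<integral>\<omega>. f \<omega> \<partial>gibbs_measure \<rho> (\<lambda>_ _. 1) \<psi> \<beta> n) \<longlonglongrightarrow> (\<integral>\<omega>. f \<omega> \<partial>mixture UNIV M cc (\<lambda>t. nu (\<beta> *\<^sub>R t)))"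
      unfolding mix by (simp add: Lim_transform_eventually)
  qed
  then show ?thesis using cc0 cc1 unfolding M_def by blast
qed

end

end

section \<open>Peaks at the maximum points, and the case \<beta> = 0\<close>

context shift_potentials
begin

context
  fixes \<beta> :: real
  assumes \<beta>: "0 < \<beta>"
begin

text \<open>By analyticity \<open>Phi \<beta>\<close> is either constant near a maximum point or has
  a leading term there. The first alternative holds on a set that is open and closed in the line; it
  would be the whole line, but the set of maximum points is compact.\<close>

lemma one_dimensional_peak:
  assumes q: "CARD('q) = 1" and p: "p \<in> maximizers (Phi \<beta>)"
  shows "\<exists>k Q c \<delta>. peak (Phi \<beta>) p k Q c \<delta>"
proof -
  obtain i :: 'q where i: "(UNIV :: 'q set) = {i}" using q card_1_singletonE by blast
  \<comment> \<open>The unit vector that identifies the one-dimensional space with the real line,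
    the component at \<open>i\<close> being the coordinate.\<close>
  define e :: "real ^ 'q" where "e = (\<chi> _. 1)"
  have rep: "s = (s $ i) *\<^sub>R e" for s :: "real ^ 'q"
  proof -
    have "s $ j = (s $ i) * 1" for j using i by (metis UNIV_I mult.right_neutral singletonD)
    then show ?thesis by (simp add: vec_eq_iff e_def)
  qed
  have ne: "norm e = 1"
  proof -
    have "norm e = \<bar>e $ i\<bar>" unfolding norm_vec_def L2_set_def i by simp
    then show ?thesis by (simp add: e_def)
  qed
  have nr: "norm s = \<bar>s $ i\<bar>" for s :: "real ^ 'q" using rep[of s] ne by (metis mult_1_right norm_scaleR)
  have germ: "(\<exists>d>0. \<forall>x. \<bar>x\<bar> < d \<longrightarrow> Phi \<beta> (p + x *\<^sub>R e) = Phi \<beta> p) \<or> (\<exists>k Q c \<delta>. peak (Phi \<beta>) p k Q c \<delta>)"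
    if p: "p \<in> maximizers (Phi \<beta>)" for p
  proof -
    define D where "D x = Phi \<beta> p - Phi \<beta> (p + x *\<^sub>R e)" for x
    have D0: "0 \<le> D x" for x using p by (simp add: D_def maximizers_def)
    obtain \<delta> F where F: "\<delta> > 0" "F holomorphic_on ball 0 \<delta>"
      "\<And>x. \<bar>x\<bar> < \<delta> \<Longrightarrow> F (complex_of_real x) =
        complex_of_real (ln (growth (\<lambda>\<omega>. lin_comb (\<beta> *\<^sub>R p) \<psi> \<omega> + x * lin_comb e \<psi> \<omega>)) - ln (growth_at (\<beta> *\<^sub>R p)))"
      using analytic_pressure[OF norm_pot_lip_nonneg lip_pot norm_pot_lip_nonneg lip_pot] by blast
    have lc: "(\<lambda>\<omega>. lin_comb (\<beta> *\<^sub>R p) \<psi> \<omega> + x * lin_comb e \<psi> \<omega>) = lin_comb (\<beta> *\<^sub>R p + x *\<^sub>R e) \<psi>" for x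
      by (simp add: lin_comb_def fun_eq_iff distrib_right sum.distrib sum_distrib_left mult.assoc)
    \<comment> \<open>The complexification of \<open>D\<close>: the square of the norm changes by
      \<open>2 * p $ i * x + x\<^sup>2\<close>, and \<open>F\<close> is evaluated at \<beta> times
      the increment because the potential is scaled by \<beta>.\<close>
    define H where "H w = complex_of_real (\<beta> / 2) * (complex_of_real (2 * p $ i) * w + w ^ 2) - F (complex_of_real \<beta> * w)" for w
    have Hhol: "H holomorphic_on ball 0 (\<delta> / \<beta>)"
    proof -
      have "(F \<circ> (\<lambda>w. complex_of_real \<beta> * w)) holomorphic_on ball 0 (\<delta> / \<beta>)"
        by (rule holomorphic_on_compose_gen[OF _ F(2)])
           (use \<beta> in \<open>auto intro!: holomorphic_intros simp: norm_mult less_divide_eq mult.commute\<close>)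
      then show ?thesis unfolding H_def o_def by (intro holomorphic_intros)
    qed
    have HD: "H (complex_of_real x) = complex_of_real (D x)" if x: "\<bar>x\<bar> < \<delta> / \<beta>" for x
    proof -
      have "\<bar>\<beta> * x\<bar> < \<delta>" using x \<beta> by (simp add: abs_mult less_divide_eq mult.commute)
      from F(3)[OF this] have Fx: "F (complex_of_real \<beta> * complex_of_real x) = complex_of_real (ln (growth_at (\<beta> *\<^sub>R (p + x *\<^sub>R e))) - ln (growth_at (\<beta> *\<^sub>R p)))"
        unfolding lc by (simp add: scaleR_add_right)
      have "(norm (p + x *\<^sub>R e))\<^sup>2 = (p $ i + x)\<^sup>2" unfolding nr by (simp add: e_def)
      then have "D x = \<beta> / 2 * (2 * p $ i * x + x\<^sup>2) - (ln (growth_at (\<beta> *\<^sub>R (p + x *\<^sub>R e))) - ln (growth_at (\<beta> *\<^sub>R p)))"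
        unfolding D_def Phi_eq nr[of p] by (simp add: power2_eq_square algebra_simps)
      then show ?thesis unfolding H_def Fx by simp
    qed
    from nonneg_analytic_leading_term[OF Hhol _ D0 _ HD]
    consider (flat) "\<forall>x. \<bar>x\<bar> < \<delta> / \<beta> \<longrightarrow> D x = 0"
      | (lead) k c where "k \<ge> 1" "c > 0" "((\<lambda>x. D x / \<bar>x\<bar> ^ k) \<longlongrightarrow> c) (at 0)"
      using F(1) \<beta> by (auto simp: D_def)
    then show ?thesis
    proof cases
      case flat
      have "\<delta> / \<beta> > 0" using F(1) \<beta> by simp
      with flat show ?thesis by (intro disjI1 exI[of _ "\<delta> / \<beta>"]) (auto simp: D_def)
    next
      case (lead k c)
      have "((\<lambda>h. (Phi \<beta> p - Phi \<beta> (p + h) - c * norm h ^ k) / norm h ^ k) \<longlongrightarrow> 0) (at 0)"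
      proof -
        have "filterlim (\<lambda>h :: real ^ 'q. h $ i) (at 0) (at 0)"
        proof (rule filterlim_atI)
          show "((\<lambda>h :: real ^ 'q. h $ i) \<longlongrightarrow> 0) (at 0)"
            using tendsto_vec_nth[OF tendsto_ident_at[of "0 :: real ^ 'q" UNIV], of i] by simp
          show "\<forall>\<^sub>F h :: real ^ 'q in at 0. h $ i \<noteq> 0"
            unfolding eventually_at
          proof (intro exI[of _ 1] conjI ballI impI)
            fix h :: "real ^ 'q" assume "h \<noteq> 0 \<and> dist h 0 < 1"
            then have "norm h \<noteq> 0" by simp
            then show "h $ i \<noteq> 0" unfolding nr[of h] by simp
          qed simp
        qed
        from tendsto_diff[OF filterlim_compose[OF lead(3) this] tendsto_const[of c]]
        have l: "((\<lambda>h :: real ^ 'q. D (h $ i) / \<bar>h $ i\<bar> ^ k - c) \<longlongrightarrow> 0) (at 0)" by simp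
        have eq: "D (h $ i) / \<bar>h $ i\<bar> ^ k - c = (Phi \<beta> p - Phi \<beta> (p + h) - c * norm h ^ k) / norm h ^ k" if "h \<noteq> 0" for h
        proof -
          have "D (h $ i) = Phi \<beta> p - Phi \<beta> (p + h)" unfolding D_def using rep[of h] by simp
          moreover have "norm h ^ k \<noteq> 0" using that by simp
          ultimately show ?thesis unfolding nr[of h, symmetric] by (simp add: diff_divide_distrib)
        qed
        have "\<forall>\<^sub>F h in at 0. D (h $ i) / \<bar>h $ i\<bar> ^ k - c = (Phi \<beta> p - Phi \<beta> (p + h) - c * norm h ^ k) / norm h ^ k"
          unfolding eventually_at using eq by (intro exI[of _ 1]) auto
        then show ?thesis by (rule Lim_transform_eventually[OF l])
      qed
      from peakI[OF lead(1,2) _ _ this] obtain d where "peak (Phi \<beta>) p k (\<lambda>h. c * norm h ^ k) (c / 2) d"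
        by (auto simp: power_mult_distrib)
      then show ?thesis by blast
    qed
  qed
  define A where "A = {x. x *\<^sub>R e \<in> maximizers (Phi \<beta>)}"
  \<comment> \<open>The interior of the set of maximum points, in the real coordinate.\<close>
  define U where "U = {x. \<exists>d>0. \<forall>y. \<bar>y - x\<bar> < d \<longrightarrow> y \<in> A}"
  have flat_iff: "x \<in> U" if "x \<in> A" "\<exists>d>0. \<forall>y. \<bar>y\<bar> < d \<longrightarrow> Phi \<beta> (x *\<^sub>R e + y *\<^sub>R e) = Phi \<beta> (x *\<^sub>R e)" for x
  proof -
    from that(2) obtain d where d: "d > 0" "\<And>y. \<bar>y\<bar> < d \<Longrightarrow> Phi \<beta> (x *\<^sub>R e + y *\<^sub>R e) = Phi \<beta> (x *\<^sub>R e)" by blast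
    have "y \<in> A" if "\<bar>y - x\<bar> < d" for y
      using d(2)[OF that] \<open>x \<in> A\<close> by (simp add: A_def maximizers_def flip: scaleR_add_left)
    then show ?thesis using d(1) by (auto simp: U_def)
  qed
  have cA: "closed A"
  proof -
    have "closed ((\<lambda>x. x *\<^sub>R e) -` maximizers (Phi \<beta>))"
      by (intro closed_vimage compact_imp_closed maximizers_Phi \<beta> continuous_intros)
    then show ?thesis by (simp add: A_def vimage_def)
  qed
  have "open U"
    unfolding open_dist
  proof
    fix x assume "x \<in> U"
    then obtain d where d: "d > 0" "\<And>y. \<bar>y - x\<bar> < d \<Longrightarrow> y \<in> A" by (auto simp: U_def)
    have "y \<in> U" if y: "dist y x < d / 2" for y
      unfolding U_def
    proof (intro CollectI exI[of _ "d / 2"] conjI allI impI)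
      fix z assume "\<bar>z - y\<bar> < d / 2"
      moreover have "\<bar>y - x\<bar> < d / 2" using y by (simp add: dist_real_def)
      ultimately have "\<bar>z - x\<bar> < d" by linarith
      then show "z \<in> A" by (rule d(2))
    qed (use d in simp)
    then show "\<exists>e>0. \<forall>y. dist y x < e \<longrightarrow> y \<in> U" using d(1) by (intro exI[of _ "d / 2"]) auto
  qed
  moreover have "closed U"
    unfolding closed_limpt
  proof (intro allI impI)
    \<comment> \<open>A limit point of \<open>U\<close> is a limit point of maximum points, so it
      cannot be a peak; only local constancy remains, which puts it into \<open>U\<close>.\<close>
    fix x assume x: "x islimpt U"
    have UA: "U \<subseteq> A" by (force simp: U_def)
    have "x islimpt A" by (rule islimpt_subset[OF x UA])
    then have xA: "x \<in> A" using cA by (simp add: closed_limpt)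
    then have "x *\<^sub>R e \<in> maximizers (Phi \<beta>)" by (simp add: A_def)
    from germ[OF this] show "x \<in> U"
    proof
      assume "\<exists>k Q c \<delta>. peak (Phi \<beta>) (x *\<^sub>R e) k Q c \<delta>"
      then obtain k Q c \<delta> where pk: "peak (Phi \<beta>) (x *\<^sub>R e) k Q c \<delta>" by blast
      then have "\<delta> > 0" unfolding peak_def by blast
      then obtain y where y: "y \<in> A" "y \<noteq> x" "dist y x < \<delta>"
        using \<open>x islimpt A\<close> unfolding islimpt_approachable by blast
      have "x *\<^sub>R e + (y - x) *\<^sub>R e \<notin> maximizers (Phi \<beta>)"
        by (rule peak_isolated[OF \<beta> pk]) (use y ne in \<open>auto simp: dist_real_def e_def vec_eq_iff\<close>)
      then show ?thesis using y(1) by (simp add: A_def flip: scaleR_add_left)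
    qed (rule flat_iff[OF xA])
  qed
  ultimately have "U = {} \<or> U = UNIV" using clopen by blast
  moreover have "U \<noteq> UNIV"
  proof
    assume "U = UNIV"
    then have "A = UNIV" by (force simp: U_def)
    obtain b where b: "\<And>s. s \<in> maximizers (Phi \<beta>) \<Longrightarrow> norm s \<le> b"
      using compact_imp_bounded[OF maximizers_Phi(2)[OF \<beta>]] by (auto simp: bounded_iff)
    have "norm ((\<bar>b\<bar> + 1) *\<^sub>R e) \<le> b" by (rule b) (use \<open>A = UNIV\<close> in \<open>auto simp: A_def\<close>)
    then show False using ne by simp
  qed
  ultimately have "U = {}" by blast
  moreover have "p $ i \<in> A" using p rep[of p] by (simp add: A_def)
  ultimately have "\<not> (\<exists>d>0. \<forall>x. \<bar>x\<bar> < d \<longrightarrow> Phi \<beta> (p + x *\<^sub>R e) = Phi \<beta> p)"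
    using flat_iff[of "p $ i"] rep[of p] by auto
  then show ?thesis using germ[OF p] by blast
qed

lemma nondegenerate_peak:
  assumes "p \<in> maximizers (Phi \<beta>)" "nondegenerate_at (Phi \<beta>) p"
  shows "\<exists>k Q c \<delta>. peak (Phi \<beta>) p k Q c \<delta>"
proof -
  obtain g H where "\<forall>\<^sub>F s in nhds p. GDERIV (Phi \<beta>) s :> g s" "(g has_derivative H) (at p)" "bij H"
    using assms(2) by (auto simp: nondegenerate_at_def)
  moreover have "\<forall>s. Phi \<beta> s \<le> Phi \<beta> p" using assms(1) by (simp add: maximizers_def)
  ultimately obtain Q c \<delta> where "peak (Phi \<beta>) p 2 Q c \<delta>"
    using nondegenerate_maximum_peak by blast
  then show ?thesis by blast
qed

end

lemma Phi_0: "Phi 0 = (\<lambda>_. ln (growth_at 0))"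
  by (simp add: Phi_eq fun_eq_iff)

text \<open>For the potential 0 the operator just integrates out one letter, so its growth is 1 and
  the product measure is conformal.\<close>

lemma nu_0: "nu 0 = Pr"
proof -
  have z: "lin_comb 0 \<psi> = (\<lambda>_. 0)" by (simp add: lin_comb_def fun_eq_iff)
  have l0: "lip 0 (\<lambda>_. 0 :: real)" by (simp add: lip_def)
  have b0: "birkhoff_sum n (\<lambda>_. 0) x = 0" for n x by (simp add: birkhoff_sum_def)
  have "iter_transfer 1 (\<lambda>_. 0) (\<lambda>_. 1 :: real) = (\<lambda>_. 1)"
    using Pr.prob_space by (simp add: iter_transfer_def b0 fun_eq_iff)
  then have "growth (\<lambda>_. 0) = 1" unfolding growth_def using limit_fun_const[OF order_refl l0] by simp
  then have "is_conformal \<rho> (\<lambda>_ _. 1) (\<lambda>_. 0) Pr"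
    unfolding is_conformal_def using Pr.prob_space_axioms integral_iter_transfer[of "\<lambda>_. 0" _ 1]
    by (auto simp: C0_UNIV sets_Pr transfer_eq_iter_transfer[of "\<lambda>_. 0"] spec_rad_eq[OF order_refl l0] b0 simp del: One_nat_def)
  from is_conformal_unique[OF order_refl l0 is_conformal_conformal_measure[OF order_refl l0] this]
  show ?thesis unfolding z .
qed

lemma gibbs_measure_0: "gibbs_measure \<rho> (\<lambda>_ _. 1) \<psi> 0 n = Pr"
  using Pr.prob_space
  by (simp add: gibbs_measure_def partition_function_def gibbs_weight_def restrict_Pr density_1)

text \<open>For \<beta> = 0 every point is a maximum point: in the first statement the finite set
  can be taken as \<open>{0}\<close>, and the second one holds because a constant function is
  nowhere nondegenerate. For positive \<beta> both cases differ only in how peaks are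
  obtained.\<close>

lemma mean_field_convergence:
  assumes \<beta>: "0 \<le> \<beta>"
  shows "(CARD('q) = 1 \<longrightarrow>
           (\<exists>T c. finite T \<and> T \<subseteq> maximizers (Phi \<beta>) \<and> (\<forall>t\<in>T. c t \<ge> 0) \<and> (\<Sum>t\<in>T. c t) = 1 \<and>
              converges_weakly UNIV (gibbs_measure \<rho> (\<lambda>_ _. 1) \<psi> \<beta>) (mixture UNIV T c (\<lambda>t. nu (\<beta> *\<^sub>R t)))))
       \<and> (CARD('q) > 1 \<longrightarrow> (\<forall>t \<in> maximizers (Phi \<beta>). nondegenerate_at (Phi \<beta>) t) \<longrightarrow>
           finite (maximizers (Phi \<beta>)) \<and>
           (\<exists>c. (\<forall>t \<in> maximizers (Phi \<beta>). c t \<ge> 0) \<and> (\<Sum>t \<in> maximizers (Phi \<beta>). c t) = 1 \<and>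
              converges_weakly UNIV (gibbs_measure \<rho> (\<lambda>_ _. 1) \<psi> \<beta>)
                (mixture UNIV (maximizers (Phi \<beta>)) c (\<lambda>t. nu (\<beta> *\<^sub>R t)))))"
proof (cases "\<beta> = 0")
  case True
  have mx: "maximizers (Phi 0) = UNIV" by (simp add: Phi_0 maximizers_def)
  have "converges_weakly UNIV (gibbs_measure \<rho> (\<lambda>_ _. 1) \<psi> 0) (mixture UNIV {0} (\<lambda>_. 1) (\<lambda>t. nu (0 *\<^sub>R t)))"
    unfolding converges_weakly_def gibbs_measure_0
  proof (intro allI impI)
    fix f :: "(nat \<Rightarrow> 'a) \<Rightarrow> real" assume "f \<in> C0 UNIV"
    then have f: "continuous_on UNIV f" by (simp add: C0_UNIV)
    obtain B where B: "\<And>x. norm (f x) \<le> B" using bounded_continuous[OF f] by metis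
    have "(\<integral>\<omega>. f \<omega> \<partial>mixture UNIV {0} (\<lambda>_. 1) (\<lambda>t. nu (0 *\<^sub>R t))) = (\<Sum>t\<in>{0 :: real ^ 'q}. 1 * (\<integral>\<omega>. f \<omega> \<partial>nu (0 *\<^sub>R t)))"
      by (rule integral_mixture[where B = B])
         (use B borel_measurable_cont[OF f] conformal_measure(1,2)[OF norm_pot_lip_nonneg lip_pot] in auto)
    then show "(\<lambda>n. \<integral>\<omega>. f \<omega> \<partial>Pr) \<longlonglongrightarrow> (\<integral>\<omega>. f \<omega> \<partial>mixture UNIV {0} (\<lambda>_. 1) (\<lambda>t. nu (0 *\<^sub>R t)))"
      by (simp add: nu_0)
  qed
  then have 1: "\<exists>T c. finite T \<and> T \<subseteq> maximizers (Phi 0) \<and> (\<forall>t\<in>T. c t \<ge> 0) \<and> (\<Sum>t\<in>T. c t) = (1 :: real) \<and>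
      converges_weakly UNIV (gibbs_measure \<rho> (\<lambda>_ _. 1) \<psi> 0) (mixture UNIV T c (\<lambda>t. nu (0 *\<^sub>R t)))"
    by (intro exI[of _ "{0}"] exI[of _ "\<lambda>_. 1"]) (simp add: mx)
  \<comment> \<open>The gradient of a constant function vanishes near 0, so its derivative is the
    zero map, which is not injective.\<close>
  have "\<not> nondegenerate_at (Phi 0) 0"
  proof
    assume "nondegenerate_at (Phi 0) 0"
    then obtain g H where gH: "\<forall>\<^sub>F s in nhds 0. GDERIV (Phi 0) s :> g s" "(g has_derivative H) (at 0)" "bij H"
      by (auto simp: nondegenerate_at_def)
    have g0: "g s = 0" if "GDERIV (Phi 0) s :> g s" for s
    proof -
      have "(Phi 0 has_derivative (\<lambda>h. 0)) (at s)" unfolding Phi_0 by simp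
      moreover have "(Phi 0 has_derivative (\<lambda>h. h \<bullet> g s)) (at s)" using that by (simp add: gderiv_def)
      ultimately have "(\<lambda>h. 0) = (\<lambda>h. h \<bullet> g s)" by (rule has_derivative_unique)
      then show ?thesis by (metis inner_eq_zero_iff)
    qed
    have ev: "\<forall>\<^sub>F s in nhds 0. g s = 0" using gH(1) by eventually_elim (rule g0)
    have "((\<lambda>_. 0) has_derivative H) (at 0)"
    proof (rule has_derivative_transform_eventually[OF gH(2)])
      show "\<forall>\<^sub>F s in at 0. g s = 0" using ev by (simp add: eventually_nhds_conv_at)
      show "g 0 = 0" using eventually_nhds_x_imp_x[OF ev] .
    qed simp
    then have "H = (\<lambda>_. 0)" by (rule has_derivative_unique) simp
    then have "H 1 = H 0" by simp
    then show False using gH(3) by (auto simp: bij_def dest: injD)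
  qed
  then show ?thesis using 1 mx True by blast
next
  case False
  with \<beta> have b: "0 < \<beta>" by simp
  show ?thesis
    using gibbs_converges[OF b one_dimensional_peak[OF b]] finite_maximizers[OF b one_dimensional_peak[OF b]]
      gibbs_converges[OF b nondegenerate_peak[OF b]] finite_maximizers[OF b nondegenerate_peak[OF b]]
    by blast
qed

end

theorem theorem3:
  fixes \<rho> :: "'a::polish_space measure"
    and A :: "'a \<Rightarrow> 'a \<Rightarrow> real"
    and \<psi> :: "'q::finite \<Rightarrow> (nat \<Rightarrow> 'a) \<Rightarrow> real"
    and \<beta> :: real
  assumes compact_E: "compact (UNIV :: 'a set)"
    and prob_rho: "prob_space \<rho>" "sets \<rho> = sets borel"
    and full_support: "\<And>U. open U \<Longrightarrow> U \<noteq> {} \<Longrightarrow> measure \<rho> U > 0"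
    and ball_continuous:
      "\<forall>\<^sub>F \<epsilon> in at_right (0::real). continuous_on UNIV (\<lambda>x. measure \<rho> (ball x \<epsilon>))"
    and A_continuous: "continuous_on UNIV (\<lambda>(x, y). A x y)"
    and A_values: "\<And>x y. A x y \<in> {0, 1}"
    and A_lipschitz: "\<exists>Lip. \<forall>x y z. \<bar>A x y - A x z\<bar> \<le> Lip * dist y z"
    and A_mixing: "\<exists>N. \<forall>n\<ge>N. \<forall>a b. \<exists>z :: nat \<Rightarrow> 'a.
      z 0 = a \<and> z n = b \<and> (\<Prod>i<n. A (z i) (z (Suc i))) = 1"
    and normalizable: "emeasure (product_measure \<rho>) (Omega A) > 0"
    and psi_lipschitz: "\<And>i. \<psi> i \<in> C1 (Omega A)"
    and beta_nonneg: "\<beta> \<ge> 0"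
  shows "(CARD('q) = 1 \<longrightarrow>
           (\<exists>T c. finite T \<and> T \<subseteq> maximizers (phi_beta \<rho> A \<psi> \<beta>) \<and>
              (\<forall>t\<in>T. c t \<ge> 0) \<and> (\<Sum>t\<in>T. c t) = 1 \<and>
              converges_weakly (Omega A) (gibbs_measure \<rho> A \<psi> \<beta>)
                (mixture (Omega A) T c (\<lambda>t. conformal_measure \<rho> A (lin_comb (\<beta> *\<^sub>R t) \<psi>)))))
       \<and> (CARD('q) > 1 \<longrightarrow>
           (\<forall>t \<in> maximizers (phi_beta \<rho> A \<psi> \<beta>). nondegenerate_at (phi_beta \<rho> A \<psi> \<beta>) t) \<longrightarrow>
           finite (maximizers (phi_beta \<rho> A \<psi> \<beta>)) \<and>
           (\<exists>c. (\<forall>t \<in> maximizers (phi_beta \<rho> A \<psi> \<beta>). c t \<ge> 0) \<and>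
              (\<Sum>t \<in> maximizers (phi_beta \<rho> A \<psi> \<beta>). c t) = 1 \<and>
              converges_weakly (Omega A) (gibbs_measure \<rho> A \<psi> \<beta>)
                (mixture (Omega A) (maximizers (phi_beta \<rho> A \<psi> \<beta>)) c
                  (\<lambda>t. conformal_measure \<rho> A (lin_comb (\<beta> *\<^sub>R t) \<psi>)))))"
proof -
  interpret prob_space \<rho> by (rule prob_rho)
  interpret full_shift \<rho> by unfold_locales (rule compact_E, rule prob_rho)
  have A: "A = (\<lambda>_ _. 1)"
    by (rule transition_trivial[OF full_support A_continuous A_values normalizable])
  have "\<forall>i. \<exists>l. lip l (\<psi> i)"
    using psi_lipschitz unfolding A Omega_full C1_def lip_def by auto
  then obtain l where l: "\<And>i. lip (l i) (\<psi> i)" by metis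
  \<comment> \<open>A common Lipschitz constant of the finite family; inserting 0 ensures that it is
    nonnegative.\<close>
  define L where "L = Max (insert 0 (range l))"
  have L: "0 \<le> L" "\<And>i. lip L (\<psi> i)"
  proof -
    show "0 \<le> L" unfolding L_def by (rule Max_ge) auto
    show "lip L (\<psi> i)" for i by (rule lip_mono[OF l]) (unfold L_def, rule Max_ge, auto)
  qed
  have "\<forall>i. \<exists>m. \<forall>x. \<bar>\<psi> i x\<bar> \<le> m"
    using bounded_continuous[OF lip_imp_continuous[OF L(2)]] by (metis real_norm_def)
  then obtain m where m: "\<And>i x. \<bar>\<psi> i x\<bar> \<le> m i" by metis
  have M: "\<bar>\<psi> i x\<bar> \<le> Max (range m)" for i x
    by (rule order_trans[OF m]) (auto intro!: Max_ge)
  interpret shift_potentials \<rho> \<psi> L "Max (range m)" by unfold_locales (rule L M)+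
  show ?thesis using mean_field_convergence[OF beta_nonneg] unfolding A Phi_def Omega_full .
qed

end
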